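(* Let $\mathcal C$ be a braided monoidal category, let $\mathcal A$ and $\mathcal B$ be $\mathcal C$-categories, with $\mathcal A$ locally small, cocomplete and $\mathcal C$-monoidal, let $\mathcal A_0\subset\mathcal A$ be a subcategory right coclosed in $\mathcal A$, and let $F:\mathcal B\to\mathcal A_0\subset\mathcal A$ be a $\mathcal C$-functor. Assume that $\mathcal A_0$ or $\mathcal B$ is small. Then: (1) $E:=\mathrm{coend}_{\mathcal C}(F)$ exists in $\mathcal A$, and $F$ factors as $F=U\circ I_F$ with a functor $I_F:\mathcal B\to\mathrm{Comod}_{\mathcal A_0}\text{-}E$, where $U:\mathrm{Comod}_{\mathcal A_0}\text{-}E\to\mathcal A_0$ is the forgetful functor. (2) Suppose moreover that $\mathcal A$ is $\mathcal C$-braided $\mathcal C$-monoidal, $\mathcal A_0$ is a $\mathcal C$-monoidal subcategory of $\mathcal A$, $\mathcal B$ is $\mathcal C$-monoidal, $F$ is a $\mathcal C$-monoidal functor, and the functor $\mathrm{Nat}_{\mathcal C}(F,F\otimes_{\mathcal A}-)$ is multirepresentable. Then $E=\mathrm{coend}_{\mathcal C}(F)$ is a bialgebra in $\mathcal A$, the category $\mathrm{Comod}_{\mathcal A_0}\text{-}E$ has a natural $\mathcal C$-monoidal structure, and $I_F$ is a $\mathcal C$-monoidal functor.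
   Context: $\mathcal C$-categories. For a monoidal category $(\mathcal C,\otimes,I)$, a $\mathcal C$-category is a category $\mathcal B$ with a bifunctor $\otimes_{\mathcal{CB}}:\mathcal C\times\mathcal B\to\mathcal B$ and coherent natural isomorphisms $(X\otimes Y)\otimes_{\mathcal{CB}}P\cong X\otimes_{\mathcal{CB}}(Y\otimes_{\mathcal{CB}}P)$ and $I\otimes_{\mathcal{CB}}P\cong P$. A $\mathcal C$-functor $F:\mathcal B\to\mathcal B'$ is a functor with a coherent natural isomorphism $\xi:F(X\otimes_{\mathcal{CB}}P)\to X\otimes_{\mathcal{CB}'}F(P)$. A $\mathcal C$-natural transformation is a natural transformation $\phi:F\to F'$ with $\xi'\circ\phi_{X\otimes P}=(\mathrm{id}_X\otimes\phi_P)\circ\xi$. $\mathrm{Nat}_{\mathcal C}(F,F')$ is the collection of these. Monoidal versions ($\mathcal C$ braided). A $\mathcal C$-bifunctor $\mathcal B\times\mathcal B'\to\mathcal B''$ is a bifunctor which is a $\mathcal C$-functor in each variable, the two structures being compatible (the two induced morphisms $H(X\otimes P,Y\otimes Q)\to X\otimes Y\otimes H(P,Q)$, pulling out $X,Y$ in either order, agree up to the braiding of $\mathcal C$). A $\mathcal C$-bimorphism is a natural transformation of $\mathcal C$-bifunctors compatible with the $\mathcal C$-structure in each variable. A $\mathcal C$-monoidal category is a $\mathcal C$-category $\mathcal A$ with a coherent monoidal structure $\otimes_{\mathcal A}$ that is a coherent $\mathcal C$-bifunctor. A $\mathcal C$-monoidal functor is a monoidal functor which is a $\mathcal C$-functor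 and whose monoidal structure morphism is a $\mathcal C$-bimorphism. $\mathcal A$ is $\mathcal C$-braided if it is braided with braiding coherent with that of $\mathcal C$ (i.e. compatible via $X\mapsto X\otimes_{\mathcal{CA}}I_{\mathcal A}$). An object $P\in\mathcal A$ is $\mathcal C$-central if for all $X\in\mathcal C$, $Q\in\mathcal A$ the double braiding $X\otimes P\otimes Q\to P\otimes X\otimes Q\to X\otimes P\otimes Q$ is the identity (with $X$ regarded in $\mathcal A$ as $X\otimes_{\mathcal{CA}}I_{\mathcal A}$). Cohomomorphisms. For $X,Y\in\mathcal A$, $\mathrm{cohom}_{\mathcal A}(X,Y)$ with $\mathrm{coev}_{X,Y}:X\to Y\otimes_{\mathcal A}\mathrm{cohom}_{\mathcal A}(X,Y)$ is universal: every $\phi:X\to Y\otimes_{\mathcal A} Z$ equals $(\mathrm{id}_Y\otimes\mathrm{coact}(\phi))\circ\mathrm{coev}_{X,Y}$ for a unique $\mathrm{coact}(\phi):\mathrm{cohom}_{\mathcal A}(X,Y)\to Z$. $\mathcal A_0\subset\mathcal A$ is right coclosed in $\mathcal A$ if $\mathrm{cohom}_{\mathcal A}(X,Y)\in\mathcal A$ exists for all $X,Y\in\mathcal A_0$. $\mathrm{cohom}_{\mathcal A}$ is covariant in the first and contravariant in the second variable. $\mathrm{coend}_{\mathcal C}(F)$. A cowedge over $F$ with value $d\in\mathcal A$ is a family $\mu'_X:\mathrm{cohom}_{\mathcal A}(F(X),F(X))\to d$, $X\in\mathcal B$, with $\mu'_X\circ\mathrm{cohom}(\mathrm{id}_{F(X)},F(f)^{op})=\mu'_Y\circ\mathrm{cohom}(F(f),\mathrm{id}_{F(Y)})$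 on $\mathrm{cohom}_{\mathcal A}(F(X),F(Y))$ for all $f:X\to Y$. It is a $\mathcal C$-cowedge if moreover $\mu'_{C\otimes X}\circ\mathrm{cohom}(\mathrm{id}_{F(C\otimes X)},\xi^{op})=\mu'_X\circ\lambda_{C,X}$ on $\mathrm{cohom}_{\mathcal A}(F(C\otimes X),C\otimes F(X))$ for all $C\in\mathcal C$, $X\in\mathcal B$, where $\lambda_{C,X}:=\mathrm{coact}((\mathrm{id}_C\otimes\mathrm{coev}_{F(X),F(X)})\circ\xi)$. $\mathrm{coend}_{\mathcal C}(F)$ is the initial $\mathcal C$-cowedge $(i_X)_X$; it is a coalgebra coacting on each $F(X)$ by $\delta_X=(\mathrm{id}\otimes i_X)\circ\mathrm{coev}_{F(X),F(X)}$, where $\delta:F\to F\otimes_{\mathcal A}\mathrm{coend}_{\mathcal C}(F)$ is the universal $\mathcal C$-natural transformation representing $\mathrm{Nat}_{\mathcal C}(F,F\otimes_{\mathcal A}-):\mathcal A\to\mathrm{Sets}$. The functor $I_F$ sends $X$ to $(F(X),\delta_X)$. $\mathrm{Comod}_{\mathcal A_0}\text{-}E$ is the category of right $E$-comodules with underlying object in $\mathcal A_0$. Multirepresentability. $\mathrm{Nat}_{\mathcal C}(F,F\otimes_{\mathcal A}-)$ is multirepresentable if $E=\mathrm{coend}_{\mathcal C}(F)$ is $\mathcal C$-central and for every $n$ the functor $M\mapsto\mathrm{Nat}_{\mathcal C}(F^{n},F^{n}\otimes_{\mathcal A}M)$ is represented by $E^{\otimes n}$ with universal element $\delta_n$, where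 $F^n(X_1,\dots,X_n)=F(X_1)\otimes\cdots\otimes F(X_n)$ and $\delta_n:F^n\to F^n\otimes E^{\otimes n}$ is $\delta^{\otimes n}$ followed by the braidings moving all copies of $E$ to the right. In that case the multiplication $E\otimes E\to E$ is the morphism corresponding to $F(X)\otimes F(Y)\cong F(X\otimes Y)\xrightarrow{\delta}F(X\otimes Y)\otimes E\cong F(X)\otimes F(Y)\otimes E$, and the unit of $E$ comes from $\delta$ at the unit object.
   Formalization: In the alternative "A_0 is small" it is also assumed that for each object P of A_0 the objects X of B with F(X) = P form a small set; without this E need not exist (F constant at k from a large discrete B to vector spaces). *)

theory Defs
  imports "HOL-Library.Equipollence"
begin

section \<open>Size\<close>

text \<open>
  Smallness is relative to a universe, given by the cardinality of a type. The closure conditions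
  say that this cardinal is infinite, strong limit and regular: it is inaccessible (a Grothendieck
  universe) or countable (then small means finite). Without power sets in the universe,
  locally small cocomplete categories would degenerate to preorders.
\<close>

definition small :: "'u itself \<Rightarrow> 'a set \<Rightarrow> bool" where
  "small U S \<longleftrightarrow> S \<prec> (UNIV :: 'u set)"

definition universe :: "'u itself \<Rightarrow> bool" where
  "universe U \<longleftrightarrow>
     infinite (UNIV :: 'u set) \<and>
     (\<forall>S :: 'u set. small U S \<longrightarrow> small U (Pow S)) \<and>
     (\<forall>(S :: 'u set) (T :: 'u \<Rightarrow> 'u set).
        small U S \<and> (\<forall>x\<in>S. small U (T x)) \<longrightarrow> small U (\<Union>x\<in>S. T x))"


section \<open>Categories\<close>

text \<open>
  A category has a set of objects and a family of hom sets. The hom sets need not be disjoint, so an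
  arrow does not determine its domain and codomain; operations whose result depends on them
  (inverses, components of transformations) take the objects as arguments. This makes the arrows of
  a comodule category literally arrows of the underlying category. Nothing is required outside the
  set of objects.
\<close>

record ('o, 'm) cat =
  obj :: "'o set"
  hom :: "'o \<Rightarrow> 'o \<Rightarrow> 'm set"
  ident :: "'o \<Rightarrow> 'm"
  cmp :: "'m \<Rightarrow> 'm \<Rightarrow> 'm" (infixl "\<cdot>\<index>" 65)

locale category =
  fixes A :: "('o, 'm) cat"
  assumes ident_hom: "X \<in> obj A \<Longrightarrow> ident A X \<in> hom A X X"
    and cmp_hom: "\<lbrakk>X \<in> obj A; Y \<in> obj A; Z \<in> obj A; f \<in> hom A X Y; g \<in> hom A Y Z\<rbrakk>
      \<Longrightarrow> g \<cdot>\<^bsub>A\<^esub> f \<in> hom A X Z"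
    and cmp_ident_left: "\<lbrakk>X \<in> obj A; Y \<in> obj A; f \<in> hom A X Y\<rbrakk> \<Longrightarrow> ident A Y \<cdot>\<^bsub>A\<^esub> f = f"
    and cmp_ident_right: "\<lbrakk>X \<in> obj A; Y \<in> obj A; f \<in> hom A X Y\<rbrakk> \<Longrightarrow> f \<cdot>\<^bsub>A\<^esub> ident A X = f"
    and cmp_assoc: "\<lbrakk>W \<in> obj A; X \<in> obj A; Y \<in> obj A; Z \<in> obj A;
        f \<in> hom A W X; g \<in> hom A X Y; h \<in> hom A Y Z\<rbrakk>
      \<Longrightarrow> (h \<cdot>\<^bsub>A\<^esub> g) \<cdot>\<^bsub>A\<^esub> f = h \<cdot>\<^bsub>A\<^esub> (g \<cdot>\<^bsub>A\<^esub> f)"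

definition inverse_arrows :: "('o, 'm) cat \<Rightarrow> 'o \<Rightarrow> 'o \<Rightarrow> 'm \<Rightarrow> 'm \<Rightarrow> bool" where
  "inverse_arrows A X Y f g \<longleftrightarrow>
     f \<in> hom A X Y \<and> g \<in> hom A Y X \<and> g \<cdot>\<^bsub>A\<^esub> f = ident A X \<and> f \<cdot>\<^bsub>A\<^esub> g = ident A Y"

definition iso :: "('o, 'm) cat \<Rightarrow> 'o \<Rightarrow> 'o \<Rightarrow> 'm \<Rightarrow> bool" where
  "iso A X Y f \<longleftrightarrow> (\<exists>g. inverse_arrows A X Y f g)"

definition inv_arr :: "('o, 'm) cat \<Rightarrow> 'o \<Rightarrow> 'o \<Rightarrow> 'm \<Rightarrow> 'm" where
  "inv_arr A X Y f = (THE g. inverse_arrows A X Y f g)"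

locale cat_functor = src: category B + tgt: category A
  for B :: "('b, 'n) cat" and A :: "('o, 'm) cat" +
  fixes FO :: "'b \<Rightarrow> 'o" and FM :: "'n \<Rightarrow> 'm"
  assumes obj_map: "X \<in> obj B \<Longrightarrow> FO X \<in> obj A"
    and hom_map: "\<lbrakk>X \<in> obj B; Y \<in> obj B; f \<in> hom B X Y\<rbrakk> \<Longrightarrow> FM f \<in> hom A (FO X) (FO Y)"
    and ident_map: "X \<in> obj B \<Longrightarrow> FM (ident B X) = ident A (FO X)"
    and cmp_map: "\<lbrakk>X \<in> obj B; Y \<in> obj B; Z \<in> obj B; f \<in> hom B X Y; g \<in> hom B Y Z\<rbrakk>
      \<Longrightarrow> FM (g \<cdot>\<^bsub>B\<^esub> f) = FM g \<cdot>\<^bsub>A\<^esub> FM f"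

definition subcategory :: "('o, 'm) cat \<Rightarrow> ('o, 'm) cat \<Rightarrow> bool" where
  "subcategory A\<^sub>0 A \<longleftrightarrow>
     category A\<^sub>0 \<and> obj A\<^sub>0 \<subseteq> obj A \<and>
     (\<forall>X\<in>obj A\<^sub>0. ident A\<^sub>0 X = ident A X) \<and>
     (\<forall>X\<in>obj A\<^sub>0. \<forall>Y\<in>obj A\<^sub>0. hom A\<^sub>0 X Y \<subseteq> hom A X Y) \<and>
     (\<forall>X\<in>obj A\<^sub>0. \<forall>Y\<in>obj A\<^sub>0. \<forall>Z\<in>obj A\<^sub>0. \<forall>f\<in>hom A\<^sub>0 X Y. \<forall>g\<in>hom A\<^sub>0 Y Z.
        g \<cdot>\<^bsub>A\<^sub>0\<^esub> f = g \<cdot>\<^bsub>A\<^esub> f)"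

definition locally_small :: "'u itself \<Rightarrow> ('o, 'm) cat \<Rightarrow> bool" where
  "locally_small U A \<longleftrightarrow> (\<forall>X\<in>obj A. \<forall>Y\<in>obj A. small U (hom A X Y))"

definition small_category :: "'u itself \<Rightarrow> ('o, 'm) cat \<Rightarrow> bool" where
  "small_category U A \<longleftrightarrow> small U (obj A) \<and> locally_small U A"

text \<open>
  Smallness of the target bounds the family of all \<open>F X\<close>, but a cowedge over \<open>F\<close> has one component
  for each object \<open>X\<close> of the source: the constant functor at the field \<open>k\<close>, from a large discrete
  category to the small category with the single object \<open>k\<close>, has no coend in vector spaces.
  Small fibres exclude this; they are automatic if the source is small.
\<close>

definition small_fibres :: "'u itself \<Rightarrow> ('b, 'n) cat \<Rightarrow> ('o, 'm) cat \<Rightarrow> ('b \<Rightarrow> 'o) \<Rightarrow> bool" where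
  "small_fibres U B A FO \<longleftrightarrow> (\<forall>P\<in>obj A. small U {X \<in> obj B. FO X = P})"

definition cocone ::
  "('j, 'k) cat \<Rightarrow> ('o, 'm) cat \<Rightarrow> ('j \<Rightarrow> 'o) \<Rightarrow> ('k \<Rightarrow> 'm) \<Rightarrow> 'o \<Rightarrow> ('j \<Rightarrow> 'm) \<Rightarrow> bool" where
  "cocone J A DO DM d \<mu> \<longleftrightarrow>
     d \<in> obj A \<and> (\<forall>x\<in>obj J. \<mu> x \<in> hom A (DO x) d) \<and>
     (\<forall>x\<in>obj J. \<forall>y\<in>obj J. \<forall>f\<in>hom J x y. \<mu> y \<cdot>\<^bsub>A\<^esub> DM f = \<mu> x)"

definition colimit ::
  "('j, 'k) cat \<Rightarrow> ('o, 'm) cat \<Rightarrow> ('j \<Rightarrow> 'o) \<Rightarrow> ('k \<Rightarrow> 'm) \<Rightarrow> 'o \<Rightarrow> ('j \<Rightarrow> 'm) \<Rightarrow> bool" where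
  "colimit J A DO DM c \<iota> \<longleftrightarrow>
     cocone J A DO DM c \<iota> \<and>
     (\<forall>d \<mu>. cocone J A DO DM d \<mu> \<longrightarrow>
        (\<exists>!h. h \<in> hom A c d \<and> (\<forall>x\<in>obj J. h \<cdot>\<^bsub>A\<^esub> \<iota> x = \<mu> x)))"

text \<open>Every small category is isomorphic to one whose objects and arrows lie in the universe type.\<close>

definition cocomplete :: "'u itself \<Rightarrow> ('o, 'm) cat \<Rightarrow> bool" where
  "cocomplete U A \<longleftrightarrow>
     (\<forall>(J :: ('u, 'u) cat) DO DM. small_category U J \<and> cat_functor J A DO DM \<longrightarrow>
        (\<exists>c \<iota>. colimit J A DO DM c \<iota>))"


section \<open>Monoidal and braided categories\<close>

text \<open>\<open>\<otimes>\<close> is the tensor product of objects, \<open>\<boxtimes>\<close> that of arrows.\<close>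

record ('o, 'm) monoidal =
  tens :: "'o \<Rightarrow> 'o \<Rightarrow> 'o" (infixl "\<otimes>\<index>" 75)
  tensm :: "'m \<Rightarrow> 'm \<Rightarrow> 'm" (infixl "\<boxtimes>\<index>" 75)
  uno :: "'o"
  assoc :: "'o \<Rightarrow> 'o \<Rightarrow> 'o \<Rightarrow> 'm"
  lunit :: "'o \<Rightarrow> 'm"
  runit :: "'o \<Rightarrow> 'm"

locale cat_bifunctor = fst: category B + snd: category B' + tgt: category A
  for B :: "('b, 'n) cat" and B' :: "('b', 'n') cat" and A :: "('o, 'm) cat" +
  fixes HO :: "'b \<Rightarrow> 'b' \<Rightarrow> 'o" and HM :: "'n \<Rightarrow> 'n' \<Rightarrow> 'm"
  assumes obj_map: "\<lbrakk>P \<in> obj B; Q \<in> obj B'\<rbrakk> \<Longrightarrow> HO P Q \<in> obj A"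
    and hom_map: "\<lbrakk>P \<in> obj B; P' \<in> obj B; Q \<in> obj B'; Q' \<in> obj B'; f \<in> hom B P P'; g \<in> hom B' Q Q'\<rbrakk>
      \<Longrightarrow> HM f g \<in> hom A (HO P Q) (HO P' Q')"
    and ident_map: "\<lbrakk>P \<in> obj B; Q \<in> obj B'\<rbrakk> \<Longrightarrow> HM (ident B P) (ident B' Q) = ident A (HO P Q)"
    and cmp_map: "\<lbrakk>P \<in> obj B; P' \<in> obj B; P'' \<in> obj B; Q \<in> obj B'; Q' \<in> obj B'; Q'' \<in> obj B';
        f \<in> hom B P P'; f' \<in> hom B P' P''; g \<in> hom B' Q Q'; g' \<in> hom B' Q' Q''\<rbrakk>
      \<Longrightarrow> HM (f' \<cdot>\<^bsub>B\<^esub> f) (g' \<cdot>\<^bsub>B'\<^esub> g) = HM f' g' \<cdot>\<^bsub>A\<^esub> HM f g"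

locale monoidal_category = cat_bifunctor A A A "tens M" "tensm M"
  for A :: "('o, 'm) cat" and M :: "('o, 'm) monoidal" +
  assumes uno_obj: "uno M \<in> obj A"
    and assoc_iso: "\<lbrakk>P \<in> obj A; Q \<in> obj A; R \<in> obj A\<rbrakk>
      \<Longrightarrow> iso A ((P \<otimes>\<^bsub>M\<^esub> Q) \<otimes>\<^bsub>M\<^esub> R) (P \<otimes>\<^bsub>M\<^esub> (Q \<otimes>\<^bsub>M\<^esub> R)) (assoc M P Q R)"
    and assoc_nat: "\<lbrakk>P \<in> obj A; P' \<in> obj A; Q \<in> obj A; Q' \<in> obj A; R \<in> obj A; R' \<in> obj A;
        f \<in> hom A P P'; g \<in> hom A Q Q'; h \<in> hom A R R'\<rbrakk>
      \<Longrightarrow> assoc M P' Q' R' \<cdot>\<^bsub>A\<^esub> ((f \<boxtimes>\<^bsub>M\<^esub> g) \<boxtimes>\<^bsub>M\<^esub> h) = (f \<boxtimes>\<^bsub>M\<^esub> (g \<boxtimes>\<^bsub>M\<^esub> h)) \<cdot>\<^bsub>A\<^esub> assoc M P Q R"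
    and lunit_iso: "P \<in> obj A \<Longrightarrow> iso A (uno M \<otimes>\<^bsub>M\<^esub> P) P (lunit M P)"
    and lunit_nat: "\<lbrakk>P \<in> obj A; P' \<in> obj A; f \<in> hom A P P'\<rbrakk>
      \<Longrightarrow> lunit M P' \<cdot>\<^bsub>A\<^esub> (ident A (uno M) \<boxtimes>\<^bsub>M\<^esub> f) = f \<cdot>\<^bsub>A\<^esub> lunit M P"
    and runit_iso: "P \<in> obj A \<Longrightarrow> iso A (P \<otimes>\<^bsub>M\<^esub> uno M) P (runit M P)"
    and runit_nat: "\<lbrakk>P \<in> obj A; P' \<in> obj A; f \<in> hom A P P'\<rbrakk>
      \<Longrightarrow> runit M P' \<cdot>\<^bsub>A\<^esub> (f \<boxtimes>\<^bsub>M\<^esub> ident A (uno M)) = f \<cdot>\<^bsub>A\<^esub> runit M P"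
    and pentagon: "\<lbrakk>P \<in> obj A; Q \<in> obj A; R \<in> obj A; S \<in> obj A\<rbrakk>
      \<Longrightarrow> assoc M P Q (R \<otimes>\<^bsub>M\<^esub> S) \<cdot>\<^bsub>A\<^esub> assoc M (P \<otimes>\<^bsub>M\<^esub> Q) R S =
          (ident A P \<boxtimes>\<^bsub>M\<^esub> assoc M Q R S) \<cdot>\<^bsub>A\<^esub> assoc M P (Q \<otimes>\<^bsub>M\<^esub> R) S \<cdot>\<^bsub>A\<^esub> (assoc M P Q R \<boxtimes>\<^bsub>M\<^esub> ident A S)"
    and triangle: "\<lbrakk>P \<in> obj A; Q \<in> obj A\<rbrakk>
      \<Longrightarrow> (ident A P \<boxtimes>\<^bsub>M\<^esub> lunit M Q) \<cdot>\<^bsub>A\<^esub> assoc M P (uno M) Q = runit M P \<boxtimes>\<^bsub>M\<^esub> ident A Q"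

locale braided_monoidal_category = monoidal_category A M
  for A :: "('o, 'm) cat" and M :: "('o, 'm) monoidal" +
  fixes \<tau> :: "'o \<Rightarrow> 'o \<Rightarrow> 'm"
  assumes braid_iso: "\<lbrakk>P \<in> obj A; Q \<in> obj A\<rbrakk> \<Longrightarrow> iso A (P \<otimes>\<^bsub>M\<^esub> Q) (Q \<otimes>\<^bsub>M\<^esub> P) (\<tau> P Q)"
    and braid_nat: "\<lbrakk>P \<in> obj A; P' \<in> obj A; Q \<in> obj A; Q' \<in> obj A; f \<in> hom A P P'; g \<in> hom A Q Q'\<rbrakk>
      \<Longrightarrow> \<tau> P' Q' \<cdot>\<^bsub>A\<^esub> (f \<boxtimes>\<^bsub>M\<^esub> g) = (g \<boxtimes>\<^bsub>M\<^esub> f) \<cdot>\<^bsub>A\<^esub> \<tau> P Q"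
    and hexagon: "\<lbrakk>P \<in> obj A; Q \<in> obj A; R \<in> obj A\<rbrakk>
      \<Longrightarrow> assoc M Q R P \<cdot>\<^bsub>A\<^esub> \<tau> P (Q \<otimes>\<^bsub>M\<^esub> R) \<cdot>\<^bsub>A\<^esub> assoc M P Q R =
          (ident A Q \<boxtimes>\<^bsub>M\<^esub> \<tau> P R) \<cdot>\<^bsub>A\<^esub> assoc M Q P R \<cdot>\<^bsub>A\<^esub> (\<tau> P Q \<boxtimes>\<^bsub>M\<^esub> ident A R)"
    and hexagon_inv: "\<lbrakk>P \<in> obj A; Q \<in> obj A; R \<in> obj A\<rbrakk>
      \<Longrightarrow> \<tau> (P \<otimes>\<^bsub>M\<^esub> Q) R =
          assoc M R P Q \<cdot>\<^bsub>A\<^esub> (\<tau> P R \<boxtimes>\<^bsub>M\<^esub> ident A Q) \<cdot>\<^bsub>A\<^esub>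
          inv_arr A ((P \<otimes>\<^bsub>M\<^esub> R) \<otimes>\<^bsub>M\<^esub> Q) (P \<otimes>\<^bsub>M\<^esub> (R \<otimes>\<^bsub>M\<^esub> Q)) (assoc M P R Q) \<cdot>\<^bsub>A\<^esub>
          (ident A P \<boxtimes>\<^bsub>M\<^esub> \<tau> Q R) \<cdot>\<^bsub>A\<^esub> assoc M P Q R"


section \<open>Categories with an action of a monoidal category\<close>

text \<open>\<open>\<rhd>\<close> is the action on objects, \<open>\<unrhd>\<close> that on arrows.\<close>

record ('c, 'd, 'o, 'm) action =
  act :: "'c \<Rightarrow> 'o \<Rightarrow> 'o" (infixr "\<rhd>\<index>" 75)
  actm :: "'d \<Rightarrow> 'm \<Rightarrow> 'm" (infixr "\<unrhd>\<index>" 75)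
  act_assoc :: "'c \<Rightarrow> 'c \<Rightarrow> 'o \<Rightarrow> 'm"
  act_unit :: "'o \<Rightarrow> 'm"

locale c_category = base: monoidal_category C MC + cat_bifunctor C B B "act a" "actm a"
  for C :: "('c, 'd) cat" and MC :: "('c, 'd) monoidal"
    and B :: "('b, 'n) cat" and a :: "('c, 'd, 'b, 'n) action" +
  assumes act_assoc_iso: "\<lbrakk>X \<in> obj C; Y \<in> obj C; P \<in> obj B\<rbrakk>
      \<Longrightarrow> iso B ((X \<otimes>\<^bsub>MC\<^esub> Y) \<rhd>\<^bsub>a\<^esub> P) (X \<rhd>\<^bsub>a\<^esub> (Y \<rhd>\<^bsub>a\<^esub> P)) (act_assoc a X Y P)"
    and act_assoc_nat: "\<lbrakk>X \<in> obj C; X' \<in> obj C; Y \<in> obj C; Y' \<in> obj C; P \<in> obj B; P' \<in> obj B;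
        f \<in> hom C X X'; g \<in> hom C Y Y'; h \<in> hom B P P'\<rbrakk>
      \<Longrightarrow> act_assoc a X' Y' P' \<cdot>\<^bsub>B\<^esub> ((f \<boxtimes>\<^bsub>MC\<^esub> g) \<unrhd>\<^bsub>a\<^esub> h) = (f \<unrhd>\<^bsub>a\<^esub> (g \<unrhd>\<^bsub>a\<^esub> h)) \<cdot>\<^bsub>B\<^esub> act_assoc a X Y P"
    and act_unit_iso: "P \<in> obj B \<Longrightarrow> iso B (uno MC \<rhd>\<^bsub>a\<^esub> P) P (act_unit a P)"
    and act_unit_nat: "\<lbrakk>P \<in> obj B; P' \<in> obj B; h \<in> hom B P P'\<rbrakk>
      \<Longrightarrow> act_unit a P' \<cdot>\<^bsub>B\<^esub> (ident C (uno MC) \<unrhd>\<^bsub>a\<^esub> h) = h \<cdot>\<^bsub>B\<^esub> act_unit a P"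
    and act_pentagon: "\<lbrakk>X \<in> obj C; Y \<in> obj C; Z \<in> obj C; P \<in> obj B\<rbrakk>
      \<Longrightarrow> act_assoc a X Y (Z \<rhd>\<^bsub>a\<^esub> P) \<cdot>\<^bsub>B\<^esub> act_assoc a (X \<otimes>\<^bsub>MC\<^esub> Y) Z P =
          (ident C X \<unrhd>\<^bsub>a\<^esub> act_assoc a Y Z P) \<cdot>\<^bsub>B\<^esub> act_assoc a X (Y \<otimes>\<^bsub>MC\<^esub> Z) P \<cdot>\<^bsub>B\<^esub>
          (assoc MC X Y Z \<unrhd>\<^bsub>a\<^esub> ident B P)"
    and act_triangle: "\<lbrakk>X \<in> obj C; P \<in> obj B\<rbrakk>
      \<Longrightarrow> (ident C X \<unrhd>\<^bsub>a\<^esub> act_unit a P) \<cdot>\<^bsub>B\<^esub> act_assoc a X (uno MC) P = runit MC X \<unrhd>\<^bsub>a\<^esub> ident B P"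
    and act_triangle_left: "\<lbrakk>X \<in> obj C; P \<in> obj B\<rbrakk>
      \<Longrightarrow> act_unit a (X \<rhd>\<^bsub>a\<^esub> P) \<cdot>\<^bsub>B\<^esub> act_assoc a (uno MC) X P = lunit MC X \<unrhd>\<^bsub>a\<^esub> ident B P"

locale c_functor =
  src: c_category C MC B a + tgt: c_category C MC B' a' + cat_functor B B' FO FM
  for C :: "('c, 'd) cat" and MC :: "('c, 'd) monoidal"
    and B :: "('b, 'n) cat" and a :: "('c, 'd, 'b, 'n) action"
    and B' :: "('o, 'm) cat" and a' :: "('c, 'd, 'o, 'm) action"
    and FO :: "'b \<Rightarrow> 'o" and FM :: "'n \<Rightarrow> 'm" +
  fixes \<xi> :: "'c \<Rightarrow> 'b \<Rightarrow> 'm"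
  assumes xi_iso: "\<lbrakk>X \<in> obj C; P \<in> obj B\<rbrakk> \<Longrightarrow> iso B' (FO (X \<rhd>\<^bsub>a\<^esub> P)) (X \<rhd>\<^bsub>a'\<^esub> FO P) (\<xi> X P)"
    and xi_nat: "\<lbrakk>X \<in> obj C; X' \<in> obj C; P \<in> obj B; P' \<in> obj B; f \<in> hom C X X'; g \<in> hom B P P'\<rbrakk>
      \<Longrightarrow> \<xi> X' P' \<cdot>\<^bsub>B'\<^esub> FM (f \<unrhd>\<^bsub>a\<^esub> g) = (f \<unrhd>\<^bsub>a'\<^esub> FM g) \<cdot>\<^bsub>B'\<^esub> \<xi> X P"
    and xi_assoc: "\<lbrakk>X \<in> obj C; Y \<in> obj C; P \<in> obj B\<rbrakk>
      \<Longrightarrow> act_assoc a' X Y (FO P) \<cdot>\<^bsub>B'\<^esub> \<xi> (X \<otimes>\<^bsub>MC\<^esub> Y) P =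
          (ident C X \<unrhd>\<^bsub>a'\<^esub> \<xi> Y P) \<cdot>\<^bsub>B'\<^esub> \<xi> X (Y \<rhd>\<^bsub>a\<^esub> P) \<cdot>\<^bsub>B'\<^esub> FM (act_assoc a X Y P)"
    and xi_unit: "P \<in> obj B \<Longrightarrow> act_unit a' (FO P) \<cdot>\<^bsub>B'\<^esub> \<xi> (uno MC) P = FM (act_unit a P)"

text \<open>
  A \<open>C\<close>-bifunctor \<open>H\<close> comes with \<open>l\<close> from \<open>H (X \<rhd> P) Q\<close> to \<open>X \<rhd> H P Q\<close> and \<open>r\<close> from \<open>H P (X \<rhd> Q)\<close>
  to \<open>X \<rhd> H P Q\<close>. In \<open>lr_braid\<close>, the orientation of the braiding is the one for which \<open>C\<close>, acting on
  itself by its tensor product, is a \<open>C\<close>-bifunctor when \<open>r\<close> moves \<open>X\<close> past \<open>P\<close> by \<open>\<beta> P X\<close>.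
\<close>

locale c_bifunctor =
  base: braided_monoidal_category C MC \<beta> +
  fst: c_category C MC B a + snd: c_category C MC B' a' + tgt: c_category C MC B'' a'' +
  cat_bifunctor B B' B'' HO HM
  for C :: "('c, 'd) cat" and MC :: "('c, 'd) monoidal" and \<beta> :: "'c \<Rightarrow> 'c \<Rightarrow> 'd"
    and B :: "('b, 'n) cat" and a :: "('c, 'd, 'b, 'n) action"
    and B' :: "('b', 'n') cat" and a' :: "('c, 'd, 'b', 'n') action"
    and B'' :: "('o, 'm) cat" and a'' :: "('c, 'd, 'o, 'm) action"
    and HO :: "'b \<Rightarrow> 'b' \<Rightarrow> 'o" and HM :: "'n \<Rightarrow> 'n' \<Rightarrow> 'm" +
  fixes l :: "'c \<Rightarrow> 'b \<Rightarrow> 'b' \<Rightarrow> 'm" and r :: "'c \<Rightarrow> 'b \<Rightarrow> 'b' \<Rightarrow> 'm"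
  assumes c_functor_fst: "Q \<in> obj B' \<Longrightarrow>
        c_functor C MC B a B'' a'' (\<lambda>P. HO P Q) (\<lambda>f. HM f (ident B' Q)) (\<lambda>X P. l X P Q)"
    and c_functor_snd: "P \<in> obj B \<Longrightarrow>
        c_functor C MC B' a' B'' a'' (HO P) (HM (ident B P)) (\<lambda>X Q. r X P Q)"
    and l_nat: "\<lbrakk>X \<in> obj C; P \<in> obj B; Q \<in> obj B'; Q' \<in> obj B'; g \<in> hom B' Q Q'\<rbrakk>
      \<Longrightarrow> l X P Q' \<cdot>\<^bsub>B''\<^esub> HM (ident B (X \<rhd>\<^bsub>a\<^esub> P)) g = (ident C X \<unrhd>\<^bsub>a''\<^esub> HM (ident B P) g) \<cdot>\<^bsub>B''\<^esub> l X P Q"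
    and r_nat: "\<lbrakk>X \<in> obj C; P \<in> obj B; P' \<in> obj B; Q \<in> obj B'; f \<in> hom B P P'\<rbrakk>
      \<Longrightarrow> r X P' Q \<cdot>\<^bsub>B''\<^esub> HM f (ident B' (X \<rhd>\<^bsub>a'\<^esub> Q)) = (ident C X \<unrhd>\<^bsub>a''\<^esub> HM f (ident B' Q)) \<cdot>\<^bsub>B''\<^esub> r X P Q"
    and lr_braid: "\<lbrakk>X \<in> obj C; Y \<in> obj C; P \<in> obj B; Q \<in> obj B'\<rbrakk>
      \<Longrightarrow> (ident C Y \<unrhd>\<^bsub>a''\<^esub> l X P Q) \<cdot>\<^bsub>B''\<^esub> r Y (X \<rhd>\<^bsub>a\<^esub> P) Q =
          act_assoc a'' Y X (HO P Q) \<cdot>\<^bsub>B''\<^esub> (\<beta> X Y \<unrhd>\<^bsub>a''\<^esub> ident B'' (HO P Q)) \<cdot>\<^bsub>B''\<^esub>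
          inv_arr B'' ((X \<otimes>\<^bsub>MC\<^esub> Y) \<rhd>\<^bsub>a''\<^esub> HO P Q) (X \<rhd>\<^bsub>a''\<^esub> (Y \<rhd>\<^bsub>a''\<^esub> HO P Q)) (act_assoc a'' X Y (HO P Q)) \<cdot>\<^bsub>B''\<^esub>
          (ident C X \<unrhd>\<^bsub>a''\<^esub> r Y P Q) \<cdot>\<^bsub>B''\<^esub> l X P (Y \<rhd>\<^bsub>a'\<^esub> Q)"

locale c_bimorphism =
  src: c_bifunctor C MC \<beta> B a B' a' B'' a'' HO HM l r +
  tgt: c_bifunctor C MC \<beta> B a B' a' B'' a'' KO KM l' r'
  for C :: "('c, 'd) cat" and MC :: "('c, 'd) monoidal" and \<beta> :: "'c \<Rightarrow> 'c \<Rightarrow> 'd"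
    and B :: "('b, 'n) cat" and a :: "('c, 'd, 'b, 'n) action"
    and B' :: "('b', 'n') cat" and a' :: "('c, 'd, 'b', 'n') action"
    and B'' :: "('o, 'm) cat" and a'' :: "('c, 'd, 'o, 'm) action"
    and HO :: "'b \<Rightarrow> 'b' \<Rightarrow> 'o" and HM :: "'n \<Rightarrow> 'n' \<Rightarrow> 'm"
    and l :: "'c \<Rightarrow> 'b \<Rightarrow> 'b' \<Rightarrow> 'm" and r :: "'c \<Rightarrow> 'b \<Rightarrow> 'b' \<Rightarrow> 'm"
    and KO :: "'b \<Rightarrow> 'b' \<Rightarrow> 'o" and KM :: "'n \<Rightarrow> 'n' \<Rightarrow> 'm"
    and l' :: "'c \<Rightarrow> 'b \<Rightarrow> 'b' \<Rightarrow> 'm" and r' :: "'c \<Rightarrow> 'b \<Rightarrow> 'b' \<Rightarrow> 'm" +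
  fixes \<phi> :: "'b \<Rightarrow> 'b' \<Rightarrow> 'm"
  assumes comp_hom: "\<lbrakk>P \<in> obj B; Q \<in> obj B'\<rbrakk> \<Longrightarrow> \<phi> P Q \<in> hom B'' (HO P Q) (KO P Q)"
    and natural: "\<lbrakk>P \<in> obj B; P' \<in> obj B; Q \<in> obj B'; Q' \<in> obj B'; f \<in> hom B P P'; g \<in> hom B' Q Q'\<rbrakk>
      \<Longrightarrow> \<phi> P' Q' \<cdot>\<^bsub>B''\<^esub> HM f g = KM f g \<cdot>\<^bsub>B''\<^esub> \<phi> P Q"
    and compat_fst: "\<lbrakk>X \<in> obj C; P \<in> obj B; Q \<in> obj B'\<rbrakk>
      \<Longrightarrow> l' X P Q \<cdot>\<^bsub>B''\<^esub> \<phi> (X \<rhd>\<^bsub>a\<^esub> P) Q = (ident C X \<unrhd>\<^bsub>a''\<^esub> \<phi> P Q) \<cdot>\<^bsub>B''\<^esub> l X P Q"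
    and compat_snd: "\<lbrakk>X \<in> obj C; P \<in> obj B; Q \<in> obj B'\<rbrakk>
      \<Longrightarrow> r' X P Q \<cdot>\<^bsub>B''\<^esub> \<phi> P (X \<rhd>\<^bsub>a'\<^esub> Q) = (ident C X \<unrhd>\<^bsub>a''\<^esub> \<phi> P Q) \<cdot>\<^bsub>B''\<^esub> r X P Q"


section \<open>Monoidal categories and functors over a braided category\<close>

text \<open>
  The \<open>C\<close>-bifunctor structure of the tensor product: \<open>pull1\<close> from \<open>(X \<rhd> P) \<otimes> Q\<close> and \<open>pull2\<close> from
  \<open>P \<otimes> (X \<rhd> Q)\<close> to \<open>X \<rhd> (P \<otimes> Q)\<close>. Coherence with the monoidal structure means that the associator
  is \<open>C\<close>-natural in each of its three variables, and the unitors are \<open>C\<close>-natural.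
\<close>

record ('c, 'o, 'm) pulls =
  pull1 :: "'c \<Rightarrow> 'o \<Rightarrow> 'o \<Rightarrow> 'm"
  pull2 :: "'c \<Rightarrow> 'o \<Rightarrow> 'o \<Rightarrow> 'm"

locale c_monoidal_category =
  monoidal_category A M + c_bifunctor C MC \<beta> A a A a A a "tens M" "tensm M" "pull1 p" "pull2 p"
  for C :: "('c, 'd) cat" and MC :: "('c, 'd) monoidal" and \<beta> :: "'c \<Rightarrow> 'c \<Rightarrow> 'd"
    and A :: "('o, 'm) cat" and a :: "('c, 'd, 'o, 'm) action"
    and M :: "('o, 'm) monoidal" and p :: "('c, 'o, 'm) pulls" +
  assumes assoc_fst: "\<lbrakk>X \<in> obj C; P \<in> obj A; Q \<in> obj A; R \<in> obj A\<rbrakk>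
      \<Longrightarrow> pull1 p X P (Q \<otimes>\<^bsub>M\<^esub> R) \<cdot>\<^bsub>A\<^esub> assoc M (X \<rhd>\<^bsub>a\<^esub> P) Q R =
          (ident C X \<unrhd>\<^bsub>a\<^esub> assoc M P Q R) \<cdot>\<^bsub>A\<^esub> pull1 p X (P \<otimes>\<^bsub>M\<^esub> Q) R \<cdot>\<^bsub>A\<^esub> (pull1 p X P Q \<boxtimes>\<^bsub>M\<^esub> ident A R)"
    and assoc_snd: "\<lbrakk>X \<in> obj C; P \<in> obj A; Q \<in> obj A; R \<in> obj A\<rbrakk>
      \<Longrightarrow> pull2 p X P (Q \<otimes>\<^bsub>M\<^esub> R) \<cdot>\<^bsub>A\<^esub> (ident A P \<boxtimes>\<^bsub>M\<^esub> pull1 p X Q R) \<cdot>\<^bsub>A\<^esub> assoc M P (X \<rhd>\<^bsub>a\<^esub> Q) R =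
          (ident C X \<unrhd>\<^bsub>a\<^esub> assoc M P Q R) \<cdot>\<^bsub>A\<^esub> pull1 p X (P \<otimes>\<^bsub>M\<^esub> Q) R \<cdot>\<^bsub>A\<^esub> (pull2 p X P Q \<boxtimes>\<^bsub>M\<^esub> ident A R)"
    and assoc_thd: "\<lbrakk>X \<in> obj C; P \<in> obj A; Q \<in> obj A; R \<in> obj A\<rbrakk>
      \<Longrightarrow> pull2 p X P (Q \<otimes>\<^bsub>M\<^esub> R) \<cdot>\<^bsub>A\<^esub> (ident A P \<boxtimes>\<^bsub>M\<^esub> pull2 p X Q R) \<cdot>\<^bsub>A\<^esub> assoc M P Q (X \<rhd>\<^bsub>a\<^esub> R) =
          (ident C X \<unrhd>\<^bsub>a\<^esub> assoc M P Q R) \<cdot>\<^bsub>A\<^esub> pull2 p X (P \<otimes>\<^bsub>M\<^esub> Q) R"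
    and lunit_c_nat: "\<lbrakk>X \<in> obj C; P \<in> obj A\<rbrakk>
      \<Longrightarrow> (ident C X \<unrhd>\<^bsub>a\<^esub> lunit M P) \<cdot>\<^bsub>A\<^esub> pull2 p X (uno M) P = lunit M (X \<rhd>\<^bsub>a\<^esub> P)"
    and runit_c_nat: "\<lbrakk>X \<in> obj C; P \<in> obj A\<rbrakk>
      \<Longrightarrow> (ident C X \<unrhd>\<^bsub>a\<^esub> runit M P) \<cdot>\<^bsub>A\<^esub> pull1 p X P (uno M) = runit M (X \<rhd>\<^bsub>a\<^esub> P)"

definition c_monoidal_subcategory ::
  "('c, 'd) cat \<Rightarrow> ('c, 'd) monoidal \<Rightarrow> ('c \<Rightarrow> 'c \<Rightarrow> 'd) \<Rightarrow> ('o, 'm) cat \<Rightarrow> ('o, 'm) cat \<Rightarrow>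
   ('c, 'd, 'o, 'm) action \<Rightarrow> ('o, 'm) monoidal \<Rightarrow> ('c, 'o, 'm) pulls \<Rightarrow> bool" where
  "c_monoidal_subcategory C MC \<beta> A\<^sub>0 A a M p \<longleftrightarrow>
     subcategory A\<^sub>0 A \<and> c_monoidal_category C MC \<beta> A a M p \<and> c_monoidal_category C MC \<beta> A\<^sub>0 a M p"

text \<open>The embedding of \<open>C\<close>, \<open>X \<mapsto> X \<rhd> I\<close>, and its monoidal structure.\<close>

definition embed :: "('c, 'd, 'o, 'm) action \<Rightarrow> ('o, 'm) monoidal \<Rightarrow> 'c \<Rightarrow> 'o" where
  "embed a M X = X \<rhd>\<^bsub>a\<^esub> uno M"

definition embed_mult ::
  "('c, 'd) cat \<Rightarrow> ('c, 'd) monoidal \<Rightarrow> ('o, 'm) cat \<Rightarrow> ('c, 'd, 'o, 'm) action \<Rightarrow> ('o, 'm) monoidal \<Rightarrow>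
   ('c, 'o, 'm) pulls \<Rightarrow> 'c \<Rightarrow> 'c \<Rightarrow> 'm" where
  "embed_mult C MC A a M p X Y =
     inv_arr A ((X \<otimes>\<^bsub>MC\<^esub> Y) \<rhd>\<^bsub>a\<^esub> uno M) (X \<rhd>\<^bsub>a\<^esub> (Y \<rhd>\<^bsub>a\<^esub> uno M)) (act_assoc a X Y (uno M)) \<cdot>\<^bsub>A\<^esub>
     (ident C X \<unrhd>\<^bsub>a\<^esub> lunit M (embed a M Y)) \<cdot>\<^bsub>A\<^esub> pull1 p X (uno M) (embed a M Y)"

text \<open>
  Coherence of the braiding \<open>\<tau>\<close> with that of \<open>C\<close>: along the embedding it is \<open>\<beta>\<close>, and \<open>pull2\<close>, which
  moves an object \<open>X\<close> of \<open>C\<close> to the left past \<open>P\<close>, is the braiding of \<open>P\<close> with the embedded \<open>X\<close>.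
  The analogous condition on \<open>\<tau> (X \<rhd> P) Q\<close> is not imposed: together with \<open>braid_pull2\<close> it would
  make the double braiding with every embedded object trivial, hence every object \<open>C\<close>-central.
\<close>

locale c_braided_category =
  c_monoidal_category C MC \<beta> A a M p + braided_monoidal_category A M \<tau>
  for C :: "('c, 'd) cat" and MC :: "('c, 'd) monoidal" and \<beta> :: "'c \<Rightarrow> 'c \<Rightarrow> 'd"
    and A :: "('o, 'm) cat" and a :: "('c, 'd, 'o, 'm) action"
    and M :: "('o, 'm) monoidal" and p :: "('c, 'o, 'm) pulls" and \<tau> :: "'o \<Rightarrow> 'o \<Rightarrow> 'm" +
  assumes braid_embed: "\<lbrakk>X \<in> obj C; Y \<in> obj C\<rbrakk>
      \<Longrightarrow> embed_mult C MC A a M p Y X \<cdot>\<^bsub>A\<^esub> \<tau> (embed a M X) (embed a M Y) =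
          (\<beta> X Y \<unrhd>\<^bsub>a\<^esub> ident A (uno M)) \<cdot>\<^bsub>A\<^esub> embed_mult C MC A a M p X Y"
    and braid_pull2: "\<lbrakk>X \<in> obj C; P \<in> obj A; Q \<in> obj A\<rbrakk>
      \<Longrightarrow> pull1 p X Q P \<cdot>\<^bsub>A\<^esub> \<tau> P (X \<rhd>\<^bsub>a\<^esub> Q) = (ident C X \<unrhd>\<^bsub>a\<^esub> \<tau> P Q) \<cdot>\<^bsub>A\<^esub> pull2 p X P Q"

definition c_central ::
  "('c, 'd) cat \<Rightarrow> ('o, 'm) cat \<Rightarrow> ('c, 'd, 'o, 'm) action \<Rightarrow> ('o, 'm) monoidal \<Rightarrow>
   ('o \<Rightarrow> 'o \<Rightarrow> 'm) \<Rightarrow> 'o \<Rightarrow> bool" where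
  "c_central C A a M \<tau> P \<longleftrightarrow>
     P \<in> obj A \<and>
     (\<forall>X\<in>obj C. \<forall>Q\<in>obj A.
        (\<tau> P (embed a M X) \<boxtimes>\<^bsub>M\<^esub> ident A Q) \<cdot>\<^bsub>A\<^esub> (\<tau> (embed a M X) P \<boxtimes>\<^bsub>M\<^esub> ident A Q) =
        ident A ((embed a M X \<otimes>\<^bsub>M\<^esub> P) \<otimes>\<^bsub>M\<^esub> Q))"

text \<open>
  The structure morphism \<open>J\<close> goes from \<open>F P \<otimes> F Q\<close> to \<open>F (P \<otimes> Q)\<close>. Both sides are \<open>C\<close>-bifunctors, with
  the structures composed from \<open>\<xi>\<close> and the \<open>C\<close>-bifunctor structures of the tensor products.
\<close>

locale c_monoidal_functor =
  src: c_monoidal_category C MC \<beta> B b N q + tgt: c_monoidal_category C MC \<beta> A a M p +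
  c_functor C MC B b A a FO FM \<xi>
  for C :: "('c, 'd) cat" and MC :: "('c, 'd) monoidal" and \<beta> :: "'c \<Rightarrow> 'c \<Rightarrow> 'd"
    and B :: "('b, 'n) cat" and b :: "('c, 'd, 'b, 'n) action"
    and N :: "('b, 'n) monoidal" and q :: "('c, 'b, 'n) pulls"
    and A :: "('o, 'm) cat" and a :: "('c, 'd, 'o, 'm) action"
    and M :: "('o, 'm) monoidal" and p :: "('c, 'o, 'm) pulls"
    and FO :: "'b \<Rightarrow> 'o" and FM :: "'n \<Rightarrow> 'm" and \<xi> :: "'c \<Rightarrow> 'b \<Rightarrow> 'm" +
  fixes J :: "'b \<Rightarrow> 'b \<Rightarrow> 'm" and J\<^sub>0 :: "'m"
  assumes J_iso: "\<lbrakk>P \<in> obj B; Q \<in> obj B\<rbrakk> \<Longrightarrow> iso A (FO P \<otimes>\<^bsub>M\<^esub> FO Q) (FO (P \<otimes>\<^bsub>N\<^esub> Q)) (J P Q)"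
    and J0_iso: "iso A (uno M) (FO (uno N)) J\<^sub>0"
    and J_assoc: "\<lbrakk>P \<in> obj B; Q \<in> obj B; R \<in> obj B\<rbrakk>
      \<Longrightarrow> FM (assoc N P Q R) \<cdot>\<^bsub>A\<^esub> J (P \<otimes>\<^bsub>N\<^esub> Q) R \<cdot>\<^bsub>A\<^esub> (J P Q \<boxtimes>\<^bsub>M\<^esub> ident A (FO R)) =
          J P (Q \<otimes>\<^bsub>N\<^esub> R) \<cdot>\<^bsub>A\<^esub> (ident A (FO P) \<boxtimes>\<^bsub>M\<^esub> J Q R) \<cdot>\<^bsub>A\<^esub> assoc M (FO P) (FO Q) (FO R)"
    and J_lunit: "P \<in> obj B
      \<Longrightarrow> FM (lunit N P) \<cdot>\<^bsub>A\<^esub> J (uno N) P \<cdot>\<^bsub>A\<^esub> (J\<^sub>0 \<boxtimes>\<^bsub>M\<^esub> ident A (FO P)) = lunit M (FO P)"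
    and J_runit: "P \<in> obj B
      \<Longrightarrow> FM (runit N P) \<cdot>\<^bsub>A\<^esub> J P (uno N) \<cdot>\<^bsub>A\<^esub> (ident A (FO P) \<boxtimes>\<^bsub>M\<^esub> J\<^sub>0) = runit M (FO P)"
    and J_c_bimorphism: "c_bimorphism C MC \<beta> B b B b A a
          (\<lambda>P Q. FO P \<otimes>\<^bsub>M\<^esub> FO Q) (\<lambda>f g. FM f \<boxtimes>\<^bsub>M\<^esub> FM g)
          (\<lambda>X P Q. pull1 p X (FO P) (FO Q) \<cdot>\<^bsub>A\<^esub> (\<xi> X P \<boxtimes>\<^bsub>M\<^esub> ident A (FO Q)))
          (\<lambda>X P Q. pull2 p X (FO P) (FO Q) \<cdot>\<^bsub>A\<^esub> (ident A (FO P) \<boxtimes>\<^bsub>M\<^esub> \<xi> X Q))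
          (\<lambda>P Q. FO (P \<otimes>\<^bsub>N\<^esub> Q)) (\<lambda>f g. FM (f \<boxtimes>\<^bsub>N\<^esub> g))
          (\<lambda>X P Q. \<xi> X (P \<otimes>\<^bsub>N\<^esub> Q) \<cdot>\<^bsub>A\<^esub> FM (pull1 q X P Q))
          (\<lambda>X P Q. \<xi> X (P \<otimes>\<^bsub>N\<^esub> Q) \<cdot>\<^bsub>A\<^esub> FM (pull2 q X P Q))
          J"


section \<open>Cohomomorphism objects\<close>

definition is_cohom ::
  "('o, 'm) cat \<Rightarrow> ('o, 'm) monoidal \<Rightarrow> 'o \<Rightarrow> 'o \<Rightarrow> 'o \<Rightarrow> 'm \<Rightarrow> bool" where
  "is_cohom A M X Y H v \<longleftrightarrow>
     H \<in> obj A \<and> v \<in> hom A X (Y \<otimes>\<^bsub>M\<^esub> H) \<and>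
     (\<forall>Z\<in>obj A. \<forall>\<phi>\<in>hom A X (Y \<otimes>\<^bsub>M\<^esub> Z). \<exists>!g. g \<in> hom A H Z \<and> \<phi> = (ident A Y \<boxtimes>\<^bsub>M\<^esub> g) \<cdot>\<^bsub>A\<^esub> v)"

definition right_coclosed :: "('o, 'm) cat \<Rightarrow> ('o, 'm) cat \<Rightarrow> ('o, 'm) monoidal \<Rightarrow> bool" where
  "right_coclosed A\<^sub>0 A M \<longleftrightarrow> (\<forall>X\<in>obj A\<^sub>0. \<forall>Y\<in>obj A\<^sub>0. \<exists>H v. is_cohom A M X Y H v)"

text \<open>
  A fixed choice of cohomomorphism objects for all pairs that have one, not only for pairs from
  \<open>A\<^sub>0\<close>: the definition of a \<open>C\<close>-cowedge uses \<open>cohom (F (X \<rhd> P)) (X \<rhd> F P)\<close>, which exists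
  because its arguments are isomorphic.
\<close>

definition cohom_pair :: "('o, 'm) cat \<Rightarrow> ('o, 'm) monoidal \<Rightarrow> 'o \<Rightarrow> 'o \<Rightarrow> 'o \<times> 'm" where
  "cohom_pair A M X Y = (SOME (H, v). is_cohom A M X Y H v)"

definition cohom :: "('o, 'm) cat \<Rightarrow> ('o, 'm) monoidal \<Rightarrow> 'o \<Rightarrow> 'o \<Rightarrow> 'o" where
  "cohom A M X Y = fst (cohom_pair A M X Y)"

definition coev :: "('o, 'm) cat \<Rightarrow> ('o, 'm) monoidal \<Rightarrow> 'o \<Rightarrow> 'o \<Rightarrow> 'm" where
  "coev A M X Y = snd (cohom_pair A M X Y)"

definition coact :: "('o, 'm) cat \<Rightarrow> ('o, 'm) monoidal \<Rightarrow> 'o \<Rightarrow> 'o \<Rightarrow> 'o \<Rightarrow> 'm \<Rightarrow> 'm" where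
  "coact A M X Y Z \<phi> =
     (THE g. g \<in> hom A (cohom A M X Y) Z \<and> \<phi> = (ident A Y \<boxtimes>\<^bsub>M\<^esub> g) \<cdot>\<^bsub>A\<^esub> coev A M X Y)"

text \<open>For \<open>f\<close> from \<open>X\<close> to \<open>X'\<close> and \<open>g\<close> from \<open>Y\<close> to \<open>Y'\<close>, an arrow from \<open>cohom X Y'\<close> to \<open>cohom X' Y\<close>.\<close>

definition cohom_map ::
  "('o, 'm) cat \<Rightarrow> ('o, 'm) monoidal \<Rightarrow> 'o \<Rightarrow> 'o \<Rightarrow> 'o \<Rightarrow> 'o \<Rightarrow> 'm \<Rightarrow> 'm \<Rightarrow> 'm" where
  "cohom_map A M X X' Y Y' f g =
     coact A M X Y' (cohom A M X' Y)
       ((g \<boxtimes>\<^bsub>M\<^esub> ident A (cohom A M X' Y)) \<cdot>\<^bsub>A\<^esub> coev A M X' Y \<cdot>\<^bsub>A\<^esub> f)"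


section \<open>The coendomorphism object of a functor\<close>

definition cowedge ::
  "('o, 'm) cat \<Rightarrow> ('o, 'm) monoidal \<Rightarrow> ('b, 'n) cat \<Rightarrow> ('b \<Rightarrow> 'o) \<Rightarrow> ('n \<Rightarrow> 'm) \<Rightarrow>
   'o \<Rightarrow> ('b \<Rightarrow> 'm) \<Rightarrow> bool" where
  "cowedge A M B FO FM d \<mu> \<longleftrightarrow>
     d \<in> obj A \<and>
     (\<forall>P\<in>obj B. \<mu> P \<in> hom A (cohom A M (FO P) (FO P)) d) \<and>
     (\<forall>P\<in>obj B. \<forall>Q\<in>obj B. \<forall>f\<in>hom B P Q.
        \<mu> P \<cdot>\<^bsub>A\<^esub> cohom_map A M (FO P) (FO P) (FO P) (FO Q) (ident A (FO P)) (FM f) =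
        \<mu> Q \<cdot>\<^bsub>A\<^esub> cohom_map A M (FO P) (FO Q) (FO Q) (FO Q) (FM f) (ident A (FO Q)))"

definition cowedge_lambda ::
  "('c, 'd) cat \<Rightarrow> ('o, 'm) cat \<Rightarrow> ('c, 'd, 'o, 'm) action \<Rightarrow> ('o, 'm) monoidal \<Rightarrow> ('c, 'o, 'm) pulls \<Rightarrow>
   ('c, 'd, 'b, 'n) action \<Rightarrow> ('b \<Rightarrow> 'o) \<Rightarrow> ('c \<Rightarrow> 'b \<Rightarrow> 'm) \<Rightarrow> 'c \<Rightarrow> 'b \<Rightarrow> 'm" where
  "cowedge_lambda C A a M p b FO \<xi> X P =
     (let H = cohom A M (FO P) (FO P) in
      coact A M (FO (X \<rhd>\<^bsub>b\<^esub> P)) (X \<rhd>\<^bsub>a\<^esub> FO P) H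
        (inv_arr A ((X \<rhd>\<^bsub>a\<^esub> FO P) \<otimes>\<^bsub>M\<^esub> H) (X \<rhd>\<^bsub>a\<^esub> (FO P \<otimes>\<^bsub>M\<^esub> H)) (pull1 p X (FO P) H) \<cdot>\<^bsub>A\<^esub>
         (ident C X \<unrhd>\<^bsub>a\<^esub> coev A M (FO P) (FO P)) \<cdot>\<^bsub>A\<^esub> \<xi> X P))"

definition c_cowedge ::
  "('c, 'd) cat \<Rightarrow> ('o, 'm) cat \<Rightarrow> ('c, 'd, 'o, 'm) action \<Rightarrow> ('o, 'm) monoidal \<Rightarrow> ('c, 'o, 'm) pulls \<Rightarrow>
   ('b, 'n) cat \<Rightarrow> ('c, 'd, 'b, 'n) action \<Rightarrow> ('b \<Rightarrow> 'o) \<Rightarrow> ('n \<Rightarrow> 'm) \<Rightarrow> ('c \<Rightarrow> 'b \<Rightarrow> 'm) \<Rightarrow>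
   'o \<Rightarrow> ('b \<Rightarrow> 'm) \<Rightarrow> bool" where
  "c_cowedge C A a M p B b FO FM \<xi> d \<mu> \<longleftrightarrow>
     cowedge A M B FO FM d \<mu> \<and>
     (\<forall>X\<in>obj C. \<forall>P\<in>obj B.
        \<mu> (X \<rhd>\<^bsub>b\<^esub> P) \<cdot>\<^bsub>A\<^esub>
          cohom_map A M (FO (X \<rhd>\<^bsub>b\<^esub> P)) (FO (X \<rhd>\<^bsub>b\<^esub> P)) (FO (X \<rhd>\<^bsub>b\<^esub> P)) (X \<rhd>\<^bsub>a\<^esub> FO P)
            (ident A (FO (X \<rhd>\<^bsub>b\<^esub> P))) (\<xi> X P) =
        \<mu> P \<cdot>\<^bsub>A\<^esub> cowedge_lambda C A a M p b FO \<xi> X P)"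

definition c_coend ::
  "('c, 'd) cat \<Rightarrow> ('o, 'm) cat \<Rightarrow> ('c, 'd, 'o, 'm) action \<Rightarrow> ('o, 'm) monoidal \<Rightarrow> ('c, 'o, 'm) pulls \<Rightarrow>
   ('b, 'n) cat \<Rightarrow> ('c, 'd, 'b, 'n) action \<Rightarrow> ('b \<Rightarrow> 'o) \<Rightarrow> ('n \<Rightarrow> 'm) \<Rightarrow> ('c \<Rightarrow> 'b \<Rightarrow> 'm) \<Rightarrow>
   'o \<Rightarrow> ('b \<Rightarrow> 'm) \<Rightarrow> bool" where
  "c_coend C A a M p B b FO FM \<xi> E i \<longleftrightarrow>
     c_cowedge C A a M p B b FO FM \<xi> E i \<and>
     (\<forall>d \<mu>. c_cowedge C A a M p B b FO FM \<xi> d \<mu> \<longrightarrow>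
        (\<exists>!h. h \<in> hom A E d \<and> (\<forall>P\<in>obj B. h \<cdot>\<^bsub>A\<^esub> i P = \<mu> P)))"

definition coend_delta ::
  "('o, 'm) cat \<Rightarrow> ('o, 'm) monoidal \<Rightarrow> ('b \<Rightarrow> 'o) \<Rightarrow> ('b \<Rightarrow> 'm) \<Rightarrow> 'b \<Rightarrow> 'm" where
  "coend_delta A M FO i P = (ident A (FO P) \<boxtimes>\<^bsub>M\<^esub> i P) \<cdot>\<^bsub>A\<^esub> coev A M (FO P) (FO P)"


section \<open>Coalgebras, bialgebras and comodules\<close>

definition coalgebra :: "('o, 'm) cat \<Rightarrow> ('o, 'm) monoidal \<Rightarrow> 'o \<Rightarrow> 'm \<Rightarrow> 'm \<Rightarrow> bool" where
  "coalgebra A M E \<Delta> \<epsilon> \<longleftrightarrow>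
     E \<in> obj A \<and> \<Delta> \<in> hom A E (E \<otimes>\<^bsub>M\<^esub> E) \<and> \<epsilon> \<in> hom A E (uno M) \<and>
     assoc M E E E \<cdot>\<^bsub>A\<^esub> (\<Delta> \<boxtimes>\<^bsub>M\<^esub> ident A E) \<cdot>\<^bsub>A\<^esub> \<Delta> = (ident A E \<boxtimes>\<^bsub>M\<^esub> \<Delta>) \<cdot>\<^bsub>A\<^esub> \<Delta> \<and>
     lunit M E \<cdot>\<^bsub>A\<^esub> (\<epsilon> \<boxtimes>\<^bsub>M\<^esub> ident A E) \<cdot>\<^bsub>A\<^esub> \<Delta> = ident A E \<and>
     runit M E \<cdot>\<^bsub>A\<^esub> (ident A E \<boxtimes>\<^bsub>M\<^esub> \<epsilon>) \<cdot>\<^bsub>A\<^esub> \<Delta> = ident A E"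

definition algebra :: "('o, 'm) cat \<Rightarrow> ('o, 'm) monoidal \<Rightarrow> 'o \<Rightarrow> 'm \<Rightarrow> 'm \<Rightarrow> bool" where
  "algebra A M E m \<eta> \<longleftrightarrow>
     E \<in> obj A \<and> m \<in> hom A (E \<otimes>\<^bsub>M\<^esub> E) E \<and> \<eta> \<in> hom A (uno M) E \<and>
     m \<cdot>\<^bsub>A\<^esub> (m \<boxtimes>\<^bsub>M\<^esub> ident A E) = m \<cdot>\<^bsub>A\<^esub> (ident A E \<boxtimes>\<^bsub>M\<^esub> m) \<cdot>\<^bsub>A\<^esub> assoc M E E E \<and>
     m \<cdot>\<^bsub>A\<^esub> (\<eta> \<boxtimes>\<^bsub>M\<^esub> ident A E) = lunit M E \<and>
     m \<cdot>\<^bsub>A\<^esub> (ident A E \<boxtimes>\<^bsub>M\<^esub> \<eta>) = runit M E"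

text \<open>From \<open>(P \<otimes> Q) \<otimes> (R \<otimes> S)\<close> to \<open>(P \<otimes> R) \<otimes> (Q \<otimes> S)\<close>, braiding \<open>Q\<close> past \<open>R\<close>.\<close>

definition interchange ::
  "('o, 'm) cat \<Rightarrow> ('o, 'm) monoidal \<Rightarrow> ('o \<Rightarrow> 'o \<Rightarrow> 'm) \<Rightarrow> 'o \<Rightarrow> 'o \<Rightarrow> 'o \<Rightarrow> 'o \<Rightarrow> 'm" where
  "interchange A M \<tau> P Q R S =
     inv_arr A ((P \<otimes>\<^bsub>M\<^esub> R) \<otimes>\<^bsub>M\<^esub> (Q \<otimes>\<^bsub>M\<^esub> S)) (P \<otimes>\<^bsub>M\<^esub> (R \<otimes>\<^bsub>M\<^esub> (Q \<otimes>\<^bsub>M\<^esub> S))) (assoc M P R (Q \<otimes>\<^bsub>M\<^esub> S)) \<cdot>\<^bsub>A\<^esub>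
     (ident A P \<boxtimes>\<^bsub>M\<^esub>
       (assoc M R Q S \<cdot>\<^bsub>A\<^esub> (\<tau> Q R \<boxtimes>\<^bsub>M\<^esub> ident A S) \<cdot>\<^bsub>A\<^esub>
        inv_arr A ((Q \<otimes>\<^bsub>M\<^esub> R) \<otimes>\<^bsub>M\<^esub> S) (Q \<otimes>\<^bsub>M\<^esub> (R \<otimes>\<^bsub>M\<^esub> S)) (assoc M Q R S))) \<cdot>\<^bsub>A\<^esub>
     assoc M P Q (R \<otimes>\<^bsub>M\<^esub> S)"

definition bialgebra ::
  "('o, 'm) cat \<Rightarrow> ('o, 'm) monoidal \<Rightarrow> ('o \<Rightarrow> 'o \<Rightarrow> 'm) \<Rightarrow> 'o \<Rightarrow> 'm \<Rightarrow> 'm \<Rightarrow> 'm \<Rightarrow> 'm \<Rightarrow> bool" where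
  "bialgebra A M \<tau> E \<Delta> \<epsilon> m \<eta> \<longleftrightarrow>
     coalgebra A M E \<Delta> \<epsilon> \<and> algebra A M E m \<eta> \<and>
     \<Delta> \<cdot>\<^bsub>A\<^esub> m = (m \<boxtimes>\<^bsub>M\<^esub> m) \<cdot>\<^bsub>A\<^esub> interchange A M \<tau> E E E E \<cdot>\<^bsub>A\<^esub> (\<Delta> \<boxtimes>\<^bsub>M\<^esub> \<Delta>) \<and>
     \<epsilon> \<cdot>\<^bsub>A\<^esub> m = lunit M (uno M) \<cdot>\<^bsub>A\<^esub> (\<epsilon> \<boxtimes>\<^bsub>M\<^esub> \<epsilon>) \<and>
     \<Delta> \<cdot>\<^bsub>A\<^esub> \<eta> = (\<eta> \<boxtimes>\<^bsub>M\<^esub> \<eta>) \<cdot>\<^bsub>A\<^esub> inv_arr A (uno M \<otimes>\<^bsub>M\<^esub> uno M) (uno M) (lunit M (uno M)) \<and>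
     \<epsilon> \<cdot>\<^bsub>A\<^esub> \<eta> = ident A (uno M)"

definition comodule ::
  "('o, 'm) cat \<Rightarrow> ('o, 'm) monoidal \<Rightarrow> 'o \<Rightarrow> 'm \<Rightarrow> 'm \<Rightarrow> 'o \<Rightarrow> 'm \<Rightarrow> bool" where
  "comodule A M E \<Delta> \<epsilon> P \<rho> \<longleftrightarrow>
     P \<in> obj A \<and> \<rho> \<in> hom A P (P \<otimes>\<^bsub>M\<^esub> E) \<and>
     assoc M P E E \<cdot>\<^bsub>A\<^esub> (\<rho> \<boxtimes>\<^bsub>M\<^esub> ident A E) \<cdot>\<^bsub>A\<^esub> \<rho> = (ident A P \<boxtimes>\<^bsub>M\<^esub> \<Delta>) \<cdot>\<^bsub>A\<^esub> \<rho> \<and>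
     runit M P \<cdot>\<^bsub>A\<^esub> (ident A P \<boxtimes>\<^bsub>M\<^esub> \<epsilon>) \<cdot>\<^bsub>A\<^esub> \<rho> = ident A P"

definition Comod ::
  "('o, 'm) cat \<Rightarrow> ('o, 'm) monoidal \<Rightarrow> ('o, 'm) cat \<Rightarrow> 'o \<Rightarrow> 'm \<Rightarrow> 'm \<Rightarrow> ('o \<times> 'm, 'm) cat" where
  "Comod A M A\<^sub>0 E \<Delta> \<epsilon> =
     \<lparr>obj = {(P, \<rho>). P \<in> obj A\<^sub>0 \<and> comodule A M E \<Delta> \<epsilon> P \<rho>},
      hom = (\<lambda>(P, \<rho>) (Q, \<sigma>). {f \<in> hom A\<^sub>0 P Q. \<sigma> \<cdot>\<^bsub>A\<^esub> f = (f \<boxtimes>\<^bsub>M\<^esub> ident A E) \<cdot>\<^bsub>A\<^esub> \<rho>}),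
      ident = (\<lambda>(P, \<rho>). ident A\<^sub>0 P),
      cmp = cmp A\<^sub>0\<rparr>"

text \<open>The forgetful functor is \<open>fst\<close> on objects and the identity on arrows.\<close>

definition forget_obj :: "'o \<times> 'm \<Rightarrow> 'o" where
  "forget_obj = fst"

definition forget_arr :: "'m \<Rightarrow> 'm" where
  "forget_arr = (\<lambda>f. f)"

text \<open>
  The \<open>C\<close>-monoidal structure on comodules lifts that of \<open>A\<^sub>0\<close> along the forgetful functor: \<open>C\<close> acts
  on the underlying objects, and tensor products carry the codiagonal coaction.
\<close>

definition Comod_action ::
  "('c, 'd) cat \<Rightarrow> ('o, 'm) cat \<Rightarrow> ('c, 'd, 'o, 'm) action \<Rightarrow> ('o, 'm) monoidal \<Rightarrow> ('c, 'o, 'm) pulls \<Rightarrow>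
   'o \<Rightarrow> ('c, 'd, 'o \<times> 'm, 'm) action" where
  "Comod_action C A a M p E =
     \<lparr>act = (\<lambda>X (P, \<rho>).
        (X \<rhd>\<^bsub>a\<^esub> P,
         inv_arr A ((X \<rhd>\<^bsub>a\<^esub> P) \<otimes>\<^bsub>M\<^esub> E) (X \<rhd>\<^bsub>a\<^esub> (P \<otimes>\<^bsub>M\<^esub> E)) (pull1 p X P E) \<cdot>\<^bsub>A\<^esub> (ident C X \<unrhd>\<^bsub>a\<^esub> \<rho>))),
      actm = actm a,
      act_assoc = (\<lambda>X Y (P, \<rho>). act_assoc a X Y P),
      act_unit = (\<lambda>(P, \<rho>). act_unit a P)\<rparr>"

definition Comod_monoidal ::
  "('o, 'm) cat \<Rightarrow> ('o, 'm) monoidal \<Rightarrow> ('o \<Rightarrow> 'o \<Rightarrow> 'm) \<Rightarrow> 'o \<Rightarrow> 'm \<Rightarrow> 'm \<Rightarrow> ('o \<times> 'm, 'm) monoidal" where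
  "Comod_monoidal A M \<tau> E m \<eta> =
     \<lparr>tens = (\<lambda>(P, \<rho>) (Q, \<sigma>).
        (P \<otimes>\<^bsub>M\<^esub> Q,
         (ident A (P \<otimes>\<^bsub>M\<^esub> Q) \<boxtimes>\<^bsub>M\<^esub> m) \<cdot>\<^bsub>A\<^esub> interchange A M \<tau> P E Q E \<cdot>\<^bsub>A\<^esub> (\<rho> \<boxtimes>\<^bsub>M\<^esub> \<sigma>))),
      tensm = tensm M,
      uno = (uno M,
        (ident A (uno M) \<boxtimes>\<^bsub>M\<^esub> \<eta>) \<cdot>\<^bsub>A\<^esub> inv_arr A (uno M \<otimes>\<^bsub>M\<^esub> uno M) (uno M) (lunit M (uno M))),
      assoc = (\<lambda>(P, \<rho>) (Q, \<sigma>) (R, \<pi>). assoc M P Q R),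
      lunit = (\<lambda>(P, \<rho>). lunit M P),
      runit = (\<lambda>(P, \<rho>). runit M P)\<rparr>"

definition Comod_pulls :: "('c, 'o, 'm) pulls \<Rightarrow> ('c, 'o \<times> 'm, 'm) pulls" where
  "Comod_pulls p =
     \<lparr>pull1 = (\<lambda>X (P, \<rho>) (Q, \<sigma>). pull1 p X P Q),
      pull2 = (\<lambda>X (P, \<rho>) (Q, \<sigma>). pull2 p X P Q)\<rparr>"

definition lift_obj ::
  "('o, 'm) cat \<Rightarrow> ('o, 'm) monoidal \<Rightarrow> ('b \<Rightarrow> 'o) \<Rightarrow> ('b \<Rightarrow> 'm) \<Rightarrow> 'b \<Rightarrow> 'o \<times> 'm" where
  "lift_obj A M FO i P = (FO P, coend_delta A M FO i P)"

text \<open>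
  The coalgebra structure of the coend is determined by the condition that \<open>coend_delta\<close> makes
  every \<open>F P\<close> a comodule.
\<close>

definition coend_comult ::
  "('o, 'm) cat \<Rightarrow> ('o, 'm) monoidal \<Rightarrow> ('b, 'n) cat \<Rightarrow> ('b \<Rightarrow> 'o) \<Rightarrow> 'o \<Rightarrow> ('b \<Rightarrow> 'm) \<Rightarrow> 'm" where
  "coend_comult A M B FO E i =
     (THE \<Delta>. \<Delta> \<in> hom A E (E \<otimes>\<^bsub>M\<^esub> E) \<and>
        (\<forall>P\<in>obj B. (ident A (FO P) \<boxtimes>\<^bsub>M\<^esub> \<Delta>) \<cdot>\<^bsub>A\<^esub> coend_delta A M FO i P =
           assoc M (FO P) E E \<cdot>\<^bsub>A\<^esub> (coend_delta A M FO i P \<boxtimes>\<^bsub>M\<^esub> ident A E) \<cdot>\<^bsub>A\<^esub> coend_delta A M FO i P))"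

definition coend_counit ::
  "('o, 'm) cat \<Rightarrow> ('o, 'm) monoidal \<Rightarrow> ('b, 'n) cat \<Rightarrow> ('b \<Rightarrow> 'o) \<Rightarrow> 'o \<Rightarrow> ('b \<Rightarrow> 'm) \<Rightarrow> 'm" where
  "coend_counit A M B FO E i =
     (THE \<epsilon>. \<epsilon> \<in> hom A E (uno M) \<and>
        (\<forall>P\<in>obj B. runit M (FO P) \<cdot>\<^bsub>A\<^esub> (ident A (FO P) \<boxtimes>\<^bsub>M\<^esub> \<epsilon>) \<cdot>\<^bsub>A\<^esub> coend_delta A M FO i P =
           ident A (FO P)))"


section \<open>Multirepresentability\<close>

text \<open>
  Iterated tensor products are bracketed to the right; the empty one is the unit object. Thus
  \<open>F\<^sup>n\<close> sends a list of \<open>n\<close> objects to \<open>tens_list (map F _)\<close>, and \<open>E\<^sup>n\<close> is \<open>tens_list (replicate n E)\<close>.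
\<close>

fun tens_list :: "('o, 'm) monoidal \<Rightarrow> 'o list \<Rightarrow> 'o" where
  "tens_list M [] = uno M"
| "tens_list M [P] = P"
| "tens_list M (P # Q # Qs) = P \<otimes>\<^bsub>M\<^esub> tens_list M (Q # Qs)"

fun tensm_list :: "('o, 'm) cat \<Rightarrow> ('o, 'm) monoidal \<Rightarrow> 'm list \<Rightarrow> 'm" where
  "tensm_list A M [] = ident A (uno M)"
| "tensm_list A M [f] = f"
| "tensm_list A M (f # g # gs) = f \<boxtimes>\<^bsub>M\<^esub> tensm_list A M (g # gs)"

text \<open>The \<open>C\<close>-functor structure of \<open>F\<^sup>n\<close> in the variable with index \<open>k < n\<close>.\<close>

fun xi_list ::
  "('o, 'm) cat \<Rightarrow> ('o, 'm) monoidal \<Rightarrow> ('c, 'o, 'm) pulls \<Rightarrow> ('b \<Rightarrow> 'o) \<Rightarrow> ('c \<Rightarrow> 'b \<Rightarrow> 'm) \<Rightarrow>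
   'c \<Rightarrow> nat \<Rightarrow> 'b list \<Rightarrow> 'm" where
  "xi_list A M p FO \<xi> X k [] = undefined"
| "xi_list A M p FO \<xi> X k [P] = \<xi> X P"
| "xi_list A M p FO \<xi> X 0 (P # Q # Qs) =
     (let T = tens_list M (map FO (Q # Qs)) in
      pull1 p X (FO P) T \<cdot>\<^bsub>A\<^esub> (\<xi> X P \<boxtimes>\<^bsub>M\<^esub> ident A T))"
| "xi_list A M p FO \<xi> X (Suc k) (P # Q # Qs) =
     pull2 p X (FO P) (tens_list M (map FO (Q # Qs))) \<cdot>\<^bsub>A\<^esub>
     (ident A (FO P) \<boxtimes>\<^bsub>M\<^esub> xi_list A M p FO \<xi> X k (Q # Qs))"

text \<open>
  Natural transformations from \<open>F\<^sup>n\<close> to \<open>F\<^sup>n \<otimes> D\<close> that are \<open>C\<close>-natural in each variable. The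
  \<open>C\<close>-functor structure of \<open>F\<^sup>n \<otimes> D\<close> is that of \<open>F\<^sup>n\<close> followed by \<open>pull1\<close>.
\<close>

definition Nat_c ::
  "('c, 'd) cat \<Rightarrow> ('o, 'm) cat \<Rightarrow> ('c, 'd, 'o, 'm) action \<Rightarrow> ('o, 'm) monoidal \<Rightarrow> ('c, 'o, 'm) pulls \<Rightarrow>
   ('b, 'n) cat \<Rightarrow> ('c, 'd, 'b, 'n) action \<Rightarrow> ('b \<Rightarrow> 'o) \<Rightarrow> ('n \<Rightarrow> 'm) \<Rightarrow> ('c \<Rightarrow> 'b \<Rightarrow> 'm) \<Rightarrow>
   nat \<Rightarrow> 'o \<Rightarrow> ('b list \<Rightarrow> 'm) \<Rightarrow> bool" where
  "Nat_c C A a M p B b FO FM \<xi> n D \<phi> \<longleftrightarrow>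
     (\<forall>Ps. length Ps = n \<and> set Ps \<subseteq> obj B \<longrightarrow>
        \<phi> Ps \<in> hom A (tens_list M (map FO Ps)) (tens_list M (map FO Ps) \<otimes>\<^bsub>M\<^esub> D)) \<and>
     (\<forall>Ps Qs fs. length Ps = n \<and> length Qs = n \<and> length fs = n \<and> set Ps \<subseteq> obj B \<and> set Qs \<subseteq> obj B \<and>
        (\<forall>k<n. fs ! k \<in> hom B (Ps ! k) (Qs ! k)) \<longrightarrow>
        \<phi> Qs \<cdot>\<^bsub>A\<^esub> tensm_list A M (map FM fs) =
        (tensm_list A M (map FM fs) \<boxtimes>\<^bsub>M\<^esub> ident A D) \<cdot>\<^bsub>A\<^esub> \<phi> Ps) \<and>
     (\<forall>Ps. \<forall>X\<in>obj C. \<forall>k<n. length Ps = n \<and> set Ps \<subseteq> obj B \<longrightarrow>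
        pull1 p X (tens_list M (map FO Ps)) D \<cdot>\<^bsub>A\<^esub> (xi_list A M p FO \<xi> X k Ps \<boxtimes>\<^bsub>M\<^esub> ident A D) \<cdot>\<^bsub>A\<^esub>
          \<phi> (Ps[k := X \<rhd>\<^bsub>b\<^esub> (Ps ! k)]) =
        (ident C X \<unrhd>\<^bsub>a\<^esub> \<phi> Ps) \<cdot>\<^bsub>A\<^esub> xi_list A M p FO \<xi> X k Ps)"

fun delta_list ::
  "('o, 'm) cat \<Rightarrow> ('o, 'm) monoidal \<Rightarrow> ('o \<Rightarrow> 'o \<Rightarrow> 'm) \<Rightarrow> ('b \<Rightarrow> 'o) \<Rightarrow> 'o \<Rightarrow> ('b \<Rightarrow> 'm) \<Rightarrow>
   'b list \<Rightarrow> 'm" where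
  "delta_list A M \<tau> FO E \<delta> [] = inv_arr A (uno M \<otimes>\<^bsub>M\<^esub> uno M) (uno M) (runit M (uno M))"
| "delta_list A M \<tau> FO E \<delta> [P] = \<delta> P"
| "delta_list A M \<tau> FO E \<delta> (P # Q # Qs) =
     interchange A M \<tau> (FO P) E
       (tens_list M (map FO (Q # Qs))) (tens_list M (replicate (length (Q # Qs)) E)) \<cdot>\<^bsub>A\<^esub>
     (\<delta> P \<boxtimes>\<^bsub>M\<^esub> delta_list A M \<tau> FO E \<delta> (Q # Qs))"

definition multirepresentable ::
  "('c, 'd) cat \<Rightarrow> ('o, 'm) cat \<Rightarrow> ('c, 'd, 'o, 'm) action \<Rightarrow> ('o, 'm) monoidal \<Rightarrow> ('c, 'o, 'm) pulls \<Rightarrow>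
   ('o \<Rightarrow> 'o \<Rightarrow> 'm) \<Rightarrow> ('b, 'n) cat \<Rightarrow> ('c, 'd, 'b, 'n) action \<Rightarrow> ('b \<Rightarrow> 'o) \<Rightarrow> ('n \<Rightarrow> 'm) \<Rightarrow>
   ('c \<Rightarrow> 'b \<Rightarrow> 'm) \<Rightarrow> 'o \<Rightarrow> ('b \<Rightarrow> 'm) \<Rightarrow> bool" where
  "multirepresentable C A a M p \<tau> B b FO FM \<xi> E \<delta> \<longleftrightarrow>
     c_central C A a M \<tau> E \<and>
     (\<forall>n. Nat_c C A a M p B b FO FM \<xi> n (tens_list M (replicate n E)) (delta_list A M \<tau> FO E \<delta>) \<and>
        (\<forall>D\<in>obj A. \<forall>\<phi>. Nat_c C A a M p B b FO FM \<xi> n D \<phi> \<longrightarrow>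
           (\<exists>!h. h \<in> hom A (tens_list M (replicate n E)) D \<and>
              (\<forall>Ps. length Ps = n \<and> set Ps \<subseteq> obj B \<longrightarrow>
                 \<phi> Ps = (ident A (tens_list M (map FO Ps)) \<boxtimes>\<^bsub>M\<^esub> h) \<cdot>\<^bsub>A\<^esub> delta_list A M \<tau> FO E \<delta> Ps))))"

definition coend_mult ::
  "('o, 'm) cat \<Rightarrow> ('o, 'm) monoidal \<Rightarrow> ('o \<Rightarrow> 'o \<Rightarrow> 'm) \<Rightarrow> ('b, 'n) cat \<Rightarrow> ('b, 'n) monoidal \<Rightarrow>
   ('b \<Rightarrow> 'o) \<Rightarrow> ('b \<Rightarrow> 'b \<Rightarrow> 'm) \<Rightarrow> 'o \<Rightarrow> ('b \<Rightarrow> 'm) \<Rightarrow> 'm" where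
  "coend_mult A M \<tau> B N FO J E \<delta> =
     (THE m. m \<in> hom A (E \<otimes>\<^bsub>M\<^esub> E) E \<and>
        (\<forall>P\<in>obj B. \<forall>Q\<in>obj B.
           (ident A (FO P \<otimes>\<^bsub>M\<^esub> FO Q) \<boxtimes>\<^bsub>M\<^esub> m) \<cdot>\<^bsub>A\<^esub> delta_list A M \<tau> FO E \<delta> [P, Q] =
           (inv_arr A (FO P \<otimes>\<^bsub>M\<^esub> FO Q) (FO (P \<otimes>\<^bsub>N\<^esub> Q)) (J P Q) \<boxtimes>\<^bsub>M\<^esub> ident A E) \<cdot>\<^bsub>A\<^esub> \<delta> (P \<otimes>\<^bsub>N\<^esub> Q) \<cdot>\<^bsub>A\<^esub> J P Q))"

definition coend_unit ::
  "('o, 'm) cat \<Rightarrow> ('o, 'm) monoidal \<Rightarrow> ('b, 'n) monoidal \<Rightarrow> ('b \<Rightarrow> 'o) \<Rightarrow> 'm \<Rightarrow> 'o \<Rightarrow> ('b \<Rightarrow> 'm) \<Rightarrow> 'm" where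
  "coend_unit A M N FO J\<^sub>0 E \<delta> =
     lunit M E \<cdot>\<^bsub>A\<^esub> (inv_arr A (uno M) (FO (uno N)) J\<^sub>0 \<boxtimes>\<^bsub>M\<^esub> ident A E) \<cdot>\<^bsub>A\<^esub> \<delta> (uno N) \<cdot>\<^bsub>A\<^esub> J\<^sub>0"

end

theory Submission
  imports Defs
begin

text \<open>
  A \<open>C\<close>-cowedge \<open>\<mu>\<close> with value \<open>D\<close> is the same thing as a \<open>C\<close>-natural family
  \<open>\<phi> P = (1 \<otimes> \<mu> P) \<cdot> coev\<close> from \<open>F\<close> to \<open>F \<otimes> D\<close>, so \<open>coend_delta\<close> is universal among such families. The
  coend exists as the colimit of the generators \<open>cohom (F P) (F P)\<close> modulo the cowedge relations;
  although \<open>C\<close> may be large, local smallness leaves only a small set of relations. Comultiplication,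
  counit, multiplication and all their axioms come from uniqueness of factorizations, through \<open>\<delta>\<close>,
  \<open>\<delta>\<^sub>2\<close> and \<open>\<delta>\<^sub>3\<close>. What has to be known about the braiding is that the interchange of tensor factors makes
  \<open>A\<close> a duoidal category: it is compatible with associators in both directions and with the units.
  These laws turn tensor products of coactions into coactions. The \<open>C\<close>-structure on comodules uses that
  \<open>pull2\<close> moves objects of \<open>C\<close> past \<open>E\<close> by the same braiding as the interchange.
\<close>

section \<open>Small sets and colimits\<close>

text \<open>The multiplication of \<open>E\<close> is chosen so that \<open>J P Q\<close> becomes an
  isomorphism from the codiagonal coaction on the tensor product of \<open>FO P\<close> and
  \<open>FO Q\<close> to the universal coaction at the product of \<open>P\<close> and
  \<open>Q\<close>. This drives part (2). The coherence arrows of \<open>B\<close> are mapped to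
  comodule maps because the universal coaction is natural, \<open>J\<close> carries this to
  codiagonal coactions, and each axiom is then read off from a coaction that is isomorphic to a
  known comodule. One variable suffices for the unit laws, two are needed to compare the
  comultiplication and counit with the multiplication, three for associativity. Two obstacles shape
  the text. First, \<open>A\<^sub>0\<close> need not be full and \<open>E\<close> lives in
  \<open>A\<close>: comodule maps must lie in \<open>A\<^sub>0\<close> while equations with
  \<open>E\<close> hold in \<open>A\<close>, so validity and inverses are compared in both
  categories. Second, the formulas for codiagonal coactions are needed before \<open>E\<close> is
  known to be a bialgebra and again afterwards. They are therefore proved for arbitrary arrows in
  place of multiplication and unit, with the term that the axiom would simplify left
  visible.\<close>

lemma small_image: "small U S \<Longrightarrow> small U (f ` S)"
  unfolding small_def using image_lepoll lesspoll_trans1 by blast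

lemma small_subset: "\<lbrakk>small U T; S \<subseteq> T\<rbrakk> \<Longrightarrow> small U S"
  unfolding small_def using lesspoll_trans1 subset_imp_lepoll by blast

lemma small_inj: "\<lbrakk>small U (f ` S); inj_on f S\<rbrakk> \<Longrightarrow> small U S"
  using small_image[of U "f ` S" "inv_into S f"] by simp

lemma small_finite: "\<lbrakk>universe (U :: 'u itself); finite S\<rbrakk> \<Longrightarrow> small U S"
  by (simp add: small_def universe_def finite_lesspoll_infinite)

lemma small_encode:
  fixes U :: "'u itself"
  assumes "small U S"
  obtains e :: "'a \<Rightarrow> 'u" where "inj_on e S"
  using assms that unfolding small_def lesspoll_def lepoll_def by blast

text \<open>The closure condition in \<open>universe\<close> speaks of unions of subsets of the
  universe type only. That type is infinite, hence absorbs its square: pairs can be coded by single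
  elements, and the sum becomes a union of the required kind.\<close>

lemma small_Sigma:
  fixes U :: "'u itself" and S :: "'a set" and T :: "'a \<Rightarrow> 'b set"
  assumes U: "universe U" and S: "small U S" and T: "\<And>x. x \<in> S \<Longrightarrow> small U (T x)"
  shows "small U (Sigma S T)"
proof -
  have inf: "infinite (UNIV :: 'u set)" using U by (simp add: universe_def)
  obtain pr :: "'u \<times> 'u \<Rightarrow> 'u" where pr: "inj pr"
    using card_of_Times_same_infinite[OF inf] card_of_ordIso[of "UNIV \<times> UNIV :: ('u \<times> 'u) set" "UNIV :: 'u set"]
    by (auto simp: bij_betw_def)
  obtain e :: "'a \<Rightarrow> 'u" where e: "inj_on e S" using S by (rule small_encode)
  have "\<forall>x\<in>S. \<exists>g :: 'b \<Rightarrow> 'u. inj_on g (T x)" using T small_encode by metis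
  then obtain g :: "'a \<Rightarrow> 'b \<Rightarrow> 'u" where g: "\<And>x. x \<in> S \<Longrightarrow> inj_on (g x) (T x)" by metis
  define h where "h = (\<lambda>(x, y). pr (e x, g x y))"
  \<comment> \<open>\<open>V u\<close> holds the codes of the pairs over the index coded by
    \<open>u\<close>; the inverse of \<open>e\<close> recovers that index.\<close>
  define V where "V u = (\<lambda>y. pr (u, g (inv_into S e u) y)) ` T (inv_into S e u)" for u
  have "small U (\<Union>u\<in>e ` S. V u)"
  proof -
    have "small U (e ` S)" using S by (rule small_image)
    moreover have "\<forall>u\<in>e ` S. small U (V u)"
      unfolding V_def by (auto simp: e intro!: small_image T)
    ultimately show ?thesis using U unfolding universe_def by blast
  qed
  moreover have "h ` Sigma S T \<subseteq> (\<Union>u\<in>e ` S. V u)"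
    by (auto simp: h_def V_def e)
  ultimately have "small U (h ` Sigma S T)" by (rule small_subset)
  moreover have "inj_on h (Sigma S T)"
  proof (rule inj_onI, clarify)
    fix x y x' y' assume *: "x \<in> S" "y \<in> T x" "x' \<in> S" "y' \<in> T x'" "h (x, y) = h (x', y')"
    then have "e x = e x'" "g x y = g x' y'" using injD[OF pr] by (auto simp: h_def)
    then show "x = x' \<and> y = y'" using * inj_onD[OF e] inj_onD[OF g] by metis
  qed
  ultimately show ?thesis by (rule small_inj)
qed

text \<open>A disjoint union is a sum over the two truth values, so smallness follows from
  \<open>small_Sigma\<close>.\<close>

lemma small_Plus:
  assumes U: "universe U" and "small U S" "small U T"
  shows "small U (S <+> T)"
proof -
  have fin: "small U (UNIV :: bool set)" using U by (rule small_finite) simp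
  have "small U (Sigma UNIV (\<lambda>z. if z then Inl ` S else Inr ` T))"
    by (rule small_Sigma[OF U fin]) (auto intro: small_image assms)
  then have "small U (snd ` Sigma UNIV (\<lambda>z. if z then Inl ` S else Inr ` T))"
    by (rule small_image)
  moreover have "S <+> T \<subseteq> snd ` Sigma UNIV (\<lambda>z. if z then Inl ` S else Inr ` T)"
  proof
    fix x assume x: "x \<in> S <+> T"
    then have "(isl x, x) \<in> Sigma UNIV (\<lambda>z. if z then Inl ` S else Inr ` T)" by auto
    then have "snd (isl x, x) \<in> snd ` Sigma UNIV (\<lambda>z. if z then Inl ` S else Inr ` T)" by (rule imageI)
    then show "x \<in> snd ` Sigma UNIV (\<lambda>z. if z then Inl ` S else Inr ` T)" by simp
  qed
  ultimately show ?thesis by (rule small_subset)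
qed

text \<open>\<open>cocomplete\<close> quantifies over index categories whose objects and arrows lie
  in the universe type; diagrams of other types are transported along injective codes. Smallness is
  asked of the union of all hom sets because one code \<open>g\<close> has to serve the arrows of
  every hom set.\<close>

lemma cocomplete_colimit:
  fixes U :: "'u itself" and J :: "('j, 'k) cat"
  assumes A: "cocomplete U A" and D: "cat_functor J A DO DM"
    and O: "small U (obj J)" and H: "small U (\<Union>x\<in>obj J. \<Union>y\<in>obj J. hom J x y)"
  shows "\<exists>c \<iota>. colimit J A DO DM c \<iota>"
proof -
  interpret D: cat_functor J A DO DM by (rule D)
  let ?H = "\<Union>x\<in>obj J. \<Union>y\<in>obj J. hom J x y"
  obtain e :: "'j \<Rightarrow> 'u" where e: "inj_on e (obj J)" using O by (rule small_encode)
  obtain g :: "'k \<Rightarrow> 'u" where g: "inj_on g ?H" using H by (rule small_encode)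
  define e' g' where "e' = inv_into (obj J) e" and "g' = inv_into ?H g"
  have e'[simp]: "e' (e x) = x" if "x \<in> obj J" for x using that e by (simp add: e'_def)
  have g'[simp]: "g' (g f) = f" if "x \<in> obj J" "y \<in> obj J" "f \<in> hom J x y" for x y f
    unfolding g'_def by (rule inv_into_f_f[OF g]) (use that in blast)
  define J' where "J' = \<lparr>obj = e ` obj J, hom = (\<lambda>x y. g ` hom J (e' x) (e' y)),
     ident = (\<lambda>x. g (ident J (e' x))), cmp = (\<lambda>h f. g (g' h \<cdot>\<^bsub>J\<^esub> g' f))\<rparr>"
  note J = D.src.ident_hom D.src.cmp_hom D.src.cmp_ident_left D.src.cmp_ident_right
  have J': "category J'"
  proof
    fix W X Y Z f h k
    assume "W \<in> obj J'" "X \<in> obj J'" "Y \<in> obj J'" "Z \<in> obj J'"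
      "f \<in> hom J' W X" "h \<in> hom J' X Y" "k \<in> hom J' Y Z"
    then obtain w x y z f' h' k' where *: "w \<in> obj J" "x \<in> obj J" "y \<in> obj J" "z \<in> obj J"
      "W = e w" "X = e x" "Y = e y" "Z = e z" "f' \<in> hom J w x" "h' \<in> hom J x y" "k' \<in> hom J y z"
      "f = g f'" "h = g h'" "k = g k'"
      by (auto simp: J'_def)
    have "g' (g (h' \<cdot>\<^bsub>J\<^esub> f')) = h' \<cdot>\<^bsub>J\<^esub> f'" "g' (g (k' \<cdot>\<^bsub>J\<^esub> h')) = k' \<cdot>\<^bsub>J\<^esub> h'"
      using * J(2) g' by metis+
    then show "k \<cdot>\<^bsub>J'\<^esub> h \<cdot>\<^bsub>J'\<^esub> f = k \<cdot>\<^bsub>J'\<^esub> (h \<cdot>\<^bsub>J'\<^esub> f)"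
      using * g' by (simp add: J'_def D.src.cmp_assoc[OF *(1-4) *(9-11)]) 
  next
    fix X Y f assume "X \<in> obj J'" "Y \<in> obj J'" "f \<in> hom J' X Y"
    then obtain x y f' where *: "x \<in> obj J" "y \<in> obj J" "X = e x" "Y = e y" "f' \<in> hom J x y" "f = g f'"
      by (auto simp: J'_def)
    have "g' (g (ident J y)) = ident J y" "g' (g (ident J x)) = ident J x"
      using * J(1) g' by metis+
    then show "ident J' Y \<cdot>\<^bsub>J'\<^esub> f = f" "f \<cdot>\<^bsub>J'\<^esub> ident J' X = f"
      using * g' by (simp_all add: J'_def J(3)[OF *(1,2,5)] J(4)[OF *(1,2,5)])
  qed (auto simp: J'_def intro!: imageI intro: J)
  have small': "small_category U J'"
    unfolding small_category_def locally_small_def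
    by (auto simp: J'_def intro!: small_image O intro: small_subset[OF H])
  have "cat_functor J' A (DO \<circ> e') (DM \<circ> g')"
  proof (intro cat_functor.intro cat_functor_axioms.intro J' D.tgt.category_axioms)
    fix X Y Z f h
    assume "X \<in> obj J'" "Y \<in> obj J'" "Z \<in> obj J'" "f \<in> hom J' X Y" "h \<in> hom J' Y Z"
    then obtain x y z f' h' where *: "x \<in> obj J" "y \<in> obj J" "z \<in> obj J"
      "X = e x" "Y = e y" "Z = e z" "f' \<in> hom J x y" "h' \<in> hom J y z" "f = g f'" "h = g h'"
      by (auto simp: J'_def)
    have "g' (g (h' \<cdot>\<^bsub>J\<^esub> f')) = h' \<cdot>\<^bsub>J\<^esub> f'" using * J(2) g' by metis
    then show "(DM \<circ> g') (h \<cdot>\<^bsub>J'\<^esub> f) = (DM \<circ> g') h \<cdot>\<^bsub>A\<^esub> (DM \<circ> g') f"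
      using * g' by (simp add: J'_def D.cmp_map[OF *(1-3,7,8)])
  next
    fix X assume "X \<in> obj J'"
    then obtain x where *: "x \<in> obj J" "X = e x" by (auto simp: J'_def)
    have "g' (g (ident J x)) = ident J x" using * J(1) g' by metis
    then show "(DM \<circ> g') (ident J' X) = ident A ((DO \<circ> e') X)"
      using * by (simp add: J'_def D.ident_map)
  qed (auto simp: J'_def intro!: D.obj_map D.hom_map)
  then obtain c \<iota> where c: "colimit J' A (DO \<circ> e') (DM \<circ> g') c \<iota>"
    using A small' unfolding cocomplete_def by blast
  have coc: "cocone J' A (DO \<circ> e') (DM \<circ> g') d (\<mu> \<circ> e') \<longleftrightarrow> cocone J A DO DM d \<mu>" for d \<mu>
    unfolding cocone_def J'_def by (simp add: ball_simps cong: ball_cong conj_cong)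
  have coc': "cocone J A DO DM c (\<iota> \<circ> e)"
    using c g' unfolding colimit_def cocone_def J'_def by (simp add: ball_simps cong: ball_cong)
  have "colimit J A DO DM c (\<iota> \<circ> e)"
    unfolding colimit_def
  proof (intro conjI allI impI coc')
    fix d \<mu> assume "cocone J A DO DM d \<mu>"
    then have "\<exists>!h. h \<in> hom A c d \<and> (\<forall>x\<in>obj J'. h \<cdot>\<^bsub>A\<^esub> \<iota> x = (\<mu> \<circ> e') x)"
      using c coc unfolding colimit_def by blast
    then show "\<exists>!h. h \<in> hom A c d \<and> (\<forall>x\<in>obj J. h \<cdot>\<^bsub>A\<^esub> (\<iota> \<circ> e) x = \<mu> x)"
      by (simp add: J'_def ball_simps cong: ball_cong)
  qed
  then show ?thesis by blast
qed

text \<open>An object given by generators \<open>D i\<close> and relations, that is, a coequalizer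
  of two arrows between coproducts, computed as a single colimit. The cowedge conditions can be fed
  in as relations.\<close>

lemma cocomplete_presentation:
  fixes U :: "'u itself" and I :: "'i set" and R :: "'r set"
  assumes U: "universe U" and cat: "category A" and A: "cocomplete U A"
    and I: "small U I" and R: "small U R"
    and D: "\<And>i. i \<in> I \<Longrightarrow> D i \<in> obj A"
    and K: "\<And>r. r \<in> R \<Longrightarrow> K r \<in> obj A \<and> src r \<in> I \<and> tgt r \<in> I \<and>
        g r \<in> hom A (K r) (D (src r)) \<and> h r \<in> hom A (K r) (D (tgt r))"
  defines "W d \<mu> \<equiv> d \<in> obj A \<and> (\<forall>i\<in>I. \<mu> i \<in> hom A (D i) d) \<and>
      (\<forall>r\<in>R. \<mu> (src r) \<cdot>\<^bsub>A\<^esub> g r = \<mu> (tgt r) \<cdot>\<^bsub>A\<^esub> h r)"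
  shows "\<exists>c \<iota>. W c \<iota> \<and> (\<forall>d \<mu>. W d \<mu> \<longrightarrow> (\<exists>!k. k \<in> hom A c d \<and> (\<forall>i\<in>I. k \<cdot>\<^bsub>A\<^esub> \<iota> i = \<mu> i)))"
proof -
  interpret category A by (rule cat)
  \<comment> \<open>A bipartite index category: a relation \<open>r\<close> is an object with an
    arrow to the generator \<open>src r\<close> (tag 1) and one to \<open>tgt r\<close> (tag 2),
    kept apart even if the two generators coincide. Tag 0 marks identities. Two non-identity arrows
    never compose, so a composite is always one of its factors.\<close>
  define J :: "('i + 'r, ('i + 'r) \<times> nat) cat" where
    "J = \<lparr>obj = I <+> R,
          hom = (\<lambda>x y. {f. f = (x, 0) \<and> x = y \<or>
            (\<exists>r. x = Inr r \<and> (f = (x, 1) \<and> y = Inl (src r) \<or> f = (x, 2) \<and> y = Inl (tgt r)))}),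
          ident = (\<lambda>x. (x, 0)),
          cmp = (\<lambda>k f. if snd k = 0 then f else k)\<rparr>"
  define DO where "DO = case_sum D K"
  define DM where "DM = (\<lambda>(x, n :: nat). if n = 0 then ident A (DO x) else
     case x of Inr r \<Rightarrow> if n = (1 :: nat) then g r else h r | Inl i \<Rightarrow> undefined)"
  have J: "category J"
    by unfold_locales (auto simp: J_def split: sum.splits if_splits)
  have DO: "x \<in> obj J \<Longrightarrow> DO x \<in> obj A" for x
    using D K by (auto simp: J_def DO_def split: sum.splits)
  have DM: "f \<in> hom J x y \<Longrightarrow> x \<in> obj J \<Longrightarrow> y \<in> obj J \<Longrightarrow> DM f \<in> hom A (DO x) (DO y)" for x y f
    by (auto simp: J_def DO_def DM_def D K ident_hom split: sum.splits if_splits dest: K)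
  have DM_cmp: "DM (k \<cdot>\<^bsub>J\<^esub> f) = DM k \<cdot>\<^bsub>A\<^esub> DM f"
    if xyz: "x \<in> obj J" "y \<in> obj J" "z \<in> obj J" "f \<in> hom J x y" "k \<in> hom J y z" for x y z f k
  proof -
    consider "k = (y, 0)" "z = y" | "f = (y, 0)" "x = y" "snd k \<noteq> 0"
      using xyz by (auto simp: J_def split: sum.splits if_splits)
    then show ?thesis
    proof cases
      case 1
      then show ?thesis using cmp_ident_left[OF DO DO DM] xyz by (simp add: J_def DM_def)
    next
      case 2
      then show ?thesis using cmp_ident_right[OF DO DO DM] xyz by (simp add: J_def DM_def)
    qed
  qed
  have F: "cat_functor J A DO DM"
  proof (intro cat_functor.intro cat_functor_axioms.intro cat J)
    fix x assume "x \<in> obj J"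
    show "DM (ident J x) = ident A (DO x)" by (simp add: J_def DM_def)
  qed (blast intro: DO DM DM_cmp)+
  have O: "small U (obj J)" by (simp add: J_def small_Plus U I R)
  have "small U (obj J \<times> {0, 1, 2 :: nat})"
    by (rule small_Sigma[OF U O]) (rule small_finite[OF U], simp)
  then have "small U (\<Union>x\<in>obj J. \<Union>y\<in>obj J. hom J x y)"
    by (rule small_subset) (auto simp: J_def split: sum.splits if_splits)
  then obtain c \<iota> where c: "colimit J A DO DM c \<iota>"
    using cocomplete_colimit[OF A F O] by blast
  \<comment> \<open>The component of a cocone at a relation is forced by the component at
    \<open>src r\<close>; that the arrow to \<open>tgt r\<close> gives the same value is the
    relation itself.\<close>
  have W: "cocone J A DO DM d \<nu> \<longleftrightarrow> W d (\<nu> \<circ> Inl) \<and> (\<forall>r\<in>R. \<nu> (Inr r) = \<nu> (Inl (src r)) \<cdot>\<^bsub>A\<^esub> g r)" for d \<nu>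
  proof
    assume *: "cocone J A DO DM d \<nu>"
    have "\<nu> (Inl (src r)) \<cdot>\<^bsub>A\<^esub> g r = \<nu> (Inr r) \<and> \<nu> (Inl (tgt r)) \<cdot>\<^bsub>A\<^esub> h r = \<nu> (Inr r)" if r: "r \<in> R" for r
    proof -
      have **: "f \<in> hom J (Inr r) (Inl i) \<Longrightarrow> i \<in> I \<Longrightarrow> \<nu> (Inl i) \<cdot>\<^bsub>A\<^esub> DM f = \<nu> (Inr r)" for i f
      proof -
        assume "f \<in> hom J (Inr r) (Inl i)" "i \<in> I"
        moreover from this r have "Inr r \<in> obj J" "Inl i \<in> obj J" by (auto simp: J_def)
        ultimately show ?thesis using * unfolding cocone_def by blast
      qed
      show ?thesis using **[of "(Inr r, 1)" "src r"] **[of "(Inr r, 2)" "tgt r"] K[OF r]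
        by (auto simp: J_def DM_def)
    qed
    then show "W d (\<nu> \<circ> Inl) \<and> (\<forall>r\<in>R. \<nu> (Inr r) = \<nu> (Inl (src r)) \<cdot>\<^bsub>A\<^esub> g r)"
      using * unfolding W_def cocone_def by (simp add: J_def DO_def ball_Un Plus_def)
  next
    assume *: "W d (\<nu> \<circ> Inl) \<and> (\<forall>r\<in>R. \<nu> (Inr r) = \<nu> (Inl (src r)) \<cdot>\<^bsub>A\<^esub> g r)"
    then have d: "d \<in> obj A" by (auto simp: W_def)
    have \<nu>: "\<nu> x \<in> hom A (DO x) d" if "x \<in> obj J" for x
    proof (cases x)
      case (Inl i)
      then show ?thesis using that * by (auto simp: W_def J_def DO_def)
    next
      case (Inr r)
      then have r: "r \<in> R" using that by (auto simp: J_def)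
      have "\<nu> (Inl (src r)) \<in> hom A (D (src r)) d" using * K[OF r] by (simp add: W_def)
      then show ?thesis using cmp_hom[of "K r" "D (src r)" d] K[OF r] D d r * Inr by (simp add: DO_def)
    qed
    have "\<nu> y \<cdot>\<^bsub>A\<^esub> DM f = \<nu> x" if xyz: "x \<in> obj J" "y \<in> obj J" "f \<in> hom J x y" for x y f
    proof -
      consider "f = (x, 0)" "x = y" | r where "r \<in> R" "f = (Inr r, 1)" "x = Inr r" "y = Inl (src r)"
        | r where "r \<in> R" "f = (Inr r, 2)" "x = Inr r" "y = Inl (tgt r)"
        using xyz by (auto simp: J_def)
      then show ?thesis
      proof cases
        case 1
        then show ?thesis using cmp_ident_right[OF DO d \<nu>] xyz by (simp add: DM_def)
      next
        case 2
        then show ?thesis using * by (simp add: DM_def)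
      next
        case 3
        then show ?thesis using * by (auto simp: DM_def W_def)
      qed
    qed
    then show "cocone J A DO DM d \<nu>" using \<nu> d by (simp add: cocone_def)
  qed
  have "\<exists>!k. k \<in> hom A c d \<and> (\<forall>i\<in>I. k \<cdot>\<^bsub>A\<^esub> (\<iota> \<circ> Inl) i = \<mu> i)" if "W d \<mu>" for d \<mu>
  proof -
    let ?\<nu> = "case_sum \<mu> (\<lambda>r. \<mu> (src r) \<cdot>\<^bsub>A\<^esub> g r)"
    have d: "d \<in> obj A" using that by (simp add: W_def)
    have "cocone J A DO DM d ?\<nu>" using that by (simp add: W comp_def)
    then have "\<exists>!k. k \<in> hom A c d \<and> (\<forall>x\<in>obj J. k \<cdot>\<^bsub>A\<^esub> \<iota> x = ?\<nu> x)"
      using c unfolding colimit_def by blast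
    moreover have "(\<forall>x\<in>obj J. k \<cdot>\<^bsub>A\<^esub> \<iota> x = ?\<nu> x) \<longleftrightarrow> (\<forall>i\<in>I. k \<cdot>\<^bsub>A\<^esub> (\<iota> \<circ> Inl) i = \<mu> i)"
      if k: "k \<in> hom A c d" for k
    proof -
      have \<iota>: "W c (\<iota> \<circ> Inl)" "\<And>r. r \<in> R \<Longrightarrow> \<iota> (Inr r) = \<iota> (Inl (src r)) \<cdot>\<^bsub>A\<^esub> g r"
        using c W unfolding colimit_def by blast+
      have "k \<cdot>\<^bsub>A\<^esub> \<iota> (Inr r) = k \<cdot>\<^bsub>A\<^esub> \<iota> (Inl (src r)) \<cdot>\<^bsub>A\<^esub> g r" if r: "r \<in> R" for r
        using cmp_assoc[of "K r" "D (src r)" c d "g r" "\<iota> (Inl (src r))" k] \<iota>(1) K[OF r] D k d \<iota>(2)[OF r]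
        by (auto simp: W_def)
      then show ?thesis using K by (auto simp: J_def Plus_def ball_Un)
    qed
    ultimately show ?thesis by (simp cong: conj_cong)
  qed
  moreover have "W c (\<iota> \<circ> Inl)" using c W unfolding colimit_def by blast
  ultimately show ?thesis by blast
qed

section \<open>A calculus of typed arrows\<close>

text \<open>
  Arrows of a category do not determine their domain and codomain. We therefore compute with arrows
  that carry both, and with a composition that is total and records ill-typedness as \<open>None\<close>:
  composition is then associative without any side condition, and validity of a composite
  is an equivalence that the simplifier can evaluate.
\<close>

datatype ('o, 'm) arrow = Arrow (dm: 'o) (raw: "'m option") (cd: 'o)

abbreviation ar :: "'o \<Rightarrow> 'm \<Rightarrow> 'o \<Rightarrow> ('o, 'm) arrow" where
  "ar X f Y \<equiv> Arrow X (Some f) Y"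

definition arr_valid :: "('o, 'm) cat \<Rightarrow> ('o, 'm) arrow \<Rightarrow> bool" where
  "arr_valid A f \<longleftrightarrow> dm f \<in> obj A \<and> cd f \<in> obj A \<and> (\<exists>m\<in>hom A (dm f) (cd f). raw f = Some m)"

text \<open>The endpoints are kept even if the composite is ill-typed, so the rules for
  \<open>dm\<close> and \<open>cd\<close> have no side conditions.\<close>

definition arr_comp :: "('o, 'm) cat \<Rightarrow> ('o, 'm) arrow \<Rightarrow> ('o, 'm) arrow \<Rightarrow> ('o, 'm) arrow" where
  "arr_comp A g f = Arrow (dm f)
     (if arr_valid A g \<and> arr_valid A f \<and> cd f = dm g then Some (the (raw g) \<cdot>\<^bsub>A\<^esub> the (raw f)) else None) (cd g)"

definition arr_id :: "('o, 'm) cat \<Rightarrow> 'o \<Rightarrow> ('o, 'm) arrow" where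
  "arr_id A X = ar X (ident A X) X"

definition arr_iso :: "('o, 'm) cat \<Rightarrow> ('o, 'm) arrow \<Rightarrow> bool" where
  "arr_iso A f \<longleftrightarrow> arr_valid A f \<and> iso A (dm f) (cd f) (the (raw f))"

definition arr_inv :: "('o, 'm) cat \<Rightarrow> ('o, 'm) arrow \<Rightarrow> ('o, 'm) arrow" where
  "arr_inv A f = Arrow (cd f) (Some (inv_arr A (dm f) (cd f) (the (raw f)))) (dm f)"

context category
begin

lemma inverse_arrows_unique:
  assumes "X \<in> obj A" "Y \<in> obj A" "inverse_arrows A X Y f g" "inverse_arrows A X Y f h"
  shows "g = h"
proof -
  have *: "f \<in> hom A X Y" "g \<in> hom A Y X" "h \<in> hom A Y X"
    "g \<cdot>\<^bsub>A\<^esub> f = ident A X" "f \<cdot>\<^bsub>A\<^esub> h = ident A Y"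
    using assms by (simp_all add: inverse_arrows_def)
  have "g = g \<cdot>\<^bsub>A\<^esub> (f \<cdot>\<^bsub>A\<^esub> h)" using assms * by (simp add: cmp_ident_right)
  also have "\<dots> = g \<cdot>\<^bsub>A\<^esub> f \<cdot>\<^bsub>A\<^esub> h" using cmp_assoc[OF assms(2,1,2,1) *(3,1,2)] by simp
  also have "\<dots> = h" using assms * by (simp add: cmp_ident_left)
  finally show ?thesis .
qed

lemma inv_arr_eq:
  "\<lbrakk>X \<in> obj A; Y \<in> obj A; inverse_arrows A X Y f g\<rbrakk> \<Longrightarrow> inv_arr A X Y f = g"
  unfolding inv_arr_def by (rule the_equality) (simp_all add: inverse_arrows_unique)

lemma iso_inverse:
  "\<lbrakk>X \<in> obj A; Y \<in> obj A; iso A X Y f\<rbrakk> \<Longrightarrow> inverse_arrows A X Y f (inv_arr A X Y f)"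
  unfolding iso_def using inv_arr_eq by metis

end

locale arrow_calculus = category A for A :: "('o, 'm) cat"
begin

abbreviation valid :: "('o, 'm) arrow \<Rightarrow> bool" where "valid \<equiv> arr_valid A"
abbreviation comp (infixr "\<bullet>" 55) where "g \<bullet> f \<equiv> arr_comp A g f"
abbreviation idt where "idt \<equiv> arr_id A"
abbreviation isom where "isom \<equiv> arr_iso A"
abbreviation rv where "rv \<equiv> arr_inv A"

lemma valid_ar [simp]: "valid (ar X f Y) \<longleftrightarrow> X \<in> obj A \<and> Y \<in> obj A \<and> f \<in> hom A X Y"
  by (simp add: arr_valid_def)

lemma valid_raw: "valid f \<Longrightarrow> f = ar (dm f) (the (raw f)) (cd f)"
  by (cases f) (auto simp: arr_valid_def)

lemma valid_Some [simp]: "valid f \<Longrightarrow> Some (the (raw f)) = raw f"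
  by (auto simp: arr_valid_def)

lemma valid_obj [simp]: "valid f \<Longrightarrow> dm f \<in> obj A" "valid f \<Longrightarrow> cd f \<in> obj A"
  by (auto simp: arr_valid_def)

lemma valid_hom: "valid f \<Longrightarrow> the (raw f) \<in> hom A (dm f) (cd f)"
  unfolding arr_valid_def by auto

lemma dm_cd [simp]:
  "dm (g \<bullet> f) = dm f" "cd (g \<bullet> f) = cd g" "dm (idt X) = X" "cd (idt X) = X"
  "dm (rv f) = cd f" "cd (rv f) = dm f"
  by (simp_all add: arr_comp_def arr_id_def arr_inv_def)

lemma valid_comp [simp]: "valid (g \<bullet> f) \<longleftrightarrow> valid g \<and> valid f \<and> cd f = dm g"
proof
  assume *: "valid g \<and> valid f \<and> cd f = dm g"
  then have "the (raw g) \<cdot>\<^bsub>A\<^esub> the (raw f) \<in> hom A (dm f) (cd g)"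
    using valid_hom[of f] valid_hom[of g] by (intro cmp_hom[of "dm f" "cd f" "cd g"]) auto
  then show "valid (g \<bullet> f)" using * by (simp add: arr_comp_def)
next
  assume *: "valid (g \<bullet> f)"
  show "valid g \<and> valid f \<and> cd f = dm g"
  proof (rule ccontr)
    assume "\<not> ?thesis"
    then have "raw (g \<bullet> f) = None" unfolding arr_comp_def by auto
    then show False using * unfolding arr_valid_def by simp
  qed
qed

lemma valid_idt [simp]: "valid (idt X) \<longleftrightarrow> X \<in> obj A"
  by (auto simp: arr_id_def intro: ident_hom)

lemma raw_idt: "raw (idt X) = Some (ident A X)"
  by (simp add: arr_id_def)

lemma raw_rv: "raw (rv f) = Some (inv_arr A (dm f) (cd f) (the (raw f)))"
  by (simp add: arr_inv_def)

lemma raw_comp: "\<lbrakk>valid g; valid f; cd f = dm g\<rbrakk> \<Longrightarrow> raw (g \<bullet> f) = Some (the (raw g) \<cdot>\<^bsub>A\<^esub> the (raw f))"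
  by (simp add: arr_comp_def)

lemma comp_ar:
  "\<lbrakk>valid (ar Y g Z); valid (ar X f Y)\<rbrakk> \<Longrightarrow> ar Y g Z \<bullet> ar X f Y = ar X (g \<cdot>\<^bsub>A\<^esub> f) Z"
  by (simp add: arr_comp_def)

text \<open>If a typing condition fails, both bracketings carry \<open>None\<close> between the same
  endpoints.\<close>

lemma comp_assoc: "(h \<bullet> g) \<bullet> f = h \<bullet> (g \<bullet> f)"
proof (cases "valid h \<and> valid g \<and> valid f \<and> cd f = dm g \<and> cd g = dm h")
  case True
  then have "the (raw h) \<cdot>\<^bsub>A\<^esub> the (raw g) \<cdot>\<^bsub>A\<^esub> the (raw f) = the (raw h) \<cdot>\<^bsub>A\<^esub> (the (raw g) \<cdot>\<^bsub>A\<^esub> the (raw f))"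
    using cmp_assoc[of "dm f" "dm g" "dm h" "cd h" "the (raw f)" "the (raw g)" "the (raw h)"]
      valid_hom[of f] valid_hom[of g] by (simp add: valid_hom)
  then show ?thesis using True
    by (intro arrow.expand) (simp add: raw_comp)
next
  case False
  then have "\<not> valid ((h \<bullet> g) \<bullet> f)" "\<not> valid (h \<bullet> (g \<bullet> f))" by auto
  then have "raw ((h \<bullet> g) \<bullet> f) = None" "raw (h \<bullet> (g \<bullet> f)) = None"
    unfolding arr_comp_def[of A "h \<bullet> g" f] arr_comp_def[of A h "g \<bullet> f"] using False by auto
  then show ?thesis by (intro arrow.expand) simp
qed

text \<open>Chains are normalized to right-nested form, where an equation for a composite of two
  arrows does not match in the middle. Applied with \<open>THEN\<close>, this supplies the version
  with an arbitrary tail \<open>r\<close>.\<close>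

lemma comp_ext: "g \<bullet> f = k \<Longrightarrow> g \<bullet> (f \<bullet> r) = k \<bullet> r"
  by (simp flip: comp_assoc)

lemma comp_idt [simp]:
  "\<lbrakk>valid f; cd f = X\<rbrakk> \<Longrightarrow> idt X \<bullet> f = f" "\<lbrakk>valid f; dm f = X\<rbrakk> \<Longrightarrow> f \<bullet> idt X = f"
proof -
  show "\<lbrakk>valid f; cd f = X\<rbrakk> \<Longrightarrow> idt X \<bullet> f = f"
    using cmp_ident_left[of "dm f" X "the (raw f)"] valid_hom[of f]
    by (intro arrow.expand) (auto simp: raw_comp raw_idt)
  show "\<lbrakk>valid f; dm f = X\<rbrakk> \<Longrightarrow> f \<bullet> idt X = f"
    using cmp_ident_right[of X "cd f" "the (raw f)"] valid_hom[of f]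
    by (intro arrow.expand) (auto simp: raw_comp raw_idt)
qed

lemma isom_valid [simp]: "isom f \<Longrightarrow> valid f"
  by (simp add: arr_iso_def)

lemma isom_ar: "\<lbrakk>X \<in> obj A; Y \<in> obj A; iso A X Y f\<rbrakk> \<Longrightarrow> isom (ar X f Y)"
  by (simp add: arr_iso_def) (auto simp: iso_def inverse_arrows_def)

lemma isom_inverse:
  assumes "isom f"
  shows "inverse_arrows A (dm f) (cd f) (the (raw f)) (inv_arr A (dm f) (cd f) (the (raw f)))"
  using assms by (intro iso_inverse) (auto simp: arr_iso_def)

lemma valid_rv [simp]: "isom f \<Longrightarrow> valid (rv f)"
  using isom_inverse[of f] by (simp add: arr_inv_def inverse_arrows_def)

lemma rv_comp_self [simp]: "isom f \<Longrightarrow> rv f \<bullet> f = idt (dm f)" "isom f \<Longrightarrow> f \<bullet> rv f = idt (cd f)"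
  using isom_inverse[of f] valid_rv[of f]
  by (auto intro!: arrow.expand simp: raw_comp arr_inv_def arr_id_def inverse_arrows_def)

lemma rv_cancel [simp]:
  "\<lbrakk>isom f; valid g; cd g = dm f\<rbrakk> \<Longrightarrow> rv f \<bullet> (f \<bullet> g) = g"
  "\<lbrakk>isom f; valid g; cd g = cd f\<rbrakk> \<Longrightarrow> f \<bullet> (rv f \<bullet> g) = g"
  by (simp_all flip: comp_assoc)

text \<open>The way in which compound arrows (composites, tensor products, actions) are shown to be
  invertible and their inverses are identified.\<close>

lemma rv_unique:
  assumes "valid f" "valid g" "g \<bullet> f = idt (dm f)" "f \<bullet> g = idt (cd f)"
  shows "isom f" "rv f = g"
proof -
  \<comment> \<open>The typing of \<open>g\<close> against \<open>f\<close> is contained in the two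
    equations; applying \<open>dm\<close> and \<open>cd\<close> to them extracts it.\<close>
  have dc: "cd f = dm g" "cd g = dm f" using assms(1,3,4) by (metis dm_cd)+
  have "inverse_arrows A (dm f) (cd f) (the (raw f)) (the (raw g))"
    using assms(1,2) dc arg_cong[OF assms(3), of raw] arg_cong[OF assms(4), of raw]
      valid_hom[of f] valid_hom[of g]
    by (simp add: inverse_arrows_def raw_comp raw_idt)
  then show "isom f" "rv f = g"
    using assms(1,2) dc inv_arr_eq[of "dm f" "cd f" "the (raw f)" "the (raw g)"] valid_raw[of g]
    by (auto simp: arr_iso_def iso_def arr_inv_def)
qed

lemma isom_idt [simp]: "X \<in> obj A \<Longrightarrow> isom (idt X)"
  and rv_idt [simp]: "X \<in> obj A \<Longrightarrow> rv (idt X) = idt X"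
  using rv_unique[of "idt X" "idt X"] by auto

lemma isom_comp [simp]: "\<lbrakk>isom f; isom g; cd f = dm g\<rbrakk> \<Longrightarrow> isom (g \<bullet> f)"
  and rv_comp: "\<lbrakk>isom f; isom g; cd f = dm g\<rbrakk> \<Longrightarrow> rv (g \<bullet> f) = rv f \<bullet> rv g"
  using rv_unique[of "g \<bullet> f" "rv f \<bullet> rv g"] by (simp_all add: comp_assoc)

lemma isom_rv [simp]: "isom f \<Longrightarrow> isom (rv f)"
  and rv_rv [simp]: "isom f \<Longrightarrow> rv (rv f) = f"
  using rv_unique[of "rv f" f] by simp_all

lemma isom_cancel_left:
  assumes "f \<bullet> g = f \<bullet> h" "isom f" "valid g" "valid h" "cd g = dm f" "cd h = dm f"
  shows "g = h"
  using arg_cong[OF assms(1), of "\<lambda>k. rv f \<bullet> k"] assms(2-) by simp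

lemma isom_cancel_right:
  assumes "g \<bullet> f = h \<bullet> f" "isom f" "valid g" "valid h" "dm g = cd f" "dm h = cd f"
  shows "g = h"
  using arg_cong[OF assms(1), of "\<lambda>k. k \<bullet> rv f"] assms(2-) by (simp add: comp_assoc)

text \<open>Inverts two opposite sides of a commuting square; this is how naturality passes to the
  inverse of a natural isomorphism.\<close>

lemma rv_square:
  assumes "f \<bullet> g = h \<bullet> k" "isom f" "isom k" "valid g" "valid h" "cd g = dm f" "cd k = dm h"
  shows "rv f \<bullet> h = g \<bullet> rv k"
proof -
  have "rv f \<bullet> h = rv f \<bullet> (h \<bullet> k) \<bullet> rv k" using assms(2-) by (simp add: comp_assoc)
  also have "\<dots> = rv f \<bullet> (f \<bullet> g) \<bullet> rv k" by (simp add: assms(1))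
  also have "\<dots> = g \<bullet> rv k"
    using assms(2-) arg_cong[OF assms(1), of dm] by (simp add: comp_assoc)
  finally show ?thesis .
qed

end

section \<open>Monoidal categories: functoriality, naturality and derived unit coherence\<close>

definition arr_tens :: "('o, 'm) cat \<Rightarrow> ('o, 'm) monoidal \<Rightarrow> ('o, 'm) arrow \<Rightarrow> ('o, 'm) arrow \<Rightarrow> ('o, 'm) arrow" where
  "arr_tens A M f g = Arrow (dm f \<otimes>\<^bsub>M\<^esub> dm g)
     (if arr_valid A f \<and> arr_valid A g then Some (the (raw f) \<boxtimes>\<^bsub>M\<^esub> the (raw g)) else None) (cd f \<otimes>\<^bsub>M\<^esub> cd g)"

definition arr_assoc :: "('o, 'm) monoidal \<Rightarrow> 'o \<Rightarrow> 'o \<Rightarrow> 'o \<Rightarrow> ('o, 'm) arrow" where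
  "arr_assoc M P Q R = ar ((P \<otimes>\<^bsub>M\<^esub> Q) \<otimes>\<^bsub>M\<^esub> R) (assoc M P Q R) (P \<otimes>\<^bsub>M\<^esub> (Q \<otimes>\<^bsub>M\<^esub> R))"

definition arr_lunit :: "('o, 'm) monoidal \<Rightarrow> 'o \<Rightarrow> ('o, 'm) arrow" where
  "arr_lunit M P = ar (uno M \<otimes>\<^bsub>M\<^esub> P) (lunit M P) P"

definition arr_runit :: "('o, 'm) monoidal \<Rightarrow> 'o \<Rightarrow> ('o, 'm) arrow" where
  "arr_runit M P = ar (P \<otimes>\<^bsub>M\<^esub> uno M) (runit M P) P"

locale monoidal_calculus = arrow_calculus A + monoidal_category A M
  for A :: "('o, 'm) cat" and M :: "('o, 'm) monoidal"
begin

abbreviation tobj (infixr "\<odot>" 75) where "P \<odot> Q \<equiv> P \<otimes>\<^bsub>M\<^esub> Q"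
abbreviation tns (infixr "\<star>" 70) where "f \<star> g \<equiv> arr_tens A M f g"
abbreviation un where "un \<equiv> uno M"
abbreviation as where "as \<equiv> arr_assoc M"
abbreviation lu where "lu \<equiv> arr_lunit M"
abbreviation ru where "ru \<equiv> arr_runit M"

lemma un_obj [simp]: "un \<in> obj A"
  by (rule uno_obj)

lemma tobj [simp]: "\<lbrakk>P \<in> obj A; Q \<in> obj A\<rbrakk> \<Longrightarrow> P \<odot> Q \<in> obj A"
  by (rule obj_map)

lemma dm_cd_monoidal [simp]:
  "dm (f \<star> g) = dm f \<odot> dm g" "cd (f \<star> g) = cd f \<odot> cd g"
  "dm (as P Q R) = (P \<odot> Q) \<odot> R" "cd (as P Q R) = P \<odot> (Q \<odot> R)"
  "dm (lu P) = un \<odot> P" "cd (lu P) = P" "dm (ru P) = P \<odot> un" "cd (ru P) = P"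
  by (simp_all add: arr_tens_def arr_assoc_def arr_lunit_def arr_runit_def)

lemma raw_monoidal:
  "raw (as P Q R) = Some (assoc M P Q R)" "raw (lu P) = Some (lunit M P)" "raw (ru P) = Some (runit M P)"
  by (simp_all add: arr_assoc_def arr_lunit_def arr_runit_def)

lemma raw_tns: "\<lbrakk>valid f; valid g\<rbrakk> \<Longrightarrow> raw (f \<star> g) = Some (the (raw f) \<boxtimes>\<^bsub>M\<^esub> the (raw g))"
  by (simp add: arr_tens_def)

lemma valid_tns [simp]: "valid (f \<star> g) \<longleftrightarrow> valid f \<and> valid g"
proof
  assume *: "valid f \<and> valid g"
  then have "the (raw f) \<boxtimes>\<^bsub>M\<^esub> the (raw g) \<in> hom A (dm f \<odot> dm g) (cd f \<odot> cd g)"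
    by (intro hom_map) (auto simp: valid_hom)
  then show "valid (f \<star> g)" using * by (simp add: arr_tens_def)
next
  assume *: "valid (f \<star> g)"
  show "valid f \<and> valid g"
  proof (rule ccontr)
    assume "\<not> ?thesis"
    then have "raw (f \<star> g) = None" unfolding arr_tens_def by auto
    then show False using * unfolding arr_valid_def by simp
  qed
qed

lemma tns_ar: "\<lbrakk>valid (ar X f Y); valid (ar X' g Y')\<rbrakk> \<Longrightarrow> ar X f Y \<star> ar X' g Y' = ar (X \<odot> X') (f \<boxtimes>\<^bsub>M\<^esub> g) (Y \<odot> Y')"
  by (simp add: arr_tens_def)

lemma tns_idt [simp]: "\<lbrakk>P \<in> obj A; Q \<in> obj A\<rbrakk> \<Longrightarrow> idt P \<star> idt Q = idt (P \<odot> Q)"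
  using ident_map by (simp add: arr_id_def tns_ar ident_hom)

text \<open>If one of the four arrows is invalid, both sides carry \<open>None\<close>, so matching
  endpoints are all that has to be assumed.\<close>

lemma tns_comp:
  assumes "cd f = dm g" "cd h = dm k"
  shows "(g \<bullet> f) \<star> (k \<bullet> h) = (g \<star> k) \<bullet> (f \<star> h)"
proof (cases "valid g \<and> valid f \<and> valid h \<and> valid k")
  case True
  then have "(the (raw g) \<cdot>\<^bsub>A\<^esub> the (raw f)) \<boxtimes>\<^bsub>M\<^esub> (the (raw k) \<cdot>\<^bsub>A\<^esub> the (raw h)) =
      (the (raw g) \<boxtimes>\<^bsub>M\<^esub> the (raw k)) \<cdot>\<^bsub>A\<^esub> (the (raw f) \<boxtimes>\<^bsub>M\<^esub> the (raw h))"
    using assms by (intro cmp_map[of "dm f" "cd f" "cd g" "dm h" "cd h" "cd k"]) (use assms valid_hom[of f] valid_hom[of h] in \<open>auto simp: valid_hom\<close>)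
  then show ?thesis using True assms by (intro arrow.expand) (simp add: raw_comp raw_tns)
next
  case False
  then have "raw ((g \<bullet> f) \<star> (k \<bullet> h)) = None"
    using valid_comp unfolding arr_tens_def by fastforce
  moreover have "raw ((g \<star> k) \<bullet> (f \<star> h)) = None"
    using False valid_tns unfolding arr_comp_def[of A "g \<star> k"] by fastforce
  ultimately show ?thesis by (intro arrow.expand) simp
qed

text \<open>Oriented against \<open>whisker_comp\<close>: arguments that let arrows on different
  factors slide past each other merge, arguments that follow a single factor split.\<close>

lemma tns_merge:
  "\<lbrakk>cd f = dm g; cd h = dm k\<rbrakk> \<Longrightarrow> (g \<star> k) \<bullet> (f \<star> h) = (g \<bullet> f) \<star> (k \<bullet> h)"
  "\<lbrakk>cd f = dm g; cd h = dm k\<rbrakk> \<Longrightarrow> (g \<star> k) \<bullet> ((f \<star> h) \<bullet> r) = ((g \<bullet> f) \<star> (k \<bullet> h)) \<bullet> r"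
  by (simp_all add: tns_comp comp_assoc)

lemma whisker_comp:
  "\<lbrakk>cd f = dm g; P \<in> obj A\<rbrakk> \<Longrightarrow> idt P \<star> (g \<bullet> f) = (idt P \<star> g) \<bullet> (idt P \<star> f)"
  "\<lbrakk>cd f = dm g; P \<in> obj A\<rbrakk> \<Longrightarrow> (g \<bullet> f) \<star> idt P = (g \<star> idt P) \<bullet> (f \<star> idt P)"
  using tns_comp[of "idt P" "idt P" f g] tns_comp[of f g "idt P" "idt P"] by simp_all

lemma isom_tns [simp]: "\<lbrakk>isom f; isom g\<rbrakk> \<Longrightarrow> isom (f \<star> g)"
  and rv_tns: "\<lbrakk>isom f; isom g\<rbrakk> \<Longrightarrow> rv (f \<star> g) = rv f \<star> rv g"
  using rv_unique[of "f \<star> g" "rv f \<star> rv g"] by (simp_all add: tns_merge)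

lemma whisker_rv [simp]:
  assumes "isom f" "P \<in> obj A"
  shows "(idt P \<star> rv f) \<bullet> (idt P \<star> f) = idt (P \<odot> dm f)"
    "(idt P \<star> f) \<bullet> (idt P \<star> rv f) = idt (P \<odot> cd f)"
    "(rv f \<star> idt P) \<bullet> (f \<star> idt P) = idt (dm f \<odot> P)"
    "(f \<star> idt P) \<bullet> (rv f \<star> idt P) = idt (cd f \<odot> P)"
  using assms by (simp_all add: tns_merge)

lemma whisker_rv_cancel [simp]:
  assumes "isom f" "P \<in> obj A" "valid r"
  shows "cd r = P \<odot> dm f \<Longrightarrow> (idt P \<star> rv f) \<bullet> (idt P \<star> f) \<bullet> r = r"
    "cd r = P \<odot> cd f \<Longrightarrow> (idt P \<star> f) \<bullet> (idt P \<star> rv f) \<bullet> r = r"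
    "cd r = dm f \<odot> P \<Longrightarrow> (rv f \<star> idt P) \<bullet> (f \<star> idt P) \<bullet> r = r"
    "cd r = cd f \<odot> P \<Longrightarrow> (f \<star> idt P) \<bullet> (rv f \<star> idt P) \<bullet> r = r"
  using assms by (simp_all flip: comp_assoc)

lemma isom_as [simp]: "\<lbrakk>P \<in> obj A; Q \<in> obj A; R \<in> obj A\<rbrakk> \<Longrightarrow> isom (as P Q R)"
  unfolding arr_assoc_def by (intro isom_ar assoc_iso) auto

lemma isom_lu [simp]: "P \<in> obj A \<Longrightarrow> isom (lu P)"
  unfolding arr_lunit_def by (intro isom_ar lunit_iso) auto

lemma isom_ru [simp]: "P \<in> obj A \<Longrightarrow> isom (ru P)"
  unfolding arr_runit_def by (intro isom_ar runit_iso) auto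

lemma valid_coherence [simp]:
  "\<lbrakk>P \<in> obj A; Q \<in> obj A; R \<in> obj A\<rbrakk> \<Longrightarrow> valid (as P Q R)"
  "P \<in> obj A \<Longrightarrow> valid (lu P)" "P \<in> obj A \<Longrightarrow> valid (ru P)"
  by simp_all

lemma as_nat:
  assumes "valid f" "valid g" "valid h" "P = cd f" "Q = cd g" "R = cd h"
  shows "as P Q R \<bullet> ((f \<star> g) \<star> h) = (f \<star> (g \<star> h)) \<bullet> as (dm f) (dm g) (dm h)"
proof -
  have "assoc M P Q R \<cdot>\<^bsub>A\<^esub> (the (raw f) \<boxtimes>\<^bsub>M\<^esub> the (raw g) \<boxtimes>\<^bsub>M\<^esub> the (raw h)) =
     (the (raw f) \<boxtimes>\<^bsub>M\<^esub> (the (raw g) \<boxtimes>\<^bsub>M\<^esub> the (raw h))) \<cdot>\<^bsub>A\<^esub> assoc M (dm f) (dm g) (dm h)"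
    using assms by (intro assoc_nat) (auto simp: valid_hom)
  then show ?thesis using assms by (intro arrow.expand) (simp add: raw_comp raw_tns raw_monoidal)
qed

lemma as_nat_idt:
  "\<lbrakk>valid h; P \<in> obj A; Q \<in> obj A; R = cd h\<rbrakk> \<Longrightarrow>
     as P Q R \<bullet> (idt (P \<odot> Q) \<star> h) = (idt P \<star> (idt Q \<star> h)) \<bullet> as P Q (dm h)"
  "\<lbrakk>valid f; Q \<in> obj A; R \<in> obj A; P = cd f\<rbrakk> \<Longrightarrow>
     as P Q R \<bullet> ((f \<star> idt Q) \<star> idt R) = (f \<star> idt (Q \<odot> R)) \<bullet> as (dm f) Q R"
  using as_nat[of "idt P" "idt Q" h P Q R] as_nat[of f "idt Q" "idt R" P Q R] by simp_all

lemma rv_as_nat: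
  assumes "valid f" "valid g" "valid h" "P = cd f" "Q = cd g" "R = cd h"
  shows "rv (as P Q R) \<bullet> (f \<star> (g \<star> h)) = ((f \<star> g) \<star> h) \<bullet> rv (as (dm f) (dm g) (dm h))"
  using assms by (intro rv_square[OF as_nat]) auto

lemma lu_nat:
  assumes "valid f" "P = cd f"
  shows "lu P \<bullet> (idt un \<star> f) = f \<bullet> lu (dm f)"
proof -
  have "lunit M (cd f) \<cdot>\<^bsub>A\<^esub> (ident A un \<boxtimes>\<^bsub>M\<^esub> the (raw f)) = the (raw f) \<cdot>\<^bsub>A\<^esub> lunit M (dm f)"
    using assms by (intro lunit_nat) (auto simp: valid_hom)
  then show ?thesis using assms by (intro arrow.expand) (simp add: raw_comp raw_tns raw_idt raw_monoidal)
qed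

lemma ru_nat:
  assumes "valid f" "P = cd f"
  shows "ru P \<bullet> (f \<star> idt un) = f \<bullet> ru (dm f)"
proof -
  have "runit M (cd f) \<cdot>\<^bsub>A\<^esub> (the (raw f) \<boxtimes>\<^bsub>M\<^esub> ident A un) = the (raw f) \<cdot>\<^bsub>A\<^esub> runit M (dm f)"
    using assms by (intro runit_nat) (auto simp: valid_hom)
  then show ?thesis using assms by (intro arrow.expand) (simp add: raw_comp raw_tns raw_idt raw_monoidal)
qed

text \<open>Naturality of the invertible unitors turns tensoring with the unit into conjugation.
  Hence a unit coherence law may be proved with an extra factor \<open>un\<close>, where the
  pentagon and the triangle apply.\<close>

lemma tns_un_faithful:
  "\<lbrakk>f \<star> idt un = g \<star> idt un; valid f; valid g; dm f = dm g; cd f = cd g\<rbrakk> \<Longrightarrow> f = g"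
  "\<lbrakk>idt un \<star> f = idt un \<star> g; valid f; valid g; dm f = dm g; cd f = cd g\<rbrakk> \<Longrightarrow> f = g"
proof -
  assume *: "valid f" "valid g" "dm f = dm g" "cd f = cd g"
  show "f = g" if "f \<star> idt un = g \<star> idt un"
    using that * ru_nat[of f "cd f"] ru_nat[of g "cd g"] by (intro isom_cancel_right[of f "ru (dm f)" g]) auto
  show "f = g" if "idt un \<star> f = idt un \<star> g"
    using that * lu_nat[of f "cd f"] lu_nat[of g "cd g"] by (intro isom_cancel_right[of f "lu (dm f)" g]) auto
qed

lemma as_pentagon:
  assumes "P \<in> obj A" "Q \<in> obj A" "R \<in> obj A" "S \<in> obj A"
  shows "as P Q (R \<odot> S) \<bullet> as (P \<odot> Q) R S = (idt P \<star> as Q R S) \<bullet> as P (Q \<odot> R) S \<bullet> (as P Q R \<star> idt S)"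
proof -
  note pentagon[OF assms]
  then have "raw (as P Q (R \<odot> S) \<bullet> as (P \<odot> Q) R S) =
      raw (((idt P \<star> as Q R S) \<bullet> as P (Q \<odot> R) S) \<bullet> (as P Q R \<star> idt S))"
    using assms by (simp add: raw_comp raw_tns raw_monoidal raw_idt)
  then show ?thesis using assms by (intro arrow.expand) (simp add: comp_assoc)
qed

lemma as_pentagon_ext:
  "\<lbrakk>P \<in> obj A; Q \<in> obj A; R \<in> obj A; S \<in> obj A\<rbrakk> \<Longrightarrow>
   (idt P \<star> as Q R S) \<bullet> as P (Q \<odot> R) S \<bullet> (as P Q R \<star> idt S) \<bullet> r = as P Q (R \<odot> S) \<bullet> as (P \<odot> Q) R S \<bullet> r"
  using as_pentagon[of P Q R S] by (metis comp_assoc)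

lemma as_triangle:
  assumes "P \<in> obj A" "Q \<in> obj A"
  shows "(idt P \<star> lu Q) \<bullet> as P un Q = ru P \<star> idt Q"
proof -
  show ?thesis using assms triangle[OF assms]
    by (intro arrow.expand) (simp add: raw_comp raw_tns raw_monoidal raw_idt)
qed

text \<open>Kelly's argument: the pentagon for \<open>P\<close>, \<open>Q\<close>,
  \<open>un\<close>, \<open>un\<close>, combined with triangles, gives the claim tensored with
  \<open>un\<close>.\<close>

lemma runit_tns:
  assumes "P \<in> obj A" "Q \<in> obj A"
  shows "(idt P \<star> ru Q) \<bullet> as P Q un = ru (P \<odot> Q)"
proof -
  have "as P Q un \<bullet> (ru (P \<odot> Q) \<star> idt un) = as P Q un \<bullet> (idt (P \<odot> Q) \<star> lu un) \<bullet> as (P \<odot> Q) un un"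
    using assms as_triangle[of "P \<odot> Q" un] by simp
  also have "\<dots> = (idt P \<star> idt Q \<star> lu un) \<bullet> as P Q (un \<odot> un) \<bullet> as (P \<odot> Q) un un"
    using assms by (simp add: as_nat_idt(1)[THEN comp_ext] comp_assoc)
  also have "\<dots> = (idt P \<star> ((idt Q \<star> lu un) \<bullet> as Q un un)) \<bullet> as P (Q \<odot> un) un \<bullet> (as P Q un \<star> idt un)"
    using assms by (simp add: as_pentagon whisker_comp comp_assoc)
  also have "\<dots> = as P Q un \<bullet> ((idt P \<star> ru Q) \<star> idt un) \<bullet> (as P Q un \<star> idt un)"
    using assms by (simp add: as_triangle as_nat[THEN comp_ext] comp_assoc)
  also have "\<dots> = as P Q un \<bullet> (((idt P \<star> ru Q) \<bullet> as P Q un) \<star> idt un)"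
    using assms by (simp add: whisker_comp)
  finally have "((idt P \<star> ru Q) \<bullet> as P Q un) \<star> idt un = ru (P \<odot> Q) \<star> idt un"
    by (rule isom_cancel_left[OF sym]) (use assms in auto)
  then show ?thesis by (rule tns_un_faithful) (use assms in auto)
qed

text \<open>The mirror image of \<open>runit_tns\<close>, from the pentagon for \<open>un\<close>,
  \<open>un\<close>, \<open>P\<close>, \<open>Q\<close>.\<close>

lemma lunit_tns:
  assumes "P \<in> obj A" "Q \<in> obj A"
  shows "lu (P \<odot> Q) \<bullet> as un P Q = lu P \<star> idt Q"
proof -
  have "((idt un \<star> lu (P \<odot> Q)) \<bullet> (idt un \<star> as un P Q)) \<bullet> (as un (un \<odot> P) Q \<bullet> (as un un P \<star> idt Q))
      = (idt un \<star> lu (P \<odot> Q)) \<bullet> as un un (P \<odot> Q) \<bullet> as (un \<odot> un) P Q"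
    using assms by (simp add: as_pentagon comp_assoc)
  also have "\<dots> = (ru un \<star> idt (P \<odot> Q)) \<bullet> as (un \<odot> un) P Q"
    using assms by (simp add: as_triangle comp_assoc flip: comp_assoc[of "idt un \<star> lu (P \<odot> Q)"])
  also have "\<dots> = as un P Q \<bullet> ((ru un \<star> idt P) \<star> idt Q)"
    using assms by (simp add: as_nat)
  also have "\<dots> = as un P Q \<bullet> ((idt un \<star> lu P) \<star> idt Q) \<bullet> (as un un P \<star> idt Q)"
    using assms by (simp add: whisker_comp flip: as_triangle)
  also have "\<dots> = (idt un \<star> lu P \<star> idt Q) \<bullet> (as un (un \<odot> P) Q \<bullet> (as un un P \<star> idt Q))"
    using assms by (simp add: as_nat[THEN comp_ext] comp_assoc)
  finally have "(idt un \<star> lu (P \<odot> Q)) \<bullet> (idt un \<star> as un P Q) = idt un \<star> lu P \<star> idt Q"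
    by (rule isom_cancel_right) (use assms in auto)
  then have "idt un \<star> (lu (P \<odot> Q) \<bullet> as un P Q) = idt un \<star> lu P \<star> idt Q"
    using assms by (simp add: whisker_comp)
  then show ?thesis by (rule tns_un_faithful) (use assms in auto)
qed

text \<open>Naturality of \<open>lu\<close> at \<open>lu un\<close> itself gives
  \<open>idt un \<star> lu un = lu (un \<odot> un)\<close>; then \<open>lunit_tns\<close> and the
  triangle compare the two unitors tensored with \<open>un\<close>.\<close>

lemma lunit_un: "lu un = ru un"
proof -
  have "lu un \<bullet> (idt un \<star> lu un) = lu un \<bullet> lu (un \<odot> un)" by (simp add: lu_nat)
  then have "idt un \<star> lu un = lu (un \<odot> un)" by (rule isom_cancel_left) auto
  then have "lu un \<star> idt un = ru un \<star> idt un"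
    using lunit_tns[of un un] as_triangle[of un un] by simp
  then show ?thesis by (rule tns_un_faithful) auto
qed

end

section \<open>The interchange of a braided category\<close>

definition arr_braid :: "('o, 'm) monoidal \<Rightarrow> ('o \<Rightarrow> 'o \<Rightarrow> 'm) \<Rightarrow> 'o \<Rightarrow> 'o \<Rightarrow> ('o, 'm) arrow" where
  "arr_braid M \<tau> P Q = ar (P \<otimes>\<^bsub>M\<^esub> Q) (\<tau> P Q) (Q \<otimes>\<^bsub>M\<^esub> P)"

locale braided_calculus = monoidal_calculus A M + braided_monoidal_category A M \<tau>
  for A :: "('o, 'm) cat" and M :: "('o, 'm) monoidal" and \<tau> :: "'o \<Rightarrow> 'o \<Rightarrow> 'm"
begin

abbreviation br where "br \<equiv> arr_braid M \<tau>"

lemma dm_cd_br [simp]: "dm (br P Q) = P \<odot> Q" "cd (br P Q) = Q \<odot> P"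
  by (simp_all add: arr_braid_def)

lemma raw_br: "raw (br P Q) = Some (\<tau> P Q)"
  by (simp add: arr_braid_def)

lemma isom_br [simp]: "\<lbrakk>P \<in> obj A; Q \<in> obj A\<rbrakk> \<Longrightarrow> isom (br P Q)"
  unfolding arr_braid_def by (intro isom_ar braid_iso) auto

lemma br_nat:
  assumes "valid f" "valid g" "P = cd f" "Q = cd g"
  shows "br P Q \<bullet> (f \<star> g) = (g \<star> f) \<bullet> br (dm f) (dm g)"
proof -
  have "\<tau> P Q \<cdot>\<^bsub>A\<^esub> (the (raw f) \<boxtimes>\<^bsub>M\<^esub> the (raw g)) = (the (raw g) \<boxtimes>\<^bsub>M\<^esub> the (raw f)) \<cdot>\<^bsub>A\<^esub> \<tau> (dm f) (dm g)"
    using assms by (intro braid_nat) (auto simp: valid_hom)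
  then show ?thesis using assms by (intro arrow.expand) (simp add: raw_comp raw_tns raw_br)
qed

lemma br_hexagon:
  assumes "P \<in> obj A" "Q \<in> obj A" "R \<in> obj A"
  shows "as Q R P \<bullet> br P (Q \<odot> R) \<bullet> as P Q R = (idt Q \<star> br P R) \<bullet> as Q P R \<bullet> (br P Q \<star> idt R)"
proof -
  have "raw ((as Q R P \<bullet> br P (Q \<odot> R)) \<bullet> as P Q R) = raw (((idt Q \<star> br P R) \<bullet> as Q P R) \<bullet> (br P Q \<star> idt R))"
    using assms hexagon[OF assms] by (simp add: raw_comp raw_tns raw_monoidal raw_br raw_idt)
  then show ?thesis using assms by (intro arrow.expand) (simp add: comp_assoc)
qed

lemma br_hexagon_inv:
  assumes "P \<in> obj A" "Q \<in> obj A" "R \<in> obj A"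
  shows "br (P \<odot> Q) R =
    as R P Q \<bullet> (br P R \<star> idt Q) \<bullet> rv (as P R Q) \<bullet> (idt P \<star> br Q R) \<bullet> as P Q R"
proof -
  have "raw (br (P \<odot> Q) R) =
    raw ((((as R P Q \<bullet> (br P R \<star> idt Q)) \<bullet> rv (as P R Q)) \<bullet> (idt P \<star> br Q R)) \<bullet> as P Q R)"
    using assms hexagon_inv[OF assms] by (simp add: raw_comp raw_tns raw_monoidal raw_rv raw_br raw_idt)
  then show ?thesis using assms by (intro arrow.expand) (simp add: comp_assoc)
qed

text \<open>The braiding axioms do not mention the unit. The law follows from the first hexagon for
  \<open>P\<close>, \<open>un\<close>, \<open>un\<close>, in which one copy of the invertible
  braiding can be cancelled.\<close>

lemma braid_unit_right:
  assumes "P \<in> obj A"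
  shows "lu P \<bullet> br P un = ru P"
proof -
  have "br P un \<bullet> (ru P \<star> idt un) = br P un \<bullet> (idt P \<star> lu un) \<bullet> as P un un"
    using assms by (simp add: as_triangle)
  also have "\<dots> = (lu un \<star> idt P) \<bullet> br P (un \<odot> un) \<bullet> as P un un"
    using assms br_nat[of "idt P" "lu un" P un, THEN comp_ext] by (simp add: comp_assoc)
  also have "\<dots> = lu (un \<odot> P) \<bullet> as un un P \<bullet> br P (un \<odot> un) \<bullet> as P un un"
    using assms lunit_tns[of un P, THEN comp_ext] by simp
  also have "\<dots> = lu (un \<odot> P) \<bullet> (idt un \<star> br P un) \<bullet> as un P un \<bullet> (br P un \<star> idt un)"
    using assms by (simp add: br_hexagon)
  also have "\<dots> = br P un \<bullet> lu (P \<odot> un) \<bullet> as un P un \<bullet> (br P un \<star> idt un)"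
    using assms by (simp add: lu_nat[THEN comp_ext] comp_assoc)
  also have "\<dots> = br P un \<bullet> ((lu P \<bullet> br P un) \<star> idt un)"
    using assms lunit_tns[of P un, THEN comp_ext] by (simp add: whisker_comp)
  finally have "ru P \<star> idt un = (lu P \<bullet> br P un) \<star> idt un"
    by (rule isom_cancel_left) (use assms in auto)
  then show ?thesis by (rule tns_un_faithful[THEN sym]) (use assms in auto)
qed

text \<open>The second hexagon for \<open>un\<close>, \<open>un\<close>, \<open>P\<close> plays the
  role that the first one has in \<open>braid_unit_right\<close>.\<close>

lemma braid_unit_left:
  assumes "P \<in> obj A"
  shows "ru P \<bullet> br un P = lu P"
proof -
  have "br un P \<bullet> (idt un \<star> lu P) \<bullet> as un un P = br un P \<bullet> (ru un \<star> idt P)"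
    using assms by (simp add: as_triangle)
  also have "\<dots> = (idt P \<star> ru un) \<bullet> br (un \<odot> un) P"
    using assms by (simp add: br_nat)
  also have "\<dots> = ru (P \<odot> un) \<bullet> (br un P \<star> idt un) \<bullet> rv (as un P un) \<bullet> (idt un \<star> br un P) \<bullet> as un un P"
    using assms runit_tns[of P un, THEN comp_ext] by (simp add: br_hexagon_inv)
  also have "\<dots> = br un P \<bullet> ru (un \<odot> P) \<bullet> rv (as un P un) \<bullet> (idt un \<star> br un P) \<bullet> as un un P"
    using assms by (simp add: ru_nat[THEN comp_ext] comp_assoc)
  also have "\<dots> = br un P \<bullet> (idt un \<star> ru P) \<bullet> (idt un \<star> br un P) \<bullet> as un un P"
    using assms runit_tns[of un P, symmetric] by (simp add: comp_assoc)
  also have "\<dots> = br un P \<bullet> (idt un \<star> (ru P \<bullet> br un P)) \<bullet> as un un P"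
    using assms by (simp add: whisker_comp comp_assoc)
  finally have "(idt un \<star> lu P) \<bullet> as un un P = (idt un \<star> (ru P \<bullet> br un P)) \<bullet> as un un P"
    by (rule isom_cancel_left) (use assms in auto)
  then have "idt un \<star> lu P = idt un \<star> (ru P \<bullet> br un P)"
    by (rule isom_cancel_right) (use assms in auto)
  then show ?thesis by (rule tns_un_faithful(2)[THEN sym]) (use assms in auto)
qed

text \<open>
  Proofs about the interchange are reduced to right-bracketed products, where the associators
  disappear and only the switch of adjacent factors remains.
\<close>

definition sw :: "'o \<Rightarrow> 'o \<Rightarrow> 'o \<Rightarrow> ('o, 'm) arrow" where
  "sw Q R S = as R Q S \<bullet> (br Q R \<star> idt S) \<bullet> rv (as Q R S)"

definition io :: "'o \<Rightarrow> 'o \<Rightarrow> 'o \<Rightarrow> 'o \<Rightarrow> ('o, 'm) arrow" where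
  "io P Q R S = rv (as P R (Q \<odot> S)) \<bullet> (idt P \<star> sw Q R S) \<bullet> as P Q (R \<odot> S)"

lemma dm_cd_io [simp]:
  "dm (sw Q R S) = Q \<odot> (R \<odot> S)" "cd (sw Q R S) = R \<odot> (Q \<odot> S)"
  "dm (io P Q R S) = (P \<odot> Q) \<odot> (R \<odot> S)" "cd (io P Q R S) = (P \<odot> R) \<odot> (Q \<odot> S)"
  by (simp_all add: sw_def io_def)

lemma isom_sw [simp]: "\<lbrakk>Q \<in> obj A; R \<in> obj A; S \<in> obj A\<rbrakk> \<Longrightarrow> isom (sw Q R S)"
  by (simp add: sw_def)

lemma isom_io [simp]: "\<lbrakk>P \<in> obj A; Q \<in> obj A; R \<in> obj A; S \<in> obj A\<rbrakk> \<Longrightarrow> isom (io P Q R S)"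
  by (simp add: io_def)

lemma valid_io [simp]:
  "\<lbrakk>Q \<in> obj A; R \<in> obj A; S \<in> obj A\<rbrakk> \<Longrightarrow> valid (sw Q R S)"
  "\<lbrakk>P \<in> obj A; Q \<in> obj A; R \<in> obj A; S \<in> obj A\<rbrakk> \<Longrightarrow> valid (io P Q R S)"
  by simp_all

lemma raw_io:
  assumes "P \<in> obj A" "Q \<in> obj A" "R \<in> obj A" "S \<in> obj A"
  shows "raw (io P Q R S) = Some (interchange A M \<tau> P Q R S)"
proof -
  have "io P Q R S = (rv (as P R (Q \<odot> S)) \<bullet>
      (idt P \<star> ((as R Q S \<bullet> (br Q R \<star> idt S)) \<bullet> rv (as Q R S)))) \<bullet> as P Q (R \<odot> S)"
    by (simp add: io_def sw_def comp_assoc)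
  then show ?thesis using assms
    by (simp add: interchange_def raw_comp raw_tns raw_monoidal raw_rv raw_br raw_idt)
qed

lemma sw_nat:
  assumes "valid f" "valid g" "valid h" "Q = cd f" "R = cd g" "S = cd h"
  shows "sw Q R S \<bullet> (f \<star> (g \<star> h)) = (g \<star> (f \<star> h)) \<bullet> sw (dm f) (dm g) (dm h)"
proof -
  have "(br Q R \<star> idt S) \<bullet> ((f \<star> g) \<star> h) = ((g \<star> f) \<star> h) \<bullet> (br (dm f) (dm g) \<star> idt (dm h))"
    using assms by (simp add: tns_merge br_nat)
  from comp_ext[OF this] show ?thesis using assms
    by (simp add: sw_def comp_assoc rv_as_nat as_nat[THEN comp_ext])
qed

lemma io_nat:
  assumes "valid f" "valid g" "valid h" "valid k" "P = cd f" "Q = cd g" "R = cd h" "S = cd k"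
  shows "io P Q R S \<bullet> ((f \<star> g) \<star> (h \<star> k)) = ((f \<star> h) \<star> (g \<star> k)) \<bullet> io (dm f) (dm g) (dm h) (dm k)"
proof -
  have "(idt P \<star> sw Q R S) \<bullet> (f \<star> g \<star> h \<star> k) = (f \<star> h \<star> g \<star> k) \<bullet> (idt (dm f) \<star> sw (dm g) (dm h) (dm k))"
    using assms by (simp add: tns_merge sw_nat)
  from comp_ext[OF this] show ?thesis using assms
    by (simp add: io_def comp_assoc as_nat rv_as_nat[THEN comp_ext])
qed

text \<open>The last factor of a switch is inert: splitting it as \<open>S \<odot> V\<close> changes
  only the brackets, which the pentagon controls.\<close>

lemma sw_as:
  assumes "Q \<in> obj A" "R \<in> obj A" "S \<in> obj A" "V \<in> obj A"
  shows "(idt R \<star> as Q S V) \<bullet> as R (Q \<odot> S) V \<bullet> (sw Q R S \<star> idt V)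
       = sw Q R (S \<odot> V) \<bullet> (idt Q \<star> as R S V) \<bullet> as Q (R \<odot> S) V"
proof -
  have "(idt R \<star> as Q S V) \<bullet> as R (Q \<odot> S) V \<bullet> (sw Q R S \<star> idt V)
     = ((idt R \<star> as Q S V) \<bullet> as R (Q \<odot> S) V \<bullet> (as R Q S \<star> idt V)) \<bullet> ((br Q R \<star> idt S) \<star> idt V) \<bullet> (rv (as Q R S) \<star> idt V)"
    using assms by (simp add: sw_def whisker_comp comp_assoc)
  also have "\<dots> = as R Q (S \<odot> V) \<bullet> as (R \<odot> Q) S V \<bullet> ((br Q R \<star> idt S) \<star> idt V) \<bullet> (rv (as Q R S) \<star> idt V)"
    using assms by (simp add: comp_assoc flip: as_pentagon)
  also have "\<dots> = as R Q (S \<odot> V) \<bullet> (br Q R \<star> idt (S \<odot> V)) \<bullet> as (Q \<odot> R) S V \<bullet> (rv (as Q R S) \<star> idt V)"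
    using assms by (simp add: as_nat_idt[THEN comp_ext] comp_assoc)
  also have "\<dots> = sw Q R (S \<odot> V) \<bullet> (as Q R (S \<odot> V) \<bullet> as (Q \<odot> R) S V) \<bullet> (rv (as Q R S) \<star> idt V)"
    using assms by (simp add: sw_def comp_assoc)
  also have "\<dots> = sw Q R (S \<odot> V) \<bullet> (idt Q \<star> as R S V) \<bullet> as Q (R \<odot> S) V \<bullet> ((as Q R S \<star> idt V) \<bullet> (rv (as Q R S) \<star> idt V))"
    using assms by (simp only: as_pentagon comp_assoc)
  also have "\<dots> = sw Q R (S \<odot> V) \<bullet> (idt Q \<star> as R S V) \<bullet> as Q (R \<odot> S) V"
    using assms by (simp add: tns_merge)
  finally show ?thesis .
qed

text \<open>The first hexagon freed of inner brackets: to pass \<open>R \<odot> S\<close>, the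
  factor \<open>Q\<close> passes \<open>R\<close> and then \<open>S\<close>.\<close>

lemma sw_tns_right:
  assumes "Q \<in> obj A" "R \<in> obj A" "S \<in> obj A" "V \<in> obj A"
  shows "as R S (Q \<odot> V) \<bullet> sw Q (R \<odot> S) V = (idt R \<star> sw Q S V) \<bullet> sw Q R (S \<odot> V) \<bullet> (idt Q \<star> as R S V)"
proof -
  let ?a = "as Q (R \<odot> S) V \<bullet> (as Q R S \<star> idt V)"
  have "(as R S (Q \<odot> V) \<bullet> sw Q (R \<odot> S) V) \<bullet> ?a
      = (as R S (Q \<odot> V) \<bullet> as (R \<odot> S) Q V) \<bullet> (br Q (R \<odot> S) \<star> idt V) \<bullet> (as Q R S \<star> idt V)"
    using assms by (simp add: sw_def comp_assoc)
  also have "\<dots> = (idt R \<star> as S Q V) \<bullet> as R (S \<odot> Q) V \<bullet> ((as R S Q \<bullet> br Q (R \<odot> S) \<bullet> as Q R S) \<star> idt V)"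
    using assms by (simp add: as_pentagon whisker_comp comp_assoc)
  also have "\<dots> = (idt R \<star> as S Q V) \<bullet> (as R (S \<odot> Q) V \<bullet> ((idt R \<star> br Q S) \<star> idt V)) \<bullet> (as R Q S \<star> idt V) \<bullet> ((br Q R \<star> idt S) \<star> idt V)"
    using assms by (simp add: br_hexagon whisker_comp comp_assoc)
  also have "\<dots> = (idt R \<star> as S Q V) \<bullet> (idt R \<star> (br Q S \<star> idt V)) \<bullet> as R (Q \<odot> S) V \<bullet> (as R Q S \<star> idt V) \<bullet> ((br Q R \<star> idt S) \<star> idt V)"
    using assms by (simp add: as_nat comp_assoc)
  also have "\<dots> = (idt R \<star> sw Q S V) \<bullet> (idt R \<star> as Q S V) \<bullet> as R (Q \<odot> S) V \<bullet> (as R Q S \<star> idt V) \<bullet> ((br Q R \<star> idt S) \<star> idt V)"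
    using assms by (simp add: sw_def whisker_comp comp_assoc)
  also have "\<dots> = (idt R \<star> sw Q S V) \<bullet> as R Q (S \<odot> V) \<bullet> as (R \<odot> Q) S V \<bullet> ((br Q R \<star> idt S) \<star> idt V)"
    using assms by (simp add: as_pentagon_ext)
  also have "\<dots> = (idt R \<star> sw Q S V) \<bullet> as R Q (S \<odot> V) \<bullet> (br Q R \<star> idt (S \<odot> V)) \<bullet> as (Q \<odot> R) S V"
    using assms by (simp add: as_nat_idt)
  also have "\<dots> = (idt R \<star> sw Q S V) \<bullet> sw Q R (S \<odot> V) \<bullet> as Q R (S \<odot> V) \<bullet> as (Q \<odot> R) S V"
    using assms by (simp add: sw_def comp_assoc)
  also have "\<dots> = ((idt R \<star> sw Q S V) \<bullet> sw Q R (S \<odot> V) \<bullet> (idt Q \<star> as R S V)) \<bullet> ?a"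
    using assms by (simp add: as_pentagon comp_assoc)
  finally show ?thesis by (rule isom_cancel_right) (use assms in auto)
qed

text \<open>The second hexagon in the same form: to move \<open>Q \<odot> R\<close> past
  \<open>S\<close>, first \<open>R\<close> moves and then \<open>Q\<close>.\<close>

lemma sw_tns_left:
  assumes "Q \<in> obj A" "R \<in> obj A" "S \<in> obj A" "V \<in> obj A"
  shows "(idt S \<star> as Q R V) \<bullet> sw (Q \<odot> R) S V = sw Q S (R \<odot> V) \<bullet> (idt Q \<star> sw R S V) \<bullet> as Q R (S \<odot> V)"
proof -
  have "((idt S \<star> as Q R V) \<bullet> sw (Q \<odot> R) S V) \<bullet> as (Q \<odot> R) S V
     = (idt S \<star> as Q R V) \<bullet> as S (Q \<odot> R) V \<bullet> (br (Q \<odot> R) S \<star> idt V)"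
    using assms by (simp add: sw_def comp_assoc)
  also have "\<dots> = ((idt S \<star> as Q R V) \<bullet> as S (Q \<odot> R) V \<bullet> (sw Q S R \<star> idt V)) \<bullet> ((idt Q \<star> br R S) \<star> idt V) \<bullet> (as Q R S \<star> idt V)"
    using assms by (simp add: br_hexagon_inv[of Q R S] sw_def whisker_comp comp_assoc)
  also have "\<dots> = sw Q S (R \<odot> V) \<bullet> (idt Q \<star> as S R V) \<bullet> as Q (S \<odot> R) V \<bullet> ((idt Q \<star> br R S) \<star> idt V) \<bullet> (as Q R S \<star> idt V)"
    using assms by (simp only: sw_as comp_assoc)
  also have "\<dots> = sw Q S (R \<odot> V) \<bullet> (idt Q \<star> as S R V) \<bullet> (idt Q \<star> (br R S \<star> idt V)) \<bullet> as Q (R \<odot> S) V \<bullet> (as Q R S \<star> idt V)"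
    using assms by (simp add: as_nat[THEN comp_ext] comp_assoc)
  also have "\<dots> = sw Q S (R \<odot> V) \<bullet> (idt Q \<star> sw R S V) \<bullet> (idt Q \<star> as R S V) \<bullet> as Q (R \<odot> S) V \<bullet> (as Q R S \<star> idt V)"
    using assms by (simp add: sw_def whisker_comp comp_assoc)
  also have "\<dots> = (sw Q S (R \<odot> V) \<bullet> (idt Q \<star> sw R S V) \<bullet> as Q R (S \<odot> V)) \<bullet> as (Q \<odot> R) S V"
    using assms by (simp add: as_pentagon comp_assoc)
  finally show ?thesis by (rule isom_cancel_right) (use assms in auto)
qed

lemma as_io: "\<lbrakk>P \<in> obj A; Q \<in> obj A; R \<in> obj A; S \<in> obj A\<rbrakk> \<Longrightarrow>
    as P R (Q \<odot> S) \<bullet> io P Q R S = (idt P \<star> sw Q R S) \<bullet> as P Q (R \<odot> S)"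
  by (simp add: io_def)

text \<open>Both sides bring the six factors into the order P, R, T, Q, S, U. On right-bracketed
  products they perform the same three switches: Q with R, S with T, and finally Q with T. Only the
  order of the first two differs, and these act on disjoint factors.\<close>

lemma io_assoc:
  assumes "P \<in> obj A" "Q \<in> obj A" "R \<in> obj A" "S \<in> obj A" "T \<in> obj A" "U \<in> obj A"
  shows "(as P R T \<star> as Q S U) \<bullet> io (P \<odot> R) (Q \<odot> S) T U \<bullet> (io P Q R S \<star> idt (T \<odot> U))
       = io P Q (R \<odot> T) (S \<odot> U) \<bullet> (idt (P \<odot> Q) \<star> io R S T U) \<bullet> as (P \<odot> Q) (R \<odot> S) (T \<odot> U)"
    (is "?L = ?R")
proof -
  let ?Z = "Q \<odot> S \<odot> U" and ?V = "T \<odot> U"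
  \<comment> \<open>\<open>?K\<close> removes the remaining brackets from the common codomain;
    \<open>?N\<close> is the right-bracketed normal form that both sides reach.\<close>
  let ?K = "(idt P \<star> as R T ?Z) \<bullet> as P (R \<odot> T) ?Z"
  let ?N = "(idt P \<star> ((idt R \<star> sw Q T (S \<odot> U)) \<bullet> (idt R \<star> idt Q \<star> sw S T U) \<bullet> sw Q R (S \<odot> ?V) \<bullet>
        (idt Q \<star> as R S ?V) \<bullet> as Q (R \<odot> S) ?V)) \<bullet> as P (Q \<odot> R \<odot> S) ?V \<bullet> (as P Q (R \<odot> S) \<star> idt ?V)"
  have split: "as P R T \<star> as Q S U = (as P R T \<star> idt ?Z) \<bullet> (idt ((P \<odot> R) \<odot> T) \<star> as Q S U)"
    using assms by (simp add: tns_merge)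
  have "?K \<bullet> ?L = as P R (T \<odot> ?Z) \<bullet> (idt (P \<odot> R) \<star> idt T \<star> as Q S U) \<bullet>
      as (P \<odot> R) T ((Q \<odot> S) \<odot> U) \<bullet> io (P \<odot> R) (Q \<odot> S) T U \<bullet> (io P Q R S \<star> idt ?V)"
    using assms by (simp add: split comp_assoc as_pentagon_ext as_nat_idt[THEN comp_ext])
  also have "\<dots> = as P R (T \<odot> ?Z) \<bullet> (idt (P \<odot> R) \<star> ((idt T \<star> as Q S U) \<bullet> sw (Q \<odot> S) T U)) \<bullet>
      as (P \<odot> R) (Q \<odot> S) ?V \<bullet> (io P Q R S \<star> idt ?V)"
    using assms by (simp add: as_io[THEN comp_ext] whisker_comp comp_assoc)
  also have "\<dots> = (idt P \<star> idt R \<star> ((idt T \<star> as Q S U) \<bullet> sw (Q \<odot> S) T U)) \<bullet>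
      as P R ((Q \<odot> S) \<odot> ?V) \<bullet> as (P \<odot> R) (Q \<odot> S) ?V \<bullet> (io P Q R S \<star> idt ?V)"
    using assms by (simp add: as_nat_idt[THEN comp_ext] comp_assoc)
  also have "\<dots> = (idt P \<star> idt R \<star> (sw Q T (S \<odot> U) \<bullet> (idt Q \<star> sw S T U) \<bullet> as Q S ?V)) \<bullet>
      (idt P \<star> as R (Q \<odot> S) ?V) \<bullet> as P (R \<odot> Q \<odot> S) ?V \<bullet> ((as P R (Q \<odot> S) \<bullet> io P Q R S) \<star> idt ?V)"
    using assms by (simp add: sw_tns_left as_pentagon[THEN comp_ext] whisker_comp comp_assoc)
  also have "\<dots> = (idt P \<star> idt R \<star> (sw Q T (S \<odot> U) \<bullet> (idt Q \<star> sw S T U))) \<bullet>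
      (idt P \<star> ((idt R \<star> as Q S ?V) \<bullet> as R (Q \<odot> S) ?V \<bullet> (sw Q R S \<star> idt ?V))) \<bullet>
      as P (Q \<odot> R \<odot> S) ?V \<bullet> (as P Q (R \<odot> S) \<star> idt ?V)"
    using assms by (simp add: as_io as_nat[THEN comp_ext] whisker_comp comp_assoc)
  also have "\<dots> = ?N"
    using assms by (simp add: sw_as whisker_comp comp_assoc)
  finally have L: "?K \<bullet> ?L = ?N" .
  have "?K \<bullet> ?R = (idt P \<star> (as R T ?Z \<bullet> sw Q (R \<odot> T) (S \<odot> U))) \<bullet> as P Q ((R \<odot> T) \<odot> S \<odot> U) \<bullet>
      (idt (P \<odot> Q) \<star> io R S T U) \<bullet> as (P \<odot> Q) (R \<odot> S) ?V"
    using assms by (simp add: as_io[THEN comp_ext] whisker_comp comp_assoc)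
  also have "\<dots> = (idt P \<star> ((idt R \<star> sw Q T (S \<odot> U)) \<bullet> sw Q R (T \<odot> S \<odot> U) \<bullet>
      (idt Q \<star> (as R T (S \<odot> U) \<bullet> io R S T U)))) \<bullet> as P Q ((R \<odot> S) \<odot> ?V) \<bullet> as (P \<odot> Q) (R \<odot> S) ?V"
    using assms by (simp add: sw_tns_right as_nat_idt[THEN comp_ext] whisker_comp comp_assoc)
  also have "\<dots> = (idt P \<star> ((idt R \<star> sw Q T (S \<odot> U)) \<bullet> (sw Q R (T \<odot> S \<odot> U) \<bullet>
      (idt Q \<star> idt R \<star> sw S T U)) \<bullet> (idt Q \<star> as R S ?V))) \<bullet> as P Q ((R \<odot> S) \<odot> ?V) \<bullet> as (P \<odot> Q) (R \<odot> S) ?V"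
    using assms by (simp add: as_io whisker_comp comp_assoc)
  also have "\<dots> = ?N"
    using assms by (simp add: sw_nat as_pentagon whisker_comp comp_assoc)
  finally have "?K \<bullet> ?L = ?K \<bullet> ?R" using L by simp
  then show ?thesis by (rule isom_cancel_left) (use assms in auto)
qed

text \<open>The companion law for two groups of three. The left side switches R with S, R with T, Q
  with S; the right side R with S, Q with S, R with T. Again the two switches that trade places act
  on disjoint factors.\<close>

lemma io_coassoc:
  assumes "P \<in> obj A" "Q \<in> obj A" "R \<in> obj A" "S \<in> obj A" "T \<in> obj A" "U \<in> obj A"
  shows "as (P \<odot> S) (Q \<odot> T) (R \<odot> U) \<bullet> (io P Q S T \<star> idt (R \<odot> U)) \<bullet> io (P \<odot> Q) R (S \<odot> T) U
       = (idt (P \<odot> S) \<star> io Q R T U) \<bullet> io P (Q \<odot> R) S (T \<odot> U) \<bullet> (as P Q R \<star> as S T U)"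
    (is "?L = ?R")
proof -
  let ?V = "R \<odot> U"
  let ?K = "(idt P \<star> idt S \<star> as Q T ?V) \<bullet> as P S ((Q \<odot> T) \<odot> ?V)"
  let ?N = "(idt P \<star> ((idt S \<star> idt Q \<star> sw R T U) \<bullet> sw Q S (R \<odot> T \<odot> U) \<bullet> (idt Q \<star> sw R S (T \<odot> U)) \<bullet>
      (idt Q \<star> idt R \<star> as S T U))) \<bullet> as P Q (R \<odot> (S \<odot> T) \<odot> U) \<bullet> as (P \<odot> Q) R ((S \<odot> T) \<odot> U)"
  have "?K \<bullet> ?L = (idt P \<star> idt S \<star> as Q T ?V) \<bullet> (idt P \<star> as S (Q \<odot> T) ?V) \<bullet> as P (S \<odot> Q \<odot> T) ?V \<bullet>
      ((as P S (Q \<odot> T) \<bullet> io P Q S T) \<star> idt ?V) \<bullet> io (P \<odot> Q) R (S \<odot> T) U"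
    using assms by (simp add: as_pentagon[THEN comp_ext] whisker_comp comp_assoc)
  also have "\<dots> = (idt P \<star> ((idt S \<star> as Q T ?V) \<bullet> as S (Q \<odot> T) ?V \<bullet> (sw Q S T \<star> idt ?V))) \<bullet>
      as P (Q \<odot> S \<odot> T) ?V \<bullet> (as P Q (S \<odot> T) \<star> idt ?V) \<bullet> io (P \<odot> Q) R (S \<odot> T) U"
    using assms by (simp add: as_io as_nat[THEN comp_ext] whisker_comp comp_assoc)
  also have "\<dots> = (idt P \<star> (sw Q S (T \<odot> ?V) \<bullet> (idt Q \<star> as S T ?V))) \<bullet> as P Q ((S \<odot> T) \<odot> ?V) \<bullet>
      as (P \<odot> Q) (S \<odot> T) ?V \<bullet> io (P \<odot> Q) R (S \<odot> T) U"
    using assms by (simp add: sw_as as_pentagon_ext whisker_comp comp_assoc)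
  also have "\<dots> = (idt P \<star> (sw Q S (T \<odot> ?V) \<bullet> (idt Q \<star> (as S T ?V \<bullet> sw R (S \<odot> T) U)))) \<bullet>
      as P Q (R \<odot> (S \<odot> T) \<odot> U) \<bullet> as (P \<odot> Q) R ((S \<odot> T) \<odot> U)"
    using assms by (simp add: as_io as_nat_idt[THEN comp_ext] whisker_comp comp_assoc)
  also have "\<dots> = (idt P \<star> ((sw Q S (T \<odot> ?V) \<bullet> (idt Q \<star> idt S \<star> sw R T U)) \<bullet> (idt Q \<star> sw R S (T \<odot> U)) \<bullet>
      (idt Q \<star> idt R \<star> as S T U))) \<bullet> as P Q (R \<odot> (S \<odot> T) \<odot> U) \<bullet> as (P \<odot> Q) R ((S \<odot> T) \<odot> U)"
    using assms by (simp add: sw_tns_right whisker_comp comp_assoc)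
  also have "\<dots> = ?N"
    using assms by (simp add: sw_nat comp_assoc)
  finally have L: "?K \<bullet> ?L = ?N" .
  have split: "as P Q R \<star> as S T U = (as P Q R \<star> idt (S \<odot> T \<odot> U)) \<bullet> (idt ((P \<odot> Q) \<odot> R) \<star> as S T U)"
    using assms by (simp add: tns_merge)
  have "?K \<bullet> ?R = (idt P \<star> idt S \<star> (as Q T ?V \<bullet> io Q R T U)) \<bullet> as P S ((Q \<odot> R) \<odot> T \<odot> U) \<bullet>
      io P (Q \<odot> R) S (T \<odot> U) \<bullet> (as P Q R \<star> as S T U)"
    using assms by (simp add: as_nat_idt[THEN comp_ext] whisker_comp comp_assoc)
  also have "\<dots> = (idt P \<star> ((idt S \<star> idt Q \<star> sw R T U) \<bullet> (idt S \<star> as Q R (T \<odot> U)) \<bullet> sw (Q \<odot> R) S (T \<odot> U))) \<bullet>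
      as P (Q \<odot> R) (S \<odot> T \<odot> U) \<bullet> (as P Q R \<star> as S T U)"
    using assms by (simp add: as_io as_io[THEN comp_ext] whisker_comp comp_assoc)
  also have "\<dots> = (idt P \<star> ((idt S \<star> idt Q \<star> sw R T U) \<bullet> sw Q S (R \<odot> T \<odot> U) \<bullet> (idt Q \<star> sw R S (T \<odot> U)))) \<bullet>
      as P Q (R \<odot> S \<odot> T \<odot> U) \<bullet> as (P \<odot> Q) R (S \<odot> T \<odot> U) \<bullet> (idt ((P \<odot> Q) \<odot> R) \<star> as S T U)"
    using assms by (simp add: sw_tns_left split as_pentagon_ext whisker_comp comp_assoc)
  also have "\<dots> = ?N"
    using assms by (simp add: as_nat_idt as_nat_idt[THEN comp_ext] whisker_comp comp_assoc)
  finally have "?K \<bullet> ?L = ?K \<bullet> ?R" using L by simp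
  then show ?thesis by (rule isom_cancel_left) (use assms in auto)
qed

text \<open>The switch with the unit is trivial because the braiding with the unit is, by
  \<open>braid_unit_left\<close> and \<open>braid_unit_right\<close>.\<close>

lemma sw_un:
  assumes "Q \<in> obj A" "S \<in> obj A"
  shows "(idt Q \<star> lu S) \<bullet> sw un Q S = lu (Q \<odot> S)" "lu (Q \<odot> S) \<bullet> sw Q un S = idt Q \<star> lu S"
proof -
  have "(idt Q \<star> lu S) \<bullet> sw un Q S = ((ru Q \<bullet> br un Q) \<star> idt S) \<bullet> rv (as un Q S)"
    using assms by (simp add: sw_def as_triangle[THEN comp_ext] whisker_comp comp_assoc)
  also have "\<dots> = lu (Q \<odot> S)"
    using assms by (simp add: braid_unit_left comp_assoc flip: lunit_tns)
  finally show "(idt Q \<star> lu S) \<bullet> sw un Q S = lu (Q \<odot> S)" .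
  have "lu (Q \<odot> S) \<bullet> sw Q un S = ((lu Q \<bullet> br Q un) \<star> idt S) \<bullet> rv (as Q un S)"
    using assms by (simp add: sw_def lunit_tns[THEN comp_ext] whisker_comp comp_assoc)
  also have "\<dots> = idt Q \<star> lu S"
    using assms by (simp add: braid_unit_right comp_assoc flip: as_triangle)
  finally show "lu (Q \<odot> S) \<bullet> sw Q un S = idt Q \<star> lu S" .
qed

text \<open>For \<open>ct_unit_left\<close>: once the unit arrow of \<open>E\<close> has been slid
  out of the interchange, both entries of the first pair are the unit object.\<close>

lemma io_un_un_left:
  assumes "P \<in> obj A" "Q \<in> obj A"
  shows "(lu P \<star> lu Q) \<bullet> io un un P Q = lu (P \<odot> Q) \<bullet> (lu un \<star> idt (P \<odot> Q))"
proof -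
  have "(lu P \<star> lu Q) \<bullet> io un un P Q = (lu P \<star> idt Q) \<bullet> (idt (un \<odot> P) \<star> lu Q) \<bullet> io un un P Q"
    using assms by (simp add: tns_merge)
  also have "\<dots> = lu (P \<odot> Q) \<bullet> (idt un \<star> idt P \<star> lu Q) \<bullet> as un P (un \<odot> Q) \<bullet> io un un P Q"
    using assms by (simp add: as_nat_idt[THEN comp_ext] comp_assoc flip: lunit_tns)
  also have "\<dots> = lu (P \<odot> Q) \<bullet> (idt un \<star> ((idt P \<star> lu Q) \<bullet> sw un P Q)) \<bullet> as un un (P \<odot> Q)"
    using assms by (simp add: as_io whisker_comp comp_assoc)
  also have "\<dots> = lu (P \<odot> Q) \<bullet> (lu un \<star> idt (P \<odot> Q))"
    using assms by (simp add: sw_un as_triangle lunit_un)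
  finally show ?thesis .
qed

lemma io_un_un_right:
  assumes "P \<in> obj A" "Q \<in> obj A"
  shows "(ru P \<star> ru Q) \<bullet> io P Q un un = ru (P \<odot> Q) \<bullet> (idt (P \<odot> Q) \<star> lu un)"
proof -
  have "(ru P \<star> ru Q) \<bullet> io P Q un un = (ru P \<star> idt Q) \<bullet> (idt (P \<odot> un) \<star> ru Q) \<bullet> io P Q un un"
    using assms by (simp add: tns_merge)
  also have "\<dots> = (idt P \<star> lu Q) \<bullet> (idt P \<star> idt un \<star> ru Q) \<bullet> as P un (Q \<odot> un) \<bullet> io P Q un un"
    using assms by (simp add: as_nat_idt[THEN comp_ext] comp_assoc flip: as_triangle)
  also have "\<dots> = (idt P \<star> ((lu Q \<bullet> (idt un \<star> ru Q)) \<bullet> sw Q un un)) \<bullet> as P Q (un \<odot> un)"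
    using assms by (simp add: as_io whisker_comp comp_assoc)
  also have "\<dots> = (idt P \<star> ru Q) \<bullet> (idt P \<star> idt Q \<star> lu un) \<bullet> as P Q (un \<odot> un)"
    using assms by (simp add: lu_nat sw_un whisker_comp comp_assoc)
  also have "\<dots> = (idt P \<star> ru Q) \<bullet> as P Q un \<bullet> (idt (P \<odot> Q) \<star> lu un)"
    using assms by (simp add: as_nat_idt)
  also have "\<dots> = ru (P \<odot> Q) \<bullet> (idt (P \<odot> Q) \<star> lu un)"
    using assms by (simp add: runit_tns[THEN comp_ext])
  finally show ?thesis .
qed

text \<open>For \<open>ct_counital\<close>: once the counits have been applied, both coefficient
  positions hold the unit object.\<close>

lemma io_un_snd:
  assumes "P \<in> obj A" "Q \<in> obj A"
  shows "ru (P \<odot> Q) \<bullet> (idt (P \<odot> Q) \<star> lu un) \<bullet> io P un Q un = ru P \<star> ru Q"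
proof -
  have "ru (P \<odot> Q) \<bullet> (idt (P \<odot> Q) \<star> lu un) \<bullet> io P un Q un =
      (idt P \<star> ru Q) \<bullet> (idt P \<star> idt Q \<star> lu un) \<bullet> as P Q (un \<odot> un) \<bullet> io P un Q un"
    using assms by (simp add: as_nat_idt[THEN comp_ext] comp_assoc flip: runit_tns)
  also have "\<dots> = (idt P \<star> (ru Q \<bullet> (idt Q \<star> lu un) \<bullet> sw un Q un)) \<bullet> as P un (Q \<odot> un)"
    using assms by (simp add: as_io whisker_comp comp_assoc)
  also have "\<dots> = (idt P \<star> (lu Q \<bullet> (idt un \<star> ru Q))) \<bullet> as P un (Q \<odot> un)"
    using assms by (simp add: sw_un lu_nat)
  also have "\<dots> = (idt P \<star> lu Q) \<bullet> as P un Q \<bullet> (idt (P \<odot> un) \<star> ru Q)"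
    using assms by (simp add: as_nat_idt whisker_comp comp_assoc)
  also have "\<dots> = ru P \<star> ru Q"
    using assms by (simp add: as_triangle[THEN comp_ext] tns_merge)
  finally show ?thesis .
qed

end

section \<open>Actions\<close>

text \<open>Objects of \<open>C\<close> act through their identities, which is all that most
  formulas need; general arrows of \<open>C\<close> enter later through \<open>pb\<close>.\<close>

definition arr_act :: "('c, 'd) cat \<Rightarrow> ('o, 'm) cat \<Rightarrow> ('c, 'd, 'o, 'm) action \<Rightarrow> 'c \<Rightarrow> ('o, 'm) arrow \<Rightarrow> ('o, 'm) arrow" where
  "arr_act C A a X f = Arrow (X \<rhd>\<^bsub>a\<^esub> dm f)
     (if X \<in> obj C \<and> arr_valid A f then Some (ident C X \<unrhd>\<^bsub>a\<^esub> the (raw f)) else None) (X \<rhd>\<^bsub>a\<^esub> cd f)"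

definition arr_pull1 :: "('c, 'd, 'o, 'm) action \<Rightarrow> ('o, 'm) monoidal \<Rightarrow> ('c, 'o, 'm) pulls \<Rightarrow> 'c \<Rightarrow> 'o \<Rightarrow> 'o \<Rightarrow> ('o, 'm) arrow" where
  "arr_pull1 a M p X P Q = ar ((X \<rhd>\<^bsub>a\<^esub> P) \<otimes>\<^bsub>M\<^esub> Q) (pull1 p X P Q) (X \<rhd>\<^bsub>a\<^esub> (P \<otimes>\<^bsub>M\<^esub> Q))"

definition arr_pull2 :: "('c, 'd, 'o, 'm) action \<Rightarrow> ('o, 'm) monoidal \<Rightarrow> ('c, 'o, 'm) pulls \<Rightarrow> 'c \<Rightarrow> 'o \<Rightarrow> 'o \<Rightarrow> ('o, 'm) arrow" where
  "arr_pull2 a M p X P Q = ar (P \<otimes>\<^bsub>M\<^esub> (X \<rhd>\<^bsub>a\<^esub> Q)) (pull2 p X P Q) (X \<rhd>\<^bsub>a\<^esub> (P \<otimes>\<^bsub>M\<^esub> Q))"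

locale action_calculus = monoidal_calculus A M + c_monoidal_category C MC \<beta> A a M p
  for C :: "('c, 'd) cat" and MC :: "('c, 'd) monoidal" and \<beta> :: "'c \<Rightarrow> 'c \<Rightarrow> 'd"
    and A :: "('o, 'm) cat" and a :: "('c, 'd, 'o, 'm) action"
    and M :: "('o, 'm) monoidal" and p :: "('c, 'o, 'm) pulls"
begin

abbreviation aobj (infixr "\<triangleright>" 75) where "X \<triangleright> P \<equiv> X \<rhd>\<^bsub>a\<^esub> P"
abbreviation pa where "pa \<equiv> arr_act C A a"
abbreviation p1 where "p1 \<equiv> arr_pull1 a M p"
abbreviation p2 where "p2 \<equiv> arr_pull2 a M p"

lemma aobj [simp]: "\<lbrakk>X \<in> obj C; P \<in> obj A\<rbrakk> \<Longrightarrow> X \<triangleright> P \<in> obj A"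
  by (rule fst.obj_map)

lemma ident_C: "X \<in> obj C \<Longrightarrow> ident C X \<in> hom C X X" "X \<in> obj C \<Longrightarrow> ident C X \<cdot>\<^bsub>C\<^esub> ident C X = ident C X"
  using base.fst.ident_hom base.fst.cmp_ident_left by blast+

lemma dm_cd_action [simp]:
  "dm (pa X f) = X \<triangleright> dm f" "cd (pa X f) = X \<triangleright> cd f"
  "dm (p1 X P Q) = (X \<triangleright> P) \<odot> Q" "cd (p1 X P Q) = X \<triangleright> (P \<odot> Q)"
  "dm (p2 X P Q) = P \<odot> (X \<triangleright> Q)" "cd (p2 X P Q) = X \<triangleright> (P \<odot> Q)"
  by (simp_all add: arr_act_def arr_pull1_def arr_pull2_def)

lemma raw_action:
  "\<lbrakk>X \<in> obj C; valid f\<rbrakk> \<Longrightarrow> raw (pa X f) = Some (ident C X \<unrhd>\<^bsub>a\<^esub> the (raw f))"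
  "raw (p1 X P Q) = Some (pull1 p X P Q)" "raw (p2 X P Q) = Some (pull2 p X P Q)"
  by (simp_all add: arr_act_def arr_pull1_def arr_pull2_def)

lemma valid_pa [simp]: "valid (pa X f) \<longleftrightarrow> X \<in> obj C \<and> valid f"
proof
  assume *: "X \<in> obj C \<and> valid f"
  then have "ident C X \<unrhd>\<^bsub>a\<^esub> the (raw f) \<in> hom A (X \<triangleright> dm f) (X \<triangleright> cd f)"
    by (intro fst.hom_map ident_C) (auto simp: valid_hom)
  then show "valid (pa X f)" using * by (simp add: arr_act_def)
next
  assume *: "valid (pa X f)"
  show "X \<in> obj C \<and> valid f"
  proof (rule ccontr)
    assume "\<not> ?thesis"
    then have "raw (pa X f) = None" unfolding arr_act_def by auto
    then show False using * unfolding arr_valid_def by simp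
  qed
qed

lemma pa_idt [simp]: "\<lbrakk>X \<in> obj C; P \<in> obj A\<rbrakk> \<Longrightarrow> pa X (idt P) = idt (X \<triangleright> P)"
  by (intro arrow.expand) (simp add: raw_action raw_idt fst.ident_map)

lemma pa_comp:
  assumes "cd f = dm g"
  shows "pa X (g \<bullet> f) = pa X g \<bullet> pa X f"
proof (cases "X \<in> obj C \<and> valid g \<and> valid f")
  case True
  have "(ident C X \<cdot>\<^bsub>C\<^esub> ident C X) \<unrhd>\<^bsub>a\<^esub> (the (raw g) \<cdot>\<^bsub>A\<^esub> the (raw f)) =
      (ident C X \<unrhd>\<^bsub>a\<^esub> the (raw g)) \<cdot>\<^bsub>A\<^esub> (ident C X \<unrhd>\<^bsub>a\<^esub> the (raw f))"
    using True assms valid_hom[of f] valid_hom[of g]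
    by (intro fst.cmp_map[of X X X "dm f" "cd f" "cd g"] ident_C) auto
  then show ?thesis using True assms by (intro arrow.expand) (simp add: raw_comp raw_action ident_C)
next
  case False
  then have "raw (pa X (g \<bullet> f)) = None" by (auto simp: arr_act_def)
  moreover have "raw (pa X g \<bullet> pa X f) = None"
    using False valid_pa unfolding arr_comp_def[of A "pa X g"] by fastforce
  ultimately show ?thesis by (intro arrow.expand) simp
qed

lemma isom_pa [simp]: "\<lbrakk>isom f; X \<in> obj C\<rbrakk> \<Longrightarrow> isom (pa X f)"
  and rv_pa: "\<lbrakk>isom f; X \<in> obj C\<rbrakk> \<Longrightarrow> rv (pa X f) = pa X (rv f)"
  using rv_unique[of "pa X f" "pa X (rv f)"] by (simp_all flip: pa_comp)

lemma isom_pull [simp]: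
  assumes "X \<in> obj C" "P \<in> obj A" "Q \<in> obj A"
  shows "isom (p1 X P Q)" "isom (p2 X P Q)"
  unfolding arr_pull1_def arr_pull2_def
  using assms c_functor.xi_iso[OF c_functor_fst[of Q], of X P] c_functor.xi_iso[OF c_functor_snd[of P], of X Q]
  by (auto intro!: isom_ar)

lemma valid_pull [simp]:
  assumes "X \<in> obj C" "P \<in> obj A" "Q \<in> obj A"
  shows "valid (p1 X P Q)" "valid (p2 X P Q)"
  using assms by simp_all

text \<open>Joint naturality, assembled from the axioms for one variable at a time:
  \<open>xi_nat\<close> for the first and \<open>l_nat\<close> for the second.\<close>

lemma p1_nat:
  assumes "X \<in> obj C" "valid f" "valid g" "P = cd f" "Q = cd g"
  shows "p1 X P Q \<bullet> (pa X f \<star> g) = pa X (f \<star> g) \<bullet> p1 X (dm f) (dm g)"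
proof -
  have "raw (p1 X P (dm g) \<bullet> (pa X f \<star> idt (dm g))) = raw (pa X (f \<star> idt (dm g)) \<bullet> p1 X (dm f) (dm g))"
    using assms c_functor.xi_nat[OF c_functor_fst[of "dm g"], of X X "dm f" "cd f" "ident C X" "the (raw f)"]
    by (simp add: ident_C valid_hom raw_comp raw_tns raw_action raw_idt)
  then have 1: "p1 X P (dm g) \<bullet> (pa X f \<star> idt (dm g)) = pa X (f \<star> idt (dm g)) \<bullet> p1 X (dm f) (dm g)"
    using assms by (intro arrow.expand) simp
  have "raw (p1 X P Q \<bullet> (idt (X \<triangleright> P) \<star> g)) = raw (pa X (idt P \<star> g) \<bullet> p1 X P (dm g))"
    using assms l_nat[of X P "dm g" Q "the (raw g)"]
    by (simp add: valid_hom raw_comp raw_tns raw_action raw_idt)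
  then have 2: "p1 X P Q \<bullet> (idt (X \<triangleright> P) \<star> g) = pa X (idt P \<star> g) \<bullet> p1 X P (dm g)"
    using assms by (intro arrow.expand) simp
  have "pa X f \<star> g = (idt (X \<triangleright> P) \<star> g) \<bullet> (pa X f \<star> idt (dm g))"
    using assms by (simp add: tns_merge)
  moreover have "pa X (f \<star> g) = pa X (idt P \<star> g) \<bullet> pa X (f \<star> idt (dm g))"
    using assms by (simp add: tns_merge flip: pa_comp)
  ultimately show ?thesis using 1 2[THEN comp_ext] by (simp add: comp_assoc)
qed

lemma p2_nat:
  assumes "X \<in> obj C" "valid f" "valid g" "P = cd f" "Q = cd g"
  shows "p2 X P Q \<bullet> (f \<star> pa X g) = pa X (f \<star> g) \<bullet> p2 X (dm f) (dm g)"
proof -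
  have "raw (p2 X P Q \<bullet> (idt P \<star> pa X g)) = raw (pa X (idt P \<star> g) \<bullet> p2 X P (dm g))"
    using assms c_functor.xi_nat[OF c_functor_snd[of P], of X X "dm g" "cd g" "ident C X" "the (raw g)"]
    by (simp add: ident_C valid_hom raw_comp raw_tns raw_action raw_idt)
  then have 1: "p2 X P Q \<bullet> (idt P \<star> pa X g) = pa X (idt P \<star> g) \<bullet> p2 X P (dm g)"
    using assms by (intro arrow.expand) simp
  have "raw (p2 X P (dm g) \<bullet> (f \<star> idt (X \<triangleright> dm g))) = raw (pa X (f \<star> idt (dm g)) \<bullet> p2 X (dm f) (dm g))"
    using assms r_nat[of X "dm f" P "dm g" "the (raw f)"]
    by (simp add: valid_hom raw_comp raw_tns raw_action raw_idt)
  then have 2: "p2 X P (dm g) \<bullet> (f \<star> idt (X \<triangleright> dm g)) = pa X (f \<star> idt (dm g)) \<bullet> p2 X (dm f) (dm g)"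
    using assms by (intro arrow.expand) simp
  have "f \<star> pa X g = (idt P \<star> pa X g) \<bullet> (f \<star> idt (X \<triangleright> dm g))"
    using assms by (simp add: tns_merge)
  moreover have "pa X (f \<star> g) = pa X (idt P \<star> g) \<bullet> pa X (f \<star> idt (dm g))"
    using assms by (simp add: tns_merge flip: pa_comp)
  ultimately show ?thesis using 1[THEN comp_ext] 2 by (simp add: comp_assoc)
qed

lemma pull_as:
  assumes "X \<in> obj C" "P \<in> obj A" "Q \<in> obj A" "R \<in> obj A"
  shows "p1 X P (Q \<odot> R) \<bullet> as (X \<triangleright> P) Q R = pa X (as P Q R) \<bullet> p1 X (P \<odot> Q) R \<bullet> (p1 X P Q \<star> idt R)"
    and "p2 X P (Q \<odot> R) \<bullet> (idt P \<star> p1 X Q R) \<bullet> as P (X \<triangleright> Q) R =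
      pa X (as P Q R) \<bullet> p1 X (P \<odot> Q) R \<bullet> (p2 X P Q \<star> idt R)"
    and "p2 X P (Q \<odot> R) \<bullet> (idt P \<star> p2 X Q R) \<bullet> as P Q (X \<triangleright> R) = pa X (as P Q R) \<bullet> p2 X (P \<odot> Q) R"
proof -
  have "raw (p1 X P (Q \<odot> R) \<bullet> as (X \<triangleright> P) Q R) = raw ((pa X (as P Q R) \<bullet> p1 X (P \<odot> Q) R) \<bullet> (p1 X P Q \<star> idt R))"
    using assms assoc_fst[OF assms] by (simp add: raw_comp raw_tns raw_action raw_monoidal raw_idt)
  then show "p1 X P (Q \<odot> R) \<bullet> as (X \<triangleright> P) Q R = pa X (as P Q R) \<bullet> p1 X (P \<odot> Q) R \<bullet> (p1 X P Q \<star> idt R)"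
    by (intro arrow.expand) (simp add: comp_assoc)
  have "raw ((p2 X P (Q \<odot> R) \<bullet> (idt P \<star> p1 X Q R)) \<bullet> as P (X \<triangleright> Q) R) =
      raw ((pa X (as P Q R) \<bullet> p1 X (P \<odot> Q) R) \<bullet> (p2 X P Q \<star> idt R))"
    using assms assoc_snd[OF assms] by (simp add: raw_comp raw_tns raw_action raw_monoidal raw_idt)
  then show "p2 X P (Q \<odot> R) \<bullet> (idt P \<star> p1 X Q R) \<bullet> as P (X \<triangleright> Q) R =
      pa X (as P Q R) \<bullet> p1 X (P \<odot> Q) R \<bullet> (p2 X P Q \<star> idt R)"
    by (intro arrow.expand) (simp add: comp_assoc)
  have "raw ((p2 X P (Q \<odot> R) \<bullet> (idt P \<star> p2 X Q R)) \<bullet> as P Q (X \<triangleright> R)) = raw (pa X (as P Q R) \<bullet> p2 X (P \<odot> Q) R)"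
    using assms assoc_thd[OF assms] by (simp add: raw_comp raw_tns raw_action raw_monoidal raw_idt)
  then show "p2 X P (Q \<odot> R) \<bullet> (idt P \<star> p2 X Q R) \<bullet> as P Q (X \<triangleright> R) = pa X (as P Q R) \<bullet> p2 X (P \<odot> Q) R"
    by (intro arrow.expand) (simp add: comp_assoc)
qed

lemma pull_unit:
  assumes "X \<in> obj C" "P \<in> obj A"
  shows "pa X (lu P) \<bullet> p2 X un P = lu (X \<triangleright> P)" "pa X (ru P) \<bullet> p1 X P un = ru (X \<triangleright> P)"
  using assms lunit_c_nat[OF assms] runit_c_nat[OF assms]
  by (auto intro!: arrow.expand simp: raw_comp raw_action raw_monoidal)

end

locale braided_action_calculus =
  action_calculus C MC \<beta> A a M p + braided_calculus A M \<tau> + c_braided_category C MC \<beta> A a M p \<tau>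
  for C :: "('c, 'd) cat" and MC :: "('c, 'd) monoidal" and \<beta> :: "'c \<Rightarrow> 'c \<Rightarrow> 'd"
    and A :: "('o, 'm) cat" and a :: "('c, 'd, 'o, 'm) action"
    and M :: "('o, 'm) monoidal" and p :: "('c, 'o, 'm) pulls" and \<tau> :: "'o \<Rightarrow> 'o \<Rightarrow> 'm"
begin

lemma pull_br:
  assumes "X \<in> obj C" "P \<in> obj A" "Q \<in> obj A"
  shows "p1 X Q P \<bullet> br P (X \<triangleright> Q) = pa X (br P Q) \<bullet> p2 X P Q"
  using assms braid_pull2[OF assms] by (intro arrow.expand) (simp add: raw_comp raw_action raw_br)

text \<open>The interchange never moves its first factor, so \<open>X\<close> may be pulled out of
  that factor before or after it. Naturality of \<open>p1\<close> and its compatibility with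
  associators express this.\<close>

lemma p1_io:
  assumes "X \<in> obj C" "P \<in> obj A" "Q \<in> obj A" "R \<in> obj A" "S \<in> obj A"
  shows "pa X (io P Q R S) \<bullet> p1 X (P \<odot> Q) (R \<odot> S) \<bullet> (p1 X P Q \<star> idt (R \<odot> S)) =
    p1 X (P \<odot> R) (Q \<odot> S) \<bullet> (p1 X P R \<star> idt (Q \<odot> S)) \<bullet> io (X \<triangleright> P) Q R S" (is "?L = ?R")
proof -
  have "pa X (as P R (Q \<odot> S)) \<bullet> ?L =
      pa X (idt P \<star> sw Q R S) \<bullet> pa X (as P Q (R \<odot> S)) \<bullet> p1 X (P \<odot> Q) (R \<odot> S) \<bullet> (p1 X P Q \<star> idt (R \<odot> S))"
    using assms by (simp add: as_io flip: pa_comp comp_assoc)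
  also have "\<dots> = (pa X (idt P \<star> sw Q R S) \<bullet> p1 X P (Q \<odot> R \<odot> S)) \<bullet> as (X \<triangleright> P) Q (R \<odot> S)"
    using assms by (simp add: pull_as comp_assoc)
  also have "\<dots> = p1 X P (R \<odot> Q \<odot> S) \<bullet> as (X \<triangleright> P) R (Q \<odot> S) \<bullet> io (X \<triangleright> P) Q R S"
    using assms p1_nat[of X "idt P" "sw Q R S" P "R \<odot> Q \<odot> S"] by (simp add: as_io flip: comp_assoc)
  also have "\<dots> = pa X (as P R (Q \<odot> S)) \<bullet> ?R"
    using assms by (simp add: pull_as[THEN comp_ext] comp_assoc)
  finally show ?thesis by (rule isom_cancel_left) (use assms in auto)
qed

text \<open>Here two ways of moving \<open>X\<close> must agree: the switch braids \<open>Q\<close>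
  past \<open>X \<triangleright> R\<close>, while \<open>p2\<close> moves \<open>X\<close> past
  \<open>Q\<close> by the structure of the action. By \<open>pull_br\<close> both are the same
  braiding.\<close>

lemma p2_sw:
  assumes "X \<in> obj C" "Q \<in> obj A" "R \<in> obj A" "S \<in> obj A"
  shows "pa X (sw Q R S) \<bullet> p2 X Q (R \<odot> S) \<bullet> (idt Q \<star> p1 X R S) = p1 X R (Q \<odot> S) \<bullet> sw Q (X \<triangleright> R) S"
    (is "?L = ?R")
proof -
  have "?L \<bullet> as Q (X \<triangleright> R) S = (pa X (sw Q R S) \<bullet> pa X (as Q R S)) \<bullet> p1 X (Q \<odot> R) S \<bullet> (p2 X Q R \<star> idt S)"
    using assms by (simp add: pull_as comp_assoc)
  also have "\<dots> = pa X (as R Q S) \<bullet> (pa X (br Q R \<star> idt S) \<bullet> p1 X (Q \<odot> R) S) \<bullet> (p2 X Q R \<star> idt S)"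
    using assms by (simp add: sw_def comp_assoc flip: pa_comp) (simp add: pa_comp comp_assoc)
  also have "pa X (br Q R \<star> idt S) \<bullet> p1 X (Q \<odot> R) S = p1 X (R \<odot> Q) S \<bullet> (pa X (br Q R) \<star> idt S)"
    using assms by (simp add: p1_nat)
  also have "pa X (as R Q S) \<bullet> (p1 X (R \<odot> Q) S \<bullet> (pa X (br Q R) \<star> idt S)) \<bullet> (p2 X Q R \<star> idt S) =
      pa X (as R Q S) \<bullet> p1 X (R \<odot> Q) S \<bullet> ((pa X (br Q R) \<bullet> p2 X Q R) \<star> idt S)"
    using assms by (simp add: whisker_comp comp_assoc)
  also have "\<dots> = (pa X (as R Q S) \<bullet> p1 X (R \<odot> Q) S \<bullet> (p1 X R Q \<star> idt S)) \<bullet> (br Q (X \<triangleright> R) \<star> idt S)"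
    using assms by (simp add: whisker_comp comp_assoc flip: pull_br)
  also have "\<dots> = ?R \<bullet> as Q (X \<triangleright> R) S"
    using assms by (simp add: sw_def comp_assoc flip: pull_as)
  finally show ?thesis by (rule isom_cancel_right) (use assms in auto)
qed

text \<open>Unlike in \<open>p1_io\<close>, the object \<open>X\<close> sits on the third factor and
  has to cross the second one, which is the case treated in \<open>p2_sw\<close>.\<close>

lemma p2_io:
  assumes "X \<in> obj C" "P \<in> obj A" "Q \<in> obj A" "R \<in> obj A" "S \<in> obj A"
  shows "pa X (io P Q R S) \<bullet> p2 X (P \<odot> Q) (R \<odot> S) \<bullet> (idt (P \<odot> Q) \<star> p1 X R S) =
    p1 X (P \<odot> R) (Q \<odot> S) \<bullet> (p2 X P R \<star> idt (Q \<odot> S)) \<bullet> io P Q (X \<triangleright> R) S" (is "?L = ?R")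
proof -
  have "pa X (as P R (Q \<odot> S)) \<bullet> ?L =
      pa X (idt P \<star> sw Q R S) \<bullet> (pa X (as P Q (R \<odot> S)) \<bullet> p2 X (P \<odot> Q) (R \<odot> S)) \<bullet> (idt (P \<odot> Q) \<star> p1 X R S)"
    using assms by (simp add: as_io flip: pa_comp comp_assoc)
  also have "\<dots> = (pa X (idt P \<star> sw Q R S) \<bullet> p2 X P (Q \<odot> R \<odot> S)) \<bullet> (idt P \<star> p2 X Q (R \<odot> S)) \<bullet>
      (idt P \<star> idt Q \<star> p1 X R S) \<bullet> as P Q ((X \<triangleright> R) \<odot> S)"
    using assms by (simp add: as_nat_idt comp_assoc flip: pull_as)
  also have "\<dots> = p2 X P (R \<odot> Q \<odot> S) \<bullet> (idt P \<star> (pa X (sw Q R S) \<bullet> p2 X Q (R \<odot> S) \<bullet> (idt Q \<star> p1 X R S))) \<bullet>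
      as P Q ((X \<triangleright> R) \<odot> S)"
    using assms p2_nat[of X "idt P" "sw Q R S" P "R \<odot> Q \<odot> S", symmetric] by (simp add: whisker_comp comp_assoc)
  also have "\<dots> = p2 X P (R \<odot> Q \<odot> S) \<bullet> (idt P \<star> p1 X R (Q \<odot> S)) \<bullet> as P (X \<triangleright> R) (Q \<odot> S) \<bullet> io P Q (X \<triangleright> R) S"
    using assms by (simp add: p2_sw as_io whisker_comp comp_assoc)
  also have "\<dots> = pa X (as P R (Q \<odot> S)) \<bullet> ?R"
    using assms pull_as(2)[of X P R "Q \<odot> S"] by (simp flip: comp_assoc)
  finally show ?thesis by (rule isom_cancel_left) (use assms in auto)
qed

end

section \<open>The coendomorphism object\<close>

context action_calculus
begin

lemma ar_eq_iff: "\<lbrakk>valid g; dm g = X; cd g = Y\<rbrakk> \<Longrightarrow> ar X f Y = g \<longleftrightarrow> f = the (raw g)"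
  by (cases g) (auto simp: arr_valid_def)

abbreviation coh where "coh \<equiv> cohom A M"
abbreviation ev where "ev P Q \<equiv> ar P (coev A M P Q) (Q \<odot> coh P Q)"
abbreviation coclosed where "coclosed P Q \<equiv> P \<in> obj A \<and> Q \<in> obj A \<and> (\<exists>H v. is_cohom A M P Q H v)"

lemma is_cohom_cohom:
  assumes "coclosed P Q"
  shows "is_cohom A M P Q (coh P Q) (coev A M P Q)"
proof -
  obtain H v where "is_cohom A M P Q H v" using assms by blast
  then have "case (H, v) of (H, v) \<Rightarrow> is_cohom A M P Q H v" by simp
  from someI[of "\<lambda>(H, v). is_cohom A M P Q H v", OF this] show ?thesis
    by (simp add: cohom_def coev_def cohom_pair_def split_beta)
qed

lemma valid_ev [simp]: "coclosed P Q \<Longrightarrow> coh P Q \<in> obj A" "coclosed P Q \<Longrightarrow> coev A M P Q \<in> hom A P (Q \<odot> coh P Q)"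
  using is_cohom_cohom[of P Q] by (simp_all add: is_cohom_def)

lemma is_cohom_factor:
  assumes v: "is_cohom A M P Q H v" and "P \<in> obj A" "Q \<in> obj A" "valid \<phi>" "dm \<phi> = P" "cd \<phi> = Q \<odot> Z" "Z \<in> obj A"
  shows "\<exists>!g. g \<in> hom A H Z \<and> \<phi> = (idt Q \<star> ar H g Z) \<bullet> ar P v (Q \<odot> H)"
proof -
  have "the (raw \<phi>) \<in> hom A P (Q \<odot> Z)" using assms valid_hom by metis
  then have ex1: "\<exists>!g. g \<in> hom A H Z \<and> the (raw \<phi>) = (ident A Q \<boxtimes>\<^bsub>M\<^esub> g) \<cdot>\<^bsub>A\<^esub> v"
    using v \<open>Z \<in> obj A\<close> unfolding is_cohom_def by blast
  have *: "raw \<phi> = Some (the (raw \<phi>))" using assms by simp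
  have "\<phi> = (idt Q \<star> ar H g Z) \<bullet> ar P v (Q \<odot> H) \<longleftrightarrow> the (raw \<phi>) = (ident A Q \<boxtimes>\<^bsub>M\<^esub> g) \<cdot>\<^bsub>A\<^esub> v"
    if "g \<in> hom A H Z" for g
  proof -
    have "raw ((idt Q \<star> ar H g Z) \<bullet> ar P v (Q \<odot> H)) = Some ((ident A Q \<boxtimes>\<^bsub>M\<^esub> g) \<cdot>\<^bsub>A\<^esub> v)"
      using assms that by (simp add: raw_comp raw_tns raw_idt is_cohom_def)
    then show ?thesis using * assms by (metis arrow.expand arrow.sel(1,3) dm_cd(1,2) dm_cd_monoidal(2) dm_cd(4) option.inject)
  qed
  then show ?thesis using ex1 by (metis (no_types, lifting))
qed

lemma ev_unique:
  assumes "(idt Q \<star> g) \<bullet> ev P Q = (idt Q \<star> h) \<bullet> ev P Q" "coclosed P Q" "valid g" "valid h"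
    "dm g = coh P Q" "dm h = coh P Q" "cd g = cd h"
  shows "g = h"
proof -
  have "\<exists>!k. k \<in> hom A (coh P Q) (cd g) \<and> (idt Q \<star> g) \<bullet> ev P Q = (idt Q \<star> ar (coh P Q) k (cd g)) \<bullet> ev P Q"
    by (rule is_cohom_factor[OF is_cohom_cohom]) (use assms in auto)
  moreover have g: "g = ar (coh P Q) (the (raw g)) (cd g)" and h: "h = ar (coh P Q) (the (raw h)) (cd g)"
    using valid_raw[of g] valid_raw[of h] assms by auto
  moreover have "the (raw g) \<in> hom A (coh P Q) (cd g)" "the (raw h) \<in> hom A (coh P Q) (cd g)"
    using valid_hom[of g] valid_hom[of h] assms by auto
  ultimately have "the (raw g) = the (raw h)" using assms(1) by metis
  then show ?thesis using g h by metis
qed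

lemma coact_spec:
  assumes "coclosed P Q" "valid \<phi>" "dm \<phi> = P" "cd \<phi> = Q \<odot> Z" "Z \<in> obj A"
  shows "coact A M P Q Z (the (raw \<phi>)) \<in> hom A (coh P Q) Z"
    and "(idt Q \<star> ar (coh P Q) (coact A M P Q Z (the (raw \<phi>))) Z) \<bullet> ev P Q = \<phi>"
proof -
  have *: "the (raw \<phi>) \<in> hom A P (Q \<odot> Z)" using assms valid_hom by metis
  have "coact A M P Q Z (the (raw \<phi>)) \<in> hom A (coh P Q) Z \<and>
      the (raw \<phi>) = (ident A Q \<boxtimes>\<^bsub>M\<^esub> coact A M P Q Z (the (raw \<phi>))) \<cdot>\<^bsub>A\<^esub> coev A M P Q"
    unfolding coact_def
    by (rule theI') (use is_cohom_cohom[OF assms(1)] assms(5) * in \<open>auto simp: is_cohom_def\<close>)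
  then show "coact A M P Q Z (the (raw \<phi>)) \<in> hom A (coh P Q) Z"
    and "(idt Q \<star> ar (coh P Q) (coact A M P Q Z (the (raw \<phi>))) Z) \<bullet> ev P Q = \<phi>"
  proof -
    assume "coact A M P Q Z (the (raw \<phi>)) \<in> hom A (coh P Q) Z \<and>
      the (raw \<phi>) = (ident A Q \<boxtimes>\<^bsub>M\<^esub> coact A M P Q Z (the (raw \<phi>))) \<cdot>\<^bsub>A\<^esub> coev A M P Q"
    then have h: "coact A M P Q Z (the (raw \<phi>)) \<in> hom A (coh P Q) Z"
      and e: "(ident A Q \<boxtimes>\<^bsub>M\<^esub> coact A M P Q Z (the (raw \<phi>))) \<cdot>\<^bsub>A\<^esub> coev A M P Q = the (raw \<phi>)" by simp_all
    have "raw ((idt Q \<star> ar (coh P Q) (coact A M P Q Z (the (raw \<phi>))) Z) \<bullet> ev P Q) = Some (the (raw \<phi>))"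
      using assms(1,5) h by (simp add: raw_comp raw_tns raw_idt e)
    then show "(idt Q \<star> ar (coh P Q) (coact A M P Q Z (the (raw \<phi>))) Z) \<bullet> ev P Q = \<phi>"
      using assms by (intro arrow.expand) simp
  qed simp
qed

lemma cohom_map_spec:
  assumes "coclosed P Q'" "coclosed P' Q" "f \<in> hom A P P'" "g \<in> hom A Q Q'"
  shows "cohom_map A M P P' Q Q' f g \<in> hom A (coh P Q') (coh P' Q)"
    and "(idt Q' \<star> ar (coh P Q') (cohom_map A M P P' Q Q' f g) (coh P' Q)) \<bullet> ev P Q' =
      (ar Q g Q' \<star> idt (coh P' Q)) \<bullet> ev P' Q \<bullet> ar P f P'"
proof -
  let ?\<phi> = "((ar Q g Q' \<star> idt (coh P' Q)) \<bullet> ev P' Q) \<bullet> ar P f P'"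
  have \<phi>: "the (raw ?\<phi>) = (g \<boxtimes>\<^bsub>M\<^esub> ident A (coh P' Q)) \<cdot>\<^bsub>A\<^esub> coev A M P' Q \<cdot>\<^bsub>A\<^esub> f"
    using assms by (simp add: raw_comp raw_tns raw_idt)
  show "cohom_map A M P P' Q Q' f g \<in> hom A (coh P Q') (coh P' Q)"
    "(idt Q' \<star> ar (coh P Q') (cohom_map A M P P' Q Q' f g) (coh P' Q)) \<bullet> ev P Q' =
      (ar Q g Q' \<star> idt (coh P' Q)) \<bullet> ev P' Q \<bullet> ar P f P'"
    using coact_spec[of P Q' ?\<phi> "coh P' Q"] assms unfolding cohom_map_def \<phi>
    by (simp_all add: comp_assoc)
qed

text \<open>The same object serves again once the coevaluation is composed with
  \<open>k \<star> idt H\<close>. This provides the cohomomorphism object of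
  \<open>FO (X \<rhd> P)\<close> and \<open>X \<rhd> FO P\<close>, whose second argument need not
  belong to \<open>A\<^sub>0\<close>.\<close>

lemma coclosed_iso:
  assumes "coclosed P Q" "isom k" "dm k = Q" "cd k = Q'"
  shows "coclosed P Q'"
proof -
  obtain H v where v: "is_cohom A M P Q H v" using assms by blast
  then have *: "H \<in> obj A" "v \<in> hom A P (Q \<odot> H)" by (auto simp: is_cohom_def)
  let ?v = "(k \<star> idt H) \<bullet> ar P v (Q \<odot> H)"
  have obj: "P \<in> obj A" "Q \<in> obj A" "Q' \<in> obj A" using assms valid_obj[of k] by auto
  have v': "?v = ar P (the (raw ?v)) (Q' \<odot> H)" using valid_raw[of ?v] assms * obj by simp
  have "is_cohom A M P Q' H (the (raw ?v))"
    unfolding is_cohom_def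
  proof (intro conjI ballI)
    show "H \<in> obj A" by fact
    show "the (raw ?v) \<in> hom A P (Q' \<odot> H)" using valid_hom[of ?v] assms * obj by simp
    fix Z \<phi> assume Z: "Z \<in> obj A" and \<phi>: "\<phi> \<in> hom A P (Q' \<odot> Z)"
    have "\<exists>!g. g \<in> hom A H Z \<and> (rv k \<star> idt Z) \<bullet> ar P \<phi> (Q' \<odot> Z) = (idt Q \<star> ar H g Z) \<bullet> ar P v (Q \<odot> H)"
      by (rule is_cohom_factor[OF v]) (use assms * Z \<phi> obj in auto)
    moreover have "(rv k \<star> idt Z) \<bullet> ar P \<phi> (Q' \<odot> Z) = (idt Q \<star> ar H g Z) \<bullet> ar P v (Q \<odot> H) \<longleftrightarrow>
        \<phi> = (ident A Q' \<boxtimes>\<^bsub>M\<^esub> g) \<cdot>\<^bsub>A\<^esub> the (raw ?v)" if g: "g \<in> hom A H Z" for g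
    proof -
      have 1: "(idt Q' \<star> ar H g Z) \<bullet> ?v = (k \<star> idt Z) \<bullet> (idt Q \<star> ar H g Z) \<bullet> ar P v (Q \<odot> H)"
        using assms * Z g obj by (simp add: tns_merge)
      have "(rv k \<star> idt Z) \<bullet> ar P \<phi> (Q' \<odot> Z) = (idt Q \<star> ar H g Z) \<bullet> ar P v (Q \<odot> H) \<longleftrightarrow>
          ar P \<phi> (Q' \<odot> Z) = (k \<star> idt Z) \<bullet> (idt Q \<star> ar H g Z) \<bullet> ar P v (Q \<odot> H)" (is "?l = ?r \<longleftrightarrow> _")
      proof
        assume "?l = ?r"
        from arg_cong[OF this, of "\<lambda>h. (k \<star> idt Z) \<bullet> h"]
        show "ar P \<phi> (Q' \<odot> Z) = (k \<star> idt Z) \<bullet> ?r" using assms * Z g \<phi> obj by simp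
      next
        assume "ar P \<phi> (Q' \<odot> Z) = (k \<star> idt Z) \<bullet> ?r"
        then show "?l = ?r" using assms * Z g \<phi> obj by simp
      qed
      also have "\<dots> \<longleftrightarrow> \<phi> = (ident A Q' \<boxtimes>\<^bsub>M\<^esub> g) \<cdot>\<^bsub>A\<^esub> the (raw ?v)"
        unfolding 1[symmetric] using assms * Z g \<phi> obj
        by (subst ar_eq_iff) (auto simp: raw_comp[of "idt Q' \<star> ar H g Z"] raw_tns[of "idt Q'"] raw_idt)
      finally show ?thesis .
    qed
    ultimately show "\<exists>!g. g \<in> hom A H Z \<and> \<phi> = (ident A Q' \<boxtimes>\<^bsub>M\<^esub> g) \<cdot>\<^bsub>A\<^esub> the (raw ?v)"
      by (simp cong: conj_cong)
  qed
  then show ?thesis using obj by blast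
qed

end

text \<open>\<open>coclosed_F\<close> is what right coclosedness of \<open>A\<^sub>0\<close> gives
  for the values of \<open>F\<close>; with it the coend can be treated entirely inside
  \<open>A\<close>.\<close>

locale coend_calculus =
  action_calculus C MC \<beta> A a M p + F: c_functor C MC B b A a FO FM \<xi>
  for C :: "('c, 'd) cat" and MC :: "('c, 'd) monoidal" and \<beta> :: "'c \<Rightarrow> 'c \<Rightarrow> 'd"
    and A :: "('o, 'm) cat" and a :: "('c, 'd, 'o, 'm) action"
    and M :: "('o, 'm) monoidal" and p :: "('c, 'o, 'm) pulls"
    and B :: "('b, 'n) cat" and b :: "('c, 'd, 'b, 'n) action"
    and FO :: "'b \<Rightarrow> 'o" and FM :: "'n \<Rightarrow> 'm" and \<xi> :: "'c \<Rightarrow> 'b \<Rightarrow> 'm" +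
  assumes coclosed_F: "\<lbrakk>P \<in> obj B; Q \<in> obj B\<rbrakk> \<Longrightarrow> \<exists>H v. is_cohom A M (FO P) (FO Q) H v"
begin

abbreviation bobj (infixr "\<triangleright>\<^sub>B" 75) where "X \<triangleright>\<^sub>B P \<equiv> X \<rhd>\<^bsub>b\<^esub> P"
abbreviation fm where "fm P Q f \<equiv> ar (FO P) (FM f) (FO Q)"
abbreviation xi where "xi X P \<equiv> ar (FO (X \<triangleright>\<^sub>B P)) (\<xi> X P) (X \<triangleright> FO P)"
abbreviation cohF where "cohF P \<equiv> coh (FO P) (FO P)"
abbreviation evF where "evF P \<equiv> ev (FO P) (FO P)"

lemma F_obj [simp]: "P \<in> obj B \<Longrightarrow> FO P \<in> obj A"
  by (rule F.obj_map)

lemma b_obj [simp]: "\<lbrakk>X \<in> obj C; P \<in> obj B\<rbrakk> \<Longrightarrow> X \<triangleright>\<^sub>B P \<in> obj B"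
  by (rule F.src.obj_map)

lemma coclosed_FF: "\<lbrakk>P \<in> obj B; Q \<in> obj B\<rbrakk> \<Longrightarrow> coclosed (FO P) (FO Q)"
  using coclosed_F by simp

lemma cohF_obj [simp]: "P \<in> obj B \<Longrightarrow> cohF P \<in> obj A"
  and coev_hom [simp]: "P \<in> obj B \<Longrightarrow> coev A M (FO P) (FO P) \<in> hom A (FO P) (FO P \<odot> cohF P)"
  using valid_ev[OF coclosed_FF[of P P]] by auto

lemma FM_hom [simp]: "\<lbrakk>f \<in> hom B P Q; P \<in> obj B; Q \<in> obj B\<rbrakk> \<Longrightarrow> FM f \<in> hom A (FO P) (FO Q)"
  by (rule F.hom_map)

lemma isom_xi [simp]: "\<lbrakk>X \<in> obj C; P \<in> obj B\<rbrakk> \<Longrightarrow> isom (xi X P)"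
  by (intro isom_ar F.xi_iso) auto

lemma xi_hom [simp]: "\<lbrakk>X \<in> obj C; P \<in> obj B\<rbrakk> \<Longrightarrow> \<xi> X P \<in> hom A (FO (X \<triangleright>\<^sub>B P)) (X \<triangleright> FO P)"
  using F.xi_iso[of X P] by (auto simp: iso_def inverse_arrows_def)

text \<open>\<open>coend_delta\<close> as a typed arrow, for the components of any family and with
  any value, so that it applies to every candidate cowedge.\<close>

definition delta :: "('b \<Rightarrow> 'm) \<Rightarrow> 'o \<Rightarrow> 'b \<Rightarrow> ('o, 'm) arrow" where
  "delta \<mu> D P = (idt (FO P) \<star> ar (cohF P) (\<mu> P) D) \<bullet> evF P"

text \<open>The C-natural transformations from F to F tensored with \<open>D\<close>. The
  C-structure of the target is that of F followed by \<open>p1\<close>.\<close>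

definition cnat :: "'o \<Rightarrow> ('b \<Rightarrow> ('o, 'm) arrow) \<Rightarrow> bool" where
  "cnat D \<phi> \<longleftrightarrow> D \<in> obj A \<and>
     (\<forall>P\<in>obj B. valid (\<phi> P) \<and> dm (\<phi> P) = FO P \<and> cd (\<phi> P) = FO P \<odot> D) \<and>
     (\<forall>P\<in>obj B. \<forall>Q\<in>obj B. \<forall>f\<in>hom B P Q. \<phi> Q \<bullet> fm P Q f = (fm P Q f \<star> idt D) \<bullet> \<phi> P) \<and>
     (\<forall>X\<in>obj C. \<forall>P\<in>obj B. p1 X (FO P) D \<bullet> (xi X P \<star> idt D) \<bullet> \<phi> (X \<triangleright>\<^sub>B P) = pa X (\<phi> P) \<bullet> xi X P)"

lemma dm_cd_delta [simp]: "dm (delta \<mu> D P) = FO P" "cd (delta \<mu> D P) = FO P \<odot> D"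
  by (simp_all add: delta_def)

lemma valid_delta [simp]: "\<lbrakk>P \<in> obj B; D \<in> obj A; \<mu> P \<in> hom A (cohF P) D\<rbrakk> \<Longrightarrow> valid (delta \<mu> D P)"
  by (simp add: delta_def)

lemma raw_delta:
  "\<lbrakk>P \<in> obj B; D \<in> obj A; \<mu> P \<in> hom A (cohF P) D\<rbrakk> \<Longrightarrow> raw (delta \<mu> D P) = Some (coend_delta A M FO \<mu> P)"
  by (simp add: delta_def coend_delta_def raw_comp raw_tns raw_idt)

text \<open>By universality, arrows out of a cohomomorphism object are compared after composition
  with the coevaluation. The composites are left unmerged so that \<open>cohom_map_spec\<close> and
  \<open>coact_spec\<close> can rewrite the factor next to \<open>ev P Q\<close>.\<close>

lemma comp_eq_iff:
  assumes "\<mu> \<in> hom A K D" "g \<in> hom A H K" "\<nu> \<in> hom A K' D" "h \<in> hom A H K'"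
    "K \<in> obj A" "D \<in> obj A" "K' \<in> obj A" "coclosed P Q" "H = coh P Q"
  shows "\<mu> \<cdot>\<^bsub>A\<^esub> g = \<nu> \<cdot>\<^bsub>A\<^esub> h \<longleftrightarrow>
    (idt Q \<star> ar K \<mu> D) \<bullet> (idt Q \<star> ar H g K) \<bullet> ev P Q = (idt Q \<star> ar K' \<nu> D) \<bullet> (idt Q \<star> ar H h K') \<bullet> ev P Q"
    (is "?l \<longleftrightarrow> ?r")
proof -
  have H: "H \<in> obj A" using assms by simp
  have "?l \<longleftrightarrow> ar K \<mu> D \<bullet> ar H g K = ar K' \<nu> D \<bullet> ar H h K'"
    using assms H by (simp add: comp_ar)
  also have "\<dots> \<longleftrightarrow> (idt Q \<star> (ar K \<mu> D \<bullet> ar H g K)) \<bullet> ev P Q = (idt Q \<star> (ar K' \<nu> D \<bullet> ar H h K')) \<bullet> ev P Q"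
    using ev_unique[of Q "ar K \<mu> D \<bullet> ar H g K" P "ar K' \<nu> D \<bullet> ar H h K'"] assms H by auto
  also have "\<dots> \<longleftrightarrow> ?r"
    using assms H by (simp add: whisker_comp comp_assoc)
  finally show ?thesis .
qed

text \<open>Against the coevaluation of the pair \<open>FO P\<close>, \<open>FO Q\<close>, each
  \<open>cohom_map\<close> leaves just \<open>FM f\<close> on one side of an ordinary coevaluation;
  what remains is the naturality square at \<open>f\<close>.\<close>

lemma cowedge_iff_natural:
  assumes "D \<in> obj A" "\<And>P. P \<in> obj B \<Longrightarrow> \<mu> P \<in> hom A (cohF P) D" "P \<in> obj B" "Q \<in> obj B" "f \<in> hom B P Q"
  shows "\<mu> P \<cdot>\<^bsub>A\<^esub> cohom_map A M (FO P) (FO P) (FO P) (FO Q) (ident A (FO P)) (FM f) =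
        \<mu> Q \<cdot>\<^bsub>A\<^esub> cohom_map A M (FO P) (FO Q) (FO Q) (FO Q) (FM f) (ident A (FO Q)) \<longleftrightarrow>
      delta \<mu> D Q \<bullet> fm P Q f = (fm P Q f \<star> idt D) \<bullet> delta \<mu> D P"
proof -
  have idt: "ar X (ident A X) X = idt X" for X by (simp add: arr_id_def)
  have id: "ident A (FO P) \<in> hom A (FO P) (FO P)" "ident A (FO Q) \<in> hom A (FO Q) (FO Q)"
    using assms by (simp_all add: ident_hom)
  have cc: "coclosed (FO P) (FO Q)" "coclosed (FO P) (FO P)" "coclosed (FO Q) (FO Q)"
    using assms by (simp_all add: coclosed_F)
  have m: "(idt (FO Q) \<star> ar (cohF P) (\<mu> P) D) \<bullet> (fm P Q f \<star> idt (cohF P)) = (fm P Q f \<star> idt D) \<bullet> (idt (FO P) \<star> ar (cohF P) (\<mu> P) D)"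
    using assms by (simp add: tns_merge)
  show ?thesis
    using assms id cc
    by (subst comp_eq_iff[OF assms(2)[OF assms(3)] _ assms(2)[OF assms(4)], of _ "coh (FO P) (FO Q)" _ "FO P" "FO Q"])
      (auto simp: cohom_map_spec idt delta_def comp_assoc m[THEN comp_ext])
qed

text \<open>The same translation for the pair \<open>FO (X \<triangleright>\<^sub>B P)\<close>,
  \<open>X \<triangleright> FO P\<close>. Against its coevaluation, \<open>cowedge_lambda\<close>
  contributes an inverse of \<open>p1\<close>; clearing it leaves C-naturality at \<open>X\<close>
  and \<open>P\<close>.\<close>

lemma c_cowedge_iff_natural:
  assumes "D \<in> obj A" "\<And>P. P \<in> obj B \<Longrightarrow> \<mu> P \<in> hom A (cohF P) D" "X \<in> obj C" "P \<in> obj B"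
  shows "\<mu> (X \<triangleright>\<^sub>B P) \<cdot>\<^bsub>A\<^esub>
          cohom_map A M (FO (X \<triangleright>\<^sub>B P)) (FO (X \<triangleright>\<^sub>B P)) (FO (X \<triangleright>\<^sub>B P)) (X \<triangleright> FO P)
            (ident A (FO (X \<triangleright>\<^sub>B P))) (\<xi> X P) =
        \<mu> P \<cdot>\<^bsub>A\<^esub> cowedge_lambda C A a M p b FO \<xi> X P \<longleftrightarrow>
      p1 X (FO P) D \<bullet> (xi X P \<star> idt D) \<bullet> delta \<mu> D (X \<triangleright>\<^sub>B P) = pa X (delta \<mu> D P) \<bullet> xi X P"
    (is "?l \<longleftrightarrow> ?r")
proof -
  let ?Q = "X \<triangleright>\<^sub>B P"
  have Q: "?Q \<in> obj B" using assms by simp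
  have idt: "ar Y (ident A Y) Y = idt Y" for Y by (simp add: arr_id_def)
  have id: "ident A (FO ?Q) \<in> hom A (FO ?Q) (FO ?Q)" using assms by (simp add: ident_hom)
  have cQ: "coclosed (FO ?Q) (FO ?Q)" using Q by (rule coclosed_FF) fact
  have cc: "coclosed (FO ?Q) (X \<triangleright> FO P)"
    by (rule coclosed_iso[OF cQ, of "xi X P"]) (use assms in auto)
  let ?\<phi> = "(rv (p1 X (FO P) (cohF P)) \<bullet> pa X (evF P)) \<bullet> xi X P"
  have \<phi>: "cowedge_lambda C A a M p b FO \<xi> X P = coact A M (FO ?Q) (X \<triangleright> FO P) (cohF P) (the (raw ?\<phi>))"
    using assms by (simp add: cowedge_lambda_def Let_def raw_comp raw_action raw_rv)
  note l = coact_spec[of "FO ?Q" "X \<triangleright> FO P" ?\<phi> "cohF P", folded \<phi>]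
  have m1: "(idt (X \<triangleright> FO P) \<star> ar (cohF ?Q) (\<mu> ?Q) D) \<bullet> (xi X P \<star> idt (cohF ?Q)) =
      (xi X P \<star> idt D) \<bullet> (idt (FO ?Q) \<star> ar (cohF ?Q) (\<mu> ?Q) D)"
    using assms Q by (simp add: tns_merge)
  have m2: "p1 X (FO P) D \<bullet> (idt (X \<triangleright> FO P) \<star> ar (cohF P) (\<mu> P) D) =
      pa X (idt (FO P) \<star> ar (cohF P) (\<mu> P) D) \<bullet> p1 X (FO P) (cohF P)"
    using assms p1_nat[of X "idt (FO P)" "ar (cohF P) (\<mu> P) D" "FO P" D] by simp
  have "?l \<longleftrightarrow> (xi X P \<star> idt D) \<bullet> delta \<mu> D ?Q =
       (idt (X \<triangleright> FO P) \<star> ar (cohF P) (\<mu> P) D) \<bullet> ?\<phi>"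
    using assms id cc cQ Q l
    by (subst comp_eq_iff[OF assms(2)[OF Q] _ assms(2)[OF assms(4)], of _ "coh (FO ?Q) (X \<triangleright> FO P)" _ "FO ?Q" "X \<triangleright> FO P"])
      (auto simp: cohom_map_spec idt delta_def comp_assoc m1[THEN comp_ext])
  also have "\<dots> \<longleftrightarrow> ?r"
  proof -
    have "p1 X (FO P) D \<bullet> ((idt (X \<triangleright> FO P) \<star> ar (cohF P) (\<mu> P) D) \<bullet> ?\<phi>) = pa X (delta \<mu> D P) \<bullet> xi X P"
      using assms by (simp add: m2[THEN comp_ext] delta_def pa_comp comp_assoc)
    then show ?thesis
      using isom_cancel_left[of "p1 X (FO P) D" "(xi X P \<star> idt D) \<bullet> delta \<mu> D ?Q"
          "(idt (X \<triangleright> FO P) \<star> ar (cohF P) (\<mu> P) D) \<bullet> ?\<phi>"] assms Q by (auto simp: comp_assoc)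
  qed
  finally show ?thesis .
qed

lemma c_cowedge_iff:
  "c_cowedge C A a M p B b FO FM \<xi> D \<mu> \<longleftrightarrow>
     D \<in> obj A \<and> (\<forall>P\<in>obj B. \<mu> P \<in> hom A (cohF P) D) \<and> cnat D (delta \<mu> D)"
  using cowedge_iff_natural[of D \<mu>] c_cowedge_iff_natural[of D \<mu>]
  unfolding c_cowedge_def cowedge_def cnat_def by (auto cong: ball_cong conj_cong)

lemma cnat_delta:
  assumes "cnat D \<phi>"
  obtains \<mu> where "\<And>P. P \<in> obj B \<Longrightarrow> \<mu> P \<in> hom A (cohF P) D" "\<And>P. P \<in> obj B \<Longrightarrow> delta \<mu> D P = \<phi> P"
proof -
  have "\<exists>m. m \<in> hom A (cohF P) D \<and> (idt (FO P) \<star> ar (cohF P) m D) \<bullet> evF P = \<phi> P" if P: "P \<in> obj B" for P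
  proof -
    have "coclosed (FO P) (FO P)" using P by (simp add: coclosed_F)
    from coact_spec[OF this, of "\<phi> P" D] show ?thesis using assms P unfolding cnat_def by blast
  qed
  then show ?thesis using that unfolding delta_def by metis
qed

lemma cnat_cong: "(\<And>P. P \<in> obj B \<Longrightarrow> \<phi> P = \<psi> P) \<Longrightarrow> cnat D \<phi> \<longleftrightarrow> cnat D \<psi>"
  unfolding cnat_def by (simp cong: ball_cong conj_cong)

end

section \<open>Existence of the coend, and operations on natural families\<close>

context coend_calculus
begin

text \<open>
  The category \<open>C\<close> may be large, so the relation at \<open>X\<close> and \<open>P\<close> is indexed by the arrow it
  imposes, of which there is only a small set for given \<open>X \<rhd> P\<close> and \<open>P\<close>.
\<close>

definition c_relation :: "'b \<Rightarrow> 'b \<Rightarrow> 'm \<Rightarrow> bool" where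
  "c_relation Q P t \<longleftrightarrow> t \<in> hom A (cohF Q) (cohF P) \<and>
     (\<exists>X\<in>obj C. Q = X \<triangleright>\<^sub>B P \<and> (idt (FO Q) \<star> ar (cohF Q) t (cohF P)) \<bullet> evF Q =
        (rv (xi X P) \<star> idt (cohF P)) \<bullet> rv (p1 X (FO P) (cohF P)) \<bullet> pa X (evF P) \<bullet> xi X P)"

text \<open>Since \<open>xi X P\<close> is invertible, the C-cowedge condition can be solved for
  \<open>\<mu> (X \<triangleright>\<^sub>B P)\<close>: it must be \<open>\<mu> P\<close> after the
  arrow \<open>t\<close>. The relation therefore starts at
  \<open>cohF (X \<triangleright>\<^sub>B P)\<close>, which is determined by an object of
  \<open>B\<close> alone.\<close>

lemma c_relation_iff:
  assumes "D \<in> obj A" "\<And>P. P \<in> obj B \<Longrightarrow> \<mu> P \<in> hom A (cohF P) D" "X \<in> obj C" "P \<in> obj B"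
    "t \<in> hom A (cohF (X \<triangleright>\<^sub>B P)) (cohF P)"
    "(idt (FO (X \<triangleright>\<^sub>B P)) \<star> ar (cohF (X \<triangleright>\<^sub>B P)) t (cohF P)) \<bullet> evF (X \<triangleright>\<^sub>B P) =
        (rv (xi X P) \<star> idt (cohF P)) \<bullet> rv (p1 X (FO P) (cohF P)) \<bullet> pa X (evF P) \<bullet> xi X P"
  shows "\<mu> (X \<triangleright>\<^sub>B P) \<cdot>\<^bsub>A\<^esub> ident A (cohF (X \<triangleright>\<^sub>B P)) = \<mu> P \<cdot>\<^bsub>A\<^esub> t \<longleftrightarrow>
     p1 X (FO P) D \<bullet> (xi X P \<star> idt D) \<bullet> delta \<mu> D (X \<triangleright>\<^sub>B P) = pa X (delta \<mu> D P) \<bullet> xi X P"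
    (is "?l \<longleftrightarrow> ?r")
proof -
  let ?Q = "X \<triangleright>\<^sub>B P" and ?k = "ar (cohF P) (\<mu> P) D"
  have Q: "?Q \<in> obj B" using assms by simp
  have cQ: "coclosed (FO ?Q) (FO ?Q)" using Q by (rule coclosed_FF) fact
  have idt: "ar Y (ident A Y) Y = idt Y" for Y by (simp add: arr_id_def)
  let ?\<psi> = "(idt (FO ?Q) \<star> ?k) \<bullet> (rv (xi X P) \<star> idt (cohF P)) \<bullet> rv (p1 X (FO P) (cohF P)) \<bullet> pa X (evF P) \<bullet> xi X P"
  have "?l \<longleftrightarrow> delta \<mu> D ?Q = ?\<psi>"
    using assms Q by (subst comp_eq_iff[OF assms(2)[OF Q] _ assms(2)[OF assms(4)], of _ "cohF ?Q" _ "FO ?Q" "FO ?Q"])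
      (auto simp: idt delta_def ident_hom coclosed_F)
  also have "\<dots> \<longleftrightarrow> ?r"
  proof -
    have m1: "(xi X P \<star> idt D) \<bullet> (idt (FO ?Q) \<star> ?k) \<bullet> (rv (xi X P) \<star> idt (cohF P)) = idt (X \<triangleright> FO P) \<star> ?k"
      using assms Q by (simp add: tns_merge)
    have m2: "p1 X (FO P) D \<bullet> (idt (X \<triangleright> FO P) \<star> ?k) = pa X (idt (FO P) \<star> ?k) \<bullet> p1 X (FO P) (cohF P)"
      using assms p1_nat[of X "idt (FO P)" ?k "FO P" D] by simp
    have "p1 X (FO P) D \<bullet> (xi X P \<star> idt D) \<bullet> ?\<psi> =
       p1 X (FO P) D \<bullet> ((xi X P \<star> idt D) \<bullet> (idt (FO ?Q) \<star> ?k) \<bullet> (rv (xi X P) \<star> idt (cohF P))) \<bullet>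
         rv (p1 X (FO P) (cohF P)) \<bullet> pa X (evF P) \<bullet> xi X P"
      by (simp add: comp_assoc)
    also have "\<dots> = pa X (delta \<mu> D P) \<bullet> xi X P"
      unfolding m1 using assms Q by (simp add: m2[THEN comp_ext] delta_def pa_comp comp_assoc)
    finally have *: "(p1 X (FO P) D \<bullet> (xi X P \<star> idt D)) \<bullet> ?\<psi> = pa X (delta \<mu> D P) \<bullet> xi X P"
      by (simp add: comp_assoc)
    show ?thesis
      using isom_cancel_left[of "p1 X (FO P) D \<bullet> (xi X P \<star> idt D)" "delta \<mu> D ?Q" ?\<psi>] * assms Q
      by (auto simp: comp_assoc)
  qed
  finally show ?thesis .
qed

lemma coend_exists:
  fixes U :: "'u itself"
  assumes U: "universe U" and B: "small U (obj B)" and ls: "locally_small U A" and cc: "cocomplete U A"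
  shows "\<exists>E i. c_coend C A a M p B b FO FM \<xi> E i"
proof -
  \<comment> \<open>Indexed by the image \<open>FM f\<close> and not by \<open>f\<close>: smallness
    is assumed only for the objects of \<open>B\<close>, whereas the images lie in hom sets of
    \<open>A\<close>, which are small.\<close>
  define R1 where "R1 = (SIGMA P:obj B. SIGMA Q:obj B. {k. \<exists>f\<in>hom B P Q. k = FM f})"
  define R2 where "R2 = (SIGMA Q:obj B. SIGMA P:obj B. {t. c_relation Q P t})"
  \<comment> \<open>A naturality relation compares two arrows out of
    \<open>coh (FO P) (FO Q)\<close>; a relation of the second kind starts at \<open>cohF Q\<close>
    and compares the identity with \<open>t\<close>.\<close>
  define K where "K = case_sum (\<lambda>(P, Q, k :: 'm). coh (FO P) (FO Q)) (\<lambda>(Q, P :: 'b, t :: 'm). cohF Q)"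
  define src where "src = case_sum (\<lambda>(P :: 'b, Q :: 'b, k :: 'm). P) (\<lambda>(Q :: 'b, P :: 'b, t :: 'm). Q :: 'b)"
  define tgt where "tgt = case_sum (\<lambda>(P :: 'b, Q :: 'b, k :: 'm). Q) (\<lambda>(Q :: 'b, P :: 'b, t :: 'm). P :: 'b)"
  define g where "g = case_sum (\<lambda>(P, Q, k). cohom_map A M (FO P) (FO P) (FO P) (FO Q) (ident A (FO P)) k)
     (\<lambda>(Q, P :: 'b, t :: 'm). ident A (cohF Q))"
  define h where "h = case_sum (\<lambda>(P, Q, k). cohom_map A M (FO P) (FO Q) (FO Q) (FO Q) k (ident A (FO Q)))
     (\<lambda>(Q :: 'b, P :: 'b, t :: 'm). t)"
  have "category A" by (rule category_axioms)
  have hom: "small U (hom A X Y)" if "X \<in> obj A" "Y \<in> obj A" for X Y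
    using ls that by (simp add: locally_small_def)
  have "small U R1" unfolding R1_def
  proof (intro small_Sigma[OF U] B)
    fix P Q assume "P \<in> obj B" "Q \<in> obj B"
    then show "small U {k. \<exists>f\<in>hom B P Q. k = FM f}"
      by (intro small_subset[OF hom[of "FO P" "FO Q"]]) auto
  qed
  moreover have "small U R2" unfolding R2_def
  proof (intro small_Sigma[OF U] B)
    fix Q P assume "Q \<in> obj B" "P \<in> obj B"
    then show "small U {t. c_relation Q P t}"
      by (intro small_subset[OF hom[of "cohF Q" "cohF P"]]) (auto simp: c_relation_def)
  qed
  ultimately have R: "small U (R1 <+> R2)" by (rule small_Plus[OF U])
  have rel: "K r \<in> obj A \<and> src r \<in> obj B \<and> tgt r \<in> obj B \<and>
      g r \<in> hom A (K r) (cohF (src r)) \<and> h r \<in> hom A (K r) (cohF (tgt r))" if "r \<in> R1 <+> R2" for r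
    using that
  proof
    fix z assume z: "z \<in> R1" "r = Inl z"
    then obtain P Q f where *: "z = (P, Q, FM f)" "P \<in> obj B" "Q \<in> obj B" "f \<in> hom B P Q"
      by (auto simp: R1_def)
    show ?thesis
      using * coclosed_FF[OF *(2,3)] coclosed_FF[OF *(2,2)] coclosed_FF[OF *(3,3)]
      by (simp add: z K_def src_def tgt_def g_def h_def cohom_map_spec ident_hom)
  next
    fix z assume z: "z \<in> R2" "r = Inr z"
    then obtain Q P t where "z = (Q, P, t)" "P \<in> obj B" "Q \<in> obj B" "c_relation Q P t"
      by (auto simp: R2_def)
    then show ?thesis
      by (simp add: z K_def src_def tgt_def g_def h_def c_relation_def ident_hom)
  qed
  let ?W = "\<lambda>d \<mu>. d \<in> obj A \<and> (\<forall>P\<in>obj B. \<mu> P \<in> hom A (cohF P) d) \<and>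
      (\<forall>r\<in>R1 <+> R2. \<mu> (src r) \<cdot>\<^bsub>A\<^esub> g r = \<mu> (tgt r) \<cdot>\<^bsub>A\<^esub> h r)"
  have W: "?W d \<mu> \<longleftrightarrow> c_cowedge C A a M p B b FO FM \<xi> d \<mu>" for d \<mu>
  proof (cases "d \<in> obj A \<and> (\<forall>P\<in>obj B. \<mu> P \<in> hom A (cohF P) d)")
    case True
    then have d: "d \<in> obj A" and \<mu>: "\<And>P. P \<in> obj B \<Longrightarrow> \<mu> P \<in> hom A (cohF P) d" by auto
    have "(\<forall>r\<in>R1 <+> R2. \<mu> (src r) \<cdot>\<^bsub>A\<^esub> g r = \<mu> (tgt r) \<cdot>\<^bsub>A\<^esub> h r) \<longleftrightarrow>
       (\<forall>z\<in>R1. \<mu> (src (Inl z)) \<cdot>\<^bsub>A\<^esub> g (Inl z) = \<mu> (tgt (Inl z)) \<cdot>\<^bsub>A\<^esub> h (Inl z)) \<and>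
       (\<forall>z\<in>R2. \<mu> (src (Inr z)) \<cdot>\<^bsub>A\<^esub> g (Inr z) = \<mu> (tgt (Inr z)) \<cdot>\<^bsub>A\<^esub> h (Inr z))"
      by (auto simp: Plus_def)
    also have "(\<forall>z\<in>R1. \<mu> (src (Inl z)) \<cdot>\<^bsub>A\<^esub> g (Inl z) = \<mu> (tgt (Inl z)) \<cdot>\<^bsub>A\<^esub> h (Inl z)) \<longleftrightarrow>
       (\<forall>P\<in>obj B. \<forall>Q\<in>obj B. \<forall>f\<in>hom B P Q. delta \<mu> d Q \<bullet> fm P Q f = (fm P Q f \<star> idt d) \<bullet> delta \<mu> d P)" (is "_ \<longleftrightarrow> ?n")
    proof -
      have "(\<forall>z\<in>R1. \<mu> (src (Inl z)) \<cdot>\<^bsub>A\<^esub> g (Inl z) = \<mu> (tgt (Inl z)) \<cdot>\<^bsub>A\<^esub> h (Inl z)) \<longleftrightarrow>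
        (\<forall>P\<in>obj B. \<forall>Q\<in>obj B. \<forall>f\<in>hom B P Q.
          \<mu> P \<cdot>\<^bsub>A\<^esub> cohom_map A M (FO P) (FO P) (FO P) (FO Q) (ident A (FO P)) (FM f) =
          \<mu> Q \<cdot>\<^bsub>A\<^esub> cohom_map A M (FO P) (FO Q) (FO Q) (FO Q) (FM f) (ident A (FO Q)))"
        unfolding R1_def src_def tgt_def g_def h_def by auto
      then show ?thesis using cowedge_iff_natural[of d \<mu>, OF d \<mu>] by (simp cong: ball_cong)
    qed
    also have "(\<forall>z\<in>R2. \<mu> (src (Inr z)) \<cdot>\<^bsub>A\<^esub> g (Inr z) = \<mu> (tgt (Inr z)) \<cdot>\<^bsub>A\<^esub> h (Inr z)) \<longleftrightarrow>
       (\<forall>X\<in>obj C. \<forall>P\<in>obj B. p1 X (FO P) d \<bullet> (xi X P \<star> idt d) \<bullet> delta \<mu> d (X \<triangleright>\<^sub>B P) = pa X (delta \<mu> d P) \<bullet> xi X P)"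
    proof safe
      fix X P assume *: "\<forall>z\<in>R2. \<mu> (src (Inr z)) \<cdot>\<^bsub>A\<^esub> g (Inr z) = \<mu> (tgt (Inr z)) \<cdot>\<^bsub>A\<^esub> h (Inr z)"
        and X: "X \<in> obj C" "P \<in> obj B"
      let ?\<phi> = "(rv (xi X P) \<star> idt (cohF P)) \<bullet> rv (p1 X (FO P) (cohF P)) \<bullet> pa X (evF P) \<bullet> xi X P"
      have "coclosed (FO (X \<triangleright>\<^sub>B P)) (FO (X \<triangleright>\<^sub>B P))" using X by (intro coclosed_FF) auto
      from coact_spec[OF this, of ?\<phi> "cohF P"] obtain t where t: "t \<in> hom A (cohF (X \<triangleright>\<^sub>B P)) (cohF P)"
        "(idt (FO (X \<triangleright>\<^sub>B P)) \<star> ar (cohF (X \<triangleright>\<^sub>B P)) t (cohF P)) \<bullet> evF (X \<triangleright>\<^sub>B P) = ?\<phi>"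
        using X by auto
      \<comment> \<open>So every pair \<open>X\<close>, \<open>P\<close> is represented in
        \<open>R2\<close>, although \<open>X\<close> is not part of the index.\<close>
      then have "(X \<triangleright>\<^sub>B P, P, t) \<in> R2" using X by (auto simp: R2_def c_relation_def)
      then have "\<mu> (X \<triangleright>\<^sub>B P) \<cdot>\<^bsub>A\<^esub> ident A (cohF (X \<triangleright>\<^sub>B P)) = \<mu> P \<cdot>\<^bsub>A\<^esub> t"
        using *[rule_format, of "(X \<triangleright>\<^sub>B P, P, t)"] by (simp add: src_def tgt_def g_def h_def)
      then show "p1 X (FO P) d \<bullet> (xi X P \<star> idt d) \<bullet> delta \<mu> d (X \<triangleright>\<^sub>B P) = pa X (delta \<mu> d P) \<bullet> xi X P"
        using c_relation_iff[OF d \<mu> X t] by simp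
    next
      fix Q P t
      assume *: "\<forall>X\<in>obj C. \<forall>P\<in>obj B. p1 X (FO P) d \<bullet> (xi X P \<star> idt d) \<bullet> delta \<mu> d (X \<triangleright>\<^sub>B P) = pa X (delta \<mu> d P) \<bullet> xi X P"
        and "(Q, P, t) \<in> R2"
      \<comment> \<open>The same index may come from several objects of \<open>C\<close>; any one of
        them yields the equation.\<close>
      then obtain X where X: "X \<in> obj C" "P \<in> obj B" "Q = X \<triangleright>\<^sub>B P" "t \<in> hom A (cohF Q) (cohF P)"
        "(idt (FO Q) \<star> ar (cohF Q) t (cohF P)) \<bullet> evF Q =
        (rv (xi X P) \<star> idt (cohF P)) \<bullet> rv (p1 X (FO P) (cohF P)) \<bullet> pa X (evF P) \<bullet> xi X P"
        by (auto simp: R2_def c_relation_def)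
      then show "\<mu> (src (Inr (Q, P, t))) \<cdot>\<^bsub>A\<^esub> g (Inr (Q, P, t)) = \<mu> (tgt (Inr (Q, P, t))) \<cdot>\<^bsub>A\<^esub> h (Inr (Q, P, t))"
        using c_relation_iff[OF d \<mu> X(1,2), of t] * by (simp add: src_def tgt_def g_def h_def)
    qed
    finally show ?thesis using True d \<mu> unfolding c_cowedge_iff cnat_def by simp
  next
    case False
    then show ?thesis unfolding c_cowedge_iff by blast
  qed
  have "\<exists>c \<iota>. ?W c \<iota> \<and> (\<forall>d \<mu>. ?W d \<mu> \<longrightarrow> (\<exists>!k. k \<in> hom A c d \<and> (\<forall>P\<in>obj B. k \<cdot>\<^bsub>A\<^esub> \<iota> P = \<mu> P)))"
    by (rule cocomplete_presentation[OF U \<open>category A\<close> cc B R _ rel]) auto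
  then show ?thesis unfolding W c_coend_def by blast
qed

text \<open>Arrows act on natural families by composition. Applied to the universal family, this
  gives the family whose two factorizations are compared in \<open>de_unique\<close>.\<close>

lemma cnat_postcomp:
  assumes "cnat D \<phi>" "valid h" "dm h = D"
  shows "cnat (cd h) (\<lambda>P. (idt (FO P) \<star> h) \<bullet> \<phi> P)"
proof -
  have D: "D \<in> obj A" and \<phi>: "\<And>P. P \<in> obj B \<Longrightarrow> valid (\<phi> P)" "\<And>P. P \<in> obj B \<Longrightarrow> dm (\<phi> P) = FO P"
    "\<And>P. P \<in> obj B \<Longrightarrow> cd (\<phi> P) = FO P \<odot> D"
    and nat: "\<And>P Q f. P \<in> obj B \<Longrightarrow> Q \<in> obj B \<Longrightarrow> f \<in> hom B P Q \<Longrightarrow> \<phi> Q \<bullet> fm P Q f = (fm P Q f \<star> idt D) \<bullet> \<phi> P"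
    and act: "\<And>X P. X \<in> obj C \<Longrightarrow> P \<in> obj B \<Longrightarrow>
      p1 X (FO P) D \<bullet> (xi X P \<star> idt D) \<bullet> \<phi> (X \<triangleright>\<^sub>B P) = pa X (\<phi> P) \<bullet> xi X P"
    using assms(1) by (auto simp: cnat_def)
  show ?thesis
    unfolding cnat_def
  proof (intro conjI ballI)
    fix P Q f assume *: "P \<in> obj B" "Q \<in> obj B" "f \<in> hom B P Q"
    have "(idt (FO Q) \<star> h) \<bullet> (fm P Q f \<star> idt D) = (fm P Q f \<star> idt (cd h)) \<bullet> (idt (FO P) \<star> h)"
      using * assms by (simp add: tns_merge)
    from comp_ext[OF this]
    show "((idt (FO Q) \<star> h) \<bullet> \<phi> Q) \<bullet> fm P Q f = (fm P Q f \<star> idt (cd h)) \<bullet> ((idt (FO P) \<star> h) \<bullet> \<phi> P)"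
      by (simp add: nat[OF *] comp_assoc)
  next
    fix X P assume *: "X \<in> obj C" "P \<in> obj B"
    have 1: "(xi X P \<star> idt (cd h)) \<bullet> (idt (FO (X \<triangleright>\<^sub>B P)) \<star> h) = (idt (X \<triangleright> FO P) \<star> h) \<bullet> (xi X P \<star> idt D)"
      using * assms by (simp add: tns_merge)
    have 2: "p1 X (FO P) (cd h) \<bullet> (idt (X \<triangleright> FO P) \<star> h) = pa X (idt (FO P) \<star> h) \<bullet> p1 X (FO P) D"
      using * assms p1_nat[of X "idt (FO P)" h] by simp
    show "p1 X (FO P) (cd h) \<bullet> (xi X P \<star> idt (cd h)) \<bullet> (idt (FO (X \<triangleright>\<^sub>B P)) \<star> h) \<bullet> \<phi> (X \<triangleright>\<^sub>B P) =
        pa X ((idt (FO P) \<star> h) \<bullet> \<phi> P) \<bullet> xi X P"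
      using * assms \<phi> by (simp add: 1[THEN comp_ext] 2[THEN comp_ext] act pa_comp comp_assoc)
  qed (use assms D \<phi> in auto)
qed

text \<open>Coefficient objects accumulate when families are composed. With both families universal
  this is the iterated coaction, whose factorization is the comultiplication.\<close>

lemma cnat_comp:
  assumes "cnat D \<phi>" "cnat D' \<psi>"
  shows "cnat (D \<odot> D') (\<lambda>P. as (FO P) D D' \<bullet> (\<phi> P \<star> idt D') \<bullet> \<psi> P)"
proof -
  have D: "D \<in> obj A" "D' \<in> obj A"
    and \<phi>: "\<And>P. P \<in> obj B \<Longrightarrow> valid (\<phi> P)" "\<And>P. P \<in> obj B \<Longrightarrow> dm (\<phi> P) = FO P" "\<And>P. P \<in> obj B \<Longrightarrow> cd (\<phi> P) = FO P \<odot> D"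
      "\<And>P. P \<in> obj B \<Longrightarrow> valid (\<psi> P)" "\<And>P. P \<in> obj B \<Longrightarrow> dm (\<psi> P) = FO P" "\<And>P. P \<in> obj B \<Longrightarrow> cd (\<psi> P) = FO P \<odot> D'"
    and nat: "\<And>P Q f. P \<in> obj B \<Longrightarrow> Q \<in> obj B \<Longrightarrow> f \<in> hom B P Q \<Longrightarrow> \<phi> Q \<bullet> fm P Q f = (fm P Q f \<star> idt D) \<bullet> \<phi> P"
      "\<And>P Q f. P \<in> obj B \<Longrightarrow> Q \<in> obj B \<Longrightarrow> f \<in> hom B P Q \<Longrightarrow> \<psi> Q \<bullet> fm P Q f = (fm P Q f \<star> idt D') \<bullet> \<psi> P"
    and act: "\<And>X P. X \<in> obj C \<Longrightarrow> P \<in> obj B \<Longrightarrow>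
      p1 X (FO P) D \<bullet> (xi X P \<star> idt D) \<bullet> \<phi> (X \<triangleright>\<^sub>B P) = pa X (\<phi> P) \<bullet> xi X P"
      "\<And>X P. X \<in> obj C \<Longrightarrow> P \<in> obj B \<Longrightarrow>
      p1 X (FO P) D' \<bullet> (xi X P \<star> idt D') \<bullet> \<psi> (X \<triangleright>\<^sub>B P) = pa X (\<psi> P) \<bullet> xi X P"
    using assms by (auto simp: cnat_def)
  show ?thesis
    unfolding cnat_def
  proof (intro conjI ballI)
    fix P Q f assume *: "P \<in> obj B" "Q \<in> obj B" "f \<in> hom B P Q"
    have 1: "(\<phi> Q \<star> idt D') \<bullet> (fm P Q f \<star> idt D') = ((fm P Q f \<star> idt D) \<star> idt D') \<bullet> (\<phi> P \<star> idt D')"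
      using * D \<phi> nat by (simp flip: whisker_comp)
    show "(as (FO Q) D D' \<bullet> (\<phi> Q \<star> idt D') \<bullet> \<psi> Q) \<bullet> fm P Q f =
       (fm P Q f \<star> idt (D \<odot> D')) \<bullet> as (FO P) D D' \<bullet> (\<phi> P \<star> idt D') \<bullet> \<psi> P"
      using * D \<phi> by (simp add: nat 1[THEN comp_ext] as_nat_idt[THEN comp_ext] comp_assoc)
  next
    fix X P assume *: "X \<in> obj C" "P \<in> obj B"
    let ?Q = "X \<triangleright>\<^sub>B P"
    have "p1 X (FO P) (D \<odot> D') \<bullet> (xi X P \<star> idt (D \<odot> D')) \<bullet> as (FO ?Q) D D' \<bullet> (\<phi> ?Q \<star> idt D') \<bullet> \<psi> ?Q =
      (p1 X (FO P) (D \<odot> D') \<bullet> as (X \<triangleright> FO P) D D') \<bullet> ((xi X P \<star> idt D) \<star> idt D') \<bullet> (\<phi> ?Q \<star> idt D') \<bullet> \<psi> ?Q"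
      using * D \<phi> as_nat_idt(2)[of "xi X P" D D' "X \<triangleright> FO P", symmetric, THEN comp_ext] by (simp add: comp_assoc)
    also have "\<dots> = pa X (as (FO P) D D') \<bullet> p1 X (FO P \<odot> D) D' \<bullet>
      ((p1 X (FO P) D \<bullet> (xi X P \<star> idt D) \<bullet> \<phi> ?Q) \<star> idt D') \<bullet> \<psi> ?Q"
      using * D \<phi> by (simp add: pull_as whisker_comp comp_assoc)
    also have "\<dots> = pa X (as (FO P) D D') \<bullet> (p1 X (FO P \<odot> D) D' \<bullet> (pa X (\<phi> P) \<star> idt D')) \<bullet> (xi X P \<star> idt D') \<bullet> \<psi> ?Q"
      using * D \<phi> by (simp add: act whisker_comp comp_assoc)
    also have "p1 X (FO P \<odot> D) D' \<bullet> (pa X (\<phi> P) \<star> idt D') = pa X (\<phi> P \<star> idt D') \<bullet> p1 X (FO P) D'"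
      using * D \<phi> by (simp add: p1_nat)
    finally show "p1 X (FO P) (D \<odot> D') \<bullet> (xi X P \<star> idt (D \<odot> D')) \<bullet> as (FO ?Q) D D' \<bullet> (\<phi> ?Q \<star> idt D') \<bullet> \<psi> ?Q =
       pa X (as (FO P) D D' \<bullet> (\<phi> P \<star> idt D') \<bullet> \<psi> P) \<bullet> xi X P"
      using * D \<phi> act by (simp add: pa_comp comp_assoc)
  qed (use D \<phi> in auto)
qed

text \<open>The trivial coaction; its factorization through the universal one is the counit.\<close>

lemma cnat_unit: "cnat un (\<lambda>P. rv (ru (FO P)))"
  unfolding cnat_def
proof (intro conjI ballI)
  fix P Q f assume *: "P \<in> obj B" "Q \<in> obj B" "f \<in> hom B P Q"
  then show "rv (ru (FO Q)) \<bullet> fm P Q f = (fm P Q f \<star> idt un) \<bullet> rv (ru (FO P))"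
    using ru_nat[of "fm P Q f" "FO Q"] by (intro rv_square) auto
next
  fix X P assume *: "X \<in> obj C" "P \<in> obj B"
  have "(xi X P \<star> idt un) \<bullet> rv (ru (FO (X \<triangleright>\<^sub>B P))) = rv (ru (X \<triangleright> FO P)) \<bullet> xi X P"
    using * ru_nat[of "xi X P" "X \<triangleright> FO P"] by (intro rv_square[symmetric]) auto
  moreover have "rv (ru (X \<triangleright> FO P)) = rv (p1 X (FO P) un) \<bullet> pa X (rv (ru (FO P)))"
    using * by (simp add: rv_comp rv_pa flip: pull_unit(2))
  ultimately show "p1 X (FO P) un \<bullet> (xi X P \<star> idt un) \<bullet> rv (ru (FO (X \<triangleright>\<^sub>B P))) = pa X (rv (ru (FO P))) \<bullet> xi X P"
    using * by (simp add: comp_assoc)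
qed auto

end

section \<open>Coalgebras and comodules\<close>

context monoidal_calculus
begin

lemma coalgebraI:
  assumes "E \<in> obj A" "\<Delta> \<in> hom A E (E \<odot> E)" "\<epsilon> \<in> hom A E un"
    and "as E E E \<bullet> (ar E \<Delta> (E \<odot> E) \<star> idt E) \<bullet> ar E \<Delta> (E \<odot> E) = (idt E \<star> ar E \<Delta> (E \<odot> E)) \<bullet> ar E \<Delta> (E \<odot> E)"
    and "lu E \<bullet> (ar E \<epsilon> un \<star> idt E) \<bullet> ar E \<Delta> (E \<odot> E) = idt E"
    and "ru E \<bullet> (idt E \<star> ar E \<epsilon> un) \<bullet> ar E \<Delta> (E \<odot> E) = idt E"
  shows "coalgebra A M E \<Delta> \<epsilon>"
proof -
  let ?D = "ar E \<Delta> (E \<odot> E)" and ?e = "ar E \<epsilon> un"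
  have "raw ((as E E E \<bullet> (?D \<star> idt E)) \<bullet> ?D) = raw ((idt E \<star> ?D) \<bullet> ?D)"
    "raw ((lu E \<bullet> (?e \<star> idt E)) \<bullet> ?D) = raw (idt E)" "raw ((ru E \<bullet> (idt E \<star> ?e)) \<bullet> ?D) = raw (idt E)"
    using assms by (simp_all add: comp_assoc)
  then show ?thesis using assms(1-3)
    by (simp add: coalgebra_def raw_comp raw_tns raw_monoidal raw_idt)
qed

lemma comodule_iff:
  assumes "E \<in> obj A" "\<Delta> \<in> hom A E (E \<odot> E)" "\<epsilon> \<in> hom A E un"
  shows "comodule A M E \<Delta> \<epsilon> P \<rho> \<longleftrightarrow> P \<in> obj A \<and> \<rho> \<in> hom A P (P \<odot> E) \<and>
    as P E E \<bullet> (ar P \<rho> (P \<odot> E) \<star> idt E) \<bullet> ar P \<rho> (P \<odot> E) = (idt P \<star> ar E \<Delta> (E \<odot> E)) \<bullet> ar P \<rho> (P \<odot> E) \<and>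
    ru P \<bullet> (idt P \<star> ar E \<epsilon> un) \<bullet> ar P \<rho> (P \<odot> E) = idt P"
proof (cases "P \<in> obj A \<and> \<rho> \<in> hom A P (P \<odot> E)")
  case True
  let ?D = "ar E \<Delta> (E \<odot> E)" and ?e = "ar E \<epsilon> un" and ?r = "ar P \<rho> (P \<odot> E)"
  have "as P E E \<bullet> (?r \<star> idt E) \<bullet> ?r = (idt P \<star> ?D) \<bullet> ?r \<longleftrightarrow>
      raw ((as P E E \<bullet> (?r \<star> idt E)) \<bullet> ?r) = raw ((idt P \<star> ?D) \<bullet> ?r)"
    "ru P \<bullet> (idt P \<star> ?e) \<bullet> ?r = idt P \<longleftrightarrow> raw ((ru P \<bullet> (idt P \<star> ?e)) \<bullet> ?r) = raw (idt P)"
    by (auto intro!: arrow.expand simp: comp_assoc)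
  then show ?thesis using True assms
    by (simp add: comodule_def raw_comp raw_tns raw_monoidal raw_idt)
qed (auto simp: comodule_def)

lemma comodule_hom_iff:
  assumes "E \<in> obj A" "P \<in> obj A" "Q \<in> obj A" "\<rho> \<in> hom A P (P \<odot> E)" "\<sigma> \<in> hom A Q (Q \<odot> E)" "f \<in> hom A P Q"
  shows "\<sigma> \<cdot>\<^bsub>A\<^esub> f = (f \<boxtimes>\<^bsub>M\<^esub> ident A E) \<cdot>\<^bsub>A\<^esub> \<rho> \<longleftrightarrow>
    ar Q \<sigma> (Q \<odot> E) \<bullet> ar P f Q = (ar P f Q \<star> idt E) \<bullet> ar P \<rho> (P \<odot> E)"
proof -
  have "ar Q \<sigma> (Q \<odot> E) \<bullet> ar P f Q = (ar P f Q \<star> idt E) \<bullet> ar P \<rho> (P \<odot> E) \<longleftrightarrow>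
    raw (ar Q \<sigma> (Q \<odot> E) \<bullet> ar P f Q) = raw ((ar P f Q \<star> idt E) \<bullet> ar P \<rho> (P \<odot> E))"
    by (auto intro!: arrow.expand)
  then show ?thesis using assms by (simp add: raw_comp raw_tns raw_idt)
qed

end

locale comodules = monoidal_calculus A M
  for A :: "('o, 'm) cat" and M :: "('o, 'm) monoidal" +
  fixes A\<^sub>0 :: "('o, 'm) cat" and E :: 'o and \<Delta> \<epsilon> :: 'm
  assumes sub: "subcategory A\<^sub>0 A"
    and E_obj [simp]: "E \<in> obj A" and Delta_hom [simp]: "\<Delta> \<in> hom A E (E \<odot> E)" and eps_hom [simp]: "\<epsilon> \<in> hom A E un"
begin

abbreviation K where "K \<equiv> Comod A M A\<^sub>0 E \<Delta> \<epsilon>"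
abbreviation dl where "dl \<equiv> ar E \<Delta> (E \<odot> E)"
abbreviation ep where "ep \<equiv> ar E \<epsilon> un"
abbreviation co where "co P \<rho> \<equiv> ar P \<rho> (P \<odot> E)"

lemma sub_category: "category A\<^sub>0"
  and sub_obj [simp]: "P \<in> obj A\<^sub>0 \<Longrightarrow> P \<in> obj A"
  and sub_ident: "P \<in> obj A\<^sub>0 \<Longrightarrow> ident A\<^sub>0 P = ident A P"
  and sub_hom: "\<lbrakk>f \<in> hom A\<^sub>0 P Q; P \<in> obj A\<^sub>0; Q \<in> obj A\<^sub>0\<rbrakk> \<Longrightarrow> f \<in> hom A P Q"
  and sub_cmp: "\<lbrakk>P \<in> obj A\<^sub>0; Q \<in> obj A\<^sub>0; R \<in> obj A\<^sub>0; f \<in> hom A\<^sub>0 P Q; g \<in> hom A\<^sub>0 Q R\<rbrakk> \<Longrightarrow> g \<cdot>\<^bsub>A\<^sub>0\<^esub> f = g \<cdot>\<^bsub>A\<^esub> f"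
  using sub unfolding subcategory_def by blast+

lemma K_obj: "(P, \<rho>) \<in> obj K \<longleftrightarrow> P \<in> obj A\<^sub>0 \<and> comodule A M E \<Delta> \<epsilon> P \<rho>"
  by (simp add: Comod_def)

lemma K_hom:
  assumes "(P, \<rho>) \<in> obj K" "(Q, \<sigma>) \<in> obj K"
  shows "f \<in> hom K (P, \<rho>) (Q, \<sigma>) \<longleftrightarrow>
    f \<in> hom A\<^sub>0 P Q \<and> co Q \<sigma> \<bullet> ar P f Q = (ar P f Q \<star> idt E) \<bullet> co P \<rho>"
  using assms comodule_hom_iff[of E P Q \<rho> \<sigma> f]
  by (auto simp: Comod_def comodule_def intro: sub_hom)

lemma K_ident [simp]: "ident K (P, \<rho>) = ident A\<^sub>0 P" and K_cmp [simp]: "cmp K = cmp A\<^sub>0"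
  by (simp_all add: Comod_def)

lemma K_objD:
  assumes "Z \<in> obj K"
  shows "fst Z \<in> obj A\<^sub>0" "fst Z \<in> obj A" "snd Z \<in> hom A (fst Z) (fst Z \<odot> E)"
    "as (fst Z) E E \<bullet> (co (fst Z) (snd Z) \<star> idt E) \<bullet> co (fst Z) (snd Z) = (idt (fst Z) \<star> dl) \<bullet> co (fst Z) (snd Z)"
    "ru (fst Z) \<bullet> (idt (fst Z) \<star> ep) \<bullet> co (fst Z) (snd Z) = idt (fst Z)"
  using assms by (cases Z; simp add: K_obj comodule_iff)+

lemma K_homD:
  assumes "f \<in> hom K X Y" "X \<in> obj K" "Y \<in> obj K"
  shows "f \<in> hom A\<^sub>0 (fst X) (fst Y)" "f \<in> hom A (fst X) (fst Y)"
    "co (fst Y) (snd Y) \<bullet> ar (fst X) f (fst Y) = (ar (fst X) f (fst Y) \<star> idt E) \<bullet> co (fst X) (snd X)"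
proof -
  show "f \<in> hom A\<^sub>0 (fst X) (fst Y)"
    "co (fst Y) (snd Y) \<bullet> ar (fst X) f (fst Y) = (ar (fst X) f (fst Y) \<star> idt E) \<bullet> co (fst X) (snd X)"
    using assms by (cases X; cases Y; simp add: K_hom)+
  then show "f \<in> hom A (fst X) (fst Y)" using assms by (auto intro: sub_hom dest: K_objD)
qed

lemma K_homI:
  assumes "X \<in> obj K" "Y \<in> obj K" "f \<in> hom A\<^sub>0 (fst X) (fst Y)"
    "co (fst Y) (snd Y) \<bullet> ar (fst X) f (fst Y) = (ar (fst X) f (fst Y) \<star> idt E) \<bullet> co (fst X) (snd X)"
  shows "f \<in> hom K X Y"
  using assms by (cases X; cases Y; simp add: K_hom)

lemma K_category: "category K"
proof -
  interpret A0: category A\<^sub>0 by (rule sub_category)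
  show ?thesis
  proof
    fix X assume X: "X \<in> obj K"
    have "ar (fst X) (ident A\<^sub>0 (fst X)) (fst X) = idt (fst X)"
      using K_objD[OF X] by (simp add: sub_ident arr_id_def)
    then show "ident K X \<in> hom K X X"
      using K_objD[OF X] X by (intro K_homI) (auto simp: A0.ident_hom split_beta Comod_def)
  next
    fix X Y Z f g assume XYZ: "X \<in> obj K" "Y \<in> obj K" "Z \<in> obj K" and fg: "f \<in> hom K X Y" "g \<in> hom K Y Z"
    note D = K_objD[OF XYZ(1)] K_objD[OF XYZ(2)] K_objD[OF XYZ(3)] K_homD[OF fg(1) XYZ(1,2)] K_homD[OF fg(2) XYZ(2,3)]
    have "ar (fst X) (g \<cdot>\<^bsub>A\<^sub>0\<^esub> f) (fst Z) = ar (fst Y) g (fst Z) \<bullet> ar (fst X) f (fst Y)"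
      using D by (simp add: comp_ar sub_cmp[of "fst X" "fst Y" "fst Z"])
    moreover have "g \<cdot>\<^bsub>A\<^sub>0\<^esub> f \<in> hom A\<^sub>0 (fst X) (fst Z)" using D by (intro A0.cmp_hom[of "fst X" "fst Y"]) auto
    moreover have "co (fst Z) (snd Z) \<bullet> ar (fst Y) g (fst Z) \<bullet> ar (fst X) f (fst Y) =
       ((ar (fst Y) g (fst Z) \<bullet> ar (fst X) f (fst Y)) \<star> idt E) \<bullet> co (fst X) (snd X)"
      using D K_homD(3)[OF fg(1) XYZ(1,2)] K_homD(3)[OF fg(2) XYZ(2,3), THEN comp_ext]
      by (simp add: whisker_comp comp_assoc)
    ultimately show "g \<cdot>\<^bsub>K\<^esub> f \<in> hom K X Z" using XYZ by (intro K_homI) auto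
  next
    fix X Y f assume XY: "X \<in> obj K" "Y \<in> obj K" and f: "f \<in> hom K X Y"
    show "ident K Y \<cdot>\<^bsub>K\<^esub> f = f" "f \<cdot>\<^bsub>K\<^esub> ident K X = f"
      using K_objD(1)[OF XY(1)] K_objD(1)[OF XY(2)] K_homD(1)[OF f XY] A0.cmp_ident_left A0.cmp_ident_right
      by (cases X; cases Y; simp)+
  next
    fix W X Y Z f g h
    assume o: "W \<in> obj K" "X \<in> obj K" "Y \<in> obj K" "Z \<in> obj K" "f \<in> hom K W X" "g \<in> hom K X Y" "h \<in> hom K Y Z"
    show "h \<cdot>\<^bsub>K\<^esub> g \<cdot>\<^bsub>K\<^esub> f = h \<cdot>\<^bsub>K\<^esub> (g \<cdot>\<^bsub>K\<^esub> f)"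
      using A0.cmp_assoc[OF K_objD(1)[OF o(1)] K_objD(1)[OF o(2)] K_objD(1)[OF o(3)] K_objD(1)[OF o(4)]
          K_homD(1)[OF o(5,1,2)] K_homD(1)[OF o(6,2,3)] K_homD(1)[OF o(7,3,4)]] by simp
  qed
qed

lemma forget_functor: "cat_functor K A\<^sub>0 forget_obj forget_arr"
  by (intro cat_functor.intro cat_functor_axioms.intro K_category sub_category)
    (auto simp: forget_obj_def forget_arr_def dest: K_objD K_homD)

text \<open>Arrows of the comodule category are arrows of \<open>A\<^sub>0\<close> with the same
  composition, so all equations are inherited and only membership in the new hom sets has to be
  supplied.\<close>

lemma lift_functor:
  assumes G: "cat_functor B A\<^sub>0 FO FM"
    and obj: "\<And>P. P \<in> obj B \<Longrightarrow> GO P \<in> obj K \<and> fst (GO P) = FO P"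
    and hom: "\<And>P Q f. \<lbrakk>P \<in> obj B; Q \<in> obj B; f \<in> hom B P Q\<rbrakk> \<Longrightarrow> FM f \<in> hom K (GO P) (GO Q)"
  shows "cat_functor B K GO FM"
proof -
  interpret G: cat_functor B A\<^sub>0 FO FM by (rule G)
  show ?thesis
  proof (intro cat_functor.intro cat_functor_axioms.intro K_category G.src.category_axioms)
    fix P assume "P \<in> obj B"
    then show "FM (ident B P) = ident K (GO P)" using obj[of P] by (cases "GO P") (auto simp: G.ident_map)
  qed (use obj hom in \<open>auto simp: G.cmp_map\<close>)
qed

end

locale coend_universal = coend_calculus C MC \<beta> A a M p B b FO FM \<xi>
  for C :: "('c, 'd) cat" and MC :: "('c, 'd) monoidal" and \<beta> :: "'c \<Rightarrow> 'c \<Rightarrow> 'd"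
    and A :: "('o, 'm) cat" and a :: "('c, 'd, 'o, 'm) action"
    and M :: "('o, 'm) monoidal" and p :: "('c, 'o, 'm) pulls"
    and B :: "('b, 'n) cat" and b :: "('c, 'd, 'b, 'n) action"
    and FO :: "'b \<Rightarrow> 'o" and FM :: "'n \<Rightarrow> 'm" and \<xi> :: "'c \<Rightarrow> 'b \<Rightarrow> 'm" +
  fixes E :: 'o and i :: "'b \<Rightarrow> 'm"
  assumes coend: "c_coend C A a M p B b FO FM \<xi> E i"
begin

abbreviation de where "de \<equiv> delta i E"

lemma E_obj [simp]: "E \<in> obj A" and i_hom [simp]: "P \<in> obj B \<Longrightarrow> i P \<in> hom A (cohF P) E"
  and cnat_de: "cnat E de"
  using coend by (auto simp: c_coend_def c_cowedge_iff)

lemma raw_de: "P \<in> obj B \<Longrightarrow> raw (de P) = Some (coend_delta A M FO i P)"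
  by (simp add: raw_delta)

lemma de_nat: "\<lbrakk>P \<in> obj B; Q \<in> obj B; f \<in> hom B P Q\<rbrakk> \<Longrightarrow> de Q \<bullet> fm P Q f = (fm P Q f \<star> idt E) \<bullet> de P"
  and de_act: "\<lbrakk>X \<in> obj C; P \<in> obj B\<rbrakk> \<Longrightarrow> p1 X (FO P) E \<bullet> (xi X P \<star> idt E) \<bullet> de (X \<triangleright>\<^sub>B P) = pa X (de P) \<bullet> xi X P"
  using cnat_de by (auto simp: cnat_def)

text \<open>The universal property of the cowedge, restated for families: as arrows out of
  \<open>cohF P\<close> are determined by their composite with the coevaluation, \<open>h\<close>
  matches \<open>i P\<close> to \<open>\<mu> P\<close> exactly if it matches \<open>de P\<close> to
  \<open>\<phi> P\<close>.\<close>

lemma de_factor: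
  assumes "cnat D \<phi>"
  shows "\<exists>!h. h \<in> hom A E D \<and> (\<forall>P\<in>obj B. (idt (FO P) \<star> ar E h D) \<bullet> de P = \<phi> P)"
proof -
  obtain \<mu> where \<mu>: "\<And>P. P \<in> obj B \<Longrightarrow> \<mu> P \<in> hom A (cohF P) D" "\<And>P. P \<in> obj B \<Longrightarrow> delta \<mu> D P = \<phi> P"
    using cnat_delta[OF assms] by metis
  have D: "D \<in> obj A" using assms by (simp add: cnat_def)
  have "cnat D (delta \<mu> D)" using \<mu>(2) assms cnat_cong by metis
  then have "c_cowedge C A a M p B b FO FM \<xi> D \<mu>" using D \<mu>(1) by (simp add: c_cowedge_iff)
  then have "\<exists>!h. h \<in> hom A E D \<and> (\<forall>P\<in>obj B. h \<cdot>\<^bsub>A\<^esub> i P = \<mu> P)"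
    using coend by (simp add: c_coend_def)
  moreover have "h \<cdot>\<^bsub>A\<^esub> i P = \<mu> P \<longleftrightarrow> (idt (FO P) \<star> ar E h D) \<bullet> de P = \<phi> P"
    if "h \<in> hom A E D" "P \<in> obj B" for h P
  proof -
    have "h \<cdot>\<^bsub>A\<^esub> i P = \<mu> P \<longleftrightarrow> ar E h D \<bullet> ar (cohF P) (i P) E = ar (cohF P) (\<mu> P) D"
      using that D by (simp add: comp_ar)
    also have "\<dots> \<longleftrightarrow> (idt (FO P) \<star> (ar E h D \<bullet> ar (cohF P) (i P) E)) \<bullet> evF P = (idt (FO P) \<star> ar (cohF P) (\<mu> P) D) \<bullet> evF P"
      using ev_unique[of "FO P" "ar E h D \<bullet> ar (cohF P) (i P) E" "FO P" "ar (cohF P) (\<mu> P) D"]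
        coclosed_FF[OF that(2,2)] that D \<mu>(1)[OF that(2)] by auto
    also have "\<dots> \<longleftrightarrow> (idt (FO P) \<star> ar E h D) \<bullet> de P = \<phi> P"
      using that D \<mu> by (simp add: delta_def whisker_comp comp_assoc flip: \<mu>(2))
    finally show ?thesis .
  qed
  ultimately show ?thesis by (simp cong: conj_cong ball_cong)
qed

text \<open>Both arrows factor the same family, namely the universal one followed by
  \<open>g\<close>. All equations between arrows out of \<open>E\<close> are proved in this
  way.\<close>

lemma de_unique:
  assumes "valid g" "valid h" "dm g = E" "dm h = E" "cd g = cd h"
    and eq: "\<And>P. P \<in> obj B \<Longrightarrow> (idt (FO P) \<star> g) \<bullet> de P = (idt (FO P) \<star> h) \<bullet> de P"
  shows "g = h"
proof -
  have g: "g = ar E (the (raw g)) (cd g)" and h: "h = ar E (the (raw h)) (cd g)"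
    using valid_raw[of g] valid_raw[of h] assms(1-5) by auto
  moreover have "the (raw g) \<in> hom A E (cd g)" "the (raw h) \<in> hom A E (cd g)"
    using valid_hom[of g] valid_hom[of h] assms(1-5) by auto
  ultimately have "the (raw g) = the (raw h)"
    using de_factor[OF cnat_postcomp[OF cnat_de assms(1,3)]] eq by metis
  then show ?thesis using g h by metis
qed

abbreviation \<Delta> where "\<Delta> \<equiv> coend_comult A M B FO E i"
abbreviation \<epsilon> where "\<epsilon> \<equiv> coend_counit A M B FO E i"
abbreviation dl where "dl \<equiv> ar E \<Delta> (E \<odot> E)"
abbreviation ep where "ep \<equiv> ar E \<epsilon> un"

text \<open>\<open>coend_comult\<close> is a definite description. It denotes because its condition
  is the factorization of the iterated coaction, which exists and is unique by
  \<open>de_factor\<close>.\<close>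

lemma comult_spec: "\<Delta> \<in> hom A E (E \<odot> E) \<and>
    (\<forall>P\<in>obj B. (idt (FO P) \<star> dl) \<bullet> de P = as (FO P) E E \<bullet> (de P \<star> idt E) \<bullet> de P)"
proof -
  have "(idt (FO P) \<star> ar E h (E \<odot> E)) \<bullet> de P = as (FO P) E E \<bullet> (de P \<star> idt E) \<bullet> de P \<longleftrightarrow>
     (ident A (FO P) \<boxtimes>\<^bsub>M\<^esub> h) \<cdot>\<^bsub>A\<^esub> coend_delta A M FO i P =
        assoc M (FO P) E E \<cdot>\<^bsub>A\<^esub> (coend_delta A M FO i P \<boxtimes>\<^bsub>M\<^esub> ident A E) \<cdot>\<^bsub>A\<^esub> coend_delta A M FO i P"
    if "P \<in> obj B" "h \<in> hom A E (E \<odot> E)" for P h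
  proof -
    have "(idt (FO P) \<star> ar E h (E \<odot> E)) \<bullet> de P = as (FO P) E E \<bullet> (de P \<star> idt E) \<bullet> de P \<longleftrightarrow>
      raw ((idt (FO P) \<star> ar E h (E \<odot> E)) \<bullet> de P) = raw ((as (FO P) E E \<bullet> (de P \<star> idt E)) \<bullet> de P)"
      by (auto intro!: arrow.expand simp: comp_assoc)
    then show ?thesis using that by (simp add: raw_comp raw_tns raw_monoidal raw_idt raw_de)
  qed
  then show ?thesis
    using theI'[OF de_factor[OF cnat_comp[OF cnat_de cnat_de]]] unfolding coend_comult_def
    by (simp cong: conj_cong ball_cong)
qed

lemma counit_spec: "\<epsilon> \<in> hom A E un \<and> (\<forall>P\<in>obj B. (idt (FO P) \<star> ep) \<bullet> de P = rv (ru (FO P)))"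
proof -
  have "(idt (FO P) \<star> ar E h un) \<bullet> de P = rv (ru (FO P)) \<longleftrightarrow>
     runit M (FO P) \<cdot>\<^bsub>A\<^esub> (ident A (FO P) \<boxtimes>\<^bsub>M\<^esub> h) \<cdot>\<^bsub>A\<^esub> coend_delta A M FO i P = ident A (FO P)"
    if P: "P \<in> obj B" and h: "h \<in> hom A E un" for P h
  proof -
    have "(idt (FO P) \<star> ar E h un) \<bullet> de P = rv (ru (FO P)) \<longleftrightarrow> ru (FO P) \<bullet> (idt (FO P) \<star> ar E h un) \<bullet> de P = idt (FO P)"
      using isom_cancel_left[of "ru (FO P)" "(idt (FO P) \<star> ar E h un) \<bullet> de P" "rv (ru (FO P))"] P h by auto
    also have "\<dots> \<longleftrightarrow> raw ((ru (FO P) \<bullet> (idt (FO P) \<star> ar E h un)) \<bullet> de P) = raw (idt (FO P))"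
      by (auto intro!: arrow.expand simp: comp_assoc)
    finally show ?thesis using P h by (simp add: raw_comp raw_tns raw_monoidal raw_idt raw_de)
  qed
  then show ?thesis
    using theI'[OF de_factor[OF cnat_unit]] unfolding coend_counit_def
    by (simp cong: conj_cong ball_cong)
qed

lemma dl_hom [simp]: "\<Delta> \<in> hom A E (E \<odot> E)" and ep_hom [simp]: "\<epsilon> \<in> hom A E un"
  and de_dl: "P \<in> obj B \<Longrightarrow> (idt (FO P) \<star> dl) \<bullet> de P = as (FO P) E E \<bullet> (de P \<star> idt E) \<bullet> de P"
  and de_ep: "P \<in> obj B \<Longrightarrow> (idt (FO P) \<star> ep) \<bullet> de P = rv (ru (FO P))"
  using comult_spec counit_spec by auto

lemma coalgebra: "coalgebra A M E \<Delta> \<epsilon>"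
proof (rule coalgebraI)
  \<comment> \<open>Tested against \<open>de P\<close>, both sides become the threefold coaction;
    the pentagon and naturality of the associator reconcile the brackets.\<close>
  show "as E E E \<bullet> (dl \<star> idt E) \<bullet> dl = (idt E \<star> dl) \<bullet> dl"
  proof (rule de_unique)
    fix P assume P: "P \<in> obj B"
    let ?P = "FO P" and ?d = "de P"
    have "(idt ?P \<star> (as E E E \<bullet> (dl \<star> idt E) \<bullet> dl)) \<bullet> ?d =
        (idt ?P \<star> as E E E) \<bullet> ((idt ?P \<star> (dl \<star> idt E)) \<bullet> as ?P E E) \<bullet> (?d \<star> idt E) \<bullet> ?d"
      using P by (simp add: whisker_comp de_dl comp_assoc)
    also have "\<dots> = (idt ?P \<star> as E E E) \<bullet> as ?P (E \<odot> E) E \<bullet> (((idt ?P \<star> dl) \<bullet> ?d) \<star> idt E) \<bullet> ?d"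
      using P as_nat[of "idt ?P" dl "idt E" ?P "E \<odot> E" E, symmetric, THEN comp_ext]
      by (simp add: whisker_comp comp_assoc)
    also have "\<dots> = as ?P E (E \<odot> E) \<bullet> as (?P \<odot> E) E E \<bullet> ((?d \<star> idt E) \<star> idt E) \<bullet> (?d \<star> idt E) \<bullet> ?d"
      using P by (simp add: de_dl whisker_comp comp_assoc as_pentagon_ext)
    also have "\<dots> = as ?P E (E \<odot> E) \<bullet> (?d \<star> idt (E \<odot> E)) \<bullet> as ?P E E \<bullet> (?d \<star> idt E) \<bullet> ?d"
      using P by (simp add: as_nat_idt[THEN comp_ext] comp_assoc)
    also have "\<dots> = as ?P E (E \<odot> E) \<bullet> (?d \<star> idt (E \<odot> E)) \<bullet> (idt ?P \<star> dl) \<bullet> ?d"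
      using P by (simp add: de_dl)
    also have "\<dots> = as ?P E (E \<odot> E) \<bullet> (idt (?P \<odot> E) \<star> dl) \<bullet> (?d \<star> idt E) \<bullet> ?d"
      using P by (simp add: tns_merge)
    also have "\<dots> = (idt ?P \<star> ((idt E \<star> dl) \<bullet> dl)) \<bullet> ?d"
      using P by (simp add: as_nat_idt[THEN comp_ext] whisker_comp de_dl comp_assoc)
    finally show "(idt ?P \<star> (as E E E \<bullet> (dl \<star> idt E) \<bullet> dl)) \<bullet> ?d = (idt ?P \<star> ((idt E \<star> dl) \<bullet> dl)) \<bullet> ?d" .
  qed simp_all
  show "lu E \<bullet> (ep \<star> idt E) \<bullet> dl = idt E"
  proof (rule de_unique)
    fix P assume P: "P \<in> obj B"
    let ?P = "FO P" and ?d = "de P"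
    have "(idt ?P \<star> (lu E \<bullet> (ep \<star> idt E) \<bullet> dl)) \<bullet> ?d =
        (idt ?P \<star> lu E) \<bullet> ((idt ?P \<star> (ep \<star> idt E)) \<bullet> as ?P E E) \<bullet> (?d \<star> idt E) \<bullet> ?d"
      using P by (simp add: whisker_comp de_dl comp_assoc)
    also have "\<dots> = (idt ?P \<star> lu E) \<bullet> as ?P un E \<bullet> (((idt ?P \<star> ep) \<bullet> ?d) \<star> idt E) \<bullet> ?d"
      using P as_nat[of "idt ?P" ep "idt E" ?P un E, symmetric, THEN comp_ext]
      by (simp add: whisker_comp comp_assoc)
    also have "\<dots> = ?d"
      using P by (simp add: de_ep as_triangle[THEN comp_ext])
    finally show "(idt ?P \<star> (lu E \<bullet> (ep \<star> idt E) \<bullet> dl)) \<bullet> ?d = (idt ?P \<star> idt E) \<bullet> ?d"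
      using P by simp
  qed simp_all
  show "ru E \<bullet> (idt E \<star> ep) \<bullet> dl = idt E"
  proof (rule de_unique)
    fix P assume P: "P \<in> obj B"
    let ?P = "FO P" and ?d = "de P"
    have "(idt ?P \<star> (ru E \<bullet> (idt E \<star> ep) \<bullet> dl)) \<bullet> ?d =
        (idt ?P \<star> ru E) \<bullet> (idt ?P \<star> (idt E \<star> ep)) \<bullet> as ?P E E \<bullet> (?d \<star> idt E) \<bullet> ?d"
      using P by (simp add: whisker_comp de_dl comp_assoc)
    also have "\<dots> = ru (?P \<odot> E) \<bullet> (idt (?P \<odot> E) \<star> ep) \<bullet> (?d \<star> idt E) \<bullet> ?d"
      using P as_nat_idt(1)[of ep ?P E un, symmetric, THEN comp_ext]
      by (simp add: comp_assoc runit_tns[THEN comp_ext])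
    also have "\<dots> = ru (?P \<odot> E) \<bullet> (?d \<star> idt un) \<bullet> (idt ?P \<star> ep) \<bullet> ?d"
      using P by (simp add: tns_merge)
    also have "\<dots> = ?d"
      using P by (simp add: ru_nat[THEN comp_ext] de_ep comp_assoc)
    finally show "(idt ?P \<star> (ru E \<bullet> (idt E \<star> ep) \<bullet> dl)) \<bullet> ?d = (idt ?P \<star> idt E) \<bullet> ?d"
      using P by simp
  qed simp_all
qed simp_all

lemma de_ar: "P \<in> obj B \<Longrightarrow> ar (FO P) (coend_delta A M FO i P) (FO P \<odot> E) = de P"
  using valid_raw[of "de P"] by (simp add: raw_de)

lemma coend_delta_hom [simp]: "P \<in> obj B \<Longrightarrow> coend_delta A M FO i P \<in> hom A (FO P) (FO P \<odot> E)"
  using valid_hom[of "de P"] by (simp add: raw_de)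

lemma delta_comodule: "P \<in> obj B \<Longrightarrow> comodule A M E \<Delta> \<epsilon> (FO P) (coend_delta A M FO i P)"
  by (simp add: comodule_iff de_ar de_dl de_ep)

lemma lift_cat_functor:
  assumes "subcategory A\<^sub>0 A" "cat_functor B A\<^sub>0 FO FM"
  shows "cat_functor B (Comod A M A\<^sub>0 E \<Delta> \<epsilon>) (lift_obj A M FO i) FM"
proof -
  interpret K: comodules A M A\<^sub>0 E \<Delta> \<epsilon>
    by unfold_locales (use assms in auto)
  interpret F0: cat_functor B A\<^sub>0 FO FM by (rule assms)
  have obj: "lift_obj A M FO i P \<in> obj K.K" if "P \<in> obj B" for P
    using that by (simp add: lift_obj_def K.K_obj delta_comodule F0.obj_map)
  show ?thesis
  proof (rule K.lift_functor[OF assms(2)])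
    fix P Q f assume "P \<in> obj B" "Q \<in> obj B" "f \<in> hom B P Q"
    then show "FM f \<in> hom K.K (lift_obj A M FO i P) (lift_obj A M FO i Q)"
      by (intro K.K_homI obj) (auto simp: lift_obj_def de_ar de_nat F0.hom_map)
  qed (use obj in \<open>auto simp: lift_obj_def\<close>)
qed

end

section \<open>Tensor products of coactions\<close>

text \<open>\<open>m\<close> and \<open>\<eta>\<close> are arbitrary arrows of the right type,
  because the formulas below serve to prove the algebra axioms for the coend as well as to exploit
  them.\<close>

locale tensor_coaction = braided_calculus A M \<tau>
  for A :: "('o, 'm) cat" and M :: "('o, 'm) monoidal" and \<tau> :: "'o \<Rightarrow> 'o \<Rightarrow> 'm" +
  fixes E :: 'o and m \<eta> :: 'm
  assumes Eobj [simp]: "E \<in> obj A" and mu_hom [simp]: "m \<in> hom A (E \<odot> E) E" and et_hom [simp]: "\<eta> \<in> hom A un E"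
begin

abbreviation mu where "mu \<equiv> ar (E \<odot> E) m E"
abbreviation et where "et \<equiv> ar un \<eta> E"

text \<open>Only the shape of a coaction. Coassociativity and counitality are kept apart, since for
  codiagonal coactions they are something to be proved.\<close>

definition coaction :: "('o, 'm) arrow \<Rightarrow> bool" where
  "coaction r \<longleftrightarrow> valid r \<and> cd r = dm r \<odot> E"

definition ct :: "('o, 'm) arrow \<Rightarrow> ('o, 'm) arrow \<Rightarrow> ('o, 'm) arrow" where
  "ct r s = (idt (dm r \<odot> dm s) \<star> mu) \<bullet> io (dm r) E (dm s) E \<bullet> (r \<star> s)"

definition cu :: "('o, 'm) arrow" where
  "cu = (idt un \<star> et) \<bullet> rv (lu un)"

text \<open>The threefold codiagonal coaction before multiplication: the copies of \<open>E\<close>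
  are collected on the right but not yet multiplied. On the universal coactions it is
  \<open>\<delta>\<^sub>3\<close>.\<close>

definition ct3 :: "('o, 'm) arrow \<Rightarrow> ('o, 'm) arrow \<Rightarrow> ('o, 'm) arrow \<Rightarrow> ('o, 'm) arrow" where
  "ct3 r s t = io (dm r) E (dm s \<odot> dm t) (E \<odot> E) \<bullet> (r \<star> (io (dm s) E (dm t) E \<bullet> (s \<star> t)))"

definition chom :: "('o, 'm) arrow \<Rightarrow> ('o, 'm) arrow \<Rightarrow> ('o, 'm) arrow \<Rightarrow> bool" where
  "chom r s f \<longleftrightarrow> valid f \<and> dm f = dm r \<and> cd f = dm s \<and> s \<bullet> f = (f \<star> idt E) \<bullet> r"

lemma coactionI: "\<lbrakk>valid r; cd r = dm r \<odot> E\<rbrakk> \<Longrightarrow> coaction r"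
  by (simp add: coaction_def)

lemma coactionD [simp]: "coaction r \<Longrightarrow> valid r" "coaction r \<Longrightarrow> cd r = dm r \<odot> E"
  by (auto simp: coaction_def)

lemma dm_ct [simp]: "dm (ct r s) = dm r \<odot> dm s" "dm cu = un" "dm (ct3 r s t) = dm r \<odot> dm s \<odot> dm t"
  "cd (ct3 r s t) = (dm r \<odot> dm s \<odot> dm t) \<odot> E \<odot> E \<odot> E"
  by (simp_all add: ct_def cu_def ct3_def)

lemma coaction_ct [simp]: "\<lbrakk>coaction r; coaction s\<rbrakk> \<Longrightarrow> coaction (ct r s)"
  by (rule coactionI) (simp_all add: ct_def)

lemma coaction_cu [simp]: "coaction cu"
  by (rule coactionI) (simp_all add: cu_def)

lemma ct_chom:
  assumes f: "chom r r' f" and g: "chom s s' g"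
    and c: "coaction r" "coaction r'" "coaction s" "coaction s'"
  shows "chom (ct r s) (ct r' s') (f \<star> g)"
proof -
  have fg: "valid f" "dm f = dm r" "cd f = dm r'" "valid g" "dm g = dm s" "cd g = dm s'"
    and eq: "r' \<bullet> f = (f \<star> idt E) \<bullet> r" "s' \<bullet> g = (g \<star> idt E) \<bullet> s"
    using f g by (auto simp: chom_def)
  have "ct r' s' \<bullet> (f \<star> g) = (idt (dm r' \<odot> dm s') \<star> mu) \<bullet> io (dm r') E (dm s') E \<bullet>
      ((f \<star> idt E) \<star> (g \<star> idt E)) \<bullet> (r \<star> s)"
    using fg c by (simp add: ct_def comp_assoc tns_merge eq)
  also have "\<dots> = (idt (dm r' \<odot> dm s') \<star> mu) \<bullet> ((f \<star> g) \<star> idt (E \<odot> E)) \<bullet> io (dm r) E (dm s) E \<bullet> (r \<star> s)"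
    using fg c by (simp add: io_nat[THEN comp_ext] comp_assoc)
  also have "\<dots> = ((f \<star> g) \<star> idt E) \<bullet> ct r s"
    using fg c by (simp add: ct_def tns_merge)
  finally show ?thesis using fg by (simp add: chom_def)
qed

lemma chom_comp:
  assumes "chom r s f" "chom s t g" "valid r" "cd r = dm r \<odot> E" shows "chom r t (g \<bullet> f)"
proof -
  have fg: "valid f" "dm f = dm r" "cd f = dm s" "valid g" "dm g = dm s" "cd g = dm t"
    and eq: "s \<bullet> f = (f \<star> idt E) \<bullet> r" "t \<bullet> g = (g \<star> idt E) \<bullet> s"
    using assms by (auto simp: chom_def)
  then show ?thesis using assms(3,4)
    by (simp add: chom_def eq(2)[THEN comp_ext] whisker_comp comp_assoc)
qed

lemma chom_idt [simp]: "coaction r \<Longrightarrow> chom r r (idt (dm r))"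
  by (simp add: chom_def)

lemma chom_rv:
  assumes f: "chom r s f" and i: "isom f" and c: "coaction r" "coaction s"
  shows "chom s r (rv f)"
proof -
  have fg: "dm f = dm r" "cd f = dm s" "s \<bullet> f = (f \<star> idt E) \<bullet> r" using f by (auto simp: chom_def)
  have "rv (f \<star> idt E) \<bullet> s = r \<bullet> rv f"
    by (rule rv_square) (use fg i c in auto)
  then show ?thesis using fg i c by (simp add: chom_def rv_tns)
qed

text \<open>Together with \<open>ct_assoc_right\<close> this isolates the multiplication: both
  bracketings are \<open>ct3\<close> followed by one of the two ways of multiplying three copies of
  \<open>E\<close>. Used one way it gives associativity of the multiplication
  (\<open>mult_assoc\<close>), used the other way it makes the associator a comodule map
  (\<open>chom_as\<close>). The interchanges are matched by \<open>io_assoc\<close>.\<close>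

lemma ct_assoc_left:
  assumes "coaction r" "coaction s" "coaction t"
  shows "(as (dm r) (dm s) (dm t) \<star> idt E) \<bullet> ct (ct r s) t =
    (idt (dm r \<odot> dm s \<odot> dm t) \<star> (mu \<bullet> (mu \<star> idt E) \<bullet> rv (as E E E))) \<bullet> ct3 r s t \<bullet> as (dm r) (dm s) (dm t)"
proof -
  let ?P = "dm r" and ?Q = "dm s" and ?R = "dm t"
  \<comment> \<open>The inner multiplication slides past the outer interchange, so that the two
    interchanges become adjacent and \<open>io_assoc\<close> applies.\<close>
  have 0: "io (?P \<odot> ?Q) E ?R E \<bullet> ((idt (?P \<odot> ?Q) \<star> mu) \<star> idt (?R \<odot> E)) =
      (idt ((?P \<odot> ?Q) \<odot> ?R) \<star> (mu \<star> idt E)) \<bullet> io (?P \<odot> ?Q) (E \<odot> E) ?R E"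
    using assms io_nat[of "idt (?P \<odot> ?Q)" mu "idt ?R" "idt E"] by simp
  have "ct (ct r s) t = (idt ((?P \<odot> ?Q) \<odot> ?R) \<star> mu) \<bullet> io (?P \<odot> ?Q) E ?R E \<bullet>
      ((idt (?P \<odot> ?Q) \<star> mu) \<star> idt (?R \<odot> E)) \<bullet> (io ?P E ?Q E \<star> idt (?R \<odot> E)) \<bullet> ((r \<star> s) \<star> t)"
    using assms by (simp add: ct_def tns_merge)
  also have "\<dots> = (idt ((?P \<odot> ?Q) \<odot> ?R) \<star> mu) \<bullet> (idt ((?P \<odot> ?Q) \<odot> ?R) \<star> (mu \<star> idt E)) \<bullet>
      io (?P \<odot> ?Q) (E \<odot> E) ?R E \<bullet> (io ?P E ?Q E \<star> idt (?R \<odot> E)) \<bullet> ((r \<star> s) \<star> t)"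
    by (simp add: 0[THEN comp_ext] comp_assoc)
  finally have 1: "ct (ct r s) t = \<dots>" .
  have 2: "as ?P ?Q ?R \<star> idt ((E \<odot> E) \<odot> E) = (idt (?P \<odot> ?Q \<odot> ?R) \<star> rv (as E E E)) \<bullet> (as ?P ?Q ?R \<star> as E E E)"
    using assms by (simp add: tns_merge)
  have 3: "(as ?P ?Q ?R \<star> idt E) \<bullet> (idt ((?P \<odot> ?Q) \<odot> ?R) \<star> mu) \<bullet> (idt ((?P \<odot> ?Q) \<odot> ?R) \<star> (mu \<star> idt E)) =
     (idt (?P \<odot> ?Q \<odot> ?R) \<star> (mu \<bullet> (mu \<star> idt E))) \<bullet> (as ?P ?Q ?R \<star> idt ((E \<odot> E) \<odot> E))"
    using assms by (simp add: tns_merge)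
  have "(as ?P ?Q ?R \<star> idt E) \<bullet> ct (ct r s) t =
     ((as ?P ?Q ?R \<star> idt E) \<bullet> (idt ((?P \<odot> ?Q) \<odot> ?R) \<star> mu) \<bullet> (idt ((?P \<odot> ?Q) \<odot> ?R) \<star> (mu \<star> idt E))) \<bullet>
      io (?P \<odot> ?Q) (E \<odot> E) ?R E \<bullet> (io ?P E ?Q E \<star> idt (?R \<odot> E)) \<bullet> ((r \<star> s) \<star> t)"
    unfolding 1 by (simp add: comp_assoc)
  also have "\<dots> = (idt (?P \<odot> ?Q \<odot> ?R) \<star> (mu \<bullet> (mu \<star> idt E))) \<bullet> (idt (?P \<odot> ?Q \<odot> ?R) \<star> rv (as E E E)) \<bullet>
      ((as ?P ?Q ?R \<star> as E E E) \<bullet> io (?P \<odot> ?Q) (E \<odot> E) ?R E \<bullet> (io ?P E ?Q E \<star> idt (?R \<odot> E))) \<bullet> ((r \<star> s) \<star> t)"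
    unfolding 3 2 by (simp add: comp_assoc)
  also have "\<dots> = (idt (?P \<odot> ?Q \<odot> ?R) \<star> (mu \<bullet> (mu \<star> idt E) \<bullet> rv (as E E E))) \<bullet>
      io ?P E (?Q \<odot> ?R) (E \<odot> E) \<bullet> (idt (?P \<odot> E) \<star> io ?Q E ?R E) \<bullet> (as (?P \<odot> E) (?Q \<odot> E) (?R \<odot> E) \<bullet> ((r \<star> s) \<star> t))"
    using assms by (subst io_assoc) (simp_all add: whisker_comp comp_assoc)
  also have "\<dots> = (idt (?P \<odot> ?Q \<odot> ?R) \<star> (mu \<bullet> (mu \<star> idt E) \<bullet> rv (as E E E))) \<bullet>
      io ?P E (?Q \<odot> ?R) (E \<odot> E) \<bullet> ((idt (?P \<odot> E) \<star> io ?Q E ?R E) \<bullet> (r \<star> s \<star> t)) \<bullet> as ?P ?Q ?R"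
    using assms by (simp add: as_nat comp_assoc)
  also have "(idt (?P \<odot> E) \<star> io ?Q E ?R E) \<bullet> (r \<star> s \<star> t) = r \<star> (io ?Q E ?R E \<bullet> (s \<star> t))"
    using assms by (simp add: tns_merge)
  finally show ?thesis by (simp add: ct3_def comp_assoc)
qed

lemma ct_assoc_right:
  assumes "coaction r" "coaction s" "coaction t"
  shows "ct r (ct s t) = (idt (dm r \<odot> dm s \<odot> dm t) \<star> (mu \<bullet> (idt E \<star> mu))) \<bullet> ct3 r s t"
proof -
  let ?P = "dm r" and ?Q = "dm s" and ?R = "dm t"
  have "ct r (ct s t) = (idt (?P \<odot> ?Q \<odot> ?R) \<star> mu) \<bullet> (io ?P E (?Q \<odot> ?R) E \<bullet>
      ((idt ?P \<star> idt E) \<star> (idt (?Q \<odot> ?R) \<star> mu))) \<bullet> (r \<star> (io ?Q E ?R E \<bullet> (s \<star> t)))"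
    using assms by (simp add: ct_def tns_merge comp_assoc)
  also have "io ?P E (?Q \<odot> ?R) E \<bullet> ((idt ?P \<star> idt E) \<star> (idt (?Q \<odot> ?R) \<star> mu)) =
      (idt (?P \<odot> ?Q \<odot> ?R) \<star> (idt E \<star> mu)) \<bullet> io ?P E (?Q \<odot> ?R) (E \<odot> E)"
    using assms by (subst io_nat) simp_all
  finally show ?thesis using assms by (simp add: ct3_def whisker_comp comp_assoc)
qed

text \<open>The same separation for the unit: the arrow applied to \<open>E\<close> on the
  right-hand side becomes the identity once the left unit law holds.\<close>

lemma ct_unit_left:
  assumes "coaction r"
  shows "(lu (dm r) \<star> idt E) \<bullet> ct cu r = (idt (dm r) \<star> (mu \<bullet> (et \<star> idt E) \<bullet> rv (lu E))) \<bullet> r \<bullet> lu (dm r)"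
proof -
  let ?P = "dm r"
  have "ct cu r = (idt (un \<odot> ?P) \<star> mu) \<bullet> (io un E ?P E \<bullet> ((idt un \<star> et) \<star> (idt ?P \<star> idt E))) \<bullet> (rv (lu un) \<star> r)"
    using assms by (simp add: ct_def tns_merge comp_assoc) (simp add: cu_def)
  also have "io un E ?P E \<bullet> ((idt un \<star> et) \<star> (idt ?P \<star> idt E)) = (idt (un \<odot> ?P) \<star> (et \<star> idt E)) \<bullet> io un un ?P E"
    using assms by (subst io_nat) simp_all
  finally have "(lu ?P \<star> idt E) \<bullet> ct cu r = ((lu ?P \<star> idt E) \<bullet> (idt (un \<odot> ?P) \<star> mu) \<bullet> (idt (un \<odot> ?P) \<star> (et \<star> idt E))) \<bullet>
      io un un ?P E \<bullet> (rv (lu un) \<star> r)"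
    by (simp add: comp_assoc)
  also have "(lu ?P \<star> idt E) \<bullet> (idt (un \<odot> ?P) \<star> mu) \<bullet> (idt (un \<odot> ?P) \<star> (et \<star> idt E)) =
      (idt ?P \<star> (mu \<bullet> (et \<star> idt E) \<bullet> rv (lu E))) \<bullet> (lu ?P \<star> lu E)"
    using assms by (simp add: tns_merge comp_assoc)
  finally have "(lu ?P \<star> idt E) \<bullet> ct cu r = (idt ?P \<star> (mu \<bullet> (et \<star> idt E) \<bullet> rv (lu E))) \<bullet>
      ((lu ?P \<star> lu E) \<bullet> io un un ?P E) \<bullet> (rv (lu un) \<star> r)"
    by (simp add: comp_assoc)
  also have "((lu ?P \<star> lu E) \<bullet> io un un ?P E) \<bullet> (rv (lu un) \<star> r) = lu (?P \<odot> E) \<bullet> (idt un \<star> r)"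
    using assms by (simp add: io_un_un_left tns_merge comp_assoc)
  also have "\<dots> = r \<bullet> lu ?P" using assms by (simp add: lu_nat)
  finally show ?thesis .
qed

lemma ct_unit_right:
  assumes "coaction r"
  shows "(ru (dm r) \<star> idt E) \<bullet> ct r cu = (idt (dm r) \<star> (mu \<bullet> (idt E \<star> et) \<bullet> rv (ru E))) \<bullet> r \<bullet> ru (dm r)"
proof -
  let ?P = "dm r"
  have "ct r cu = (idt (?P \<odot> un) \<star> mu) \<bullet> (io ?P E un E \<bullet> ((idt ?P \<star> idt E) \<star> (idt un \<star> et))) \<bullet> (r \<star> rv (lu un))"
    using assms by (simp add: ct_def tns_merge comp_assoc) (simp add: cu_def)
  also have "io ?P E un E \<bullet> ((idt ?P \<star> idt E) \<star> (idt un \<star> et)) = (idt (?P \<odot> un) \<star> (idt E \<star> et)) \<bullet> io ?P E un un"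
    using assms by (subst io_nat) simp_all
  finally have "(ru ?P \<star> idt E) \<bullet> ct r cu = ((ru ?P \<star> idt E) \<bullet> (idt (?P \<odot> un) \<star> mu) \<bullet> (idt (?P \<odot> un) \<star> (idt E \<star> et))) \<bullet>
      io ?P E un un \<bullet> (r \<star> rv (lu un))"
    by (simp add: comp_assoc)
  also have "(ru ?P \<star> idt E) \<bullet> (idt (?P \<odot> un) \<star> mu) \<bullet> (idt (?P \<odot> un) \<star> (idt E \<star> et)) =
      (idt ?P \<star> (mu \<bullet> (idt E \<star> et) \<bullet> rv (ru E))) \<bullet> (ru ?P \<star> ru E)"
    using assms by (simp add: tns_merge comp_assoc)
  finally have "(ru ?P \<star> idt E) \<bullet> ct r cu = (idt ?P \<star> (mu \<bullet> (idt E \<star> et) \<bullet> rv (ru E))) \<bullet>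
      ((ru ?P \<star> ru E) \<bullet> io ?P E un un) \<bullet> (r \<star> rv (lu un))"
    by (simp add: comp_assoc)
  also have "((ru ?P \<star> ru E) \<bullet> io ?P E un un) \<bullet> (r \<star> rv (lu un)) = ru (?P \<odot> E) \<bullet> (r \<star> idt un)"
    using assms by (simp add: io_un_un_right tns_merge comp_assoc)
  also have "\<dots> = r \<bullet> ru ?P" using assms by (simp add: ru_nat)
  finally show ?thesis .
qed

end

section \<open>Coassociativity and counitality of codiagonal coactions\<close>

locale tensor_coalgebra = tensor_coaction A M \<tau> E m \<eta>
  for A :: "('o, 'm) cat" and M :: "('o, 'm) monoidal" and \<tau> :: "'o \<Rightarrow> 'o \<Rightarrow> 'm"
    and E :: 'o and m \<eta> :: 'm +
  fixes \<Delta> \<epsilon> :: 'm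
  assumes Dl_hom [simp]: "\<Delta> \<in> hom A E (E \<odot> E)" and Ep_hom [simp]: "\<epsilon> \<in> hom A E un"
begin

abbreviation dl where "dl \<equiv> ar E \<Delta> (E \<odot> E)"
abbreviation ep where "ep \<equiv> ar E \<epsilon> un"

definition coassoc :: "('o, 'm) arrow \<Rightarrow> bool" where
  "coassoc r \<longleftrightarrow> as (dm r) E E \<bullet> (r \<star> idt E) \<bullet> r = (idt (dm r) \<star> dl) \<bullet> r"

definition counital :: "('o, 'm) arrow \<Rightarrow> bool" where
  "counital r \<longleftrightarrow> ru (dm r) \<bullet> (idt (dm r) \<star> ep) \<bullet> r = idt (dm r)"

text \<open>Comodule laws are invariant under isomorphism of coactions. Used along \<open>J\<close>,
  this gives them for codiagonal coactions before any compatibility of multiplication and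
  comultiplication is known.\<close>

lemma coassoc_transfer:
  assumes f: "chom r s f" and i: "isom f" and c: "coaction r" "coaction s" and s: "coassoc s"
  shows "coassoc r"
proof -
  have fg: "valid f" "dm f = dm r" "cd f = dm s" "s \<bullet> f = (f \<star> idt E) \<bullet> r" using f by (auto simp: chom_def)
  have "(f \<star> idt (E \<odot> E)) \<bullet> as (dm r) E E \<bullet> (r \<star> idt E) \<bullet> r = as (dm s) E E \<bullet> (((f \<star> idt E) \<bullet> r) \<star> idt E) \<bullet> r"
    using fg c as_nat_idt(2)[of f E E "dm s", symmetric, THEN comp_ext] by (simp add: whisker_comp comp_assoc)
  also have "\<dots> = (as (dm s) E E \<bullet> (s \<star> idt E) \<bullet> s) \<bullet> f"
    using fg c by (simp add: whisker_comp comp_assoc flip: fg(4))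
  also have "\<dots> = (idt (dm s) \<star> dl) \<bullet> s \<bullet> f"
    using s by (simp add: coassoc_def comp_assoc)
  also have "\<dots> = (f \<star> idt (E \<odot> E)) \<bullet> (idt (dm r) \<star> dl) \<bullet> r"
    using fg c by (simp add: tns_merge)
  finally show ?thesis
    unfolding coassoc_def by (rule isom_cancel_left) (use fg i c in auto)
qed

lemma counital_transfer:
  assumes f: "chom r s f" and i: "isom f" and c: "coaction r" "coaction s" and s: "counital s"
  shows "counital r"
proof -
  have fg: "valid f" "dm f = dm r" "cd f = dm s" "s \<bullet> f = (f \<star> idt E) \<bullet> r" using f by (auto simp: chom_def)
  have "f \<bullet> ru (dm r) \<bullet> (idt (dm r) \<star> ep) \<bullet> r = ru (dm s) \<bullet> (f \<star> idt un) \<bullet> (idt (dm r) \<star> ep) \<bullet> r"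
    using fg c by (simp add: ru_nat[THEN comp_ext] comp_assoc)
  also have "\<dots> = ru (dm s) \<bullet> (idt (dm s) \<star> ep) \<bullet> (f \<star> idt E) \<bullet> r"
    using fg c by (simp add: tns_merge)
  also have "\<dots> = (ru (dm s) \<bullet> (idt (dm s) \<star> ep) \<bullet> s) \<bullet> f"
    using fg by (simp add: comp_assoc)
  also have "\<dots> = f \<bullet> idt (dm r)"
    using fg s c by (simp add: counital_def)
  finally show ?thesis
    unfolding counital_def by (rule isom_cancel_left) (use fg i c in auto)
qed

text \<open>If \<open>r\<close> and \<open>s\<close> are coassociative, \<open>io_coassoc\<close>
  expresses the iterated codiagonal coaction through the comultiplication of the tensor product
  coalgebra. If \<open>ct r s\<close> is itself coassociative, the same composite is governed by
  \<open>dl \<bullet> mu\<close>. Comparing the two is the bialgebra axiom.\<close>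

lemma ct_coassoc:
  assumes c: "coaction r" "coaction s" and co: "coassoc r" "coassoc s"
  shows "as (dm r \<odot> dm s) E E \<bullet> (ct r s \<star> idt E) \<bullet> ct r s =
    (idt (dm r \<odot> dm s) \<star> ((mu \<star> mu) \<bullet> io E E E E \<bullet> (dl \<star> dl))) \<bullet> io (dm r) E (dm s) E \<bullet> (r \<star> s)"
proof -
  let ?P = "dm r" and ?Q = "dm s" and ?EE = "E \<odot> E"
  have "(idt (?P \<odot> ?Q) \<star> (dl \<star> dl)) \<bullet> io ?P E ?Q E = io ?P ?EE ?Q ?EE \<bullet> ((idt ?P \<star> dl) \<star> (idt ?Q \<star> dl))"
    using c by (subst io_nat) simp_all
  from this[THEN comp_ext, of "r \<star> s"] have "(idt (?P \<odot> ?Q) \<star> (dl \<star> dl)) \<bullet> io ?P E ?Q E \<bullet> (r \<star> s) =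
      io ?P ?EE ?Q ?EE \<bullet> (((idt ?P \<star> dl) \<bullet> r) \<star> ((idt ?Q \<star> dl) \<bullet> s))"
    using c by (simp add: tns_merge comp_assoc)
  also have "\<dots> = io ?P ?EE ?Q ?EE \<bullet> (as ?P E E \<star> as ?Q E E) \<bullet> ((r \<star> idt E) \<star> (s \<star> idt E)) \<bullet> (r \<star> s)"
    using c co by (simp add: coassoc_def tns_merge)
  finally have 1: "(idt (?P \<odot> ?Q) \<star> (dl \<star> dl)) \<bullet> io ?P E ?Q E \<bullet> (r \<star> s) = \<dots>" .
  have 2: "io (?P \<odot> E) E (?Q \<odot> E) E \<bullet> ((r \<star> idt E) \<star> (s \<star> idt E)) = ((r \<star> s) \<star> idt ?EE) \<bullet> io ?P E ?Q E"
    using c by (subst io_nat) simp_all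
  have 3: "(idt (?P \<odot> ?Q) \<star> (mu \<star> mu)) \<bullet> as (?P \<odot> ?Q) ?EE ?EE = as (?P \<odot> ?Q) E E \<bullet> ((idt (?P \<odot> ?Q) \<star> mu) \<star> mu)"
    using c by (subst as_nat) simp_all
  have "(idt (?P \<odot> ?Q) \<star> ((mu \<star> mu) \<bullet> io E E E E \<bullet> (dl \<star> dl))) \<bullet> io ?P E ?Q E \<bullet> (r \<star> s) =
     (idt (?P \<odot> ?Q) \<star> (mu \<star> mu)) \<bullet> ((idt (?P \<odot> ?Q) \<star> io E E E E) \<bullet> io ?P ?EE ?Q ?EE \<bullet> (as ?P E E \<star> as ?Q E E)) \<bullet>
       ((r \<star> idt E) \<star> (s \<star> idt E)) \<bullet> (r \<star> s)"
    using c by (simp add: whisker_comp comp_assoc 1)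
  also have "(idt (?P \<odot> ?Q) \<star> io E E E E) \<bullet> io ?P ?EE ?Q ?EE \<bullet> (as ?P E E \<star> as ?Q E E) =
     as (?P \<odot> ?Q) ?EE ?EE \<bullet> (io ?P E ?Q E \<star> idt ?EE) \<bullet> io (?P \<odot> E) E (?Q \<odot> E) E"
    using c by (subst io_coassoc) simp_all
  also have "(idt (?P \<odot> ?Q) \<star> (mu \<star> mu)) \<bullet> (as (?P \<odot> ?Q) ?EE ?EE \<bullet> (io ?P E ?Q E \<star> idt ?EE) \<bullet> io (?P \<odot> E) E (?Q \<odot> E) E) \<bullet>
       ((r \<star> idt E) \<star> (s \<star> idt E)) \<bullet> (r \<star> s) =
     ((idt (?P \<odot> ?Q) \<star> (mu \<star> mu)) \<bullet> as (?P \<odot> ?Q) ?EE ?EE) \<bullet> (io ?P E ?Q E \<star> idt ?EE) \<bullet>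
       (io (?P \<odot> E) E (?Q \<odot> E) E \<bullet> ((r \<star> idt E) \<star> (s \<star> idt E))) \<bullet> (r \<star> s)"
    by (simp add: comp_assoc)
  also have "\<dots> = as (?P \<odot> ?Q) E E \<bullet> (((idt (?P \<odot> ?Q) \<star> mu) \<star> mu) \<bullet> (io ?P E ?Q E \<star> idt ?EE) \<bullet> ((r \<star> s) \<star> idt ?EE)) \<bullet>
      io ?P E ?Q E \<bullet> (r \<star> s)"
    unfolding 2 3 by (simp add: comp_assoc)
  also have "((idt (?P \<odot> ?Q) \<star> mu) \<star> mu) \<bullet> (io ?P E ?Q E \<star> idt ?EE) \<bullet> ((r \<star> s) \<star> idt ?EE) =
      (ct r s \<star> idt E) \<bullet> (idt (?P \<odot> ?Q) \<star> mu)"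
    using c by (simp add: ct_def tns_merge comp_assoc)
  finally show ?thesis by (simp add: ct_def comp_assoc)
qed

text \<open>The analogue of \<open>ct_coassoc\<close> for the counit, with \<open>io_un_snd\<close>
  in the place of \<open>io_coassoc\<close>.\<close>

lemma ct_counital:
  assumes c: "coaction r" "coaction s" and co: "counital r" "counital s"
  shows "ru (dm r \<odot> dm s) \<bullet> (idt (dm r \<odot> dm s) \<star> (lu un \<bullet> (ep \<star> ep))) \<bullet> io (dm r) E (dm s) E \<bullet> (r \<star> s) =
    idt (dm r \<odot> dm s)"
proof -
  let ?P = "dm r" and ?Q = "dm s"
  have 1: "(idt (?P \<odot> ?Q) \<star> (ep \<star> ep)) \<bullet> io ?P E ?Q E = io ?P un ?Q un \<bullet> ((idt ?P \<star> ep) \<star> (idt ?Q \<star> ep))"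
    using c by (subst io_nat) simp_all
  have "ru (?P \<odot> ?Q) \<bullet> (idt (?P \<odot> ?Q) \<star> (lu un \<bullet> (ep \<star> ep))) \<bullet> io ?P E ?Q E \<bullet> (r \<star> s) =
     (ru (?P \<odot> ?Q) \<bullet> (idt (?P \<odot> ?Q) \<star> lu un) \<bullet> io ?P un ?Q un) \<bullet> ((idt ?P \<star> ep) \<star> (idt ?Q \<star> ep)) \<bullet> (r \<star> s)"
    using c by (simp add: whisker_comp comp_assoc 1[THEN comp_ext])
  also have "\<dots> = (ru ?P \<bullet> (idt ?P \<star> ep) \<bullet> r) \<star> (ru ?Q \<bullet> (idt ?Q \<star> ep) \<bullet> s)"
    using c by (simp add: io_un_snd tns_merge)
  also have "\<dots> = idt (?P \<odot> ?Q)" using c co by (simp add: counital_def)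
  finally show ?thesis .
qed

end

section \<open>Arrows of the subcategory within the calculus of the ambient category\<close>

locale subcat_calculus = monoidal_calculus A M
  for A :: "('o, 'm) cat" and M :: "('o, 'm) monoidal" +
  fixes A\<^sub>0 :: "('o, 'm) cat"
  assumes sub: "subcategory A\<^sub>0 A" and mon0: "monoidal_category A\<^sub>0 M"
begin

abbreviation v0 where "v0 \<equiv> arr_valid A\<^sub>0"

lemma cat0: "category A\<^sub>0"
  and obj0 [simp]: "P \<in> obj A\<^sub>0 \<Longrightarrow> P \<in> obj A"
  and ident0: "P \<in> obj A\<^sub>0 \<Longrightarrow> ident A\<^sub>0 P = ident A P"
  and hom0: "\<lbrakk>f \<in> hom A\<^sub>0 P Q; P \<in> obj A\<^sub>0; Q \<in> obj A\<^sub>0\<rbrakk> \<Longrightarrow> f \<in> hom A P Q"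
  and cmp0: "\<lbrakk>P \<in> obj A\<^sub>0; Q \<in> obj A\<^sub>0; R \<in> obj A\<^sub>0; f \<in> hom A\<^sub>0 P Q; g \<in> hom A\<^sub>0 Q R\<rbrakk> \<Longrightarrow> g \<cdot>\<^bsub>A\<^sub>0\<^esub> f = g \<cdot>\<^bsub>A\<^esub> f"
  using sub unfolding subcategory_def by blast+

lemma v0D: "v0 f \<Longrightarrow> dm f \<in> obj A\<^sub>0" "v0 f \<Longrightarrow> cd f \<in> obj A\<^sub>0" "v0 f \<Longrightarrow> the (raw f) \<in> hom A\<^sub>0 (dm f) (cd f)"
  by (auto simp: arr_valid_def)

lemma v0_valid [simp]: "v0 f \<Longrightarrow> valid f"
  unfolding arr_valid_def using hom0 obj0 by blast

lemma v0_ar [simp]: "v0 (ar X f Y) \<longleftrightarrow> X \<in> obj A\<^sub>0 \<and> Y \<in> obj A\<^sub>0 \<and> f \<in> hom A\<^sub>0 X Y"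
  by (auto simp: arr_valid_def)

lemma raw_comp0: "\<lbrakk>v0 g; v0 f; cd f = dm g\<rbrakk> \<Longrightarrow> raw (g \<bullet> f) = Some (the (raw g) \<cdot>\<^bsub>A\<^sub>0\<^esub> the (raw f))"
  using cmp0[of "dm f" "dm g" "cd g" "the (raw f)" "the (raw g)"] v0D[of f] v0D[of g] by (simp add: raw_comp)

lemma v0_comp [simp]: "\<lbrakk>v0 g; v0 f; cd f = dm g\<rbrakk> \<Longrightarrow> v0 (g \<bullet> f)"
  using category.cmp_hom[OF cat0, of "dm f" "dm g" "cd g" "the (raw f)" "the (raw g)"] v0D[of f] v0D[of g]
  by (subst arr_valid_def) (simp add: raw_comp0)

lemma v0_idt [simp]: "P \<in> obj A\<^sub>0 \<Longrightarrow> v0 (idt P)"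
  using category.ident_hom[OF cat0, of P] by (simp add: arr_id_def ident0)

lemma v0_tns [simp]: "\<lbrakk>v0 f; v0 g\<rbrakk> \<Longrightarrow> v0 (f \<star> g)"
  using cat_bifunctor.hom_map[OF monoidal_category.axioms(1)[OF mon0], of "dm f" "cd f" "dm g" "cd g" "the (raw f)" "the (raw g)"]
    cat_bifunctor.obj_map[OF monoidal_category.axioms(1)[OF mon0]] v0D[of f] v0D[of g]
  by (subst arr_valid_def) (simp add: raw_tns)

lemma obj0_tns [simp]: "\<lbrakk>P \<in> obj A\<^sub>0; Q \<in> obj A\<^sub>0\<rbrakk> \<Longrightarrow> P \<odot> Q \<in> obj A\<^sub>0" and obj0_un [simp]: "un \<in> obj A\<^sub>0"
  using cat_bifunctor.obj_map[OF monoidal_category.axioms(1)[OF mon0]] monoidal_category.uno_obj[OF mon0] by auto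

text \<open>An inverse found in \<open>A\<^sub>0\<close> is also an inverse in \<open>A\<close>,
  where inverses are unique. The direction matters: an arrow of \<open>A\<^sub>0\<close> may be
  invertible in \<open>A\<close> without having its inverse in \<open>A\<^sub>0\<close>.\<close>

lemma iso0:
  assumes "iso A\<^sub>0 X Y f" "X \<in> obj A\<^sub>0" "Y \<in> obj A\<^sub>0"
  shows "isom (ar X f Y)" "v0 (ar X f Y)" "v0 (rv (ar X f Y))" "inv_arr A\<^sub>0 X Y f = inv_arr A X Y f"
proof -
  have inv: "inverse_arrows A\<^sub>0 X Y f (inv_arr A\<^sub>0 X Y f)" by (rule category.iso_inverse[OF cat0 assms(2,3,1)])
  then have "inverse_arrows A X Y f (inv_arr A\<^sub>0 X Y f)"
    using assms cmp0[of X Y X f "inv_arr A\<^sub>0 X Y f"] cmp0[of Y X Y "inv_arr A\<^sub>0 X Y f" f]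
    by (auto simp: inverse_arrows_def ident0 intro: hom0)
  then show "inv_arr A\<^sub>0 X Y f = inv_arr A X Y f" "isom (ar X f Y)" "v0 (ar X f Y)" "v0 (rv (ar X f Y))"
    using assms inv inv_arr_eq[of X Y f] isom_ar[of X Y f]
    by (auto simp: iso_def arr_inv_def inverse_arrows_def)
qed

lemma v0_coherence [simp]:
  assumes "P \<in> obj A\<^sub>0" "Q \<in> obj A\<^sub>0" "R \<in> obj A\<^sub>0"
  shows "v0 (as P Q R)" "v0 (rv (as P Q R))" "v0 (lu P)" "v0 (rv (lu P))" "v0 (ru P)" "v0 (rv (ru P))"
  unfolding arr_assoc_def arr_lunit_def arr_runit_def
  using assms iso0[OF monoidal_category.assoc_iso[OF mon0 assms]]
    iso0[OF monoidal_category.lunit_iso[OF mon0 assms(1)]] iso0[OF monoidal_category.runit_iso[OF mon0 assms(1)]]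
  by simp_all

end

section \<open>Natural families on lists\<close>

lemma tens_list_Cons: "Ps \<noteq> [] \<Longrightarrow> tens_list M (P # Ps) = P \<otimes>\<^bsub>M\<^esub> tens_list M Ps"
  by (cases Ps) auto

context coend_calculus
begin

abbreviation TF where "TF Ps \<equiv> tens_list M (map FO Ps)"

lemma tens_list_obj: "set Ps \<subseteq> obj A \<Longrightarrow> tens_list M Ps \<in> obj A"
  by (induction Ps rule: induct_list012) auto

lemma TF_obj [simp]: "set Ps \<subseteq> obj B \<Longrightarrow> TF Ps \<in> obj A"
  by (rule tens_list_obj) auto

lemma tensm_list_hom:
  assumes "length Ps = length fs" "length Qs = length fs" "set Ps \<subseteq> obj B" "set Qs \<subseteq> obj B"
    "\<forall>k<length fs. fs ! k \<in> hom B (Ps ! k) (Qs ! k)"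
  shows "tensm_list A M (map FM fs) \<in> hom A (TF Ps) (TF Qs)"
  using assms
proof (induction fs arbitrary: Ps Qs rule: induct_list012)
  case 1
  then show ?case by (simp add: ident_hom)
next
  case (2 f)
  then obtain P Q where "Ps = [P]" "Qs = [Q]" by (auto simp: length_Suc_conv)
  then show ?case using 2 by simp
next
  case (3 f g gs)
  obtain P Ps' where Ps: "Ps = P # Ps'" using 3(3) by (cases Ps) auto
  obtain Q Qs' where Qs: "Qs = Q # Qs'" using 3(4) by (cases Qs) auto
  have ne: "Ps' \<noteq> []" "Qs' \<noteq> []" using 3(3,4) Ps Qs by auto
  have "\<forall>k<length (g # gs). (g # gs) ! k \<in> hom B (Ps' ! k) (Qs' ! k)"
    using 3(7) Ps Qs by (metis Suc_less_eq length_Cons nth_Cons_Suc)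
  then have "tensm_list A M (map FM (g # gs)) \<in> hom A (TF Ps') (TF Qs')"
    using 3 Ps Qs by (intro 3(2)) auto
  moreover have "f \<in> hom B P Q" using 3(7) Ps Qs by force
  ultimately show ?case using 3(3-6) Ps Qs ne
    by (auto simp: tens_list_Cons intro!: hom_map)
qed

lemma xi_list_hom:
  assumes "k < length Ps" "set Ps \<subseteq> obj B" "X \<in> obj C"
  shows "xi_list A M p FO \<xi> X k Ps \<in> hom A (TF (Ps[k := X \<triangleright>\<^sub>B (Ps ! k)])) (X \<triangleright> TF Ps)"
  using assms
proof (induction Ps arbitrary: k rule: induct_list012)
  case (3 P Q Qs)
  let ?T = "TF (Q # Qs)"
  have o: "P \<in> obj B" "set (Q # Qs) \<subseteq> obj B" using 3 by auto
  then have T: "?T \<in> obj A" by (intro TF_obj)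
  show ?case
  proof (cases k)
    case 0
    have "valid (p1 X (FO P) ?T \<bullet> (xi X P \<star> idt ?T))" using o T 3 by simp
    from valid_hom[OF this] show ?thesis using o T 3 0
      by (simp add: raw_comp raw_action raw_tns raw_idt Let_def)
  next
    case (Suc j)
    let ?T' = "TF ((Q # Qs)[j := X \<triangleright>\<^sub>B ((Q # Qs) ! j)])"
    have j: "j < length (Q # Qs)" using 3 Suc by simp
    have "set ((Q # Qs)[j := X \<triangleright>\<^sub>B ((Q # Qs) ! j)]) \<subseteq> obj B"
      using o(2) 3(5) j nth_mem[OF j] set_update_subset_insert[of "Q # Qs" j] by fastforce
    then have T': "?T' \<in> obj A" by (rule TF_obj)
    have "xi_list A M p FO \<xi> X j (Q # Qs) \<in> hom A ?T' (X \<triangleright> ?T)" by (rule 3(2)[OF j o(2) 3(5)])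
    then have "valid (p2 X (FO P) ?T \<bullet> (idt (FO P) \<star> ar ?T' (xi_list A M p FO \<xi> X j (Q # Qs)) (X \<triangleright> ?T)))"
      using o T 3 T' by simp
    \<comment> \<open>\<open>tens_list\<close> unfolds only on a tail that is visibly nonempty, so
      nonemptiness of the updated tail is established separately.\<close>
    moreover have "TF ((P # Q # Qs)[k := X \<triangleright>\<^sub>B ((P # Q # Qs) ! k)]) = FO P \<odot> ?T'"
    proof -
      have "(P # Q # Qs)[k := X \<triangleright>\<^sub>B ((P # Q # Qs) ! k)] = P # (Q # Qs)[j := X \<triangleright>\<^sub>B ((Q # Qs) ! j)]"
        using Suc by simp
      moreover have "map FO ((Q # Qs)[j := X \<triangleright>\<^sub>B ((Q # Qs) ! j)]) \<noteq> []"
        by (simp del: list_update.simps)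
      from tens_list_Cons[OF this, of M "FO P"] show ?thesis using calculation by (simp only: list.map)
    qed
    ultimately show ?thesis
      using o T 3 Suc T' \<open>xi_list A M p FO \<xi> X j (Q # Qs) \<in> hom A ?T' (X \<triangleright> ?T)\<close>
        valid_hom[of "p2 X (FO P) ?T \<bullet> (idt (FO P) \<star> ar ?T' (xi_list A M p FO \<xi> X j (Q # Qs)) (X \<triangleright> ?T))"]
      by (simp add: raw_comp raw_action raw_tns raw_idt)
  qed
qed simp_all

text \<open>The counterpart of \<open>cnat_postcomp\<close> for several variables, on which
  uniqueness of arrows out of tensor powers of \<open>E\<close> rests.\<close>

lemma Nat_c_postcomp:
  assumes \<phi>: "Nat_c C A a M p B b FO FM \<xi> n D \<phi>" and D: "D \<in> obj A" "D' \<in> obj A" and h: "h \<in> hom A D D'"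
  shows "Nat_c C A a M p B b FO FM \<xi> n D' (\<lambda>Ps. (ident A (TF Ps) \<boxtimes>\<^bsub>M\<^esub> h) \<cdot>\<^bsub>A\<^esub> \<phi> Ps)"
proof -
  let ?h = "ar D h D'" and ?\<phi> = "\<lambda>Ps. ar (TF Ps) (\<phi> Ps) (TF Ps \<odot> D)"
  have hom: "\<phi> Ps \<in> hom A (TF Ps) (TF Ps \<odot> D)" if "length Ps = n" "set Ps \<subseteq> obj B" for Ps
    using \<phi> that unfolding Nat_c_def by blast
  have 1: "raw ((idt (TF Ps) \<star> ?h) \<bullet> ?\<phi> Ps) = Some ((ident A (TF Ps) \<boxtimes>\<^bsub>M\<^esub> h) \<cdot>\<^bsub>A\<^esub> \<phi> Ps)"
    if "length Ps = n" "set Ps \<subseteq> obj B" for Ps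
    using that hom[OF that] D h by (simp add: raw_comp raw_tns raw_idt)
  show ?thesis
    unfolding Nat_c_def
  proof (intro conjI allI impI ballI)
    fix Ps assume *: "length Ps = n \<and> set Ps \<subseteq> obj B"
    have "valid ((idt (TF Ps) \<star> ?h) \<bullet> ?\<phi> Ps)" using * hom D h by simp
    from valid_hom[OF this] show "(ident A (TF Ps) \<boxtimes>\<^bsub>M\<^esub> h) \<cdot>\<^bsub>A\<^esub> \<phi> Ps \<in> hom A (TF Ps) (TF Ps \<odot> D')"
      using * 1 by simp
  next
    fix Ps Qs fs
    assume *: "length Ps = n \<and> length Qs = n \<and> length fs = n \<and> set Ps \<subseteq> obj B \<and> set Qs \<subseteq> obj B \<and>
        (\<forall>k<n. fs ! k \<in> hom B (Ps ! k) (Qs ! k))"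
    let ?t = "tensm_list A M (map FM fs)"
    have t: "?t \<in> hom A (TF Ps) (TF Qs)" using * by (intro tensm_list_hom) auto
    have o: "TF Ps \<in> obj A" "TF Qs \<in> obj A" "\<phi> Ps \<in> hom A (TF Ps) (TF Ps \<odot> D)" "\<phi> Qs \<in> hom A (TF Qs) (TF Qs \<odot> D)"
      using * hom by auto
    have "\<phi> Qs \<cdot>\<^bsub>A\<^esub> ?t = (?t \<boxtimes>\<^bsub>M\<^esub> ident A D) \<cdot>\<^bsub>A\<^esub> \<phi> Ps" using \<phi> * unfolding Nat_c_def by blast
    then have "raw (?\<phi> Qs \<bullet> ar (TF Ps) ?t (TF Qs)) = raw ((ar (TF Ps) ?t (TF Qs) \<star> idt D) \<bullet> ?\<phi> Ps)"
      using o t D by (simp add: raw_comp raw_tns raw_idt)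
    then have n: "?\<phi> Qs \<bullet> ar (TF Ps) ?t (TF Qs) = (ar (TF Ps) ?t (TF Qs) \<star> idt D) \<bullet> ?\<phi> Ps"
      by (intro arrow.expand) simp
    have "((idt (TF Qs) \<star> ?h) \<bullet> ?\<phi> Qs) \<bullet> ar (TF Ps) ?t (TF Qs) =
        ((idt (TF Qs) \<star> ?h) \<bullet> (ar (TF Ps) ?t (TF Qs) \<star> idt D)) \<bullet> ?\<phi> Ps"
      by (simp add: n comp_assoc)
    also have "\<dots> = (ar (TF Ps) ?t (TF Qs) \<star> idt D') \<bullet> ((idt (TF Ps) \<star> ?h) \<bullet> ?\<phi> Ps)"
      using o t D h by (simp add: tns_merge comp_assoc)
    finally have "((idt (TF Qs) \<star> ?h) \<bullet> ?\<phi> Qs) \<bullet> ar (TF Ps) ?t (TF Qs) =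
        (ar (TF Ps) ?t (TF Qs) \<star> idt D') \<bullet> ((idt (TF Ps) \<star> ?h) \<bullet> ?\<phi> Ps)" .
    from arg_cong[OF this, of raw] show "((ident A (TF Qs) \<boxtimes>\<^bsub>M\<^esub> h) \<cdot>\<^bsub>A\<^esub> \<phi> Qs) \<cdot>\<^bsub>A\<^esub> ?t =
       (?t \<boxtimes>\<^bsub>M\<^esub> ident A D') \<cdot>\<^bsub>A\<^esub> ((ident A (TF Ps) \<boxtimes>\<^bsub>M\<^esub> h) \<cdot>\<^bsub>A\<^esub> \<phi> Ps)"
      using o t D h by (simp add: raw_comp raw_tns raw_idt)
  next
    fix Ps X k assume X: "X \<in> obj C" and k: "k < n" and *: "length Ps = n \<and> set Ps \<subseteq> obj B"
    let ?Ps = "Ps[k := X \<triangleright>\<^sub>B (Ps ! k)]"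
    let ?x = "xi_list A M p FO \<xi> X k Ps"
    let ?xi = "ar (TF ?Ps) ?x (X \<triangleright> TF Ps)"
    have x: "?x \<in> hom A (TF ?Ps) (X \<triangleright> TF Ps)" using * X k by (intro xi_list_hom) auto
    have "Ps ! k \<in> obj B" using * k nth_mem[of k Ps] by auto
    then have Ps: "length ?Ps = n" "set ?Ps \<subseteq> obj B"
      using * X set_update_subset_insert[of Ps k "X \<triangleright>\<^sub>B (Ps ! k)"] by auto
    have o: "TF Ps \<in> obj A" "TF ?Ps \<in> obj A" "\<phi> Ps \<in> hom A (TF Ps) (TF Ps \<odot> D)" "\<phi> ?Ps \<in> hom A (TF ?Ps) (TF ?Ps \<odot> D)"
      using * Ps hom by auto
    have "pull1 p X (TF Ps) D \<cdot>\<^bsub>A\<^esub> (?x \<boxtimes>\<^bsub>M\<^esub> ident A D) \<cdot>\<^bsub>A\<^esub> \<phi> ?Ps = (ident C X \<unrhd>\<^bsub>a\<^esub> \<phi> Ps) \<cdot>\<^bsub>A\<^esub> ?x"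
      using \<phi> * X k unfolding Nat_c_def by blast
    then have "raw ((p1 X (TF Ps) D \<bullet> (?xi \<star> idt D)) \<bullet> ?\<phi> ?Ps) = raw (pa X (?\<phi> Ps) \<bullet> ?xi)"
      using o x X D by (simp add: raw_comp raw_tns raw_idt raw_action)
    then have n: "p1 X (TF Ps) D \<bullet> (?xi \<star> idt D) \<bullet> ?\<phi> ?Ps = pa X (?\<phi> Ps) \<bullet> ?xi"
      by (intro arrow.expand) (simp add: comp_assoc)
    have 2: "(?xi \<star> idt D') \<bullet> (idt (TF ?Ps) \<star> ?h) = (idt (X \<triangleright> TF Ps) \<star> ?h) \<bullet> (?xi \<star> idt D)"
      using o x X D h by (simp add: tns_merge)
    have 3: "p1 X (TF Ps) D' \<bullet> (idt (X \<triangleright> TF Ps) \<star> ?h) = pa X (idt (TF Ps) \<star> ?h) \<bullet> p1 X (TF Ps) D"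
      using o X D h p1_nat[of X "idt (TF Ps)" ?h] by simp
    have "(p1 X (TF Ps) D' \<bullet> (?xi \<star> idt D')) \<bullet> ((idt (TF ?Ps) \<star> ?h) \<bullet> ?\<phi> ?Ps) = pa X ((idt (TF Ps) \<star> ?h) \<bullet> ?\<phi> Ps) \<bullet> ?xi"
      using o x X D h n by (simp add: 2[THEN comp_ext] 3[THEN comp_ext] pa_comp comp_assoc)
    from arg_cong[OF this, of raw]
    show "pull1 p X (TF Ps) D' \<cdot>\<^bsub>A\<^esub> (?x \<boxtimes>\<^bsub>M\<^esub> ident A D') \<cdot>\<^bsub>A\<^esub> ((ident A (TF ?Ps) \<boxtimes>\<^bsub>M\<^esub> h) \<cdot>\<^bsub>A\<^esub> \<phi> ?Ps) =
       (ident C X \<unrhd>\<^bsub>a\<^esub> ((ident A (TF Ps) \<boxtimes>\<^bsub>M\<^esub> h) \<cdot>\<^bsub>A\<^esub> \<phi> Ps)) \<cdot>\<^bsub>A\<^esub> ?x"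
      using o x X D h by (simp add: raw_comp raw_tns raw_idt raw_action)
  qed
qed

end

section \<open>The bialgebra structure\<close>

text \<open>The monoidal functor has target \<open>A\<^sub>0\<close>, so \<open>J P Q\<close> and
  \<open>\<xi> X P\<close> are arrows of \<open>A\<^sub>0\<close> and can be comodule maps; the
  coend is formed for the same functor viewed as a functor into \<open>A\<close>.\<close>

locale coend_bialgebra =
  braided_action_calculus C MC \<beta> A a M p \<tau> +
  coend_universal C MC \<beta> A a M p B b FO FM \<xi> E i +
  subcat_calculus A M A\<^sub>0 +
  J: c_monoidal_functor C MC \<beta> B b N q A\<^sub>0 a M p FO FM \<xi> J J\<^sub>0
  for C :: "('c, 'd) cat" and MC :: "('c, 'd) monoidal" and \<beta> :: "'c \<Rightarrow> 'c \<Rightarrow> 'd"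
    and A :: "('o, 'm) cat" and a :: "('c, 'd, 'o, 'm) action"
    and M :: "('o, 'm) monoidal" and p :: "('c, 'o, 'm) pulls" and \<tau> :: "'o \<Rightarrow> 'o \<Rightarrow> 'm"
    and B :: "('b, 'n) cat" and b :: "('c, 'd, 'b, 'n) action"
    and FO :: "'b \<Rightarrow> 'o" and FM :: "'n \<Rightarrow> 'm" and \<xi> :: "'c \<Rightarrow> 'b \<Rightarrow> 'm"
    and E :: 'o and i :: "'b \<Rightarrow> 'm" and A\<^sub>0 :: "('o, 'm) cat"
    and N :: "('b, 'n) monoidal" and q :: "('c, 'b, 'n) pulls"
    and J :: "'b \<Rightarrow> 'b \<Rightarrow> 'm" and J\<^sub>0 :: 'm +
  assumes multi: "multirepresentable C A a M p \<tau> B b FO FM \<xi> E (coend_delta A M FO i)"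
begin

abbreviation nobj (infixr "\<odot>\<^sub>B" 75) where "P \<odot>\<^sub>B Q \<equiv> P \<otimes>\<^bsub>N\<^esub> Q"
abbreviation unB where "unB \<equiv> uno N"
abbreviation jn where "jn P Q \<equiv> ar (FO P \<odot> FO Q) (J P Q) (FO (P \<odot>\<^sub>B Q))"
abbreviation j0 where "j0 \<equiv> ar un J\<^sub>0 (FO unB)"
abbreviation dC where "dC \<equiv> coend_delta A M FO i"

lemma monB: "monoidal_category B N"
  by (rule J.src.monoidal_category_axioms)

lemma nobj [simp]: "\<lbrakk>P \<in> obj B; Q \<in> obj B\<rbrakk> \<Longrightarrow> P \<odot>\<^sub>B Q \<in> obj B" and unB_obj [simp]: "unB \<in> obj B"
  using cat_bifunctor.obj_map[OF monoidal_category.axioms(1)[OF monB]] monoidal_category.uno_obj[OF monB] by auto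

lemma F0_obj [simp]: "P \<in> obj B \<Longrightarrow> FO P \<in> obj A\<^sub>0"
  by (rule J.obj_map)

lemma F0_hom [simp]: "\<lbrakk>f \<in> hom B P Q; P \<in> obj B; Q \<in> obj B\<rbrakk> \<Longrightarrow> FM f \<in> hom A\<^sub>0 (FO P) (FO Q)"
  by (rule J.hom_map)

lemma jn_iso:
  assumes "P \<in> obj B" "Q \<in> obj B"
  shows "isom (jn P Q)" "v0 (jn P Q)" "v0 (rv (jn P Q))"
  using iso0[OF J.J_iso[OF assms]] assms by auto

lemma j0_iso: "isom j0" "v0 j0" "v0 (rv j0)"
  using iso0[OF J.J0_iso] by auto

lemma J_hom [simp]: "\<lbrakk>P \<in> obj B; Q \<in> obj B\<rbrakk> \<Longrightarrow> J P Q \<in> hom A (FO P \<odot> FO Q) (FO (P \<odot>\<^sub>B Q))"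
  "\<lbrakk>P \<in> obj B; Q \<in> obj B\<rbrakk> \<Longrightarrow> J P Q \<in> hom A\<^sub>0 (FO P \<odot> FO Q) (FO (P \<odot>\<^sub>B Q))"
  "J\<^sub>0 \<in> hom A un (FO unB)" "J\<^sub>0 \<in> hom A\<^sub>0 un (FO unB)"
  using isom_valid[OF jn_iso(1)[of P Q]] jn_iso(2)[of P Q] isom_valid[OF j0_iso(1)] j0_iso(2) by auto

lemma isom_jn [simp]: "\<lbrakk>P \<in> obj B; Q \<in> obj B\<rbrakk> \<Longrightarrow> isom (jn P Q)" and isom_j0 [simp]: "isom j0"
  by (rule jn_iso j0_iso; assumption)+

lemma tnsB_hom: "\<lbrakk>f \<in> hom B P P'; g \<in> hom B Q Q'; P \<in> obj B; P' \<in> obj B; Q \<in> obj B; Q' \<in> obj B\<rbrakk>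
   \<Longrightarrow> f \<boxtimes>\<^bsub>N\<^esub> g \<in> hom B (P \<odot>\<^sub>B Q) (P' \<odot>\<^sub>B Q')"
  using cat_bifunctor.hom_map[OF monoidal_category.axioms(1)[OF monB]] by metis

text \<open>The axiom for \<open>J\<close> is an equation between composites in
  \<open>A\<^sub>0\<close>; \<open>raw_comp0\<close> lets it be read in \<open>A\<close>. The other
  laws for \<open>J\<close> are imported in the same way.\<close>

lemma jn_nat:
  assumes "f \<in> hom B P P'" "g \<in> hom B Q Q'" "P \<in> obj B" "P' \<in> obj B" "Q \<in> obj B" "Q' \<in> obj B"
  shows "jn P' Q' \<bullet> (fm P P' f \<star> fm Q Q' g) = fm (P \<odot>\<^sub>B Q) (P' \<odot>\<^sub>B Q') (f \<boxtimes>\<^bsub>N\<^esub> g) \<bullet> jn P Q"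
  using assms c_bimorphism.natural[OF J.J_c_bimorphism, of P P' Q Q' f g] tnsB_hom[OF assms]
  by (intro arrow.expand) (simp add: raw_comp0 raw_tns)

lemma iso_homB: "iso B P Q f \<Longrightarrow> f \<in> hom B P Q"
  by (auto simp: iso_def inverse_arrows_def)

lemma cohB_hom [simp]:
  "\<lbrakk>P \<in> obj B; Q \<in> obj B; R \<in> obj B\<rbrakk> \<Longrightarrow> assoc N P Q R \<in> hom B ((P \<odot>\<^sub>B Q) \<odot>\<^sub>B R) (P \<odot>\<^sub>B Q \<odot>\<^sub>B R)"
  "P \<in> obj B \<Longrightarrow> lunit N P \<in> hom B (unB \<odot>\<^sub>B P) P" "P \<in> obj B \<Longrightarrow> runit N P \<in> hom B (P \<odot>\<^sub>B unB) P"
  by (intro iso_homB monoidal_category.assoc_iso[OF monB] monoidal_category.lunit_iso[OF monB]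
      monoidal_category.runit_iso[OF monB]; assumption)+

lemma jn_assoc:
  assumes "P \<in> obj B" "Q \<in> obj B" "R \<in> obj B"
  shows "fm ((P \<odot>\<^sub>B Q) \<odot>\<^sub>B R) (P \<odot>\<^sub>B Q \<odot>\<^sub>B R) (assoc N P Q R) \<bullet> jn (P \<odot>\<^sub>B Q) R \<bullet> (jn P Q \<star> idt (FO R)) =
    jn P (Q \<odot>\<^sub>B R) \<bullet> (idt (FO P) \<star> jn Q R) \<bullet> as (FO P) (FO Q) (FO R)"
proof -
  have "raw ((fm ((P \<odot>\<^sub>B Q) \<odot>\<^sub>B R) (P \<odot>\<^sub>B Q \<odot>\<^sub>B R) (assoc N P Q R) \<bullet> jn (P \<odot>\<^sub>B Q) R) \<bullet> (jn P Q \<star> idt (FO R))) =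
    raw ((jn P (Q \<odot>\<^sub>B R) \<bullet> (idt (FO P) \<star> jn Q R)) \<bullet> as (FO P) (FO Q) (FO R))"
    using assms J.J_assoc[OF assms] by (simp add: raw_comp0 raw_tns raw_idt raw_monoidal ident0)
  then show ?thesis by (intro arrow.expand) (simp add: comp_assoc)
qed

lemma jn_unit:
  assumes "P \<in> obj B"
  shows "fm (unB \<odot>\<^sub>B P) P (lunit N P) \<bullet> jn unB P \<bullet> (j0 \<star> idt (FO P)) = lu (FO P)"
    and "fm (P \<odot>\<^sub>B unB) P (runit N P) \<bullet> jn P unB \<bullet> (idt (FO P) \<star> j0) = ru (FO P)"
proof -
  have "raw ((fm (unB \<odot>\<^sub>B P) P (lunit N P) \<bullet> jn unB P) \<bullet> (j0 \<star> idt (FO P))) = raw (lu (FO P))"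
    "raw ((fm (P \<odot>\<^sub>B unB) P (runit N P) \<bullet> jn P unB) \<bullet> (idt (FO P) \<star> j0)) = raw (ru (FO P))"
    using assms J.J_lunit[OF assms] J.J_runit[OF assms]
    by (simp_all add: raw_comp0 raw_tns raw_idt raw_monoidal ident0)
  then show "fm (unB \<odot>\<^sub>B P) P (lunit N P) \<bullet> jn unB P \<bullet> (j0 \<star> idt (FO P)) = lu (FO P)"
    "fm (P \<odot>\<^sub>B unB) P (runit N P) \<bullet> jn P unB \<bullet> (idt (FO P) \<star> j0) = ru (FO P)"
    by (auto intro!: arrow.expand simp: comp_assoc)
qed

lemma pullB_hom [simp]:
  assumes "X \<in> obj C" "P \<in> obj B" "Q \<in> obj B"
  shows "pull1 q X P Q \<in> hom B ((X \<triangleright>\<^sub>B P) \<odot>\<^sub>B Q) (X \<triangleright>\<^sub>B (P \<odot>\<^sub>B Q))"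
    "pull2 q X P Q \<in> hom B (P \<odot>\<^sub>B (X \<triangleright>\<^sub>B Q)) (X \<triangleright>\<^sub>B (P \<odot>\<^sub>B Q))"
  using c_functor.xi_iso[OF J.src.c_functor_fst[of Q], of X P] c_functor.xi_iso[OF J.src.c_functor_snd[of P], of X Q] assms
  by (auto intro: iso_homB)

lemma xi0 [simp]:
  assumes "X \<in> obj C" "P \<in> obj B"
  shows "\<xi> X P \<in> hom A\<^sub>0 (FO (X \<triangleright>\<^sub>B P)) (X \<triangleright> FO P)"
  using J.xi_iso[OF assms] by (auto simp: iso_def inverse_arrows_def)

lemma act0 [simp]: "\<lbrakk>X \<in> obj C; P \<in> obj A\<^sub>0\<rbrakk> \<Longrightarrow> X \<triangleright> P \<in> obj A\<^sub>0"
  using cat_bifunctor.obj_map[OF c_category.axioms(2)[OF J.tgt.fst.c_category_axioms]] by metis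

lemma v0_pull [simp]:
  assumes "X \<in> obj C" "P \<in> obj A\<^sub>0" "Q \<in> obj A\<^sub>0"
  shows "v0 (p1 X P Q)" "v0 (p2 X P Q)"
  unfolding arr_pull1_def arr_pull2_def
  using iso0[OF c_functor.xi_iso[OF J.tgt.c_functor_fst[of Q], of X P]] assms
    iso0[OF c_functor.xi_iso[OF J.tgt.c_functor_snd[of P], of X Q]] by simp_all

lemma v0_pa [simp]: "\<lbrakk>X \<in> obj C; v0 f\<rbrakk> \<Longrightarrow> v0 (pa X f)"
  using cat_bifunctor.hom_map[OF c_category.axioms(2)[OF J.tgt.fst.c_category_axioms], of X X "dm f" "cd f" "ident C X" "the (raw f)"]
    v0D[of f] by (subst arr_valid_def) (simp add: raw_action ident_C)

lemma jn_pull: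
  assumes "X \<in> obj C" "P \<in> obj B" "Q \<in> obj B"
  shows "xi X (P \<odot>\<^sub>B Q) \<bullet> fm ((X \<triangleright>\<^sub>B P) \<odot>\<^sub>B Q) (X \<triangleright>\<^sub>B (P \<odot>\<^sub>B Q)) (pull1 q X P Q) \<bullet> jn (X \<triangleright>\<^sub>B P) Q =
      pa X (jn P Q) \<bullet> p1 X (FO P) (FO Q) \<bullet> (xi X P \<star> idt (FO Q))"
    and "xi X (P \<odot>\<^sub>B Q) \<bullet> fm (P \<odot>\<^sub>B (X \<triangleright>\<^sub>B Q)) (X \<triangleright>\<^sub>B (P \<odot>\<^sub>B Q)) (pull2 q X P Q) \<bullet> jn P (X \<triangleright>\<^sub>B Q) =
      pa X (jn P Q) \<bullet> p2 X (FO P) (FO Q) \<bullet> (idt (FO P) \<star> xi X Q)"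
proof -
  have "raw ((xi X (P \<odot>\<^sub>B Q) \<bullet> fm ((X \<triangleright>\<^sub>B P) \<odot>\<^sub>B Q) (X \<triangleright>\<^sub>B (P \<odot>\<^sub>B Q)) (pull1 q X P Q)) \<bullet> jn (X \<triangleright>\<^sub>B P) Q) =
      raw (pa X (jn P Q) \<bullet> (p1 X (FO P) (FO Q) \<bullet> (xi X P \<star> idt (FO Q))))"
    using assms c_bimorphism.compat_fst[OF J.J_c_bimorphism assms]
    by (simp add: raw_comp0 raw_tns raw_idt raw_action ident0)
  then show "xi X (P \<odot>\<^sub>B Q) \<bullet> fm ((X \<triangleright>\<^sub>B P) \<odot>\<^sub>B Q) (X \<triangleright>\<^sub>B (P \<odot>\<^sub>B Q)) (pull1 q X P Q) \<bullet> jn (X \<triangleright>\<^sub>B P) Q =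
      pa X (jn P Q) \<bullet> p1 X (FO P) (FO Q) \<bullet> (xi X P \<star> idt (FO Q))"
    by (intro arrow.expand) (simp add: comp_assoc)
  have "raw ((xi X (P \<odot>\<^sub>B Q) \<bullet> fm (P \<odot>\<^sub>B (X \<triangleright>\<^sub>B Q)) (X \<triangleright>\<^sub>B (P \<odot>\<^sub>B Q)) (pull2 q X P Q)) \<bullet> jn P (X \<triangleright>\<^sub>B Q)) =
      raw (pa X (jn P Q) \<bullet> (p2 X (FO P) (FO Q) \<bullet> (idt (FO P) \<star> xi X Q)))"
    using assms c_bimorphism.compat_snd[OF J.J_c_bimorphism assms]
    by (simp add: raw_comp0 raw_tns raw_idt raw_action ident0)
  then show "xi X (P \<odot>\<^sub>B Q) \<bullet> fm (P \<odot>\<^sub>B (X \<triangleright>\<^sub>B Q)) (X \<triangleright>\<^sub>B (P \<odot>\<^sub>B Q)) (pull2 q X P Q) \<bullet> jn P (X \<triangleright>\<^sub>B Q) =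
      pa X (jn P Q) \<bullet> p2 X (FO P) (FO Q) \<bullet> (idt (FO P) \<star> xi X Q)"
    by (intro arrow.expand) (simp add: comp_assoc)
qed

definition d2 :: "'b \<Rightarrow> 'b \<Rightarrow> ('o, 'm) arrow" where
  "d2 P Q = io (FO P) E (FO Q) E \<bullet> (de P \<star> de Q)"

definition d3 :: "'b \<Rightarrow> 'b \<Rightarrow> 'b \<Rightarrow> ('o, 'm) arrow" where
  "d3 P Q R = io (FO P) E (FO Q \<odot> FO R) (E \<odot> E) \<bullet> (de P \<star> d2 Q R)"

lemma d_simps [simp]:
  "dm (d2 P Q) = FO P \<odot> FO Q" "cd (d2 P Q) = (FO P \<odot> FO Q) \<odot> E \<odot> E"
  "dm (d3 P Q R) = FO P \<odot> FO Q \<odot> FO R" "cd (d3 P Q R) = (FO P \<odot> FO Q \<odot> FO R) \<odot> E \<odot> E \<odot> E"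
  "\<lbrakk>P \<in> obj B; Q \<in> obj B\<rbrakk> \<Longrightarrow> valid (d2 P Q)"
  "\<lbrakk>P \<in> obj B; Q \<in> obj B; R \<in> obj B\<rbrakk> \<Longrightarrow> valid (d3 P Q R)"
  by (simp_all add: d2_def d3_def)

lemma raw_d2: "\<lbrakk>P \<in> obj B; Q \<in> obj B\<rbrakk> \<Longrightarrow> raw (d2 P Q) = Some (delta_list A M \<tau> FO E dC [P, Q])"
  by (simp add: d2_def raw_comp raw_tns raw_io raw_de)

lemma raw_d3: "\<lbrakk>P \<in> obj B; Q \<in> obj B; R \<in> obj B\<rbrakk> \<Longrightarrow> raw (d3 P Q R) = Some (delta_list A M \<tau> FO E dC [P, Q, R])"
  by (simp add: d3_def raw_comp raw_tns raw_io raw_de raw_d2)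

lemma multi_ex1:
  assumes "D \<in> obj A" "Nat_c C A a M p B b FO FM \<xi> n D \<phi>"
  shows "\<exists>!h. h \<in> hom A (tens_list M (replicate n E)) D \<and>
      (\<forall>Ps. length Ps = n \<and> set Ps \<subseteq> obj B \<longrightarrow>
         \<phi> Ps = (ident A (TF Ps) \<boxtimes>\<^bsub>M\<^esub> h) \<cdot>\<^bsub>A\<^esub> delta_list A M \<tau> FO E dC Ps)"
  using multi assms unfolding multirepresentable_def by blast

text \<open>Both arrows factor the same natural family, the universal element followed by
  \<open>g\<close>.\<close>

lemma multi_unique:
  assumes "valid g" "valid h" "dm g = tens_list M (replicate n E)" "dm h = dm g" "cd g = cd h"
    "\<And>Ps. length Ps = n \<Longrightarrow> set Ps \<subseteq> obj B \<Longrightarrow>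
       (ident A (TF Ps) \<boxtimes>\<^bsub>M\<^esub> the (raw g)) \<cdot>\<^bsub>A\<^esub> delta_list A M \<tau> FO E dC Ps =
       (ident A (TF Ps) \<boxtimes>\<^bsub>M\<^esub> the (raw h)) \<cdot>\<^bsub>A\<^esub> delta_list A M \<tau> FO E dC Ps"
  shows "g = h"
proof -
  let ?E = "tens_list M (replicate n E)"
  have h: "the (raw g) \<in> hom A ?E (cd g)" "the (raw h) \<in> hom A ?E (cd g)"
    using valid_hom[of g] valid_hom[of h] assms(1-5) by auto
  have "Nat_c C A a M p B b FO FM \<xi> n ?E (delta_list A M \<tau> FO E dC)"
    using multi unfolding multirepresentable_def by blast
  from multi_ex1[OF _ Nat_c_postcomp[OF this _ _ h(1)]]
  have "the (raw g) = the (raw h)" using h assms(1-5) assms(6) valid_obj[of g] by metis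
  then have "raw g = raw h" using assms(1,2) by (metis valid_Some)
  then show ?thesis using assms(3-5) by (intro arrow.expand) simp
qed

lemma d2_unique:
  assumes "valid g" "valid h" "dm g = E \<odot> E" "dm h = E \<odot> E" "cd g = cd h"
    and eq: "\<And>P Q. P \<in> obj B \<Longrightarrow> Q \<in> obj B \<Longrightarrow> (idt (FO P \<odot> FO Q) \<star> g) \<bullet> d2 P Q = (idt (FO P \<odot> FO Q) \<star> h) \<bullet> d2 P Q"
  shows "g = h"
proof (rule multi_unique[of g h 2])
  fix Ps assume "length Ps = 2" "set Ps \<subseteq> obj B"
  then obtain P Q where [simp]: "Ps = [P, Q]" and o: "P \<in> obj B" "Q \<in> obj B"
    by (auto simp: numeral_2_eq_2 length_Suc_conv)
  from arg_cong[OF eq[OF o], of raw] assms(1-5) o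
  show "(ident A (TF Ps) \<boxtimes>\<^bsub>M\<^esub> the (raw g)) \<cdot>\<^bsub>A\<^esub> delta_list A M \<tau> FO E dC Ps =
       (ident A (TF Ps) \<boxtimes>\<^bsub>M\<^esub> the (raw h)) \<cdot>\<^bsub>A\<^esub> delta_list A M \<tau> FO E dC Ps"
    by (simp add: raw_comp raw_tns raw_idt raw_d2 del: delta_list.simps)
qed (use assms in \<open>auto simp: numeral_2_eq_2\<close>)

lemma d3_unique:
  assumes "valid g" "valid h" "dm g = E \<odot> E \<odot> E" "dm h = E \<odot> E \<odot> E" "cd g = cd h"
    and eq: "\<And>P Q R. P \<in> obj B \<Longrightarrow> Q \<in> obj B \<Longrightarrow> R \<in> obj B \<Longrightarrow>
      (idt (FO P \<odot> FO Q \<odot> FO R) \<star> g) \<bullet> d3 P Q R = (idt (FO P \<odot> FO Q \<odot> FO R) \<star> h) \<bullet> d3 P Q R"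
  shows "g = h"
proof (rule multi_unique[of g h 3])
  fix Ps assume "length Ps = 3" "set Ps \<subseteq> obj B"
  then obtain P Q R where [simp]: "Ps = [P, Q, R]" and o: "P \<in> obj B" "Q \<in> obj B" "R \<in> obj B"
    by (auto simp: numeral_3_eq_3 length_Suc_conv)
  from arg_cong[OF eq[OF o], of raw] assms(1-5) o
  show "(ident A (TF Ps) \<boxtimes>\<^bsub>M\<^esub> the (raw g)) \<cdot>\<^bsub>A\<^esub> delta_list A M \<tau> FO E dC Ps =
       (ident A (TF Ps) \<boxtimes>\<^bsub>M\<^esub> the (raw h)) \<cdot>\<^bsub>A\<^esub> delta_list A M \<tau> FO E dC Ps"
    by (simp add: raw_comp raw_tns raw_idt raw_d3 del: delta_list.simps)
qed (use assms in \<open>auto simp: numeral_3_eq_3\<close>)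

text \<open>The coaction that \<open>FO P \<odot> FO Q\<close> receives from the universal one at
  \<open>P \<odot>\<^sub>B Q\<close> along \<open>J\<close>. The multiplication is its factorization
  through \<open>d2\<close>.\<close>

definition dj :: "'b \<Rightarrow> 'b \<Rightarrow> ('o, 'm) arrow" where
  "dj P Q = (rv (jn P Q) \<star> idt E) \<bullet> de (P \<odot>\<^sub>B Q) \<bullet> jn P Q"

lemma dj_simps [simp]: "dm (dj P Q) = FO P \<odot> FO Q" "cd (dj P Q) = (FO P \<odot> FO Q) \<odot> E"
  "\<lbrakk>P \<in> obj B; Q \<in> obj B\<rbrakk> \<Longrightarrow> valid (dj P Q)"
  by (simp_all add: dj_def)

lemma raw_dj:
  assumes "P \<in> obj B" "Q \<in> obj B"
  shows "raw (dj P Q) = Some ((inv_arr A (FO P \<odot> FO Q) (FO (P \<odot>\<^sub>B Q)) (J P Q) \<boxtimes>\<^bsub>M\<^esub> ident A E) \<cdot>\<^bsub>A\<^esub> dC (P \<odot>\<^sub>B Q) \<cdot>\<^bsub>A\<^esub> J P Q)"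
proof -
  have "raw (dj P Q) = raw (((rv (jn P Q) \<star> idt E) \<bullet> de (P \<odot>\<^sub>B Q)) \<bullet> jn P Q)" by (simp add: dj_def comp_assoc)
  then show ?thesis using assms by (simp add: raw_comp raw_tns raw_idt raw_de raw_rv)
qed

lemma dj_nat:
  assumes "f \<in> hom B P P'" "g \<in> hom B Q Q'" "P \<in> obj B" "P' \<in> obj B" "Q \<in> obj B" "Q' \<in> obj B"
  shows "dj P' Q' \<bullet> (fm P P' f \<star> fm Q Q' g) = ((fm P P' f \<star> fm Q Q' g) \<star> idt E) \<bullet> dj P Q"
proof -
  let ?h = "fm (P \<odot>\<^sub>B Q) (P' \<odot>\<^sub>B Q') (f \<boxtimes>\<^bsub>N\<^esub> g)" and ?t = "fm P P' f \<star> fm Q Q' g"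
  note h = tnsB_hom[OF assms]
  have "rv (jn P' Q') \<bullet> ?h = ?t \<bullet> rv (jn P Q)"
    by (rule rv_square[OF jn_nat]) (use assms h in auto)
  then have "(rv (jn P' Q') \<star> idt E) \<bullet> (?h \<star> idt E) = (?t \<star> idt E) \<bullet> (rv (jn P Q) \<star> idt E)"
    using assms h by (simp flip: whisker_comp)
  from this[THEN comp_ext] show ?thesis
    using assms h de_nat[OF _ _ h, THEN comp_ext] by (simp add: dj_def comp_assoc jn_nat)
qed

text \<open>Covers both variables at once: \<open>x\<close> is the C-structure of the twofold tensor
  functor in one variable, \<open>k\<close> is the corresponding pull in \<open>B\<close>, and
  \<open>eq\<close> is one half of \<open>jn_pull\<close>. The rest is C-naturality of
  \<open>de\<close> at \<open>P \<odot>\<^sub>B Q\<close>.\<close>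

lemma dj_act:
  assumes o: "X \<in> obj C" "P \<in> obj B" "Q \<in> obj B" "P' \<in> obj B" "Q' \<in> obj B"
    and k: "k \<in> hom B (P' \<odot>\<^sub>B Q') (X \<triangleright>\<^sub>B (P \<odot>\<^sub>B Q))"
    and x: "valid x" "dm x = FO P' \<odot> FO Q'" "cd x = X \<triangleright> (FO P \<odot> FO Q)"
    and eq: "xi X (P \<odot>\<^sub>B Q) \<bullet> fm (P' \<odot>\<^sub>B Q') (X \<triangleright>\<^sub>B (P \<odot>\<^sub>B Q)) k \<bullet> jn P' Q' = pa X (jn P Q) \<bullet> x"
  shows "p1 X (FO P \<odot> FO Q) E \<bullet> (x \<star> idt E) \<bullet> dj P' Q' = pa X (dj P Q) \<bullet> x"
proof -
  let ?R = "P \<odot>\<^sub>B Q" and ?k = "fm (P' \<odot>\<^sub>B Q') (X \<triangleright>\<^sub>B (P \<odot>\<^sub>B Q)) k"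
  have "rv (pa X (jn P Q)) \<bullet> (xi X ?R \<bullet> ?k) = x \<bullet> rv (jn P' Q')"
    by (rule rv_square) (use assms in \<open>auto simp: comp_assoc\<close>)
  then have "(x \<star> idt E) \<bullet> (rv (jn P' Q') \<star> idt E) = ((pa X (rv (jn P Q)) \<bullet> xi X ?R \<bullet> ?k) \<star> idt E)"
    using assms by (simp add: rv_pa flip: whisker_comp)
  then have "(x \<star> idt E) \<bullet> dj P' Q' = (pa X (rv (jn P Q)) \<star> idt E) \<bullet> (xi X ?R \<star> idt E) \<bullet> ((?k \<star> idt E) \<bullet> de (P' \<odot>\<^sub>B Q')) \<bullet> jn P' Q'"
    using assms comp_ext[of "x \<star> idt E" "rv (jn P' Q') \<star> idt E"] by (simp add: dj_def whisker_comp comp_assoc)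
  also have "(?k \<star> idt E) \<bullet> de (P' \<odot>\<^sub>B Q') = de (X \<triangleright>\<^sub>B ?R) \<bullet> ?k"
    using assms de_nat[OF _ _ k] by simp
  finally have "p1 X (FO P \<odot> FO Q) E \<bullet> (x \<star> idt E) \<bullet> dj P' Q' =
     (p1 X (FO P \<odot> FO Q) E \<bullet> (pa X (rv (jn P Q)) \<star> idt E)) \<bullet> (xi X ?R \<star> idt E) \<bullet> de (X \<triangleright>\<^sub>B ?R) \<bullet> ?k \<bullet> jn P' Q'"
    by (simp add: comp_assoc)
  also have "p1 X (FO P \<odot> FO Q) E \<bullet> (pa X (rv (jn P Q)) \<star> idt E) = pa X (rv (jn P Q) \<star> idt E) \<bullet> p1 X (FO ?R) E"
    using assms by (simp add: p1_nat)
  also have "(pa X (rv (jn P Q) \<star> idt E) \<bullet> p1 X (FO ?R) E) \<bullet> (xi X ?R \<star> idt E) \<bullet> de (X \<triangleright>\<^sub>B ?R) \<bullet> ?k \<bullet> jn P' Q' =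
     pa X (rv (jn P Q) \<star> idt E) \<bullet> (p1 X (FO ?R) E \<bullet> (xi X ?R \<star> idt E) \<bullet> de (X \<triangleright>\<^sub>B ?R)) \<bullet> ?k \<bullet> jn P' Q'"
    by (simp add: comp_assoc)
  also have "\<dots> = pa X (rv (jn P Q) \<star> idt E) \<bullet> pa X (de ?R) \<bullet> (xi X ?R \<bullet> ?k \<bullet> jn P' Q')"
    using assms by (simp add: de_act comp_assoc)
  also have "\<dots> = pa X (dj P Q) \<bullet> x"
    unfolding eq using assms by (simp add: dj_def pa_comp comp_assoc)
  finally show ?thesis .
qed

lemma Nat_c_dj: "Nat_c C A a M p B b FO FM \<xi> 2 E (\<lambda>Ps. the (raw (dj (Ps ! 0) (Ps ! 1))))"
  unfolding Nat_c_def
proof (intro conjI allI impI ballI)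
  fix Ps :: "'b list" assume "length Ps = 2 \<and> set Ps \<subseteq> obj B"
  then obtain P Q where "Ps = [P, Q]" "P \<in> obj B" "Q \<in> obj B"
    by (auto simp: numeral_2_eq_2 length_Suc_conv)
  then show "the (raw (dj (Ps ! 0) (Ps ! 1))) \<in> hom A (TF Ps) (TF Ps \<odot> E)"
    using valid_hom[of "dj P Q"] by simp
next
  fix Ps Qs :: "'b list" and fs
  assume *: "length Ps = 2 \<and> length Qs = 2 \<and> length fs = 2 \<and> set Ps \<subseteq> obj B \<and> set Qs \<subseteq> obj B \<and>
      (\<forall>k<2. fs ! k \<in> hom B (Ps ! k) (Qs ! k))"
  then obtain P P' Q Q' f g where [simp]: "Ps = [P, Q]" "Qs = [P', Q']" "fs = [f, g]"
    and o: "P \<in> obj B" "Q \<in> obj B" "P' \<in> obj B" "Q' \<in> obj B"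
    by (auto simp: numeral_2_eq_2 length_Suc_conv)
  have fg: "f \<in> hom B P P'" "g \<in> hom B Q Q'" using * by (auto simp: numeral_2_eq_2 less_Suc_eq)
  from arg_cong[OF dj_nat[OF fg o(1,3,2,4)], of raw]
  show "the (raw (dj (Qs ! 0) (Qs ! 1))) \<cdot>\<^bsub>A\<^esub> tensm_list A M (map FM fs) =
     (tensm_list A M (map FM fs) \<boxtimes>\<^bsub>M\<^esub> ident A E) \<cdot>\<^bsub>A\<^esub> the (raw (dj (Ps ! 0) (Ps ! 1)))"
    using o fg by (simp add: raw_comp raw_tns raw_idt)
next
  fix Ps :: "'b list" and X and k :: nat
  assume X: "X \<in> obj C" and k: "k < 2" and *: "length Ps = 2 \<and> set Ps \<subseteq> obj B"
  then obtain P Q where [simp]: "Ps = [P, Q]" and o: "P \<in> obj B" "Q \<in> obj B"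
    by (auto simp: numeral_2_eq_2 length_Suc_conv)
  let ?Ps = "Ps[k := X \<triangleright>\<^sub>B (Ps ! k)]"
  consider "k = 0" | "k = 1" using k by linarith
  then show "pull1 p X (TF Ps) E \<cdot>\<^bsub>A\<^esub> (xi_list A M p FO \<xi> X k Ps \<boxtimes>\<^bsub>M\<^esub> ident A E) \<cdot>\<^bsub>A\<^esub> the (raw (dj (?Ps ! 0) (?Ps ! 1))) =
     (ident C X \<unrhd>\<^bsub>a\<^esub> the (raw (dj (Ps ! 0) (Ps ! 1)))) \<cdot>\<^bsub>A\<^esub> xi_list A M p FO \<xi> X k Ps"
  proof cases
    case 1
    let ?x = "p1 X (FO P) (FO Q) \<bullet> (xi X P \<star> idt (FO Q))"
    have "p1 X (FO P \<odot> FO Q) E \<bullet> (?x \<star> idt E) \<bullet> dj (X \<triangleright>\<^sub>B P) Q = pa X (dj P Q) \<bullet> ?x"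
      by (rule dj_act[OF _ _ _ _ _ _ _ _ _ jn_pull(1)]) (use X o in auto)
    then have "raw ((p1 X (FO P \<odot> FO Q) E \<bullet> (?x \<star> idt E)) \<bullet> dj (X \<triangleright>\<^sub>B P) Q) = raw (pa X (dj P Q) \<bullet> ?x)"
      by (simp add: comp_assoc)
    then show ?thesis using 1 X o by (simp add: raw_comp raw_tns raw_idt raw_action Let_def)
  next
    case 2
    let ?x = "p2 X (FO P) (FO Q) \<bullet> (idt (FO P) \<star> xi X Q)"
    have "p1 X (FO P \<odot> FO Q) E \<bullet> (?x \<star> idt E) \<bullet> dj P (X \<triangleright>\<^sub>B Q) = pa X (dj P Q) \<bullet> ?x"
      by (rule dj_act[OF _ _ _ _ _ _ _ _ _ jn_pull(2)]) (use X o in auto)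
    then have "raw ((p1 X (FO P \<odot> FO Q) E \<bullet> (?x \<star> idt E)) \<bullet> dj P (X \<triangleright>\<^sub>B Q)) = raw (pa X (dj P Q) \<bullet> ?x)"
      by (simp add: comp_assoc)
    then show ?thesis using 2 X o by (simp add: raw_comp raw_tns raw_idt raw_action Let_def)
  qed
qed

abbreviation mult where "mult \<equiv> coend_mult A M \<tau> B N FO J E dC"
abbreviation unit where "unit \<equiv> coend_unit A M N FO J\<^sub>0 E dC"

text \<open>Multirepresentability for two variables factors \<open>dj\<close> uniquely through
  \<open>d2\<close>, which makes the definite description in \<open>coend_mult\<close>
  denote.\<close>

lemma mult_spec: "mult \<in> hom A (E \<odot> E) E \<and>
    (\<forall>P\<in>obj B. \<forall>Q\<in>obj B. (idt (FO P \<odot> FO Q) \<star> ar (E \<odot> E) mult E) \<bullet> d2 P Q = dj P Q)"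
proof -
  have EE: "tens_list M (replicate 2 E) = E \<odot> E" by (simp add: numeral_2_eq_2)
  have all: "(\<forall>Ps. length Ps = 2 \<and> set Ps \<subseteq> obj B \<longrightarrow> \<Phi> Ps) \<longleftrightarrow> (\<forall>P\<in>obj B. \<forall>Q\<in>obj B. \<Phi> [P, Q])" for \<Phi>
    by (auto simp: numeral_2_eq_2 length_Suc_conv)
  have eq: "the (raw (dj P Q)) = (ident A (FO P \<odot> FO Q) \<boxtimes>\<^bsub>M\<^esub> h) \<cdot>\<^bsub>A\<^esub> delta_list A M \<tau> FO E dC [P, Q] \<longleftrightarrow>
      (idt (FO P \<odot> FO Q) \<star> ar (E \<odot> E) h E) \<bullet> d2 P Q = dj P Q"
    "(ident A (FO P \<odot> FO Q) \<boxtimes>\<^bsub>M\<^esub> h) \<cdot>\<^bsub>A\<^esub> delta_list A M \<tau> FO E dC [P, Q] =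
       (inv_arr A (FO P \<odot> FO Q) (FO (P \<odot>\<^sub>B Q)) (J P Q) \<boxtimes>\<^bsub>M\<^esub> ident A E) \<cdot>\<^bsub>A\<^esub> dC (P \<odot>\<^sub>B Q) \<cdot>\<^bsub>A\<^esub> J P Q \<longleftrightarrow>
      (idt (FO P \<odot> FO Q) \<star> ar (E \<odot> E) h E) \<bullet> d2 P Q = dj P Q"
    if "P \<in> obj B" "Q \<in> obj B" "h \<in> hom A (E \<odot> E) E" for P Q h
  proof -
    have "(idt (FO P \<odot> FO Q) \<star> ar (E \<odot> E) h E) \<bullet> d2 P Q = dj P Q \<longleftrightarrow>
      raw ((idt (FO P \<odot> FO Q) \<star> ar (E \<odot> E) h E) \<bullet> d2 P Q) = raw (dj P Q)"
      by (auto intro!: arrow.expand)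
    then show "the (raw (dj P Q)) = (ident A (FO P \<odot> FO Q) \<boxtimes>\<^bsub>M\<^esub> h) \<cdot>\<^bsub>A\<^esub> delta_list A M \<tau> FO E dC [P, Q] \<longleftrightarrow>
      (idt (FO P \<odot> FO Q) \<star> ar (E \<odot> E) h E) \<bullet> d2 P Q = dj P Q"
      "(ident A (FO P \<odot> FO Q) \<boxtimes>\<^bsub>M\<^esub> h) \<cdot>\<^bsub>A\<^esub> delta_list A M \<tau> FO E dC [P, Q] =
       (inv_arr A (FO P \<odot> FO Q) (FO (P \<odot>\<^sub>B Q)) (J P Q) \<boxtimes>\<^bsub>M\<^esub> ident A E) \<cdot>\<^bsub>A\<^esub> dC (P \<odot>\<^sub>B Q) \<cdot>\<^bsub>A\<^esub> J P Q \<longleftrightarrow>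
      (idt (FO P \<odot> FO Q) \<star> ar (E \<odot> E) h E) \<bullet> d2 P Q = dj P Q"
      using that by (auto simp: raw_comp raw_tns raw_idt raw_d2 raw_dj simp del: delta_list.simps)
  qed
  have "\<exists>!h. h \<in> hom A (E \<odot> E) E \<and>
      (\<forall>P\<in>obj B. \<forall>Q\<in>obj B. (idt (FO P \<odot> FO Q) \<star> ar (E \<odot> E) h E) \<bullet> d2 P Q = dj P Q)"
    using multi_ex1[OF E_obj Nat_c_dj] unfolding EE all
    by (simp add: eq del: delta_list.simps cong: conj_cong ball_cong)
  from theI'[OF this] show ?thesis
    unfolding coend_mult_def by (simp add: eq del: delta_list.simps cong: conj_cong ball_cong)
qed

definition dunit :: "('o, 'm) arrow" where
  "dunit = (rv j0 \<star> idt E) \<bullet> de unB \<bullet> j0"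

lemma dunit_simps [simp]: "valid dunit" "dm dunit = un" "cd dunit = un \<odot> E"
  by (simp_all add: dunit_def)

lemma unit_spec: "ar un unit E = lu E \<bullet> dunit" "unit \<in> hom A un E"
proof -
  have "raw (lu E \<bullet> dunit) = raw (((lu E \<bullet> (rv j0 \<star> idt E)) \<bullet> de unB) \<bullet> j0)"
    by (simp add: dunit_def comp_assoc)
  also have "\<dots> = Some unit"
    by (simp add: raw_comp raw_tns raw_idt raw_de raw_rv raw_monoidal coend_unit_def)
  finally have r: "raw (lu E \<bullet> dunit) = Some unit" .
  then show "ar un unit E = lu E \<bullet> dunit" by (intro arrow.expand) simp
  show "unit \<in> hom A un E" using valid_hom[of "lu E \<bullet> dunit"] r by simp
qed

sublocale T: tensor_coalgebra A M \<tau> E mult unit \<Delta> \<epsilon>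
  by unfold_locales (use mult_spec unit_spec in auto)

end

section \<open>From equations of typed arrows to the algebra and bialgebra axioms\<close>

context monoidal_calculus
begin

lemma algebraI:
  assumes "E \<in> obj A" "m \<in> hom A (E \<odot> E) E" "\<eta> \<in> hom A un E"
    and "ar (E \<odot> E) m E \<bullet> (ar (E \<odot> E) m E \<star> idt E) = ar (E \<odot> E) m E \<bullet> (idt E \<star> ar (E \<odot> E) m E) \<bullet> as E E E"
    and "ar (E \<odot> E) m E \<bullet> (ar un \<eta> E \<star> idt E) = lu E" "ar (E \<odot> E) m E \<bullet> (idt E \<star> ar un \<eta> E) = ru E"
  shows "algebra A M E m \<eta>"
proof -
  let ?m = "ar (E \<odot> E) m E" and ?e = "ar un \<eta> E"
  have "raw (?m \<bullet> (?m \<star> idt E)) = raw ((?m \<bullet> (idt E \<star> ?m)) \<bullet> as E E E)"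
    "raw (?m \<bullet> (?e \<star> idt E)) = raw (lu E)" "raw (?m \<bullet> (idt E \<star> ?e)) = raw (ru E)"
    using assms by (simp_all add: comp_assoc)
  then show ?thesis using assms(1-3)
    by (simp add: algebra_def raw_comp raw_tns raw_monoidal raw_idt)
qed

end

context tensor_coalgebra
begin

lemma bialgebraI:
  assumes "coalgebra A M E \<Delta> \<epsilon>" "algebra A M E m \<eta>"
    and "dl \<bullet> mu = (mu \<star> mu) \<bullet> io E E E E \<bullet> (dl \<star> dl)" "ep \<bullet> mu = lu un \<bullet> (ep \<star> ep)"
    and "dl \<bullet> et = (et \<star> et) \<bullet> rv (lu un)" "ep \<bullet> et = idt un"
  shows "bialgebra A M \<tau> E \<Delta> \<epsilon> m \<eta>"
proof -
  have "raw (dl \<bullet> mu) = raw (((mu \<star> mu) \<bullet> io E E E E) \<bullet> (dl \<star> dl))" "raw (ep \<bullet> mu) = raw (lu un \<bullet> (ep \<star> ep))"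
    "raw (dl \<bullet> et) = raw ((et \<star> et) \<bullet> rv (lu un))" "raw (ep \<bullet> et) = raw (idt un)"
    using assms by (simp_all add: comp_assoc)
  then show ?thesis using assms(1,2)
    by (simp add: bialgebra_def raw_comp raw_tns raw_monoidal raw_idt raw_io)
      (simp add: arr_inv_def raw_monoidal)
qed

end

section \<open>The bialgebra axioms for the coend\<close>

context coend_bialgebra
begin

lemma coaction_de [simp]: "P \<in> obj B \<Longrightarrow> T.coaction (de P)"
  by (rule T.coactionI) simp_all

lemma ct_de: "\<lbrakk>P \<in> obj B; Q \<in> obj B\<rbrakk> \<Longrightarrow> T.ct (de P) (de Q) = dj P Q"
  using mult_spec by (simp add: T.ct_def d2_def)

text \<open>The defining equation of the multiplication, read as a property of \<open>J\<close>. It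
  transfers to codiagonal coactions whatever holds for universal ones up to isomorphism.\<close>

lemma jn_chom: "\<lbrakk>P \<in> obj B; Q \<in> obj B\<rbrakk> \<Longrightarrow> T.chom (T.ct (de P) (de Q)) (de (P \<odot>\<^sub>B Q)) (jn P Q)"
  by (simp add: ct_de T.chom_def dj_def)

lemma fm_chom: "\<lbrakk>f \<in> hom B P Q; P \<in> obj B; Q \<in> obj B\<rbrakk> \<Longrightarrow> T.chom (de P) (de Q) (fm P Q f)"
  by (simp add: T.chom_def de_nat)

text \<open>\<open>T.cu\<close> is built from \<open>unit\<close>, and \<open>unit\<close> is the
  transported universal coaction followed by \<open>lu E\<close>; cancelling the invertible
  \<open>lu E\<close> identifies the two coactions on the unit object.\<close>

lemma cu_eq: "T.cu = dunit"
proof -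
  have "lu E \<bullet> T.cu = T.et" by (simp add: T.cu_def lu_nat[THEN comp_ext] comp_assoc)
  then have "lu E \<bullet> T.cu = lu E \<bullet> dunit" by (simp add: unit_spec)
  then show ?thesis by (rule isom_cancel_left) (use T.coaction_cu in auto)
qed

lemma j0_chom: "T.chom T.cu (de unB) j0"
  by (simp add: cu_eq T.chom_def dunit_def)

lemma de_coassoc: "P \<in> obj B \<Longrightarrow> T.coassoc (de P)" and de_counital: "P \<in> obj B \<Longrightarrow> T.counital (de P)"
  by (simp_all add: T.coassoc_def T.counital_def de_dl de_ep)

lemma cu_coassoc: "T.coassoc T.cu" and cu_counital: "T.counital T.cu"
  using T.coassoc_transfer[OF j0_chom] T.counital_transfer[OF j0_chom] de_coassoc de_counital by simp_all

text \<open>The image of the associator of \<open>B\<close> is a comodule map by naturality of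
  \<open>de\<close>, and the arrows \<open>jn\<close> are isomorphisms of coactions, so coherence of
  \<open>J\<close> makes the associator of \<open>A\<close> a comodule map. The argument is
  independent of associativity of \<open>mult\<close>, which is derived from it.\<close>

lemma ct_assoc_de:
  assumes "P \<in> obj B" "Q \<in> obj B" "R \<in> obj B"
  shows "(as (FO P) (FO Q) (FO R) \<star> idt E) \<bullet> T.ct (T.ct (de P) (de Q)) (de R) =
    T.ct (de P) (T.ct (de Q) (de R)) \<bullet> as (FO P) (FO Q) (FO R)"
proof -
  let ?L = "T.ct (T.ct (de P) (de Q)) (de R)" and ?R = "T.ct (de P) (T.ct (de Q) (de R))"
  let ?a = "as (FO P) (FO Q) (FO R)"
  \<comment> \<open>\<open>?H\<close> and \<open>?G\<close> collect the two bracketings into the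
    value of F at the triple product; by \<open>jn_assoc\<close>, \<open>?G\<close> is
    \<open>?H\<close> after the associator.\<close>
  let ?H = "jn P (Q \<odot>\<^sub>B R) \<bullet> (idt (FO P) \<star> jn Q R)"
  let ?G = "fm ((P \<odot>\<^sub>B Q) \<odot>\<^sub>B R) (P \<odot>\<^sub>B Q \<odot>\<^sub>B R) (assoc N P Q R) \<bullet> jn (P \<odot>\<^sub>B Q) R \<bullet> (jn P Q \<star> idt (FO R))"
  have idt: "T.chom (de S) (de S) (idt (FO S))" if "S \<in> obj B" for S
    using T.chom_idt[OF coaction_de[OF that]] by simp
  have H: "T.chom ?R (de (P \<odot>\<^sub>B Q \<odot>\<^sub>B R)) ?H"
    by (rule T.chom_comp[OF T.ct_chom[OF idt jn_chom] jn_chom]) (use assms in simp_all)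
  have "T.chom ?L (de ((P \<odot>\<^sub>B Q) \<odot>\<^sub>B R)) (jn (P \<odot>\<^sub>B Q) R \<bullet> (jn P Q \<star> idt (FO R)))"
    by (rule T.chom_comp[OF T.ct_chom[OF jn_chom idt] jn_chom]) (use assms in simp_all)
  then have "T.chom ?L (de (P \<odot>\<^sub>B Q \<odot>\<^sub>B R)) ?G"
    by (rule T.chom_comp[OF _ fm_chom]) (use assms in simp_all)
  then have G: "T.chom ?L (de (P \<odot>\<^sub>B Q \<odot>\<^sub>B R)) (?H \<bullet> ?a)"
    using assms by (simp add: jn_assoc comp_assoc)
  have "T.chom ?L ?R (rv ?H \<bullet> (?H \<bullet> ?a))"
    by (rule T.chom_comp[OF G T.chom_rv[OF H]]) (use assms in simp_all)
  moreover have "rv ?H \<bullet> (?H \<bullet> ?a) = ?a" by (rule rv_cancel) (use assms in simp_all)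
  ultimately show ?thesis by (simp add: T.chom_def)
qed

text \<open>By \<open>ct_assoc_de\<close>, the two ways of multiplying three copies of
  \<open>E\<close> agree after \<open>d3\<close>; uniqueness in three variables removes
  \<open>d3\<close>.\<close>

lemma mult_assoc: "T.mu \<bullet> (T.mu \<star> idt E) = T.mu \<bullet> (idt E \<star> T.mu) \<bullet> as E E E"
proof -
  have "T.mu \<bullet> (T.mu \<star> idt E) \<bullet> rv (as E E E) = T.mu \<bullet> (idt E \<star> T.mu)"
  proof (rule d3_unique)
    fix P Q R assume o: "P \<in> obj B" "Q \<in> obj B" "R \<in> obj B"
    have d3: "T.ct3 (de P) (de Q) (de R) = d3 P Q R" by (simp add: T.ct3_def d3_def d2_def)
    have "((idt (FO P \<odot> FO Q \<odot> FO R) \<star> (T.mu \<bullet> (T.mu \<star> idt E) \<bullet> rv (as E E E))) \<bullet> d3 P Q R) \<bullet> as (FO P) (FO Q) (FO R) =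
       ((idt (FO P \<odot> FO Q \<odot> FO R) \<star> (T.mu \<bullet> (idt E \<star> T.mu))) \<bullet> d3 P Q R) \<bullet> as (FO P) (FO Q) (FO R)"
      using ct_assoc_de[OF o] o T.ct_assoc_left[of "de P" "de Q" "de R"] T.ct_assoc_right[of "de P" "de Q" "de R"]
      by (simp add: d3 comp_assoc)
    then show "(idt (FO P \<odot> FO Q \<odot> FO R) \<star> (T.mu \<bullet> (T.mu \<star> idt E) \<bullet> rv (as E E E))) \<bullet> d3 P Q R =
       (idt (FO P \<odot> FO Q \<odot> FO R) \<star> (T.mu \<bullet> (idt E \<star> T.mu))) \<bullet> d3 P Q R"
      by (rule isom_cancel_right) (use o in auto)
  qed simp_all
  then have "(T.mu \<bullet> (T.mu \<star> idt E) \<bullet> rv (as E E E)) \<bullet> as E E E = (T.mu \<bullet> (idt E \<star> T.mu)) \<bullet> as E E E" by simp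
  then show ?thesis by (simp add: comp_assoc)
qed

text \<open>Coherence of \<open>J\<close> and \<open>J\<^sub>0\<close> makes the unitor a comodule
  map out of the codiagonal coaction; \<open>T.ct_unit_left\<close> turns this into an equation that
  is tested on \<open>de\<close> in one variable.\<close>

lemma mult_unit_left: "T.mu \<bullet> (T.et \<star> idt E) = lu E"
proof -
  have "T.mu \<bullet> (T.et \<star> idt E) \<bullet> rv (lu E) = idt E"
  proof (rule de_unique)
    fix P assume P: "P \<in> obj B"
    have idt: "T.chom (de P) (de P) (idt (FO P))"
      using T.chom_idt[OF coaction_de[OF P]] by simp
    have "T.chom (T.ct T.cu (de P)) (de (unB \<odot>\<^sub>B P)) (jn unB P \<bullet> (j0 \<star> idt (FO P)))"
      by (rule T.chom_comp[OF T.ct_chom[OF j0_chom idt] jn_chom]) (use P in simp_all)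
    then have "T.chom (T.ct T.cu (de P)) (de P) (fm (unB \<odot>\<^sub>B P) P (lunit N P) \<bullet> jn unB P \<bullet> (j0 \<star> idt (FO P)))"
      by (rule T.chom_comp[OF _ fm_chom]) (use P in simp_all)
    then have "de P \<bullet> lu (FO P) = (lu (FO P) \<star> idt E) \<bullet> T.ct T.cu (de P)"
      using P by (simp add: jn_unit T.chom_def)
    then have "((idt (FO P) \<star> (T.mu \<bullet> (T.et \<star> idt E) \<bullet> rv (lu E))) \<bullet> de P) \<bullet> lu (FO P) = de P \<bullet> lu (FO P)"
      using T.ct_unit_left[of "de P"] P by (simp add: comp_assoc)
    then have "(idt (FO P) \<star> (T.mu \<bullet> (T.et \<star> idt E) \<bullet> rv (lu E))) \<bullet> de P = de P"
      by (rule isom_cancel_right) (use P in auto)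
    then show "(idt (FO P) \<star> (T.mu \<bullet> (T.et \<star> idt E) \<bullet> rv (lu E))) \<bullet> de P = (idt (FO P) \<star> idt E) \<bullet> de P"
      using P by simp
  qed simp_all
  then have "(T.mu \<bullet> (T.et \<star> idt E) \<bullet> rv (lu E)) \<bullet> lu E = idt E \<bullet> lu E" by simp
  then show ?thesis by (simp add: comp_assoc)
qed

lemma mult_unit_right: "T.mu \<bullet> (idt E \<star> T.et) = ru E"
proof -
  have "T.mu \<bullet> (idt E \<star> T.et) \<bullet> rv (ru E) = idt E"
  proof (rule de_unique)
    fix P assume P: "P \<in> obj B"
    have idt: "T.chom (de P) (de P) (idt (FO P))"
      using T.chom_idt[OF coaction_de[OF P]] by simp
    have "T.chom (T.ct (de P) T.cu) (de (P \<odot>\<^sub>B unB)) (jn P unB \<bullet> (idt (FO P) \<star> j0))"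
      by (rule T.chom_comp[OF T.ct_chom[OF idt j0_chom] jn_chom]) (use P in simp_all)
    then have "T.chom (T.ct (de P) T.cu) (de P) (fm (P \<odot>\<^sub>B unB) P (runit N P) \<bullet> jn P unB \<bullet> (idt (FO P) \<star> j0))"
      by (rule T.chom_comp[OF _ fm_chom]) (use P in simp_all)
    then have "de P \<bullet> ru (FO P) = (ru (FO P) \<star> idt E) \<bullet> T.ct (de P) T.cu"
      using P by (simp add: jn_unit T.chom_def)
    then have "((idt (FO P) \<star> (T.mu \<bullet> (idt E \<star> T.et) \<bullet> rv (ru E))) \<bullet> de P) \<bullet> ru (FO P) = de P \<bullet> ru (FO P)"
      using T.ct_unit_right[of "de P"] P by (simp add: comp_assoc)
    then have "(idt (FO P) \<star> (T.mu \<bullet> (idt E \<star> T.et) \<bullet> rv (ru E))) \<bullet> de P = de P"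
      by (rule isom_cancel_right) (use P in auto)
    then show "(idt (FO P) \<star> (T.mu \<bullet> (idt E \<star> T.et) \<bullet> rv (ru E))) \<bullet> de P = (idt (FO P) \<star> idt E) \<bullet> de P"
      using P by simp
  qed simp_all
  then have "(T.mu \<bullet> (idt E \<star> T.et) \<bullet> rv (ru E)) \<bullet> ru E = idt E \<bullet> ru E" by simp
  then show ?thesis by (simp add: comp_assoc)
qed

text \<open>\<open>T.ct (de P) (de Q)\<close> is coassociative, being isomorphic to
  \<open>de (P \<odot>\<^sub>B Q)\<close>. Its iterated coaction is thus computed twice: through
  \<open>dl \<bullet> T.mu\<close> and by \<open>T.ct_coassoc\<close>.\<close>

lemma comult_mult: "dl \<bullet> T.mu = (T.mu \<star> T.mu) \<bullet> io E E E E \<bullet> (dl \<star> dl)"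
proof (rule d2_unique)
  fix P Q assume o: "P \<in> obj B" "Q \<in> obj B"
  have "T.coassoc (T.ct (de P) (de Q))"
    by (rule T.coassoc_transfer[OF jn_chom]) (use o de_coassoc in simp_all)
  then have "as (FO P \<odot> FO Q) E E \<bullet> (T.ct (de P) (de Q) \<star> idt E) \<bullet> T.ct (de P) (de Q) =
      (idt (FO P \<odot> FO Q) \<star> (dl \<bullet> T.mu)) \<bullet> d2 P Q"
    using o by (simp add: T.coassoc_def T.ct_def d2_def whisker_comp comp_assoc)
  then show "(idt (FO P \<odot> FO Q) \<star> (dl \<bullet> T.mu)) \<bullet> d2 P Q =
      (idt (FO P \<odot> FO Q) \<star> ((T.mu \<star> T.mu) \<bullet> io E E E E \<bullet> (dl \<star> dl))) \<bullet> d2 P Q"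
    using T.ct_coassoc[of "de P" "de Q"] o de_coassoc by (simp add: d2_def)
qed simp_all

lemma counit_mult: "ep \<bullet> T.mu = lu un \<bullet> (ep \<star> ep)"
proof (rule d2_unique)
  fix P Q assume o: "P \<in> obj B" "Q \<in> obj B"
  have "T.counital (T.ct (de P) (de Q))"
    by (rule T.counital_transfer[OF jn_chom]) (use o de_counital in simp_all)
  then have "ru (FO P \<odot> FO Q) \<bullet> ((idt (FO P \<odot> FO Q) \<star> (ep \<bullet> T.mu)) \<bullet> d2 P Q) = idt (FO P \<odot> FO Q)"
    using o by (simp add: T.counital_def T.ct_def d2_def whisker_comp comp_assoc)
  also have "\<dots> = ru (FO P \<odot> FO Q) \<bullet> ((idt (FO P \<odot> FO Q) \<star> (lu un \<bullet> (ep \<star> ep))) \<bullet> d2 P Q)"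
    using T.ct_counital[of "de P" "de Q"] o de_counital by (simp add: d2_def)
  finally show "(idt (FO P \<odot> FO Q) \<star> (ep \<bullet> T.mu)) \<bullet> d2 P Q = (idt (FO P \<odot> FO Q) \<star> (lu un \<bullet> (ep \<star> ep))) \<bullet> d2 P Q"
    by (rule isom_cancel_left) (use o in auto)
qed simp_all

lemma unit_cu: "T.et = lu E \<bullet> T.cu"
  by (simp add: cu_eq unit_spec)

text \<open>\<open>T.cu\<close> is coassociative, being isomorphic to \<open>de unB\<close>. With
  the unitor removed this says that the unit of \<open>E\<close> is grouplike.\<close>

lemma comult_unit: "dl \<bullet> T.et = (T.et \<star> T.et) \<bullet> rv (lu un)"
proof -
  have "dl \<bullet> T.et = lu (E \<odot> E) \<bullet> (idt un \<star> dl) \<bullet> T.cu"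
    unfolding unit_cu by (simp add: lu_nat[THEN comp_ext] comp_assoc)
  also have "\<dots> = (lu (E \<odot> E) \<bullet> as un E E) \<bullet> (T.cu \<star> idt E) \<bullet> T.cu"
    using cu_coassoc by (simp add: T.coassoc_def comp_assoc)
  also have "\<dots> = (T.et \<star> idt E) \<bullet> T.cu"
    unfolding unit_cu by (simp add: lunit_tns whisker_comp comp_assoc)
  also have "\<dots> = (T.et \<star> T.et) \<bullet> rv (lu un)"
    by (simp add: T.cu_def tns_merge)
  finally show ?thesis .
qed

lemma counit_unit: "ep \<bullet> T.et = idt un"
proof -
  have "ep \<bullet> T.et = lu un \<bullet> (idt un \<star> ep) \<bullet> T.cu"
    unfolding unit_cu by (simp add: lu_nat[THEN comp_ext] comp_assoc)
  then show ?thesis using cu_counital by (simp add: T.counital_def lunit_un)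
qed

lemma coend_is_bialgebra: "bialgebra A M \<tau> E \<Delta> \<epsilon> mult unit"
  by (intro T.bialgebraI coalgebra algebraI comult_mult counit_mult comult_unit counit_unit
      mult_assoc mult_unit_left mult_unit_right) simp_all

end

section \<open>The monoidal category of comodules\<close>

context action_calculus
begin

abbreviation aa where "aa X Y P \<equiv> ar ((X \<otimes>\<^bsub>MC\<^esub> Y) \<triangleright> P) (act_assoc a X Y P) (X \<triangleright> (Y \<triangleright> P))"
abbreviation au where "au P \<equiv> ar (uno MC \<triangleright> P) (act_unit a P) P"
abbreviation pb where "pb f X X' g \<equiv> ar (X \<triangleright> dm g) (f \<unrhd>\<^bsub>a\<^esub> the (raw g)) (X' \<triangleright> cd g)"

lemma objC [simp]: "\<lbrakk>X \<in> obj C; Y \<in> obj C\<rbrakk> \<Longrightarrow> X \<otimes>\<^bsub>MC\<^esub> Y \<in> obj C" "uno MC \<in> obj C"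
  using base.obj_map base.uno_obj by auto

lemma isom_aa [simp]: "\<lbrakk>X \<in> obj C; Y \<in> obj C; P \<in> obj A\<rbrakk> \<Longrightarrow> isom (aa X Y P)"
  and isom_au [simp]: "P \<in> obj A \<Longrightarrow> isom (au P)"
  by (intro isom_ar fst.act_assoc_iso fst.act_unit_iso; simp)+

lemma aa_hom [simp]: "\<lbrakk>X \<in> obj C; Y \<in> obj C; P \<in> obj A\<rbrakk> \<Longrightarrow> act_assoc a X Y P \<in> hom A ((X \<otimes>\<^bsub>MC\<^esub> Y) \<triangleright> P) (X \<triangleright> (Y \<triangleright> P))"
  and au_hom [simp]: "P \<in> obj A \<Longrightarrow> act_unit a P \<in> hom A (uno MC \<triangleright> P) P"
  using isom_valid[OF isom_aa] isom_valid[OF isom_au] by auto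

lemma aa_nat:
  assumes "X \<in> obj C" "Y \<in> obj C" "valid h"
  shows "aa X Y (cd h) \<bullet> pa (X \<otimes>\<^bsub>MC\<^esub> Y) h = pa X (pa Y h) \<bullet> aa X Y (dm h)"
  using assms fst.act_assoc_nat[of X X Y Y "dm h" "cd h" "ident C X" "ident C Y" "the (raw h)"]
  by (intro arrow.expand) (simp add: raw_comp raw_action ident_C valid_hom base.ident_map)

lemma au_nat:
  assumes "valid h"
  shows "au (cd h) \<bullet> pa (uno MC) h = h \<bullet> au (dm h)"
  using assms fst.act_unit_nat[of "dm h" "cd h" "the (raw h)"]
  by (intro arrow.expand) (simp add: raw_comp raw_action valid_hom)

text \<open>This is \<open>xi_assoc\<close> for the C-functor that tensors with \<open>Q\<close> on
  the right.\<close>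

lemma p1_act:
  assumes "X \<in> obj C" "Y \<in> obj C" "P \<in> obj A" "Q \<in> obj A"
  shows "aa X Y (P \<odot> Q) \<bullet> p1 (X \<otimes>\<^bsub>MC\<^esub> Y) P Q = pa X (p1 Y P Q) \<bullet> p1 X (Y \<triangleright> P) Q \<bullet> (aa X Y P \<star> idt Q)"
proof -
  have "raw (aa X Y (P \<odot> Q) \<bullet> p1 (X \<otimes>\<^bsub>MC\<^esub> Y) P Q) = raw ((pa X (p1 Y P Q) \<bullet> p1 X (Y \<triangleright> P) Q) \<bullet> (aa X Y P \<star> idt Q))"
    using assms c_functor.xi_assoc[OF c_functor_fst[of Q], of X Y P]
    by (simp add: raw_comp raw_tns raw_action raw_idt)
  then show ?thesis by (intro arrow.expand) (simp add: comp_assoc)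
qed

lemma p1_act_unit:
  assumes "P \<in> obj A" "Q \<in> obj A"
  shows "au (P \<odot> Q) \<bullet> p1 (uno MC) P Q = au P \<star> idt Q"
  using assms c_functor.xi_unit[OF c_functor_fst[of Q], of P]
  by (intro arrow.expand) (simp add: raw_comp raw_tns raw_action raw_idt)

lemma pb_hom [simp]:
  "\<lbrakk>f \<in> hom C X X'; X \<in> obj C; X' \<in> obj C; valid g\<rbrakk> \<Longrightarrow> f \<unrhd>\<^bsub>a\<^esub> the (raw g) \<in> hom A (X \<triangleright> dm g) (X' \<triangleright> cd g)"
  by (rule fst.hom_map) (auto simp: valid_hom)

lemma pb_comp:
  assumes "f \<in> hom C X X'" "X \<in> obj C" "X' \<in> obj C" "valid g" "valid h" "cd g = dm h"
  shows "pa X' h \<bullet> pb f X X' g = pb f X X' (h \<bullet> g)" "pb f X X' h \<bullet> pa X g = pb f X X' (h \<bullet> g)"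
proof -
  have fg: "the (raw g) \<in> hom A (dm g) (dm h)" "the (raw h) \<in> hom A (dm h) (cd h)"
    using valid_hom[of g] valid_hom[of h] assms by auto
  show "pa X' h \<bullet> pb f X X' g = pb f X X' (h \<bullet> g)"
    using assms fg fst.cmp_map[of X X' X' "dm g" "dm h" "cd h" f "ident C X'" "the (raw g)" "the (raw h)"]
      pb_hom[of f X X' g] base.fst.cmp_ident_left[of X X' f]
    by (intro arrow.expand) (simp add: raw_comp raw_action ident_C)
  show "pb f X X' h \<bullet> pa X g = pb f X X' (h \<bullet> g)"
    using assms fg fst.cmp_map[of X X X' "dm g" "dm h" "cd h" "ident C X" f "the (raw g)" "the (raw h)"]
      pb_hom[of f X X' h] base.fst.cmp_ident_right[of X X' f]
    by (intro arrow.expand) (simp add: raw_comp raw_action ident_C)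
qed

lemma p1_pb:
  assumes "f \<in> hom C X X'" "X \<in> obj C" "X' \<in> obj C" "valid g" "Q \<in> obj A"
  shows "p1 X' (cd g) Q \<bullet> (pb f X X' g \<star> idt Q) = pb f X X' (g \<star> idt Q) \<bullet> p1 X (dm g) Q"
  using assms c_functor.xi_nat[OF c_functor_fst[of Q], of X X' "dm g" "cd g" f "the (raw g)"]
    pb_hom[of f X X' "g \<star> idt Q"]
  by (intro arrow.expand) (simp add: raw_comp raw_tns raw_action raw_idt valid_hom)

end

text \<open>The bialgebra axioms in the form in which the comodule category uses them: compatibility
  of the unit with comultiplication and counit appears as the comodule laws for
  \<open>cu\<close>.\<close>

locale bialgebra_comodules =
  braided_action_calculus C MC \<beta> A a M p \<tau> + tensor_coalgebra A M \<tau> E m \<eta> \<Delta> \<epsilon> +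
  subcat_calculus A M A\<^sub>0 + Co: comodules A M A\<^sub>0 E \<Delta> \<epsilon> +
  Z: c_monoidal_category C MC \<beta> A\<^sub>0 a M p
  for C :: "('c, 'd) cat" and MC :: "('c, 'd) monoidal" and \<beta> :: "'c \<Rightarrow> 'c \<Rightarrow> 'd"
    and A :: "('o, 'm) cat" and a :: "('c, 'd, 'o, 'm) action"
    and M :: "('o, 'm) monoidal" and p :: "('c, 'o, 'm) pulls" and \<tau> :: "'o \<Rightarrow> 'o \<Rightarrow> 'm"
    and E :: 'o and m \<eta> \<Delta> \<epsilon> :: 'm and A\<^sub>0 :: "('o, 'm) cat" +
  assumes mult_assoc: "mu \<bullet> (mu \<star> idt E) = mu \<bullet> (idt E \<star> mu) \<bullet> as E E E"
    and mult_unit_left: "mu \<bullet> (et \<star> idt E) = lu E" and mult_unit_right: "mu \<bullet> (idt E \<star> et) = ru E"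
    and comult_mult: "dl \<bullet> mu = (mu \<star> mu) \<bullet> io E E E E \<bullet> (dl \<star> dl)"
    and counit_mult: "ep \<bullet> mu = lu un \<bullet> (ep \<star> ep)"
    and cu_coassoc: "coassoc cu" and cu_counital: "counital cu"
begin

definition com :: "('o, 'm) arrow \<Rightarrow> bool" where
  "com r \<longleftrightarrow> coaction r \<and> coassoc r \<and> counital r"

text \<open>The coaction prescribed by \<open>Comod_action\<close>. As it contains an inverse,
  proofs first compose with \<open>p1\<close> and then rewrite with \<open>p1_ca\<close>.\<close>

definition ca :: "'c \<Rightarrow> ('o, 'm) arrow \<Rightarrow> ('o, 'm) arrow" where
  "ca X r = rv (p1 X (dm r) E) \<bullet> pa X r"

lemma comD [simp]: "com r \<Longrightarrow> coaction r"
  by (simp add: com_def)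

lemma dm_ca [simp]: "dm (ca X r) = X \<triangleright> dm r" "cd (ca X r) = (X \<triangleright> dm r) \<odot> E"
  by (simp_all add: ca_def)

lemma coaction_ca [simp]: "\<lbrakk>X \<in> obj C; coaction r\<rbrakk> \<Longrightarrow> coaction (ca X r)"
  by (rule coactionI) (simp_all add: ca_def)

text \<open>The formulas of \<open>ct_coassoc\<close> and \<open>ct_counital\<close> are read in the
  opposite direction: now the bialgebra axioms are known and the comodule laws follow.\<close>

lemma com_ct:
  assumes "com r" "com s"
  shows "com (ct r s)"
proof -
  have c: "coaction r" "coaction s" using assms by simp_all
  have "coassoc (ct r s)"
    using ct_coassoc[OF c] assms c unfolding coassoc_def com_def
    by (simp add: comult_mult[symmetric]) (simp add: ct_def whisker_comp comp_assoc)
  moreover have "counital (ct r s)"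
    using ct_counital[OF c] assms c unfolding counital_def com_def
    by (simp add: counit_mult[symmetric]) (simp add: ct_def whisker_comp comp_assoc)
  ultimately show ?thesis using c by (simp add: com_def)
qed

lemma com_cu: "com cu"
  by (simp add: com_def cu_coassoc cu_counital)

lemma p1_ca: "\<lbrakk>X \<in> obj C; coaction r\<rbrakk> \<Longrightarrow> p1 X (dm r) E \<bullet> ca X r = pa X r"
  by (simp add: ca_def)

text \<open>Composition with \<open>p1\<close> turns each law for \<open>ca X r\<close> into
  \<open>pa X\<close> of the corresponding law for \<open>r\<close>; \<open>pull_as\<close> and
  \<open>pull_unit\<close> are the coherence this takes.\<close>

lemma com_ca:
  assumes X: "X \<in> obj C" and r: "com r"
  shows "com (ca X r)"
proof -
  let ?P = "dm r"
  have c: "coaction r" "?P \<in> obj A" and co: "coassoc r" "counital r" using r by (simp_all add: com_def)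
  have n: "p1 X ?P (E \<odot> E) \<bullet> (idt (X \<triangleright> ?P) \<star> dl) = pa X (idt ?P \<star> dl) \<bullet> p1 X ?P E"
    using X c p1_nat[of X "idt ?P" dl ?P "E \<odot> E"] by simp
  have "p1 X ?P (E \<odot> E) \<bullet> as (X \<triangleright> ?P) E E \<bullet> (ca X r \<star> idt E) \<bullet> ca X r =
      pa X (as ?P E E) \<bullet> p1 X (?P \<odot> E) E \<bullet> ((p1 X ?P E \<bullet> ca X r) \<star> idt E) \<bullet> ca X r"
    using X c by (simp add: pull_as[THEN comp_ext] whisker_comp comp_assoc)
  also have "\<dots> = pa X (as ?P E E \<bullet> (r \<star> idt E) \<bullet> r)"
    using X c by (simp add: p1_ca p1_nat[THEN comp_ext] pa_comp comp_assoc)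
  also have "\<dots> = pa X (idt ?P \<star> dl) \<bullet> p1 X ?P E \<bullet> ca X r"
    using X c co by (simp add: coassoc_def pa_comp p1_ca)
  also have "\<dots> = p1 X ?P (E \<odot> E) \<bullet> (idt (X \<triangleright> ?P) \<star> dl) \<bullet> ca X r"
    by (simp add: n[symmetric, THEN comp_ext] comp_assoc)
  finally have "as (X \<triangleright> ?P) E E \<bullet> (ca X r \<star> idt E) \<bullet> ca X r = (idt (X \<triangleright> ?P) \<star> dl) \<bullet> ca X r"
    by (rule isom_cancel_left) (use X c in auto)
  then have "coassoc (ca X r)" by (simp add: coassoc_def)
  moreover
  have n': "p1 X ?P un \<bullet> (idt (X \<triangleright> ?P) \<star> ep) = pa X (idt ?P \<star> ep) \<bullet> p1 X ?P E"
    using X c p1_nat[of X "idt ?P" ep ?P un] by simp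
  have "ru (X \<triangleright> ?P) \<bullet> (idt (X \<triangleright> ?P) \<star> ep) \<bullet> ca X r = pa X (ru ?P \<bullet> (idt ?P \<star> ep) \<bullet> r)"
    using X c by (simp add: pull_unit(2)[symmetric] n'[THEN comp_ext] p1_ca pa_comp comp_assoc)
  then have "counital (ca X r)" using X c co by (simp add: counital_def)
  ultimately show ?thesis using X c by (simp add: com_def)
qed

lemma chom_as:
  assumes "coaction r" "coaction s" "coaction t"
  shows "chom (ct (ct r s) t) (ct r (ct s t)) (as (dm r) (dm s) (dm t))"
proof -
  have "mu \<bullet> (mu \<star> idt E) \<bullet> rv (as E E E) = mu \<bullet> (idt E \<star> mu)"
    using mult_assoc[THEN comp_ext] by (simp add: comp_assoc)
  then show ?thesis using assms ct_assoc_left[OF assms] ct_assoc_right[OF assms]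
    by (simp add: chom_def comp_assoc)
qed

lemma chom_units:
  assumes "coaction r"
  shows "chom (ct cu r) r (lu (dm r))" "chom (ct r cu) r (ru (dm r))"
proof -
  have "mu \<bullet> (et \<star> idt E) \<bullet> rv (lu E) = idt E" "mu \<bullet> (idt E \<star> et) \<bullet> rv (ru E) = idt E"
    using mult_unit_left[THEN comp_ext] mult_unit_right[THEN comp_ext] by simp_all
  then show "chom (ct cu r) r (lu (dm r))" "chom (ct r cu) r (ru (dm r))"
    using assms ct_unit_left[OF assms] ct_unit_right[OF assms] by (simp_all add: chom_def)
qed

lemma chom_pb:
  assumes f: "f \<in> hom C X X'" "X \<in> obj C" "X' \<in> obj C" and g: "chom r s g" and c: "coaction r" "coaction s"
  shows "chom (ca X r) (ca X' s) (pb f X X' g)"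
proof -
  have g': "valid g" "dm g = dm r" "cd g = dm s" "s \<bullet> g = (g \<star> idt E) \<bullet> r" using g by (auto simp: chom_def)
  have "p1 X' (dm s) E \<bullet> ca X' s \<bullet> pb f X X' g = pb f X X' (s \<bullet> g)"
    using f g' c pb_comp(1)[OF f, of g s] by (simp add: p1_ca[THEN comp_ext])
  also have "\<dots> = pb f X X' (g \<star> idt E) \<bullet> p1 X (dm r) E \<bullet> ca X r"
    using f g' c pb_comp(2)[OF f, of r "g \<star> idt E"] by (simp add: p1_ca)
  also have "\<dots> = p1 X' (dm s) E \<bullet> (pb f X X' g \<star> idt E) \<bullet> ca X r"
    using f g' c p1_pb[OF f g'(1) Eobj, THEN comp_ext] by (simp add: comp_assoc)
  finally have "ca X' s \<bullet> pb f X X' g = (pb f X X' g \<star> idt E) \<bullet> ca X r"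
    by (rule isom_cancel_left) (use f g' c pb_hom[OF f, of g] in auto)
  then show ?thesis using f g' pb_hom[OF f, of g] c by (simp add: chom_def)
qed

lemma chom_act:
  assumes X: "X \<in> obj C" "Y \<in> obj C" and c: "coaction r"
  shows "chom (ca (X \<otimes>\<^bsub>MC\<^esub> Y) r) (ca X (ca Y r)) (aa X Y (dm r))"
proof -
  let ?P = "dm r" and ?XY = "X \<otimes>\<^bsub>MC\<^esub> Y"
  have P: "?P \<in> obj A" using c by simp
  let ?K = "pa X (p1 Y ?P E) \<bullet> p1 X (Y \<triangleright> ?P) E"
  have "?K \<bullet> ca X (ca Y r) \<bullet> aa X Y ?P = pa X (p1 Y ?P E \<bullet> ca Y r) \<bullet> aa X Y ?P"
    using X c p1_ca[of X "ca Y r", THEN comp_ext] by (simp add: pa_comp comp_assoc)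
  also have "\<dots> = aa X Y (?P \<odot> E) \<bullet> p1 ?XY ?P E \<bullet> ca ?XY r"
    using X c aa_nat[OF X, of r] by (simp add: p1_ca)
  also have "\<dots> = ?K \<bullet> (aa X Y ?P \<star> idt E) \<bullet> ca ?XY r"
    using X c P by (simp add: p1_act[THEN comp_ext] comp_assoc)
  finally have "ca X (ca Y r) \<bullet> aa X Y ?P = (aa X Y ?P \<star> idt E) \<bullet> ca ?XY r"
    by (rule isom_cancel_left) (use X c P in auto)
  then show "chom (ca ?XY r) (ca X (ca Y r)) (aa X Y ?P)" using X P by (simp add: chom_def)
qed

lemma chom_act_unit:
  assumes c: "coaction r"
  shows "chom (ca (uno MC) r) r (au (dm r))"
proof -
  let ?P = "dm r"
  have P: "?P \<in> obj A" using c by simp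
  have "(au ?P \<star> idt E) \<bullet> ca (uno MC) r = au (?P \<odot> E) \<bullet> p1 (uno MC) ?P E \<bullet> ca (uno MC) r"
    using P by (simp add: p1_act_unit[symmetric] comp_assoc)
  then show ?thesis using P c au_nat[of r] by (simp add: chom_def p1_ca)
qed

text \<open>After composition with \<open>p1\<close>, \<open>p1_io\<close> carries \<open>X\<close>
  through the interchange, and both sides become
  \<open>pa X (ct r s) \<bullet> p1 X (dm r) (dm s)\<close>.\<close>

lemma chom_pull1:
  assumes X: "X \<in> obj C" and c: "coaction r" "coaction s"
  shows "chom (ct (ca X r) s) (ca X (ct r s)) (p1 X (dm r) (dm s))"
proof -
  let ?P = "dm r" and ?Q = "dm s"
  have o: "?P \<in> obj A" "?Q \<in> obj A" using c by simp_all
  have n: "p1 X (?P \<odot> ?Q) E \<bullet> (idt (X \<triangleright> (?P \<odot> ?Q)) \<star> mu) = pa X (idt (?P \<odot> ?Q) \<star> mu) \<bullet> p1 X (?P \<odot> ?Q) (E \<odot> E)"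
    using X o p1_nat[of X "idt (?P \<odot> ?Q)" mu "?P \<odot> ?Q" E] by simp
  have "p1 X (?P \<odot> ?Q) E \<bullet> (p1 X ?P ?Q \<star> idt E) \<bullet> ct (ca X r) s =
     p1 X (?P \<odot> ?Q) E \<bullet> ((p1 X ?P ?Q \<star> idt E) \<bullet> (idt ((X \<triangleright> ?P) \<odot> ?Q) \<star> mu)) \<bullet> io (X \<triangleright> ?P) E ?Q E \<bullet> (ca X r \<star> s)"
    by (simp add: ct_def comp_assoc)
  also have "(p1 X ?P ?Q \<star> idt E) \<bullet> (idt ((X \<triangleright> ?P) \<odot> ?Q) \<star> mu) = (idt (X \<triangleright> (?P \<odot> ?Q)) \<star> mu) \<bullet> (p1 X ?P ?Q \<star> idt (E \<odot> E))"
    using X o by (simp add: tns_merge)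
  also have "p1 X (?P \<odot> ?Q) E \<bullet> ((idt (X \<triangleright> (?P \<odot> ?Q)) \<star> mu) \<bullet> (p1 X ?P ?Q \<star> idt (E \<odot> E))) \<bullet> io (X \<triangleright> ?P) E ?Q E \<bullet> (ca X r \<star> s) =
     pa X (idt (?P \<odot> ?Q) \<star> mu) \<bullet> (p1 X (?P \<odot> ?Q) (E \<odot> E) \<bullet> (p1 X ?P ?Q \<star> idt (E \<odot> E)) \<bullet> io (X \<triangleright> ?P) E ?Q E) \<bullet> (ca X r \<star> s)"
    by (simp add: n[THEN comp_ext] comp_assoc)
  also have "\<dots> = pa X (idt (?P \<odot> ?Q) \<star> mu) \<bullet> pa X (io ?P E ?Q E) \<bullet> p1 X (?P \<odot> E) (?Q \<odot> E) \<bullet>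
      ((p1 X ?P E \<star> idt (?Q \<odot> E)) \<bullet> (ca X r \<star> s))"
    using X o by (simp add: p1_io[symmetric] comp_assoc)
  also have "(p1 X ?P E \<star> idt (?Q \<odot> E)) \<bullet> (ca X r \<star> s) = pa X r \<star> s"
    using X c o by (simp add: tns_merge p1_ca)
  also have "pa X (idt (?P \<odot> ?Q) \<star> mu) \<bullet> pa X (io ?P E ?Q E) \<bullet> p1 X (?P \<odot> E) (?Q \<odot> E) \<bullet> (pa X r \<star> s) =
      pa X (ct r s) \<bullet> p1 X ?P ?Q"
    using X c o by (simp add: p1_nat ct_def pa_comp comp_assoc)
  also have "\<dots> = p1 X (?P \<odot> ?Q) E \<bullet> ca X (ct r s) \<bullet> p1 X ?P ?Q"
    using X c p1_ca[of X "ct r s", THEN comp_ext] by simp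
  finally have "(p1 X ?P ?Q \<star> idt E) \<bullet> ct (ca X r) s = ca X (ct r s) \<bullet> p1 X ?P ?Q"
    by (rule isom_cancel_left) (use X c o in auto)
  then show ?thesis using X o by (simp add: chom_def)
qed

text \<open>Here \<open>X\<close> has to pass the copy of \<open>E\<close> that belongs to
  \<open>r\<close>. The braiding inside the codiagonal coaction and \<open>pull2\<close> agree on
  this by \<open>p2_io\<close>.\<close>

lemma chom_pull2:
  assumes X: "X \<in> obj C" and c: "coaction r" "coaction s"
  shows "chom (ct r (ca X s)) (ca X (ct r s)) (p2 X (dm r) (dm s))"
proof -
  let ?P = "dm r" and ?Q = "dm s"
  have o: "?P \<in> obj A" "?Q \<in> obj A" using c by simp_all
  have n: "p1 X (?P \<odot> ?Q) E \<bullet> (idt (X \<triangleright> (?P \<odot> ?Q)) \<star> mu) = pa X (idt (?P \<odot> ?Q) \<star> mu) \<bullet> p1 X (?P \<odot> ?Q) (E \<odot> E)"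
    using X o p1_nat[of X "idt (?P \<odot> ?Q)" mu "?P \<odot> ?Q" E] by simp
  have "p1 X (?P \<odot> ?Q) E \<bullet> (p2 X ?P ?Q \<star> idt E) \<bullet> ct r (ca X s) =
     p1 X (?P \<odot> ?Q) E \<bullet> ((p2 X ?P ?Q \<star> idt E) \<bullet> (idt (?P \<odot> (X \<triangleright> ?Q)) \<star> mu)) \<bullet> io ?P E (X \<triangleright> ?Q) E \<bullet> (r \<star> ca X s)"
    by (simp add: ct_def comp_assoc)
  also have "(p2 X ?P ?Q \<star> idt E) \<bullet> (idt (?P \<odot> (X \<triangleright> ?Q)) \<star> mu) = (idt (X \<triangleright> (?P \<odot> ?Q)) \<star> mu) \<bullet> (p2 X ?P ?Q \<star> idt (E \<odot> E))"
    using X o by (simp add: tns_merge)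
  also have "p1 X (?P \<odot> ?Q) E \<bullet> ((idt (X \<triangleright> (?P \<odot> ?Q)) \<star> mu) \<bullet> (p2 X ?P ?Q \<star> idt (E \<odot> E))) \<bullet> io ?P E (X \<triangleright> ?Q) E \<bullet> (r \<star> ca X s) =
     pa X (idt (?P \<odot> ?Q) \<star> mu) \<bullet> (p1 X (?P \<odot> ?Q) (E \<odot> E) \<bullet> (p2 X ?P ?Q \<star> idt (E \<odot> E)) \<bullet> io ?P E (X \<triangleright> ?Q) E) \<bullet> (r \<star> ca X s)"
    by (simp add: n[THEN comp_ext] comp_assoc)
  also have "\<dots> = pa X (idt (?P \<odot> ?Q) \<star> mu) \<bullet> pa X (io ?P E ?Q E) \<bullet> p2 X (?P \<odot> E) (?Q \<odot> E) \<bullet>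
      ((idt (?P \<odot> E) \<star> p1 X ?Q E) \<bullet> (r \<star> ca X s))"
    using X o by (simp add: p2_io[symmetric] comp_assoc)
  also have "(idt (?P \<odot> E) \<star> p1 X ?Q E) \<bullet> (r \<star> ca X s) = r \<star> pa X s"
    using X c o by (simp add: tns_merge p1_ca)
  also have "pa X (idt (?P \<odot> ?Q) \<star> mu) \<bullet> pa X (io ?P E ?Q E) \<bullet> p2 X (?P \<odot> E) (?Q \<odot> E) \<bullet> (r \<star> pa X s) =
      pa X (ct r s) \<bullet> p2 X ?P ?Q"
    using X c o by (simp add: p2_nat ct_def pa_comp comp_assoc)
  also have "\<dots> = p1 X (?P \<odot> ?Q) E \<bullet> ca X (ct r s) \<bullet> p2 X ?P ?Q"
    using X c p1_ca[of X "ct r s", THEN comp_ext] by simp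
  finally have "(p2 X ?P ?Q \<star> idt E) \<bullet> ct r (ca X s) = ca X (ct r s) \<bullet> p2 X ?P ?Q"
    by (rule isom_cancel_left) (use X c o in auto)
  then show ?thesis using X o by (simp add: chom_def)
qed

end

section \<open>Lifting the C-monoidal structure from the subcategory to comodules\<close>

context bialgebra_comodules
begin

abbreviation K where "K \<equiv> Comod A M A\<^sub>0 E \<Delta> \<epsilon>"
abbreviation L where "L \<equiv> Comod_monoidal A M \<tau> E m \<eta>"
abbreviation k where "k \<equiv> Comod_action C A a M p E"
abbreviation s where "s \<equiv> Comod_pulls p"

definition cr :: "'o \<times> 'm \<Rightarrow> ('o, 'm) arrow" where
  "cr Z = ar (fst Z) (snd Z) (fst Z \<odot> E)"

lemma dm_cr [simp]: "dm (cr Z) = fst Z" "cd (cr Z) = fst Z \<odot> E" "raw (cr Z) = Some (snd Z)"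
  by (simp_all add: cr_def)

lemma K_obj_iff: "Z \<in> obj K \<longleftrightarrow> fst Z \<in> obj A\<^sub>0 \<and> com (cr Z)"
proof (cases Z)
  case (Pair P \<rho>)
  then show ?thesis
    by (auto simp: cr_def Co.K_obj comodule_iff com_def coaction_def coassoc_def counital_def)
qed

lemma K_objD: "Z \<in> obj K \<Longrightarrow> fst Z \<in> obj A\<^sub>0" "Z \<in> obj K \<Longrightarrow> com (cr Z)" "Z \<in> obj K \<Longrightarrow> coaction (cr Z)"
  by (simp_all add: K_obj_iff)

lemma K_hom_iff:
  assumes "X \<in> obj K" "Y \<in> obj K"
  shows "f \<in> hom K X Y \<longleftrightarrow> f \<in> hom A\<^sub>0 (fst X) (fst Y) \<and> chom (cr X) (cr Y) (ar (fst X) f (fst Y))"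
proof -
  have "f \<in> hom A\<^sub>0 (fst X) (fst Y) \<Longrightarrow> f \<in> hom A (fst X) (fst Y)"
    using K_objD(1)[OF assms(1)] K_objD(1)[OF assms(2)] by (auto intro: hom0)
  then show ?thesis
    using assms K_objD(1)[OF assms(1)] K_objD(1)[OF assms(2)]
    by (cases X; cases Y; auto simp: Co.K_hom chom_def cr_def)
qed

lemma K_ident [simp]: "ident K Z = ident A\<^sub>0 (fst Z)"
  by (cases Z) simp

lemma K_homD:
  assumes "f \<in> hom K X Y" "X \<in> obj K" "Y \<in> obj K"
  shows "f \<in> hom A\<^sub>0 (fst X) (fst Y)" "chom (cr X) (cr Y) (ar (fst X) f (fst Y))"
  using assms by (simp_all add: K_hom_iff)

text \<open>The inverse of an invertible comodule map is again a comodule map, by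
  \<open>chom_rv\<close>. The equality of inverses serves \<open>lr_braid\<close>, whose statement
  contains an inverse.\<close>

lemma K_iso:
  assumes "X \<in> obj K" "Y \<in> obj K" "iso A\<^sub>0 (fst X) (fst Y) f" "chom (cr X) (cr Y) (ar (fst X) f (fst Y))"
  shows "iso K X Y f" "inv_arr K X Y f = inv_arr A\<^sub>0 (fst X) (fst Y) f"
proof -
  let ?g = "inv_arr A\<^sub>0 (fst X) (fst Y) f"
  note o = K_objD(1)[OF assms(1)] K_objD(1)[OF assms(2)]
  have inv: "inverse_arrows A\<^sub>0 (fst X) (fst Y) f ?g"
    by (rule category.iso_inverse[OF cat0 o assms(3)])
  have rv: "rv (ar (fst X) f (fst Y)) = ar (fst Y) ?g (fst X)"
    using iso0(4)[OF assms(3) o] by (simp add: arr_inv_def)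
  have "chom (cr Y) (cr X) (ar (fst Y) ?g (fst X))"
    using chom_rv[OF assms(4) iso0(1)[OF assms(3) o] K_objD(3)[OF assms(1)] K_objD(3)[OF assms(2)]] by (simp add: rv)
  then have "inverse_arrows K X Y f ?g"
    using assms inv by (simp add: inverse_arrows_def K_hom_iff)
  then show "iso K X Y f" "inv_arr K X Y f = ?g"
    using category.inv_arr_eq[OF Co.K_category assms(1,2)] by (auto simp: iso_def)
qed

text \<open>The forgetful functor is strict: every structure arrow of comodules is that of the
  underlying objects. With these rules the simplifier reduces each coherence law for comodules to
  the same law in \<open>A\<^sub>0\<close>, so that only typing needs an argument.\<close>

lemma L_sel [simp]:
  "fst (tens L X Y) = fst X \<odot> fst Y" "fst (uno L) = un" "tensm L = tensm M"
  "assoc L X Y W = assoc M (fst X) (fst Y) (fst W)" "lunit L X = lunit M (fst X)" "runit L X = runit M (fst X)"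
  "fst (act k x X) = x \<triangleright> fst X" "actm k = actm a"
  "act_assoc k x y X = act_assoc a x y (fst X)" "act_unit k X = act_unit a (fst X)"
  "pull1 s x X Y = pull1 p x (fst X) (fst Y)" "pull2 s x X Y = pull2 p x (fst X) (fst Y)"
  by (simp_all add: Comod_monoidal_def Comod_action_def Comod_pulls_def split_beta)

lemma ar_raw: "\<lbrakk>raw f = Some x; dm f = X; cd f = Y\<rbrakk> \<Longrightarrow> ar X x Y = f"
  by (cases f) simp

lemma cr_tens [simp]:
  assumes "X \<in> obj K" "Y \<in> obj K"
  shows "cr (tens L X Y) = ct (cr X) (cr Y)"
  unfolding cr_def[of "tens L X Y"]
proof (rule ar_raw)
  note c = K_objD(3)[OF assms(1)] K_objD(3)[OF assms(2)]
  have o: "fst X \<in> obj A" "fst Y \<in> obj A" "snd X \<in> hom A (fst X) (fst X \<odot> E)" "snd Y \<in> hom A (fst Y) (fst Y \<odot> E)"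
    using coactionD(1)[OF c(1)] coactionD(1)[OF c(2)] by (simp_all add: cr_def)
  have "raw (ct (cr X) (cr Y)) = raw (((idt (fst X \<odot> fst Y) \<star> mu) \<bullet> io (fst X) E (fst Y) E) \<bullet> (cr X \<star> cr Y))"
    by (simp add: ct_def comp_assoc)
  also have "\<dots> = Some (snd (tens L X Y))"
    using o c by (simp add: raw_comp raw_tns raw_idt raw_io Comod_monoidal_def split_beta)
  finally show "raw (ct (cr X) (cr Y)) = Some (snd (tens L X Y))" .
qed (use assms in \<open>simp_all add: ct_def\<close>)

lemma cr_uno [simp]: "cr (uno L) = cu"
  unfolding cr_def
proof (rule ar_raw)
  show "raw cu = Some (snd (uno L))"
    by (simp add: cu_def raw_comp raw_tns raw_idt raw_rv raw_monoidal Comod_monoidal_def)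
qed (simp_all add: cu_def)

lemma cr_act [simp]:
  assumes "x \<in> obj C" "X \<in> obj K"
  shows "cr (act k x X) = ca x (cr X)"
  unfolding cr_def[of "act k x X"]
proof (rule ar_raw)
  have o: "fst X \<in> obj A" "snd X \<in> hom A (fst X) (fst X \<odot> E)"
    using coactionD(1)[OF K_objD(3)[OF assms(2)]] by (simp_all add: cr_def)
  then show "raw (ca x (cr X)) = Some (snd (act k x X))"
    using assms(1) coactionD(1)[OF K_objD(3)[OF assms(2)]] by (simp add: ca_def raw_comp raw_rv raw_action Comod_action_def split_beta)
qed simp_all

lemma act0 [simp]: "\<lbrakk>x \<in> obj C; P \<in> obj A\<^sub>0\<rbrakk> \<Longrightarrow> x \<triangleright> P \<in> obj A\<^sub>0"
  by (rule Z.fst.obj_map)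

lemma K_tens [simp]: "\<lbrakk>X \<in> obj K; Y \<in> obj K\<rbrakk> \<Longrightarrow> tens L X Y \<in> obj K"
  using com_ct[OF K_objD(2) K_objD(2), of X Y] K_objD(1)[of X] K_objD(1)[of Y]
  by (subst K_obj_iff) simp

lemma K_uno [simp]: "uno L \<in> obj K"
  using com_cu by (subst K_obj_iff) simp

lemma K_act [simp]: "\<lbrakk>x \<in> obj C; X \<in> obj K\<rbrakk> \<Longrightarrow> act k x X \<in> obj K"
  using com_ca[OF _ K_objD(2), of x X] K_objD(1)[of X]
  by (subst K_obj_iff) simp

lemma K_bifunctor: "cat_bifunctor K K K (tens L) (tensm L)"
proof (intro cat_bifunctor.intro cat_bifunctor_axioms.intro Co.K_category)
  fix P P' Q Q' f g
  assume o: "P \<in> obj K" "P' \<in> obj K" "Q \<in> obj K" "Q' \<in> obj K" and fg: "f \<in> hom K P P'" "g \<in> hom K Q Q'"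
  note f = K_homD[OF fg(1) o(1,2)] and g = K_homD[OF fg(2) o(3,4)]
  note d = K_objD[OF o(1)] K_objD[OF o(2)] K_objD[OF o(3)] K_objD[OF o(4)]
  have "chom (ct (cr P) (cr Q)) (ct (cr P') (cr Q')) (ar (fst P) f (fst P') \<star> ar (fst Q) g (fst Q'))"
    by (rule ct_chom) (use f g d in auto)
  moreover have "ar (fst P) f (fst P') \<star> ar (fst Q) g (fst Q') = ar (fst P \<odot> fst Q) (f \<boxtimes>\<^bsub>M\<^esub> g) (fst P' \<odot> fst Q')"
    using f g d by (intro tns_ar) (auto intro: hom0)
  ultimately show "f \<boxtimes>\<^bsub>L\<^esub> g \<in> hom K (tens L P Q) (tens L P' Q')"
    using o f g d Z.hom_map[of "fst P" "fst P'" "fst Q" "fst Q'" f g] by (simp add: K_hom_iff)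
next
  fix P Q assume "P \<in> obj K" "Q \<in> obj K"
  then show "ident K P \<boxtimes>\<^bsub>L\<^esub> ident K Q = ident K (tens L P Q)"
    using Z.ident_map[of "fst P" "fst Q"] by (simp add: K_objD)
next
  fix P P' P'' Q Q' Q'' f f' g g'
  assume o: "P \<in> obj K" "P' \<in> obj K" "P'' \<in> obj K" "Q \<in> obj K" "Q' \<in> obj K" "Q'' \<in> obj K"
    "f \<in> hom K P P'" "f' \<in> hom K P' P''" "g \<in> hom K Q Q'" "g' \<in> hom K Q' Q''"
  show "(f' \<cdot>\<^bsub>K\<^esub> f) \<boxtimes>\<^bsub>L\<^esub> (g' \<cdot>\<^bsub>K\<^esub> g) = f' \<boxtimes>\<^bsub>L\<^esub> g' \<cdot>\<^bsub>K\<^esub> f \<boxtimes>\<^bsub>L\<^esub> g"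
    using Z.cmp_map[OF K_objD(1)[OF o(1)] K_objD(1)[OF o(2)] K_objD(1)[OF o(3)] K_objD(1)[OF o(4)]
        K_objD(1)[OF o(5)] K_objD(1)[OF o(6)] K_homD(1)[OF o(7,1,2)] K_homD(1)[OF o(8,2,3)]
        K_homD(1)[OF o(9,4,5)] K_homD(1)[OF o(10,5,6)]] by simp
qed simp_all

lemma K_monoidal: "monoidal_category K L"
proof (intro monoidal_category.intro K_bifunctor monoidal_category_axioms.intro)
  fix P Q R assume o: "P \<in> obj K" "Q \<in> obj K" "R \<in> obj K"
  note d = K_objD[OF o(1)] K_objD[OF o(2)] K_objD[OF o(3)]
  show "iso K (tens L (tens L P Q) R) (tens L P (tens L Q R)) (assoc L P Q R)"
    using o d chom_as[OF d(3,6,9)] Z.assoc_iso[OF d(1,4,7)]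
    by (intro K_iso(1)) (simp_all add: arr_assoc_def)
next
  fix P P' Q Q' R R' f g h
  assume o: "P \<in> obj K" "P' \<in> obj K" "Q \<in> obj K" "Q' \<in> obj K" "R \<in> obj K" "R' \<in> obj K"
    "f \<in> hom K P P'" "g \<in> hom K Q Q'" "h \<in> hom K R R'"
  show "assoc L P' Q' R' \<cdot>\<^bsub>K\<^esub> f \<boxtimes>\<^bsub>L\<^esub> g \<boxtimes>\<^bsub>L\<^esub> h = f \<boxtimes>\<^bsub>L\<^esub> (g \<boxtimes>\<^bsub>L\<^esub> h) \<cdot>\<^bsub>K\<^esub> assoc L P Q R"
    using Z.assoc_nat[OF K_objD(1)[OF o(1)] K_objD(1)[OF o(2)] K_objD(1)[OF o(3)] K_objD(1)[OF o(4)]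
        K_objD(1)[OF o(5)] K_objD(1)[OF o(6)] K_homD(1)[OF o(7,1,2)] K_homD(1)[OF o(8,3,4)] K_homD(1)[OF o(9,5,6)]] by simp
next
  fix P assume o: "P \<in> obj K"
  note d = K_objD[OF o]
  show "iso K (tens L (uno L) P) P (lunit L P)"
    using o d chom_units(1)[OF d(3)] Z.lunit_iso[OF d(1)] by (intro K_iso(1)) (simp_all add: arr_lunit_def)
  show "iso K (tens L P (uno L)) P (runit L P)"
    using o d chom_units(2)[OF d(3)] Z.runit_iso[OF d(1)] by (intro K_iso(1)) (simp_all add: arr_runit_def)
next
  fix P P' f assume o: "P \<in> obj K" "P' \<in> obj K" "f \<in> hom K P P'"
  note d = K_objD(1)[OF o(1)] K_objD(1)[OF o(2)] K_homD(1)[OF o(3,1,2)]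
  show "lunit L P' \<cdot>\<^bsub>K\<^esub> ident K (uno L) \<boxtimes>\<^bsub>L\<^esub> f = f \<cdot>\<^bsub>K\<^esub> lunit L P"
    "runit L P' \<cdot>\<^bsub>K\<^esub> f \<boxtimes>\<^bsub>L\<^esub> ident K (uno L) = f \<cdot>\<^bsub>K\<^esub> runit L P"
    using Z.lunit_nat[OF d] Z.runit_nat[OF d] by simp_all
next
  fix P Q R S assume o: "P \<in> obj K" "Q \<in> obj K" "R \<in> obj K" "S \<in> obj K"
  show "assoc L P Q (tens L R S) \<cdot>\<^bsub>K\<^esub> assoc L (tens L P Q) R S =
    ident K P \<boxtimes>\<^bsub>L\<^esub> assoc L Q R S \<cdot>\<^bsub>K\<^esub> assoc L P (tens L Q R) S \<cdot>\<^bsub>K\<^esub> assoc L P Q R \<boxtimes>\<^bsub>L\<^esub> ident K S"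
    using Z.pentagon[OF K_objD(1)[OF o(1)] K_objD(1)[OF o(2)] K_objD(1)[OF o(3)] K_objD(1)[OF o(4)]] by simp
next
  fix P Q assume o: "P \<in> obj K" "Q \<in> obj K"
  show "ident K P \<boxtimes>\<^bsub>L\<^esub> lunit L Q \<cdot>\<^bsub>K\<^esub> assoc L P (uno L) Q = runit L P \<boxtimes>\<^bsub>L\<^esub> ident K Q"
    using Z.triangle[OF K_objD(1)[OF o(1)] K_objD(1)[OF o(2)]] by simp
qed simp

lemma K_c_category: "c_category C MC K k"
proof (intro c_category.intro c_category_axioms.intro cat_bifunctor.intro cat_bifunctor_axioms.intro
    base.monoidal_category_axioms base.fst.category_axioms Co.K_category)
  fix P P' Q Q' f g
  assume o: "P \<in> obj C" "P' \<in> obj C" "Q \<in> obj K" "Q' \<in> obj K" and f: "f \<in> hom C P P'" and g: "g \<in> hom K Q Q'"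
  note g' = K_homD[OF g o(3,4)] and d = K_objD[OF o(3)] K_objD[OF o(4)]
  have "chom (ca P (cr Q)) (ca P' (cr Q')) (pb f P P' (ar (fst Q) g (fst Q')))"
    by (rule chom_pb) (use o f g' d in auto)
  then show "f \<unrhd>\<^bsub>k\<^esub> g \<in> hom K (act k P Q) (act k P' Q')"
    using o f g' d Z.fst.hom_map[of P P' "fst Q" "fst Q'" f g] by (simp add: K_hom_iff)
next
  fix P Q assume "P \<in> obj C" "Q \<in> obj K"
  then show "ident C P \<unrhd>\<^bsub>k\<^esub> ident K Q = ident K (act k P Q)"
    using Z.fst.ident_map[of P "fst Q"] by (simp add: K_objD)
next
  fix P P' P'' Q Q' Q'' f f' g g'
  assume o: "P \<in> obj C" "P' \<in> obj C" "P'' \<in> obj C" "Q \<in> obj K" "Q' \<in> obj K" "Q'' \<in> obj K"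
    "f \<in> hom C P P'" "f' \<in> hom C P' P''" "g \<in> hom K Q Q'" "g' \<in> hom K Q' Q''"
  show "(f' \<cdot>\<^bsub>C\<^esub> f) \<unrhd>\<^bsub>k\<^esub> (g' \<cdot>\<^bsub>K\<^esub> g) = (f' \<unrhd>\<^bsub>k\<^esub> g') \<cdot>\<^bsub>K\<^esub> (f \<unrhd>\<^bsub>k\<^esub> g)"
    using Z.fst.cmp_map[OF o(1-3) K_objD(1)[OF o(4)] K_objD(1)[OF o(5)] K_objD(1)[OF o(6)] o(7,8)
        K_homD(1)[OF o(9,4,5)] K_homD(1)[OF o(10,5,6)]] by simp
next
  fix X Y P assume o: "X \<in> obj C" "Y \<in> obj C" "P \<in> obj K"
  note d = K_objD[OF o(3)]
  show "iso K (act k (X \<otimes>\<^bsub>MC\<^esub> Y) P) (act k X (act k Y P)) (act_assoc k X Y P)"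
    using o d chom_act[OF o(1,2) d(3)] Z.fst.act_assoc_iso[OF o(1,2) d(1)]
    by (intro K_iso(1)) simp_all
next
  fix X X' Y Y' P P' f g h
  assume o: "X \<in> obj C" "X' \<in> obj C" "Y \<in> obj C" "Y' \<in> obj C" "P \<in> obj K" "P' \<in> obj K"
    "f \<in> hom C X X'" "g \<in> hom C Y Y'" "h \<in> hom K P P'"
  show "act_assoc k X' Y' P' \<cdot>\<^bsub>K\<^esub> ((f \<boxtimes>\<^bsub>MC\<^esub> g) \<unrhd>\<^bsub>k\<^esub> h) = (f \<unrhd>\<^bsub>k\<^esub> (g \<unrhd>\<^bsub>k\<^esub> h)) \<cdot>\<^bsub>K\<^esub> act_assoc k X Y P"
    using Z.fst.act_assoc_nat[OF o(1-4) K_objD(1)[OF o(5)] K_objD(1)[OF o(6)] o(7,8) K_homD(1)[OF o(9,5,6)]] by simp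
next
  fix P assume o: "P \<in> obj K"
  note d = K_objD[OF o]
  show "iso K (act k (uno MC) P) P (act_unit k P)"
    using o d chom_act_unit[OF d(3)] Z.fst.act_unit_iso[OF d(1)]
    by (intro K_iso(1)) simp_all
next
  fix P P' h assume o: "P \<in> obj K" "P' \<in> obj K" "h \<in> hom K P P'"
  show "act_unit k P' \<cdot>\<^bsub>K\<^esub> (ident C (uno MC) \<unrhd>\<^bsub>k\<^esub> h) = h \<cdot>\<^bsub>K\<^esub> act_unit k P"
    using Z.fst.act_unit_nat[OF K_objD(1)[OF o(1)] K_objD(1)[OF o(2)] K_homD(1)[OF o(3,1,2)]] by simp
next
  fix X Y W P assume o: "X \<in> obj C" "Y \<in> obj C" "W \<in> obj C" "P \<in> obj K"
  show "act_assoc k X Y (act k W P) \<cdot>\<^bsub>K\<^esub> act_assoc k (X \<otimes>\<^bsub>MC\<^esub> Y) W P =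
      (ident C X \<unrhd>\<^bsub>k\<^esub> act_assoc k Y W P) \<cdot>\<^bsub>K\<^esub> act_assoc k X (Y \<otimes>\<^bsub>MC\<^esub> W) P \<cdot>\<^bsub>K\<^esub> (assoc MC X Y W \<unrhd>\<^bsub>k\<^esub> ident K P)"
    using Z.fst.act_pentagon[OF o(1-3) K_objD(1)[OF o(4)]] by simp
next
  fix X P assume o: "X \<in> obj C" "P \<in> obj K"
  show "(ident C X \<unrhd>\<^bsub>k\<^esub> act_unit k P) \<cdot>\<^bsub>K\<^esub> act_assoc k X (uno MC) P = runit MC X \<unrhd>\<^bsub>k\<^esub> ident K P"
    using Z.fst.act_triangle[OF o(1) K_objD(1)[OF o(2)]] by simp
  show "act_unit k (act k X P) \<cdot>\<^bsub>K\<^esub> act_assoc k (uno MC) X P = lunit MC X \<unrhd>\<^bsub>k\<^esub> ident K P"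
    using Z.fst.act_triangle_left[OF o(1) K_objD(1)[OF o(2)]] by simp
qed simp_all

text \<open>Changes the target from \<open>A\<^sub>0\<close> to comodules. The laws are inherited;
  the input consists of coactions on the values and of the fact that the arrows involved respect
  them.\<close>

lemma c_functor_lift:
  assumes G: "c_functor C MC D d A\<^sub>0 a GO GM \<zeta>"
    and obj: "\<And>P. P \<in> obj D \<Longrightarrow> GK P \<in> obj K \<and> fst (GK P) = GO P"
    and hom: "\<And>P Q f. \<lbrakk>P \<in> obj D; Q \<in> obj D; f \<in> hom D P Q\<rbrakk> \<Longrightarrow> GM f \<in> hom K (GK P) (GK Q)"
    and zeta: "\<And>X P. \<lbrakk>X \<in> obj C; P \<in> obj D\<rbrakk> \<Longrightarrow> \<zeta> X P \<in> hom K (GK (act d X P)) (act k X (GK P))"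
  shows "c_functor C MC D d K k GK GM \<zeta>"
proof -
  interpret G: c_functor C MC D d A\<^sub>0 a GO GM \<zeta> by (rule G)
  have sobj: "X \<in> obj C \<Longrightarrow> P \<in> obj D \<Longrightarrow> act d X P \<in> obj D" for X P by (rule G.src.obj_map)
  show ?thesis
  proof (intro c_functor.intro c_functor_axioms.intro G.src.c_category_axioms K_c_category)
    show "cat_functor D K GK GM"
      using G.cat_functor_axioms obj hom by (rule Co.lift_functor)
    fix X P assume *: "X \<in> obj C" "P \<in> obj D"
    then have o: "GK (act d X P) \<in> obj K" "act k X (GK P) \<in> obj K" using obj sobj by auto
    show "iso K (GK (act d X P)) (act k X (GK P)) (\<zeta> X P)"
      by (rule K_iso(1)[OF o]) (use * obj sobj G.xi_iso[OF *] K_homD(2)[OF zeta[OF *] o] in auto)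
  next
    fix X X' P P' f g
    assume *: "X \<in> obj C" "X' \<in> obj C" "P \<in> obj D" "P' \<in> obj D" "f \<in> hom C X X'" "g \<in> hom D P P'"
    then show "\<zeta> X' P' \<cdot>\<^bsub>K\<^esub> GM (f \<unrhd>\<^bsub>d\<^esub> g) = (f \<unrhd>\<^bsub>k\<^esub> GM g) \<cdot>\<^bsub>K\<^esub> \<zeta> X P"
      using G.xi_nat[OF *] by simp
  next
    fix X Y P assume *: "X \<in> obj C" "Y \<in> obj C" "P \<in> obj D"
    then show "act_assoc k X Y (GK P) \<cdot>\<^bsub>K\<^esub> \<zeta> (X \<otimes>\<^bsub>MC\<^esub> Y) P =
        (ident C X \<unrhd>\<^bsub>k\<^esub> \<zeta> Y P) \<cdot>\<^bsub>K\<^esub> \<zeta> X (act d Y P) \<cdot>\<^bsub>K\<^esub> GM (act_assoc d X Y P)"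
      using G.xi_assoc[OF *] obj[of P] by simp
  next
    fix P assume *: "P \<in> obj D"
    then show "act_unit k (GK P) \<cdot>\<^bsub>K\<^esub> \<zeta> (uno MC) P = GM (act_unit d P)"
      using G.xi_unit[OF *] obj[of P] by simp
  qed
qed

text \<open>Changes the source instead, by precomposition with the forgetful functor. Structures on
  the comodule category itself combine both changes.\<close>

lemma c_functor_source:
  assumes G: "c_functor C MC A\<^sub>0 a A\<^sub>0 a GO GM \<zeta>"
  shows "c_functor C MC K k A\<^sub>0 a (\<lambda>P. GO (fst P)) GM (\<lambda>X P. \<zeta> X (fst P))"
proof -
  interpret G: c_functor C MC A\<^sub>0 a A\<^sub>0 a GO GM \<zeta> by (rule G)
  show ?thesis
  proof (intro c_functor.intro c_functor_axioms.intro cat_functor.intro cat_functor_axioms.intro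
      Z.fst.c_category_axioms K_c_category Co.K_category cat0)
    fix P Q R f g assume "P \<in> obj K" "Q \<in> obj K" "R \<in> obj K" "f \<in> hom K P Q" "g \<in> hom K Q R"
    then show "GM (g \<cdot>\<^bsub>K\<^esub> f) = GM g \<cdot>\<^bsub>A\<^sub>0\<^esub> GM f"
      using G.cmp_map[of "fst P" "fst Q" "fst R" f g] by (simp add: K_objD K_homD)
  next
    fix X X' P P' f g
    assume "X \<in> obj C" "X' \<in> obj C" "P \<in> obj K" "P' \<in> obj K" "f \<in> hom C X X'" "g \<in> hom K P P'"
    then show "\<zeta> X' (fst P') \<cdot>\<^bsub>A\<^sub>0\<^esub> GM (f \<unrhd>\<^bsub>k\<^esub> g) = (f \<unrhd>\<^bsub>a\<^esub> GM g) \<cdot>\<^bsub>A\<^sub>0\<^esub> \<zeta> X (fst P)"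
      using G.xi_nat[of X X' "fst P" "fst P'" f g] by (simp add: K_objD K_homD)
  next
    fix P Q f assume "P \<in> obj K" "Q \<in> obj K" "f \<in> hom K P Q"
    then show "GM f \<in> hom A\<^sub>0 (GO (fst P)) (GO (fst Q))" by (intro G.hom_map K_homD(1) K_objD(1))
  qed (simp_all add: K_objD G.obj_map G.ident_map G.xi_iso G.xi_assoc G.xi_unit)
qed

lemma c_bifunctor_lift:
  assumes H: "c_bifunctor C MC \<beta> D d D' d' A\<^sub>0 a HO HM l r"
    and obj: "\<And>P Q. \<lbrakk>P \<in> obj D; Q \<in> obj D'\<rbrakk> \<Longrightarrow> HK P Q \<in> obj K \<and> fst (HK P Q) = HO P Q"
    and hom: "\<And>P P' Q Q' f g. \<lbrakk>P \<in> obj D; P' \<in> obj D; Q \<in> obj D'; Q' \<in> obj D'; f \<in> hom D P P'; g \<in> hom D' Q Q'\<rbrakk>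
       \<Longrightarrow> HM f g \<in> hom K (HK P Q) (HK P' Q')"
    and l: "\<And>X P Q. \<lbrakk>X \<in> obj C; P \<in> obj D; Q \<in> obj D'\<rbrakk> \<Longrightarrow> l X P Q \<in> hom K (HK (act d X P) Q) (act k X (HK P Q))"
    and r: "\<And>X P Q. \<lbrakk>X \<in> obj C; P \<in> obj D; Q \<in> obj D'\<rbrakk> \<Longrightarrow> r X P Q \<in> hom K (HK P (act d' X Q)) (act k X (HK P Q))"
  shows "c_bifunctor C MC \<beta> D d D' d' K k HK HM l r"
proof -
  interpret H: c_bifunctor C MC \<beta> D d D' d' A\<^sub>0 a HO HM l r by (rule H)
  have D: "category D" and D': "category D'"
    using cat_bifunctor.axioms(1,2)[OF H.cat_bifunctor_axioms] by auto
  show ?thesis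
  proof (intro c_bifunctor.intro c_bifunctor_axioms.intro cat_bifunctor.intro cat_bifunctor_axioms.intro
      base.braided_monoidal_category_axioms H.fst.c_category_axioms H.snd.c_category_axioms K_c_category Co.K_category D D')
    fix P Q assume *: "P \<in> obj D" "Q \<in> obj D'"
    then show "HK P Q \<in> obj K" "HM (ident D P) (ident D' Q) = ident K (HK P Q)"
      using obj H.ident_map by auto
  next
    fix P P' Q Q' f g assume "P \<in> obj D" "P' \<in> obj D" "Q \<in> obj D'" "Q' \<in> obj D'" "f \<in> hom D P P'" "g \<in> hom D' Q Q'"
    then show "HM f g \<in> hom K (HK P Q) (HK P' Q')" by (rule hom)
  next
    fix P P' P'' Q Q' Q'' f f' g g'
    assume *: "P \<in> obj D" "P' \<in> obj D" "P'' \<in> obj D" "Q \<in> obj D'" "Q' \<in> obj D'" "Q'' \<in> obj D'"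
      "f \<in> hom D P P'" "f' \<in> hom D P' P''" "g \<in> hom D' Q Q'" "g' \<in> hom D' Q' Q''"
    show "HM (f' \<cdot>\<^bsub>D\<^esub> f) (g' \<cdot>\<^bsub>D'\<^esub> g) = HM f' g' \<cdot>\<^bsub>K\<^esub> HM f g" using H.cmp_map[OF *] by simp
  next
    fix Q assume Q: "Q \<in> obj D'"
    show "c_functor C MC D d K k (\<lambda>P. HK P Q) (\<lambda>f. HM f (ident D' Q)) (\<lambda>X P. l X P Q)"
      by (rule c_functor_lift[OF H.c_functor_fst[OF Q]]) (use Q obj hom l category.ident_hom[OF D'] in auto)
  next
    fix P assume P: "P \<in> obj D"
    show "c_functor C MC D' d' K k (HK P) (HM (ident D P)) (\<lambda>X Q. r X P Q)"
      by (rule c_functor_lift[OF H.c_functor_snd[OF P]]) (use P obj hom r category.ident_hom[OF D] in auto)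
  next
    fix X P Q Q' g assume *: "X \<in> obj C" "P \<in> obj D" "Q \<in> obj D'" "Q' \<in> obj D'" "g \<in> hom D' Q Q'"
    show "l X P Q' \<cdot>\<^bsub>K\<^esub> HM (ident D (act d X P)) g = (ident C X \<unrhd>\<^bsub>k\<^esub> HM (ident D P) g) \<cdot>\<^bsub>K\<^esub> l X P Q"
      using H.l_nat[OF *] by simp
  next
    fix X P P' Q f assume *: "X \<in> obj C" "P \<in> obj D" "P' \<in> obj D" "Q \<in> obj D'" "f \<in> hom D P P'"
    show "r X P' Q \<cdot>\<^bsub>K\<^esub> HM f (ident D' (act d' X Q)) = (ident C X \<unrhd>\<^bsub>k\<^esub> HM f (ident D' Q)) \<cdot>\<^bsub>K\<^esub> r X P Q"
      using H.r_nat[OF *] by simp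
  next
    fix X Y P Q assume *: "X \<in> obj C" "Y \<in> obj C" "P \<in> obj D" "Q \<in> obj D'"
    let ?H = "HK P Q"
    have HK: "?H \<in> obj K" "fst ?H = HO P Q" using obj * by auto
    note d = K_objD[OF HK(1)]
    \<comment> \<open>An inverse depends a priori on the category in which it is taken;
      \<open>K_iso\<close> identifies this one with the inverse in \<open>A\<^sub>0\<close>.\<close>
    have "inv_arr K (act k (X \<otimes>\<^bsub>MC\<^esub> Y) ?H) (act k X (act k Y ?H)) (act_assoc k X Y ?H) =
        inv_arr A\<^sub>0 ((X \<otimes>\<^bsub>MC\<^esub> Y) \<triangleright> HO P Q) (X \<triangleright> (Y \<triangleright> HO P Q)) (act_assoc a X Y (HO P Q))"
      using K_iso(2)[of "act k (X \<otimes>\<^bsub>MC\<^esub> Y) ?H" "act k X (act k Y ?H)" "act_assoc k X Y ?H"]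
        * HK d chom_act[OF *(1,2) d(3)] Z.fst.act_assoc_iso[OF *(1,2) d(1)] by simp
    then show "(ident C Y \<unrhd>\<^bsub>k\<^esub> l X P Q) \<cdot>\<^bsub>K\<^esub> r Y (act d X P) Q =
       act_assoc k Y X ?H \<cdot>\<^bsub>K\<^esub> (\<beta> X Y \<unrhd>\<^bsub>k\<^esub> ident K ?H) \<cdot>\<^bsub>K\<^esub>
       inv_arr K (act k (X \<otimes>\<^bsub>MC\<^esub> Y) ?H) (act k X (act k Y ?H)) (act_assoc k X Y ?H) \<cdot>\<^bsub>K\<^esub>
       (ident C X \<unrhd>\<^bsub>k\<^esub> r Y P Q) \<cdot>\<^bsub>K\<^esub> l X P (act d' Y Q)"
      using H.lr_braid[OF *] HK by simp
  qed
qed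

lemma c_bifunctor_source:
  assumes H: "c_bifunctor C MC \<beta> A\<^sub>0 a A\<^sub>0 a A\<^sub>0 a HO HM l r"
  shows "c_bifunctor C MC \<beta> K k K k A\<^sub>0 a (\<lambda>P Q. HO (fst P) (fst Q)) HM
    (\<lambda>X P Q. l X (fst P) (fst Q)) (\<lambda>X P Q. r X (fst P) (fst Q))"
proof -
  interpret H: c_bifunctor C MC \<beta> A\<^sub>0 a A\<^sub>0 a A\<^sub>0 a HO HM l r by (rule H)
  show ?thesis
  proof (intro c_bifunctor.intro c_bifunctor_axioms.intro cat_bifunctor.intro cat_bifunctor_axioms.intro
      base.braided_monoidal_category_axioms Z.fst.c_category_axioms K_c_category Co.K_category cat0)
    fix P P' Q Q' f g
    assume "P \<in> obj K" "P' \<in> obj K" "Q \<in> obj K" "Q' \<in> obj K" "f \<in> hom K P P'" "g \<in> hom K Q Q'"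
    then show "HM f g \<in> hom A\<^sub>0 (HO (fst P) (fst Q)) (HO (fst P') (fst Q'))"
      by (intro H.hom_map K_homD(1) K_objD(1))
  next
    fix P P' P'' Q Q' Q'' f f' g g'
    assume o: "P \<in> obj K" "P' \<in> obj K" "P'' \<in> obj K" "Q \<in> obj K" "Q' \<in> obj K" "Q'' \<in> obj K"
      "f \<in> hom K P P'" "f' \<in> hom K P' P''" "g \<in> hom K Q Q'" "g' \<in> hom K Q' Q''"
    show "HM (f' \<cdot>\<^bsub>K\<^esub> f) (g' \<cdot>\<^bsub>K\<^esub> g) = HM f' g' \<cdot>\<^bsub>A\<^sub>0\<^esub> HM f g"
      using H.cmp_map[OF K_objD(1)[OF o(1)] K_objD(1)[OF o(2)] K_objD(1)[OF o(3)] K_objD(1)[OF o(4)]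
        K_objD(1)[OF o(5)] K_objD(1)[OF o(6)] K_homD(1)[OF o(7,1,2)] K_homD(1)[OF o(8,2,3)]
        K_homD(1)[OF o(9,4,5)] K_homD(1)[OF o(10,5,6)]] by simp
  next
    fix Q assume "Q \<in> obj K"
    then show "c_functor C MC K k A\<^sub>0 a (\<lambda>P. HO (fst P) (fst Q)) (\<lambda>f. HM f (ident K Q)) (\<lambda>X P. l X (fst P) (fst Q))"
      using c_functor_source[OF H.c_functor_fst[of "fst Q"]] by (simp add: K_objD)
  next
    fix P assume "P \<in> obj K"
    then show "c_functor C MC K k A\<^sub>0 a (\<lambda>Q. HO (fst P) (fst Q)) (HM (ident K P)) (\<lambda>X Q. r X (fst P) (fst Q))"
      using c_functor_source[OF H.c_functor_snd[of "fst P"]] by (simp add: K_objD)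
  next
    fix X P Q Q' g assume o: "X \<in> obj C" "P \<in> obj K" "Q \<in> obj K" "Q' \<in> obj K" "g \<in> hom K Q Q'"
    show "l X (fst P) (fst Q') \<cdot>\<^bsub>A\<^sub>0\<^esub> HM (ident K (act k X P)) g =
        (ident C X \<unrhd>\<^bsub>a\<^esub> HM (ident K P) g) \<cdot>\<^bsub>A\<^sub>0\<^esub> l X (fst P) (fst Q)"
      using H.l_nat[OF o(1) K_objD(1)[OF o(2)] K_objD(1)[OF o(3)] K_objD(1)[OF o(4)] K_homD(1)[OF o(5,3,4)]] by simp
  next
    fix X P P' Q f assume o: "X \<in> obj C" "P \<in> obj K" "P' \<in> obj K" "Q \<in> obj K" "f \<in> hom K P P'"
    show "r X (fst P') (fst Q) \<cdot>\<^bsub>A\<^sub>0\<^esub> HM f (ident K (act k X Q)) =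
        (ident C X \<unrhd>\<^bsub>a\<^esub> HM f (ident K Q)) \<cdot>\<^bsub>A\<^sub>0\<^esub> r X (fst P) (fst Q)"
      using H.r_nat[OF o(1) K_objD(1)[OF o(2)] K_objD(1)[OF o(3)] K_objD(1)[OF o(4)] K_homD(1)[OF o(5,2,3)]] by simp
  qed (simp_all add: K_objD H.obj_map H.ident_map H.lr_braid)
qed

lemma K_pulls:
  assumes "X \<in> obj C" "P \<in> obj K" "Q \<in> obj K"
  shows "pull1 s X P Q \<in> hom K (tens L (act k X P) Q) (act k X (tens L P Q))"
    "pull2 s X P Q \<in> hom K (tens L P (act k X Q)) (act k X (tens L P Q))"
proof -
  note d = K_objD[OF assms(2)] K_objD[OF assms(3)]
  have "iso A\<^sub>0 ((X \<triangleright> fst P) \<odot> fst Q) (X \<triangleright> (fst P \<odot> fst Q)) (pull1 p X (fst P) (fst Q))"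
    "iso A\<^sub>0 (fst P \<odot> (X \<triangleright> fst Q)) (X \<triangleright> (fst P \<odot> fst Q)) (pull2 p X (fst P) (fst Q))"
    using c_functor.xi_iso[OF Z.c_functor_fst[OF d(4)] assms(1) d(1)]
      c_functor.xi_iso[OF Z.c_functor_snd[OF d(1)] assms(1) d(4)] by simp_all
  then have "pull1 p X (fst P) (fst Q) \<in> hom A\<^sub>0 ((X \<triangleright> fst P) \<odot> fst Q) (X \<triangleright> (fst P \<odot> fst Q))"
    "pull2 p X (fst P) (fst Q) \<in> hom A\<^sub>0 (fst P \<odot> (X \<triangleright> fst Q)) (X \<triangleright> (fst P \<odot> fst Q))"
    by (auto simp: iso_def inverse_arrows_def)
  then show "pull1 s X P Q \<in> hom K (tens L (act k X P) Q) (act k X (tens L P Q))"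
    "pull2 s X P Q \<in> hom K (tens L P (act k X Q)) (act k X (tens L P Q))"
    using assms chom_pull1[OF assms(1) d(3,6)] chom_pull2[OF assms(1) d(3,6)]
    by (simp_all add: K_hom_iff arr_pull1_def arr_pull2_def)
qed

lemma K_c_monoidal: "c_monoidal_category C MC \<beta> K k L s"
proof (intro c_monoidal_category.intro K_monoidal c_monoidal_category_axioms.intro)
  \<comment> \<open>The source is changed to comodules first and the target is lifted afterwards;
    \<open>L_sel\<close> is used backwards to present the pulls as functions of comodules.\<close>
  have "c_bifunctor C MC \<beta> K k K k A\<^sub>0 a (\<lambda>P Q. fst P \<odot> fst Q) (tensm L) (pull1 s) (pull2 s)"
    using c_bifunctor_source[OF Z.c_bifunctor_axioms] by (simp flip: L_sel(11,12))
  then show "c_bifunctor C MC \<beta> K k K k K k (tens L) (tensm L) (pull1 s) (pull2 s)"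
    by (rule c_bifunctor_lift) (use K_pulls cat_bifunctor.hom_map[OF K_bifunctor] in auto)
next
  fix X P Q R assume o: "X \<in> obj C" "P \<in> obj K" "Q \<in> obj K" "R \<in> obj K"
  note d = o(1) K_objD(1)[OF o(2)] K_objD(1)[OF o(3)] K_objD(1)[OF o(4)]
  show "pull1 s X P (tens L Q R) \<cdot>\<^bsub>K\<^esub> assoc L (act k X P) Q R =
      (ident C X \<unrhd>\<^bsub>k\<^esub> assoc L P Q R) \<cdot>\<^bsub>K\<^esub> pull1 s X (tens L P Q) R \<cdot>\<^bsub>K\<^esub> pull1 s X P Q \<boxtimes>\<^bsub>L\<^esub> ident K R"
    "pull2 s X P (tens L Q R) \<cdot>\<^bsub>K\<^esub> ident K P \<boxtimes>\<^bsub>L\<^esub> pull1 s X Q R \<cdot>\<^bsub>K\<^esub> assoc L P (act k X Q) R =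
      (ident C X \<unrhd>\<^bsub>k\<^esub> assoc L P Q R) \<cdot>\<^bsub>K\<^esub> pull1 s X (tens L P Q) R \<cdot>\<^bsub>K\<^esub> pull2 s X P Q \<boxtimes>\<^bsub>L\<^esub> ident K R"
    "pull2 s X P (tens L Q R) \<cdot>\<^bsub>K\<^esub> ident K P \<boxtimes>\<^bsub>L\<^esub> pull2 s X Q R \<cdot>\<^bsub>K\<^esub> assoc L P Q (act k X R) =
      (ident C X \<unrhd>\<^bsub>k\<^esub> assoc L P Q R) \<cdot>\<^bsub>K\<^esub> pull2 s X (tens L P Q) R"
    using Z.assoc_fst[OF d] Z.assoc_snd[OF d] Z.assoc_thd[OF d] by simp_all
next
  fix X P assume o: "X \<in> obj C" "P \<in> obj K"
  note d = o(1) K_objD(1)[OF o(2)]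
  show "(ident C X \<unrhd>\<^bsub>k\<^esub> lunit L P) \<cdot>\<^bsub>K\<^esub> pull2 s X (uno L) P = lunit L (act k X P)"
    "(ident C X \<unrhd>\<^bsub>k\<^esub> runit L P) \<cdot>\<^bsub>K\<^esub> pull1 s X P (uno L) = runit L (act k X P)"
    using Z.lunit_c_nat[OF d] Z.runit_c_nat[OF d] by simp_all
qed

end

section \<open>The C-monoidal structure of the lifted functor\<close>

context coend_bialgebra
begin

abbreviation KE where "KE \<equiv> Comod A M A\<^sub>0 E \<Delta> \<epsilon>"
abbreviation LE where "LE \<equiv> Comod_monoidal A M \<tau> E mult unit"
abbreviation kE where "kE \<equiv> Comod_action C A a M p E"
abbreviation sE where "sE \<equiv> Comod_pulls p"
abbreviation GO where "GO \<equiv> lift_obj A M FO i"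

lemma bialgebra_comodules:
  "bialgebra_comodules C MC \<beta> A a M p \<tau> E mult unit \<Delta> \<epsilon> A\<^sub>0"
proof (intro bialgebra_comodules.intro bialgebra_comodules_axioms.intro)
  show "braided_action_calculus C MC \<beta> A a M p \<tau>" "tensor_coalgebra A M \<tau> E mult unit \<Delta> \<epsilon>"
    "subcat_calculus A M A\<^sub>0" "c_monoidal_category C MC \<beta> A\<^sub>0 a M p"
    by unfold_locales
  show "comodules A M A\<^sub>0 E \<Delta> \<epsilon>" by unfold_locales (use sub in auto)
qed (fact mult_assoc mult_unit_left mult_unit_right comult_mult counit_mult cu_coassoc cu_counital)+

lemma lift_c_monoidal_functor:
  "c_monoidal_category C MC \<beta> KE kE LE sE"
  "c_monoidal_functor C MC \<beta> B b N q KE kE LE sE GO FM \<xi> J J\<^sub>0"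
proof -
  interpret Q: bialgebra_comodules C MC \<beta> A a M p \<tau> E mult unit \<Delta> \<epsilon> A\<^sub>0
    by (rule bialgebra_comodules)
  show K: "c_monoidal_category C MC \<beta> KE kE LE sE" by (rule Q.K_c_monoidal)
  have fst_G [simp]: "fst (GO P) = FO P" for P by (simp add: lift_obj_def)
  have cr_G [simp]: "Q.cr (GO P) = de P" if "P \<in> obj B" for P
    using that by (simp add: Q.cr_def lift_obj_def de_ar)
  have G_obj [simp]: "GO P \<in> obj KE" if "P \<in> obj B" for P
    using that de_coassoc de_counital by (simp add: Q.K_obj_iff Q.com_def)
  have FM_K: "FM f \<in> hom KE (GO P) (GO Q)" if "P \<in> obj B" "Q \<in> obj B" "f \<in> hom B P Q" for P Q f
    using that fm_chom by (simp add: Q.K_hom_iff)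
  \<comment> \<open>That \<open>\<xi> X P\<close> is a comodule map is C-naturality of the universal
    coaction, up to the invertible \<open>p1\<close>.\<close>
  have xi_K: "\<xi> X P \<in> hom KE (GO (X \<triangleright>\<^sub>B P)) (act kE X (GO P))" if "X \<in> obj C" "P \<in> obj B" for X P
  proof -
    have "p1 X (FO P) E \<bullet> Q.ca X (de P) \<bullet> xi X P = p1 X (FO P) E \<bullet> (xi X P \<star> idt E) \<bullet> de (X \<triangleright>\<^sub>B P)"
      using that Q.p1_ca[of X "de P", THEN comp_ext] by (simp add: de_act)
    then have "Q.ca X (de P) \<bullet> xi X P = (xi X P \<star> idt E) \<bullet> de (X \<triangleright>\<^sub>B P)"
      by (rule isom_cancel_left) (use that Q.coaction_ca[of X "de P"] in auto)
    then show ?thesis using that by (simp add: Q.K_hom_iff T.chom_def)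
  qed
  have J_K: "J P Q \<in> hom KE (tens LE (GO P) (GO Q)) (GO (P \<odot>\<^sub>B Q))" if "P \<in> obj B" "Q \<in> obj B" for P Q
    using that jn_chom by (simp add: Q.K_hom_iff)
  note hom_L = cat_bifunctor.hom_map[OF Q.K_bifunctor]
  note cmp_K = category.cmp_hom[OF Q.Co.K_category]
  note ident_K = category.ident_hom[OF Q.Co.K_category]
  have F_K: "c_functor C MC B b KE kE GO FM \<xi>"
    by (rule Q.c_functor_lift[OF J.c_functor_axioms]) (use FM_K xi_K in auto)
  note JB = J.J_c_bimorphism
  \<comment> \<open>As the forgetful functor is strict, the underlying C-bifunctor is literally the
    source in \<open>J_c_bimorphism\<close>; only the values acquire coactions.\<close>
  have src: "c_bifunctor C MC \<beta> B b B b KE kE (\<lambda>P Q. tens LE (GO P) (GO Q)) (\<lambda>f g. FM f \<boxtimes>\<^bsub>LE\<^esub> FM g)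
     (\<lambda>X P Q. pull1 sE X (GO P) (GO Q) \<cdot>\<^bsub>KE\<^esub> (\<xi> X P \<boxtimes>\<^bsub>LE\<^esub> ident KE (GO Q)))
     (\<lambda>X P Q. pull2 sE X (GO P) (GO Q) \<cdot>\<^bsub>KE\<^esub> (ident KE (GO P) \<boxtimes>\<^bsub>LE\<^esub> \<xi> X Q))"
  proof (rule Q.c_bifunctor_lift)
    show "c_bifunctor C MC \<beta> B b B b A\<^sub>0 a (\<lambda>P Q. FO P \<odot> FO Q) (\<lambda>f g. FM f \<boxtimes>\<^bsub>LE\<^esub> FM g)
     (\<lambda>X P Q. pull1 sE X (GO P) (GO Q) \<cdot>\<^bsub>KE\<^esub> (\<xi> X P \<boxtimes>\<^bsub>LE\<^esub> ident KE (GO Q)))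
     (\<lambda>X P Q. pull2 sE X (GO P) (GO Q) \<cdot>\<^bsub>KE\<^esub> (ident KE (GO P) \<boxtimes>\<^bsub>LE\<^esub> \<xi> X Q))"
      using c_bimorphism.axioms(1)[OF JB] by simp
  next
    fix P P' Q Q' f g
    assume "P \<in> obj B" "P' \<in> obj B" "Q \<in> obj B" "Q' \<in> obj B" "f \<in> hom B P P'" "g \<in> hom B Q Q'"
    then show "FM f \<boxtimes>\<^bsub>LE\<^esub> FM g \<in> hom KE (tens LE (GO P) (GO Q)) (tens LE (GO P') (GO Q'))"
      by (intro hom_L FM_K G_obj)
  next
    fix X P Q assume *: "X \<in> obj C" "P \<in> obj B" "Q \<in> obj B"
    have "\<xi> X P \<boxtimes>\<^bsub>LE\<^esub> ident KE (GO Q) \<in> hom KE (tens LE (GO (X \<triangleright>\<^sub>B P)) (GO Q)) (tens LE (act kE X (GO P)) (GO Q))"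
      "ident KE (GO P) \<boxtimes>\<^bsub>LE\<^esub> \<xi> X Q \<in> hom KE (tens LE (GO P) (GO (X \<triangleright>\<^sub>B Q))) (tens LE (GO P) (act kE X (GO Q)))"
      using * by (intro hom_L xi_K ident_K; simp)+
    then show "pull1 sE X (GO P) (GO Q) \<cdot>\<^bsub>KE\<^esub> (\<xi> X P \<boxtimes>\<^bsub>LE\<^esub> ident KE (GO Q)) \<in>
        hom KE (tens LE (GO (X \<triangleright>\<^sub>B P)) (GO Q)) (act kE X (tens LE (GO P) (GO Q)))"
      "pull2 sE X (GO P) (GO Q) \<cdot>\<^bsub>KE\<^esub> (ident KE (GO P) \<boxtimes>\<^bsub>LE\<^esub> \<xi> X Q) \<in>
        hom KE (tens LE (GO P) (GO (X \<triangleright>\<^sub>B Q))) (act kE X (tens LE (GO P) (GO Q)))"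
      using * Q.K_pulls[of X "GO P" "GO Q"]
        cmp_K[of "tens LE (GO (X \<triangleright>\<^sub>B P)) (GO Q)" "tens LE (act kE X (GO P)) (GO Q)" "act kE X (tens LE (GO P) (GO Q))"]
        cmp_K[of "tens LE (GO P) (GO (X \<triangleright>\<^sub>B Q))" "tens LE (GO P) (act kE X (GO Q))" "act kE X (tens LE (GO P) (GO Q))"]
      by auto
  qed auto
  have tgt: "c_bifunctor C MC \<beta> B b B b KE kE (\<lambda>P Q. GO (P \<odot>\<^sub>B Q)) (\<lambda>f g. FM (f \<boxtimes>\<^bsub>N\<^esub> g))
     (\<lambda>X P Q. \<xi> X (P \<odot>\<^sub>B Q) \<cdot>\<^bsub>KE\<^esub> FM (pull1 q X P Q)) (\<lambda>X P Q. \<xi> X (P \<odot>\<^sub>B Q) \<cdot>\<^bsub>KE\<^esub> FM (pull2 q X P Q))"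
  proof (rule Q.c_bifunctor_lift)
    show "c_bifunctor C MC \<beta> B b B b A\<^sub>0 a (\<lambda>P Q. FO (P \<odot>\<^sub>B Q)) (\<lambda>f g. FM (f \<boxtimes>\<^bsub>N\<^esub> g))
       (\<lambda>X P Q. \<xi> X (P \<odot>\<^sub>B Q) \<cdot>\<^bsub>KE\<^esub> FM (pull1 q X P Q)) (\<lambda>X P Q. \<xi> X (P \<odot>\<^sub>B Q) \<cdot>\<^bsub>KE\<^esub> FM (pull2 q X P Q))"
      using c_bimorphism.axioms(2)[OF JB] by simp
  next
    fix P P' Q Q' f g
    assume *: "P \<in> obj B" "P' \<in> obj B" "Q \<in> obj B" "Q' \<in> obj B" "f \<in> hom B P P'" "g \<in> hom B Q Q'"
    then show "FM (f \<boxtimes>\<^bsub>N\<^esub> g) \<in> hom KE (GO (P \<odot>\<^sub>B Q)) (GO (P' \<odot>\<^sub>B Q'))"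
      by (intro FM_K nobj tnsB_hom)
  next
    fix X P Q assume *: "X \<in> obj C" "P \<in> obj B" "Q \<in> obj B"
    show "\<xi> X (P \<odot>\<^sub>B Q) \<cdot>\<^bsub>KE\<^esub> FM (pull1 q X P Q) \<in> hom KE (GO ((X \<triangleright>\<^sub>B P) \<odot>\<^sub>B Q)) (act kE X (GO (P \<odot>\<^sub>B Q)))"
      using * by (intro cmp_K[of _ "GO (X \<triangleright>\<^sub>B (P \<odot>\<^sub>B Q))"] xi_K FM_K) auto
    show "\<xi> X (P \<odot>\<^sub>B Q) \<cdot>\<^bsub>KE\<^esub> FM (pull2 q X P Q) \<in> hom KE (GO (P \<odot>\<^sub>B (X \<triangleright>\<^sub>B Q))) (act kE X (GO (P \<odot>\<^sub>B Q)))"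
      using * by (intro cmp_K[of _ "GO (X \<triangleright>\<^sub>B (P \<odot>\<^sub>B Q))"] xi_K FM_K) auto
  qed auto
  show "c_monoidal_functor C MC \<beta> B b N q KE kE LE sE GO FM \<xi> J J\<^sub>0"
  proof (intro c_monoidal_functor.intro c_monoidal_functor_axioms.intro J.src.c_monoidal_category_axioms K F_K)
    fix P Q assume *: "P \<in> obj B" "Q \<in> obj B"
    show "iso KE (tens LE (GO P) (GO Q)) (GO (P \<odot>\<^sub>B Q)) (J P Q)"
      using * jn_chom[OF *] J.J_iso[OF *] by (intro Q.K_iso(1)) auto
  next
    show "iso KE (uno LE) (GO unB) J\<^sub>0"
      using j0_chom J.J0_iso by (intro Q.K_iso(1)) auto
  next
    fix P Q R assume "P \<in> obj B" "Q \<in> obj B" "R \<in> obj B"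
    then show "FM (assoc N P Q R) \<cdot>\<^bsub>KE\<^esub> J (P \<odot>\<^sub>B Q) R \<cdot>\<^bsub>KE\<^esub> (J P Q \<boxtimes>\<^bsub>LE\<^esub> ident KE (GO R)) =
      J P (Q \<odot>\<^sub>B R) \<cdot>\<^bsub>KE\<^esub> (ident KE (GO P) \<boxtimes>\<^bsub>LE\<^esub> J Q R) \<cdot>\<^bsub>KE\<^esub> assoc LE (GO P) (GO Q) (GO R)"
      using J.J_assoc by simp
  next
    fix P assume "P \<in> obj B"
    then show "FM (lunit N P) \<cdot>\<^bsub>KE\<^esub> J unB P \<cdot>\<^bsub>KE\<^esub> (J\<^sub>0 \<boxtimes>\<^bsub>LE\<^esub> ident KE (GO P)) = lunit LE (GO P)"
      "FM (runit N P) \<cdot>\<^bsub>KE\<^esub> J P unB \<cdot>\<^bsub>KE\<^esub> (ident KE (GO P) \<boxtimes>\<^bsub>LE\<^esub> J\<^sub>0) = runit LE (GO P)"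
      using J.J_lunit J.J_runit by simp_all
  next
    show "c_bimorphism C MC \<beta> B b B b KE kE (\<lambda>P Q. tens LE (GO P) (GO Q)) (\<lambda>f g. FM f \<boxtimes>\<^bsub>LE\<^esub> FM g)
     (\<lambda>X P Q. pull1 sE X (GO P) (GO Q) \<cdot>\<^bsub>KE\<^esub> (\<xi> X P \<boxtimes>\<^bsub>LE\<^esub> ident KE (GO Q)))
     (\<lambda>X P Q. pull2 sE X (GO P) (GO Q) \<cdot>\<^bsub>KE\<^esub> (ident KE (GO P) \<boxtimes>\<^bsub>LE\<^esub> \<xi> X Q))
     (\<lambda>P Q. GO (P \<odot>\<^sub>B Q)) (\<lambda>f g. FM (f \<boxtimes>\<^bsub>N\<^esub> g))
     (\<lambda>X P Q. \<xi> X (P \<odot>\<^sub>B Q) \<cdot>\<^bsub>KE\<^esub> FM (pull1 q X P Q)) (\<lambda>X P Q. \<xi> X (P \<odot>\<^sub>B Q) \<cdot>\<^bsub>KE\<^esub> FM (pull2 q X P Q)) J"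
      using J_K c_bimorphism.natural[OF JB] c_bimorphism.compat_fst[OF JB] c_bimorphism.compat_snd[OF JB]
      by (intro c_bimorphism.intro c_bimorphism_axioms.intro src tgt) simp_all
  qed
qed

end

theorem proposition1p24:
  fixes C :: "('c, 'd) cat" and MC :: "('c, 'd) monoidal" and \<beta> :: "'c \<Rightarrow> 'c \<Rightarrow> 'd"
    and A :: "('o, 'm) cat" and a :: "('c, 'd, 'o, 'm) action"
    and M :: "('o, 'm) monoidal" and p :: "('c, 'o, 'm) pulls" and \<tau> :: "'o \<Rightarrow> 'o \<Rightarrow> 'm"
    and A\<^sub>0 :: "('o, 'm) cat"
    and B :: "('b, 'n) cat" and b :: "('c, 'd, 'b, 'n) action"
    and N :: "('b, 'n) monoidal" and q :: "('c, 'b, 'n) pulls"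
    and FO :: "'b \<Rightarrow> 'o" and FM :: "'n \<Rightarrow> 'm" and \<xi> :: "'c \<Rightarrow> 'b \<Rightarrow> 'm"
    and J :: "'b \<Rightarrow> 'b \<Rightarrow> 'm" and J\<^sub>0 :: 'm
  assumes "universe TYPE('u)"
    and "braided_monoidal_category C MC \<beta>"
    and "c_category C MC A a"
    and "c_category C MC B b"
    and "locally_small TYPE('u) A"
    and "cocomplete TYPE('u) A"
    and "c_monoidal_category C MC \<beta> A a M p"
    and "subcategory A\<^sub>0 A"
    and "right_coclosed A\<^sub>0 A M"
    and "cat_functor B A\<^sub>0 FO FM"
    and "c_functor C MC B b A a FO FM \<xi>"
    and "(small_category TYPE('u) A\<^sub>0 \<and> small_fibres TYPE('u) B A\<^sub>0 FO) \<or> small_category TYPE('u) B"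
  shows
    "(\<exists>E i. c_coend C A a M p B b FO FM \<xi> E i) \<and>
     (\<forall>E i. c_coend C A a M p B b FO FM \<xi> E i \<longrightarrow>
        (let \<Delta> = coend_comult A M B FO E i;
             \<epsilon> = coend_counit A M B FO E i
         in coalgebra A M E \<Delta> \<epsilon> \<and>
            cat_functor (Comod A M A\<^sub>0 E \<Delta> \<epsilon>) A\<^sub>0 forget_obj forget_arr \<and>
            cat_functor B (Comod A M A\<^sub>0 E \<Delta> \<epsilon>) (lift_obj A M FO i) FM \<and>
            FO = forget_obj \<circ> lift_obj A M FO i \<and> FM = forget_arr \<circ> FM)) \<and>
     (c_braided_category C MC \<beta> A a M p \<tau> \<and>
      c_monoidal_subcategory C MC \<beta> A\<^sub>0 A a M p \<and>
      c_monoidal_category C MC \<beta> B b N q \<and>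
      c_monoidal_functor C MC \<beta> B b N q A\<^sub>0 a M p FO FM \<xi> J J\<^sub>0 \<longrightarrow>
        (\<forall>E i. c_coend C A a M p B b FO FM \<xi> E i \<and>
           multirepresentable C A a M p \<tau> B b FO FM \<xi> E (coend_delta A M FO i) \<longrightarrow>
           (let \<Delta> = coend_comult A M B FO E i;
                \<epsilon> = coend_counit A M B FO E i;
                m = coend_mult A M \<tau> B N FO J E (coend_delta A M FO i);
                \<eta> = coend_unit A M N FO J\<^sub>0 E (coend_delta A M FO i);
                K = Comod A M A\<^sub>0 E \<Delta> \<epsilon>;
                k = Comod_action C A a M p E;
                L = Comod_monoidal A M \<tau> E m \<eta>;
                s = Comod_pulls p
            in bialgebra A M \<tau> E \<Delta> \<epsilon> m \<eta> \<and>
               c_monoidal_category C MC \<beta> K k L s \<and>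
               c_monoidal_functor C MC \<beta> B b N q K k L s (lift_obj A M FO i) FM \<xi> J J\<^sub>0)))"
proof -
  note U = assms(1) and sub = assms(8) and F0 = assms(10)
  interpret A: c_monoidal_category C MC \<beta> A a M p by (rule assms(7))
  have mon: "monoidal_calculus A M"
    by (intro monoidal_calculus.intro arrow_calculus.intro A.fst.category_axioms A.monoidal_category_axioms)
  have act: "action_calculus C MC \<beta> A a M p"
    by (intro action_calculus.intro mon A.c_monoidal_category_axioms)
  have FO0: "P \<in> obj B \<Longrightarrow> FO P \<in> obj A\<^sub>0" for P by (rule cat_functor.obj_map[OF F0])
  have coend: "coend_calculus C MC \<beta> A a M p B b FO FM \<xi>"
    using assms(9) FO0
    by (intro coend_calculus.intro coend_calculus_axioms.intro act assms(11)) (simp add: right_coclosed_def)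
  \<comment> \<open>Under the first alternative the objects of \<open>B\<close> are the union of the
    fibres of \<open>FO\<close> over a small set of objects; the second alternative contains the
    claim.\<close>
  have small: "small TYPE('u) (obj B)"
    using assms(12)
  proof
    assume "small_category TYPE('u) A\<^sub>0 \<and> small_fibres TYPE('u) B A\<^sub>0 FO"
    then have "small TYPE('u) (SIGMA P:obj A\<^sub>0. {X \<in> obj B. FO X = P})"
      by (intro small_Sigma[OF U]) (auto simp: small_category_def small_fibres_def)
    then have "small TYPE('u) (snd ` (SIGMA P:obj A\<^sub>0. {X \<in> obj B. FO X = P}))" by (rule small_image)
    then show ?thesis by (rule small_subset) (use FO0 in force)
  qed (simp add: small_category_def)
  have univ: "coend_universal C MC \<beta> A a M p B b FO FM \<xi> E i"
    if "c_coend C A a M p B b FO FM \<xi> E i" for E i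
    using that by (intro coend_universal.intro coend_universal_axioms.intro coend)
  have part1: "coalgebra A M E \<Delta> \<epsilon> \<and> cat_functor (Comod A M A\<^sub>0 E \<Delta> \<epsilon>) A\<^sub>0 forget_obj forget_arr \<and>
      cat_functor B (Comod A M A\<^sub>0 E \<Delta> \<epsilon>) (lift_obj A M FO i) FM"
    if E: "c_coend C A a M p B b FO FM \<xi> E i"
      and \<Delta>: "\<Delta> = coend_comult A M B FO E i" and \<epsilon>: "\<epsilon> = coend_counit A M B FO E i" for E i \<Delta> \<epsilon>
  proof -
    interpret E: coend_universal C MC \<beta> A a M p B b FO FM \<xi> E i by (rule univ[OF E])
    interpret Co: comodules A M A\<^sub>0 E \<Delta> \<epsilon>
      by (intro comodules.intro comodules_axioms.intro mon sub) (simp_all add: \<Delta> \<epsilon>)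
    show ?thesis
      using E.coalgebra Co.forget_functor E.lift_cat_functor[OF sub F0] by (simp add: \<Delta> \<epsilon>)
  qed
  have part2: "bialgebra A M \<tau> E \<Delta> \<epsilon> m \<eta> \<and>
      c_monoidal_category C MC \<beta> (Comod A M A\<^sub>0 E \<Delta> \<epsilon>) (Comod_action C A a M p E)
        (Comod_monoidal A M \<tau> E m \<eta>) (Comod_pulls p) \<and>
      c_monoidal_functor C MC \<beta> B b N q (Comod A M A\<^sub>0 E \<Delta> \<epsilon>) (Comod_action C A a M p E)
        (Comod_monoidal A M \<tau> E m \<eta>) (Comod_pulls p) (lift_obj A M FO i) FM \<xi> J J\<^sub>0"
    if br: "c_braided_category C MC \<beta> A a M p \<tau>" and s0: "c_monoidal_subcategory C MC \<beta> A\<^sub>0 A a M p"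
      and J: "c_monoidal_functor C MC \<beta> B b N q A\<^sub>0 a M p FO FM \<xi> J J\<^sub>0"
      and E: "c_coend C A a M p B b FO FM \<xi> E i"
      and multi: "multirepresentable C A a M p \<tau> B b FO FM \<xi> E (coend_delta A M FO i)"
      and eqs: "\<Delta> = coend_comult A M B FO E i" "\<epsilon> = coend_counit A M B FO E i"
        "m = coend_mult A M \<tau> B N FO J E (coend_delta A M FO i)"
        "\<eta> = coend_unit A M N FO J\<^sub>0 E (coend_delta A M FO i)" for E i \<Delta> \<epsilon> m \<eta>
  proof -
    have "monoidal_category A\<^sub>0 M"
      using s0 c_monoidal_category.axioms(1) unfolding c_monoidal_subcategory_def by blast
    moreover have "braided_monoidal_category A M \<tau>" by (rule c_braided_category.axioms(2)[OF br])
    ultimately interpret E: coend_bialgebra C MC \<beta> A a M p \<tau> B b FO FM \<xi> E i A\<^sub>0 N q J J\<^sub>0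
      by (intro coend_bialgebra.intro coend_bialgebra_axioms.intro braided_action_calculus.intro
          braided_calculus.intro subcat_calculus.intro subcat_calculus_axioms.intro act mon br univ E sub J multi)
    show ?thesis unfolding eqs using E.coend_is_bialgebra E.lift_c_monoidal_functor by blast
  qed
  have "FO = forget_obj \<circ> lift_obj A M FO i" "FM = forget_arr \<circ> FM" for i
    by (auto simp: forget_obj_def forget_arr_def lift_obj_def)
  note forget = this
  \<comment> \<open>Instantiating the defining equations with \<open>refl\<close> matches the
    unfolded \<open>let\<close> bindings, and the conjunctions are split so that each goal has its
    own rule.\<close>
  note part1 = part1[OF _ refl refl, THEN conjunct1] part1[OF _ refl refl, THEN conjunct2, THEN conjunct1]
    part1[OF _ refl refl, THEN conjunct2, THEN conjunct2]
  note part2 = part2[OF _ _ _ _ _ refl refl refl refl, THEN conjunct1]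
    part2[OF _ _ _ _ _ refl refl refl refl, THEN conjunct2, THEN conjunct1]
    part2[OF _ _ _ _ _ refl refl refl refl, THEN conjunct2, THEN conjunct2]
  show ?thesis
    unfolding Let_def
  proof (intro conjI allI impI; (elim conjE)?)
    show "\<exists>E i. c_coend C A a M p B b FO FM \<xi> E i"
      by (rule coend_calculus.coend_exists[OF coend U small assms(5,6)])
  qed (rule forget part1 part2; assumption)+
qed

end
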